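(* Let $n=3$, let $\Omega\subset\mathbb{R}^3$ be a connected bounded open set with Lipschitz boundary, $a\in L^\infty(\Omega)$ with $0<m\le a\le M$, and $F=\nabla f$, $\tilde F=\nabla\tilde f$ with $f,\tilde f\in C^1(\Omega)\cap C(\overline\Omega)$. Suppose $u$ and $\tilde u$ are admissible for $(a,F,H)$ and $(a,\tilde F,H)$ respectively (with constants $\sigma_0,\sigma_1,m,M$), with $u|_{\partial\Omega}=\tilde u|_{\partial\Omega}=0$ and coefficients $\sigma,\tilde\sigma$. Suppose $F,\tilde F\in C^2(\overline\Omega)$, $H\in C^1(\overline\Omega)$, $\sigma,\tilde\sigma\in C^2(\overline\Omega)$ and $$\|F\|_{C^2(\Omega)},\|\tilde F\|_{C^2(\Omega)},\|H\|_{C^1(\Omega)}\le k_2,\qquad\|\sigma\|_{C^2(\Omega)},\|\tilde\sigma\|_{C^2(\Omega)}\le\sigma_2$$ for some $k_2,\sigma_2>0$. Let $v=u+f$. If the level sets of $v$ can be foliated to one-dimensional curves (with constants $c_g,C_g,K$) and are well-structured (with constant $\tilde K$), then $$\|\nabla u-\nabla\tilde u\|_{L^1(\Omega)}\le C\,\|F-\tilde F\|_{L^1(\Omega)}^{1/4}$$ for some constant $C=C(\Omega,m,M,k_2,K,\tilde K,\sigma_0,\sigma_1,\sigma_2,c_g,C_g)$ independent of $\tilde u$ and $\tilde\sigma$.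
   Context: Admissibility: fix $\sigma_0,\sigma_1>0$. For data $(a,F,H)$, $u\in C^1(\overline\Omega)$ is admissible if $u$ minimizes $\int_\Omega(a|Dw+F|+Hw)\,dx$ over $w\in H_0^1(\Omega)$ and there is $\sigma\in C(\Omega)$ with $0<\sigma_0\le\sigma\le\sigma_1$ such that $J=\sigma(\nabla u+F)$ and $m\le|J|\le M$. Here $J$ is the flux field of the problem (a solution of the dual problem of maximizing $\int_\Omega F\cdot b\,dx$ over $b\in L^2(\Omega;\mathbb{R}^n)$ with $|b|\le a$ a.e. and $\int_\Omega(\nabla w\cdot b+Hw)\,dx=0$ for all $w\in H^1_0(\Omega)$); thus $\nabla\cdot J=H$ weakly, $|J|=a$ and $\sigma=a/|\nabla u+F|$. Foliation ($n=3$): the level sets of $v$ can be foliated to one-dimensional curves if for almost every $t$ in the range of $v$ there is a $C^1$ function $g_t$ on the surface $\{v=t\}\cap\Omega$ with $0<c_g\le|\nabla g_t|\le C_g$ (surface gradient; constants independent of $t$), such that for almost every $r\in\mathbb{R}$ every connected component of $\{v=t\}\cap\{g_t=r\}\cap\Omega$ is a $C^1$ curve reaching $\partial\Omega$, and $\sup_{t,r}\int_{\{v=t\}\cap\{g_t=r\}\cap\Omega}dl\le K<\infty$. Well-structured level sets ($n=3$, for the curves of the foliation): with a constant $\tilde K$, for a.e. $x\in\Omega$, every $h\in S^{2}$ and all sufficiently small $t\neq0$: if $\gamma$ is the arc-length parametrization of the foliation curve through $x$, with $\gamma(0)\in\partial\Omega$ and $\gamma(s_0)=x$, then the foliation curve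 through $x+th$ has a $C^1$ parametrization $\gamma_t$ with $\gamma_t(0)\in\partial\Omega$, $\gamma_t(s_0)=x+th$, such that $|\gamma_t'(s)-\gamma'(s)|\le\tilde K|t|$ for $s\in[0,s_0]$, and the limit $B_{x,h}(s)=\lim_{t\to0}\frac{\gamma_t(s)-\gamma(s)}{t}$ exists, with $B_{x,h}$ bounded uniformly in $x,h,s$. *)

theory Defs
  imports "HOL-Analysis.Analysis"
begin

section \<open>Classical differentiability and norms\<close>

definition grad :: "('a::euclidean_space \<Rightarrow> real) \<Rightarrow> 'a \<Rightarrow> 'a" where
  "grad f x = (\<Sum>b\<in>Basis. frechet_derivative f (at x) b *\<^sub>R b)"

text \<open>The list of basis vectors \<open>hs\<close> plays the role of a multi-index of order \<open>length hs\<close>.\<close>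

fun iter_partial ::
  "'a::euclidean_space list \<Rightarrow> ('a \<Rightarrow> 'b::real_normed_vector) \<Rightarrow> 'a \<Rightarrow> 'b" where
  "iter_partial [] f = f"
| "iter_partial (h # hs) f = (\<lambda>x. frechet_derivative (iter_partial hs f) (at x) h)"

text \<open>The space \<open>C\<^sup>k(S)\<close> for open \<open>S\<close>.\<close>

definition Ck_on ::
  "nat \<Rightarrow> 'a::euclidean_space set \<Rightarrow> ('a \<Rightarrow> 'b::real_normed_vector) \<Rightarrow> bool" where
  "Ck_on k S f \<longleftrightarrow> (\<forall>hs. set hs \<subseteq> Basis \<longrightarrow>
     (length hs < k \<longrightarrow> (\<forall>x\<in>S. iter_partial hs f differentiable (at x))) \<and>
     (length hs \<le> k \<longrightarrow> continuous_on S (iter_partial hs f)))"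

text \<open>The space \<open>C\<^sup>k\<close> of the closure of an open \<open>S\<close>: all partial derivatives of order at most \<open>k\<close>
  have continuous extensions from \<open>S\<close> to \<open>closure S\<close>; for \<open>f\<close> itself, this extension is given by
  the values of \<open>f\<close> on \<open>closure S\<close>.\<close>

definition Ck_closure ::
  "nat \<Rightarrow> 'a::euclidean_space set \<Rightarrow> ('a \<Rightarrow> 'b::real_normed_vector) \<Rightarrow> bool" where
  "Ck_closure k S f \<longleftrightarrow> Ck_on k S f \<and> continuous_on (closure S) f \<and>
     (\<forall>hs. set hs \<subseteq> Basis \<and> length hs \<le> k \<longrightarrow>
       (\<exists>g. continuous_on (closure S) g \<and> (\<forall>x\<in>S. g x = iter_partial hs f x)))"

text \<open>Sum over \<open>j \<le> k\<close> of the supremum over \<open>S\<close> of all partial derivatives of order \<open>j\<close>.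
  It is extended-valued because \<open>Sup\<close> of an unbounded set of reals is unspecified.\<close>

definition Ck_norm ::
  "nat \<Rightarrow> 'a::euclidean_space set \<Rightarrow> ('a \<Rightarrow> 'b::real_normed_vector) \<Rightarrow> ennreal" where
  "Ck_norm k S f = (\<Sum>j\<le>k. SUP hs\<in>{hs. set hs \<subseteq> Basis \<and> length hs = j}.
     SUP x\<in>S. ennreal (norm (iter_partial hs f x)))"

definition L1_norm_on ::
  "'a::euclidean_space set \<Rightarrow> ('a \<Rightarrow> 'b::euclidean_space) \<Rightarrow> real" where
  "L1_norm_on S f = (LINT x|lebesgue_on S. norm (f x))"

definition L2_on ::
  "'a::euclidean_space set \<Rightarrow> ('a \<Rightarrow> 'b::euclidean_space) \<Rightarrow> bool" where
  "L2_on S f \<longleftrightarrow> f \<in> borel_measurable (lebesgue_on S) \<and>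
     integrable (lebesgue_on S) (\<lambda>x. (norm (f x))\<^sup>2)"

text \<open>Near each boundary point, \<open>S\<close> is the region above the graph of a Lipschitz function over the
  hyperplane orthogonal to some unit vector \<open>e\<close>; \<open>\<phi>\<close> is only evaluated on that hyperplane.\<close>

definition lipschitz_boundary :: "'a::euclidean_space set \<Rightarrow> bool" where
  "lipschitz_boundary S \<longleftrightarrow> (\<forall>p\<in>frontier S. \<exists>r>0. \<exists>e L. \<exists>\<phi>::'a \<Rightarrow> real.
     norm e = 1 \<and> L-lipschitz_on UNIV \<phi> \<and>
     S \<inter> ball p r = {x \<in> ball p r. x \<bullet> e > \<phi> (x - (x \<bullet> e) *\<^sub>R e)})"


section \<open>The space of Sobolev functions vanishing on the boundary\<close>

definition test_function :: "'a::euclidean_space set \<Rightarrow> ('a \<Rightarrow> real) \<Rightarrow> bool" where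
  "test_function S \<phi> \<longleftrightarrow> (\<forall>k. Ck_on k UNIV \<phi>) \<and>
     compact (closure {x. \<phi> x \<noteq> 0}) \<and> closure {x. \<phi> x \<noteq> 0} \<subseteq> S"

text \<open>\<open>H10 S w G\<close>: \<open>w\<close> lies in the closure of the test functions in the \<open>H\<^sup>1(S)\<close> norm, and \<open>G\<close> is its
  weak gradient (the \<open>L\<^sup>2\<close> limit of the gradients of the approximating test functions).\<close>

definition H10 :: "'a::euclidean_space set \<Rightarrow> ('a \<Rightarrow> real) \<Rightarrow> ('a \<Rightarrow> 'a) \<Rightarrow> bool" where
  "H10 S w G \<longleftrightarrow> L2_on S w \<and> L2_on S G \<and>
     (\<exists>\<phi>. (\<forall>k::nat. test_function S (\<phi> k)) \<and>
       (\<lambda>k. LINT x|lebesgue_on S. (\<phi> k x - w x)\<^sup>2 + (norm (grad (\<phi> k) x - G x))\<^sup>2)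
         \<longlonglongrightarrow> 0)"


section \<open>The minimization problem, its dual, and admissibility\<close>

definition energy ::
  "'a::euclidean_space set \<Rightarrow> ('a \<Rightarrow> real) \<Rightarrow> ('a \<Rightarrow> 'a) \<Rightarrow> ('a \<Rightarrow> real)
    \<Rightarrow> ('a \<Rightarrow> real) \<Rightarrow> ('a \<Rightarrow> 'a) \<Rightarrow> real" where
  "energy S a F H w G = (LINT x|lebesgue_on S. a x * norm (G x + F x) + H x * w x)"

definition dual_feasible ::
  "'a::euclidean_space set \<Rightarrow> ('a \<Rightarrow> real) \<Rightarrow> ('a \<Rightarrow> real) \<Rightarrow> ('a \<Rightarrow> 'a) \<Rightarrow> bool" where
  "dual_feasible S a H b \<longleftrightarrow> L2_on S b \<and> (AE x in lebesgue_on S. norm (b x) \<le> a x) \<and>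
     (\<forall>w G. H10 S w G \<longrightarrow> (LINT x|lebesgue_on S. G x \<bullet> b x + H x * w x) = 0)"

definition dual_solution ::
  "'a::euclidean_space set \<Rightarrow> ('a \<Rightarrow> real) \<Rightarrow> ('a \<Rightarrow> 'a) \<Rightarrow> ('a \<Rightarrow> real)
    \<Rightarrow> ('a \<Rightarrow> 'a) \<Rightarrow> bool" where
  "dual_solution S a F H J \<longleftrightarrow> dual_feasible S a H J \<and>
     (\<forall>b. dual_feasible S a H b \<longrightarrow>
       (LINT x|lebesgue_on S. F x \<bullet> b x) \<le> (LINT x|lebesgue_on S. F x \<bullet> J x))"

text \<open>\<open>u\<close> is admissible for \<open>(a, F, H)\<close> with coefficient \<open>\<sigma>\<close>. That the flux \<open>J\<close> satisfies
  \<open>div J = H\<close> weakly, \<open>\<bar>J\<bar> = a\<close> and \<open>\<sigma> = a / \<bar>\<nabla>u + F\<bar>\<close> is a consequence, not part of the definition.\<close>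

definition admissible ::
  "'a::euclidean_space set \<Rightarrow> real \<Rightarrow> real \<Rightarrow> real \<Rightarrow> real \<Rightarrow> ('a \<Rightarrow> real) \<Rightarrow> ('a \<Rightarrow> 'a)
    \<Rightarrow> ('a \<Rightarrow> real) \<Rightarrow> ('a \<Rightarrow> real) \<Rightarrow> ('a \<Rightarrow> real) \<Rightarrow> bool" where
  "admissible S \<sigma>0 \<sigma>1 m M a F H u \<sigma> \<longleftrightarrow>
     Ck_closure 1 S u \<and>
     H10 S u (grad u) \<and>
     (\<forall>w G. H10 S w G \<longrightarrow> energy S a F H u (grad u) \<le> energy S a F H w G) \<and>
     continuous_on S \<sigma> \<and> (\<forall>x\<in>S. \<sigma>0 \<le> \<sigma> x \<and> \<sigma> x \<le> \<sigma>1) \<and>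
     (\<exists>J. dual_solution S a F H J \<and>
       (\<forall>x\<in>S. J x = \<sigma> x *\<^sub>R (grad u x + F x) \<and> m \<le> norm (J x) \<and> norm (J x) \<le> M))"


section \<open>Foliation of level sets by curves\<close>

text \<open>One-dimensional Hausdorff measure; it is the length on \<open>C\<^sup>1\<close> curves.\<close>

definition hausdorff1 :: "'a::metric_space set \<Rightarrow> ennreal" where
  "hausdorff1 A = (SUP \<delta>\<in>{0<..}. INF U\<in>{U :: nat \<Rightarrow> 'a set. A \<subseteq> (\<Union>i. U i) \<and>
     (\<forall>i. bounded (U i) \<and> diameter (U i) \<le> \<delta>)}. \<Sum>i. ennreal (diameter (U i)))"

text \<open>\<open>g\<close> is a \<open>C\<^sup>1\<close> function on the regular surface \<open>T\<close> with normal field \<open>N\<close>, and \<open>D\<close> is its surface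
  gradient: the continuous tangential field that represents the derivative of \<open>g\<close> along \<open>T\<close>.\<close>

definition surface_C1_grad ::
  "'a::euclidean_space set \<Rightarrow> ('a \<Rightarrow> 'a) \<Rightarrow> ('a \<Rightarrow> real) \<Rightarrow> ('a \<Rightarrow> 'a) \<Rightarrow> bool" where
  "surface_C1_grad T N g D \<longleftrightarrow> continuous_on T D \<and>
     (\<forall>x\<in>T. D x \<bullet> N x = 0 \<and> (g has_derivative (\<lambda>h. D x \<bullet> h)) (at x within T))"

text \<open>A subset \<open>C\<close> of the open set \<open>S\<close> is a \<open>C\<^sup>1\<close> curve reaching the boundary of \<open>S\<close>: it has an
  arc-length parametrization that starts on the boundary. \<open>C\<close> itself does not contain the
  boundary point \<open>\<gamma> 0\<close>. The predicate \<open>C1_differentiable_on\<close> uses two-sided derivatives, also at \<open>0\<close>;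
  this is no restriction, since \<open>\<gamma>\<close> is arbitrary outside the parameter interval and a \<open>C\<^sup>1\<close> map on an
  interval extends to a \<open>C\<^sup>1\<close> map across its end points.\<close>

definition C1_curve_reaching_boundary :: "'a::euclidean_space set \<Rightarrow> 'a set \<Rightarrow> bool" where
  "C1_curve_reaching_boundary S C \<longleftrightarrow> (\<exists>\<gamma>. \<exists>L>0. \<gamma> C1_differentiable_on {0..<L} \<and>
     (\<forall>s\<in>{0..<L}. norm (vector_derivative \<gamma> (at s)) = 1) \<and>
     inj_on \<gamma> {0..<L} \<and> \<gamma> 0 \<in> frontier S \<and> \<gamma> ` {0<..<L} = C)"

definition level_curve_set ::
  "'a set \<Rightarrow> ('a \<Rightarrow> real) \<Rightarrow> (real \<Rightarrow> 'a \<Rightarrow> real) \<Rightarrow> real \<Rightarrow> real \<Rightarrow> 'a set" where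
  "level_curve_set S v g t r = {x\<in>S. v x = t \<and> g t x = r}"

text \<open>The level sets of \<open>v\<close> in \<open>S\<close> are foliated to one-dimensional curves by the family \<open>g t\<close>.\<close>

definition foliated ::
  "'a::euclidean_space set \<Rightarrow> ('a \<Rightarrow> real) \<Rightarrow> (real \<Rightarrow> 'a \<Rightarrow> real)
    \<Rightarrow> real \<Rightarrow> real \<Rightarrow> real \<Rightarrow> bool" where
  "foliated S v g cg Cg K \<longleftrightarrow> 0 < cg \<and>
     (AE t in lborel. t \<in> v ` S \<longrightarrow>
       (\<exists>D. surface_C1_grad {x\<in>S. v x = t} (grad v) (g t) D \<and>
            (\<forall>x\<in>S. v x = t \<longrightarrow> cg \<le> norm (D x) \<and> norm (D x) \<le> Cg)) \<and>
       (AE r in lborel. \<forall>C\<in>components (level_curve_set S v g t r).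
            C1_curve_reaching_boundary S C) \<and>
       (\<forall>r. hausdorff1 (level_curve_set S v g t r) \<le> ennreal K))"

definition leaf ::
  "'a::topological_space set \<Rightarrow> ('a \<Rightarrow> real) \<Rightarrow> (real \<Rightarrow> 'a \<Rightarrow> real) \<Rightarrow> 'a \<Rightarrow> 'a set" where
  "leaf S v g y = connected_component_set (level_curve_set S v g (v y) (g (v y) y)) y"

text \<open>\<open>\<gamma>\<close> is a \<open>C\<^sup>1\<close> parametrization over \<open>[0, s\<^sub>0]\<close> of the foliation curve through \<open>y\<close>, from the
  boundary of \<open>S\<close> to \<open>y\<close>. The function \<open>g t\<close> carries information only for almost every \<open>t\<close>, so it is
  required that the leaf through \<open>y\<close> is a curve of the foliation.\<close>

definition leaf_param ::
  "'a::euclidean_space set \<Rightarrow> ('a \<Rightarrow> real) \<Rightarrow> (real \<Rightarrow> 'a \<Rightarrow> real) \<Rightarrow> 'a \<Rightarrow> real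
    \<Rightarrow> (real \<Rightarrow> 'a) \<Rightarrow> bool" where
  "leaf_param S v g y s\<^sub>0 \<gamma> \<longleftrightarrow>
     C1_curve_reaching_boundary S (leaf S v g y) \<and>
     \<gamma> C1_differentiable_on {0..s\<^sub>0} \<and> inj_on \<gamma> {0..s\<^sub>0} \<and>
     \<gamma> 0 \<in> frontier S \<and> \<gamma> ` {0<..s\<^sub>0} \<subseteq> leaf S v g y \<and> \<gamma> s\<^sub>0 = y"

text \<open>A leaf may reach the boundary at both of its ends, and then two arc-length parametrizations
  start on the boundary; the condition is imposed on one of them, chosen for each \<open>x\<close>. Requiring it
  for both would be unsatisfiable: it gives \<open>\<bar>\<gamma>\<^sub>t(0) - \<gamma>(0) - t h\<bar> \<le> Kt s\<^sub>0 \<bar>t\<bar>\<close> with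
  \<open>\<gamma>\<^sub>t(0)\<close> on the boundary, which fails for small \<open>s\<^sub>0\<close> and directions \<open>h\<close> transversal to a
  Lipschitz boundary.\<close>

definition well_structured ::
  "'a::euclidean_space set \<Rightarrow> ('a \<Rightarrow> real) \<Rightarrow> (real \<Rightarrow> 'a \<Rightarrow> real) \<Rightarrow> real \<Rightarrow> bool" where
  "well_structured S v g Kt \<longleftrightarrow> (\<exists>\<beta>::real. AE x in lebesgue_on S.
     \<exists>s\<^sub>0>0. \<exists>\<gamma>. leaf_param S v g x s\<^sub>0 \<gamma> \<and>
       (\<forall>s\<in>{0..s\<^sub>0}. norm (vector_derivative \<gamma> (at s)) = 1) \<and>
       (\<forall>h. norm h = 1 \<longrightarrow> (\<exists>\<delta>>0. \<exists>\<Gamma> B.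
          (\<forall>t. 0 < \<bar>t\<bar> \<and> \<bar>t\<bar> < \<delta> \<longrightarrow>
             leaf_param S v g (x + t *\<^sub>R h) s\<^sub>0 (\<Gamma> t) \<and>
             (\<forall>s\<in>{0..s\<^sub>0}.
                norm (vector_derivative (\<Gamma> t) (at s) - vector_derivative \<gamma> (at s)) \<le> Kt * \<bar>t\<bar>)) \<and>
          (\<forall>s\<in>{0..s\<^sub>0}.
             ((\<lambda>t. (\<Gamma> t s - \<gamma> s) /\<^sub>R t) \<longlongrightarrow> B s) (at 0) \<and> norm (B s) \<le> \<beta>))))"

end

theory Submission
  imports Defs
begin

text \<open>Let \<open>P = \<nabla>u + F\<close>, \<open>J = \<sigma> P\<close>, write \<open>ut\<close>, \<open>Pt\<close>, \<open>Jt\<close>, \<open>\<sigma>t\<close> for the data with tilde, and put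
  \<open>w = u - ut\<close> and \<open>\<delta> = \<parallel>F - Ft\<parallel>\<close> in \<open>L\<^sup>1\<close>.

  The Euler-Lagrange equation of the minimizer makes \<open>a P / \<bar>P\<bar>\<close> dual feasible, and comparing it with the
  maximizer \<open>J\<close> gives \<open>\<bar>J\<bar> = a\<close>. Hence \<open>\<bar>J\<bar> = \<bar>Jt\<bar>\<close>, which makes \<open>(J - Jt) \<bullet> (P - Pt)\<close> bound
  \<open>\<bar>J - Jt\<bar>\<^sup>2 / \<sigma>1\<close>, while its integral is \<open>\<integral>(J - Jt) \<bullet> (F - Ft) \<le> 2 M \<delta>\<close> because \<open>J - Jt\<close> is weakly
  divergence free.

  A vector \<open>h\<close> tangent to the level surface of \<open>v\<close> satisfies \<open>P \<bullet> h = 0\<close>, so \<open>\<nabla>w \<bullet> h\<close> is controlled by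
  \<open>G = \<bar>J - Jt\<bar> / \<sigma>0 + \<bar>F - Ft\<bar>\<close>. Since \<open>w\<close> vanishes on the boundary and every leaf reaches it,
  integrating along the leaf bounds \<open>\<bar>w\<bar>\<close> by the integral of \<open>G\<close> over the leaf; applying the coarea
  formula twice gives \<open>\<parallel>w\<parallel> \<le> C \<parallel>G\<parallel> \<le> C \<delta>\<^bsup>1/2\<^esup>\<close> in \<open>L\<^sup>1\<close>.

  Finally \<open>\<nabla> \<bullet> (\<sigma> P) = H\<close> shows that \<open>\<Delta>u\<close> and \<open>\<Delta>ut\<close> are bounded, so \<open>\<parallel>\<nabla>w\<parallel>\<^sup>2 \<le> C \<parallel>w\<parallel>\<close> with the
  \<open>L\<^sup>2\<close> norm on the left and the \<open>L\<^sup>1\<close> norm on the right, and the exponent \<open>1/4\<close> results.\<close>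


section \<open>Change of variables and length of arcs\<close>

text \<open>The obstacle is that leaves are given one at a time: for almost every \<open>t\<close>
  and \<open>r\<close> a component of a level curve has some arc-length parametrization, with no
  measurable dependence on the component, and nothing says that there are only countably many
  components. Integration therefore never starts from leaves as a family. Level surfaces and level
  curves are cut into countably many graphs over coordinate planes and axes, chosen without
  reference to the parametrizations, and the coarea formula is proved for these graphs by a
  one-dimensional substitution and Tonelli. A parametrization serves only to compare arc length with
  the graph coordinate on a single component, and this comparison also yields countability. The
  bounds m / \<sigma>1 \<le> |P| \<le> M / \<sigma>0 keep the densities of the formula between
  positive constants, and \<open>K\<close> bounds the parameter length of every leaf. The exponent
  1/4 consists of two square roots: one from the mean square to the L^1 norm of the flux difference,
  one from the mean square to the L^1 norm of the gradient difference. All integrations by parts are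
  done with functions in \<open>H10\<close>, hence without boundary terms.\<close>

lemma emeasure_image_derivative:
  fixes h h' :: "real \<Rightarrow> real"
  assumes S: "S \<in> sets borel" "bounded S"
    and der: "\<And>x. x \<in> S \<Longrightarrow> (h has_real_derivative h' x) (at x within S)"
    and inj: "inj_on h S" and cont: "continuous_on S h'"
    and bd: "\<And>x. x \<in> S \<Longrightarrow> \<bar>h' x\<bar> \<le> B" and im: "h ` S \<in> sets borel"
  shows "emeasure lborel (h ` S) = (\<integral>\<^sup>+x\<in>S. ennreal \<bar>h' x\<bar> \<partial>lborel)"
proof -
  have Sl: "S \<in> sets lebesgue" using S by simp
  have m: "(\<lambda>x. indicator S x * \<bar>h' x\<bar>) \<in> borel_measurable borel"
    using borel_measurable_continuous_on_indicator[OF S(1), of "\<lambda>x. \<bar>h' x\<bar>"] cont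
    by (auto intro: continuous_intros)
  have fin: "emeasure lborel S < \<infinity>" using emeasure_bounded_finite[OF S(2)] by simp
  have int: "integrable lborel (\<lambda>x. indicator S x *\<^sub>R \<bar>h' x\<bar>)"
  proof (rule Bochner_Integration.integrable_bound)
    show "integrable lborel (\<lambda>x. indicator S x *\<^sub>R B)"
      using S fin by (intro integrable_scaleR_left) auto
    show "(\<lambda>x. indicator S x *\<^sub>R \<bar>h' x\<bar>) \<in> borel_measurable lborel" using m by simp
    show "AE x in lborel. norm (indicator S x *\<^sub>R \<bar>h' x\<bar>) \<le> norm (indicator S x *\<^sub>R B)"
      using bd by (intro AE_I2) (auto simp: indicator_def intro: order_trans[OF _ abs_ge_self])
  qed
  then have ai: "(\<lambda>x. \<bar>h' x\<bar>) absolutely_integrable_on S"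
    unfolding set_integrable_def using integrable_completion[of "\<lambda>x. indicator S x *\<^sub>R \<bar>h' x\<bar>" lborel] m by simp
  define b where "b = integral S (\<lambda>x. \<bar>h' x\<bar>)"
  have b: "b = (LINT x|lborel. indicator S x *\<^sub>R \<bar>h' x\<bar>)"
    unfolding b_def using set_lebesgue_integral_eq_integral(2)[OF ai] m
    by (simp add: set_lebesgue_integral_def integral_completion)
  \<comment> \<open>Change of variables for the constant function 1, whose integral over the image
    is the measure of the image. Boundedness of \<open>S\<close> and of \<open>h'\<close> has
    supplied the absolute integrability that this requires.\<close>
  have "(\<lambda>x. \<bar>h' x\<bar> * 1) absolutely_integrable_on S \<and> integral S (\<lambda>x. \<bar>h' x\<bar> * 1) = b"
    using ai by (simp add: b_def)
  then have "(\<lambda>x. 1::real) absolutely_integrable_on (h ` S) \<and> integral (h ` S) (\<lambda>x. 1::real) = b"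
    using has_absolute_integral_change_of_variables_1'[OF Sl der inj, of "\<lambda>_. 1" b] by blast
  then have I: "(\<lambda>x. 1::real) absolutely_integrable_on (h ` S)" "integral (h ` S) (\<lambda>x. 1::real) = b" by auto
  have lm: "h ` S \<in> lmeasurable" using I(1) by (simp add: lmeasurable_iff_integrable set_integrable_def)
  have "measure lebesgue (h ` S) = b" using I(2) lm lmeasure_integral by metis
  then have "emeasure lebesgue (h ` S) = ennreal b"
    using emeasure_eq_ennreal_measure[OF fmeasurableD2[OF lm]] by simp
  then have "emeasure lborel (h ` S) = ennreal b" using im by simp
  also have "\<dots> = (\<integral>\<^sup>+x. ennreal (indicator S x *\<^sub>R \<bar>h' x\<bar>) \<partial>lborel)"
    unfolding b by (rule nn_integral_eq_integral[symmetric]) (use int in auto)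
  also have "\<dots> = (\<integral>\<^sup>+x\<in>S. ennreal \<bar>h' x\<bar> \<partial>lborel)"
    by (intro nn_integral_cong) (auto simp: indicator_def)
  finally show ?thesis .
qed

text \<open>Instead of approximating \<open>F\<close> by simple functions, two measures are
  compared: Lebesgue measure on the image, and the push-forward under \<open>h\<close> of the
  measure on \<open>S\<close> with density |h'|. They agree on every Borel set by
  \<open>emeasure_image_derivative\<close>, applied to the part of \<open>S\<close> that is mapped
  into it, hence they have the same integrals.\<close>

lemma nn_integral_image_derivative:
  fixes h h' :: "real \<Rightarrow> real"
  assumes S: "S \<in> sets borel" "bounded S"
    and der: "\<And>x. x \<in> S \<Longrightarrow> (h has_real_derivative h' x) (at x within S)"
    and inj: "inj_on h S" and cont: "continuous_on S h'"
    and bd: "\<And>x. x \<in> S \<Longrightarrow> \<bar>h' x\<bar> \<le> B" and im: "h ` S \<in> sets borel"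
    and F: "F \<in> borel_measurable borel"
  shows "(\<integral>\<^sup>+y\<in>h ` S. F y \<partial>lborel) = (\<integral>\<^sup>+x\<in>S. F (h x) * ennreal \<bar>h' x\<bar> \<partial>lborel)"
proof -
  have hc: "continuous_on S h"
    using der by (meson DERIV_continuous continuous_on_eq_continuous_within)
  \<comment> \<open>Cutting off with the indicator makes \<open>k\<close> and \<open>d\<close> Borel
    on the whole line; \<open>h\<close> and \<open>h'\<close> are controlled only on
    \<open>S\<close>.\<close>
  define k where "k x = indicator S x * h x" for x
  define d where "d x = ennreal \<bar>indicator S x * h' x\<bar>" for x
  have k[measurable]: "k \<in> borel_measurable borel"
    using borel_measurable_continuous_on_indicator[OF S(1) hc] by (simp add: k_def[abs_def])
  have d[measurable]: "d \<in> borel_measurable borel"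
    using borel_measurable_continuous_on_indicator[OF S(1) cont] by (simp add: d_def[abs_def])
  have eq: "density lborel (indicator (h ` S)) = distr (density lborel d) borel k"
  proof (rule measure_eqI)
    fix A assume "A \<in> sets (density lborel (indicator (h ` S)))"
    then have A[measurable]: "A \<in> sets borel" by simp
    let ?T = "S \<inter> k -` A"
    have T[measurable]: "?T \<in> sets borel"
      using S measurable_sets[OF k A] by auto
    have im': "h ` ?T = h ` S \<inter> A" by (auto simp: k_def indicator_def)
    have "emeasure (density lborel (indicator (h ` S))) A = emeasure lborel (h ` ?T)"
      using im unfolding im' by (subst emeasure_density) (auto simp: indicator_inter_arith[symmetric])
    also have "\<dots> = (\<integral>\<^sup>+x\<in>?T. ennreal \<bar>h' x\<bar> \<partial>lborel)"
    proof (rule emeasure_image_derivative[of _ _ _ B])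
      show "bounded ?T" using S(2) by (rule bounded_subset) auto
      show "\<And>x. x \<in> ?T \<Longrightarrow> (h has_real_derivative h' x) (at x within ?T)"
        using der by (meson DERIV_subset IntE inf_le1)
      show "inj_on h ?T" using inj by (rule inj_on_subset) auto
      show "continuous_on ?T h'" using cont by (rule continuous_on_subset) auto
      show "h ` ?T \<in> sets borel" unfolding im' using im A by auto
    qed (use bd T in auto)
    also have "\<dots> = (\<integral>\<^sup>+x. d x * indicator (k -` A) x \<partial>lborel)"
      by (intro nn_integral_cong) (auto simp: indicator_def d_def)
    also have "\<dots> = emeasure (distr (density lborel d) borel k) A"
      using measurable_sets[OF k A] by (simp add: emeasure_distr emeasure_density)
    finally show "emeasure (density lborel (indicator (h ` S))) A = emeasure (distr (density lborel d) borel k) A" .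
  qed simp
  have "(\<integral>\<^sup>+y\<in>h ` S. F y \<partial>lborel) = (\<integral>\<^sup>+y. F y \<partial>density lborel (indicator (h ` S)))"
    using im F by (subst nn_integral_density) (auto simp: mult.commute)
  also have "\<dots> = (\<integral>\<^sup>+x. d x * F (k x) \<partial>lborel)"
    unfolding eq using F by (subst nn_integral_distr) (auto simp: nn_integral_density)
  also have "\<dots> = (\<integral>\<^sup>+x\<in>S. F (h x) * ennreal \<bar>h' x\<bar> \<partial>lborel)"
    by (intro nn_integral_cong) (auto simp: indicator_def d_def k_def mult.commute)
  finally show ?thesis .
qed

text \<open>A unit-speed C^1 arc is nearly isometric at small scales: short chords are at least (1 -
  e) times the parameter distance. So a cover of the arc by small sets pulls back to a cover of
  [a, b] by intervals at most 1 / (1 - e) times as long. Countable subadditivity bounds b - a, and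
  then e tends to 0.\<close>

lemma hausdorff1_arc_ge:
  fixes \<gamma> :: "real \<Rightarrow> 'a::euclidean_space"
  assumes ab: "a < b" and der: "\<And>s. s \<in> {a..b} \<Longrightarrow> (\<gamma> has_vector_derivative D s) (at s)"
    and cont: "continuous_on {a..b} D" and unit: "\<And>s. s \<in> {a..b} \<Longrightarrow> norm (D s) = 1"
    and inj: "inj_on \<gamma> {a..b}" and sub: "\<gamma> ` {a..b} \<subseteq> A" and K: "hausdorff1 A \<le> ennreal K"
  shows "b - a \<le> K"
proof -
  have gc: "continuous_on {a..b} \<gamma>"
    by (rule continuous_on_vector_derivative[of _ _ D]) (use der has_vector_derivative_at_within in blast)
  have uc: "uniformly_continuous_on {a..b} D"
    using cont compact_uniformly_continuous by blast
  have chord: "\<exists>d>0. \<forall>s\<in>{a..b}. \<forall>s'\<in>{a..b}. dist s s' < d \<longrightarrow> (1 - e) * dist s s' \<le> dist (\<gamma> s) (\<gamma> s')"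
    if "0 < e" for e
  proof -
    obtain d where d: "d > 0" "\<And>s s'. s \<in> {a..b} \<Longrightarrow> s' \<in> {a..b} \<Longrightarrow> dist s' s < d \<Longrightarrow> dist (D s') (D s) < e"
      using uc \<open>0<e\<close> unfolding uniformly_continuous_on_def by metis
    \<comment> \<open>The map \<open>\<lambda>x. \<gamma> x - x *\<^sub>R D s\<close> has derivative
      \<open>D x - D s\<close>, which is at most \<open>e\<close> in norm by uniform continuity; so
      the chord differs from \<open>(s' - s) *\<^sub>R D s\<close>, of length s' - s, by at most e
      (s' - s).\<close>
    have *: "(1 - e) * (s' - s) \<le> dist (\<gamma> s) (\<gamma> s')" if "s \<in> {a..b}" "s' \<in> {a..b}" "s \<le> s'" "s' - s < d" for s s'
    proof -
      have "norm ((\<gamma> s' - s' *\<^sub>R D s) - (\<gamma> s - s *\<^sub>R D s)) \<le> e * (s' - s)"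
      proof (cases "s = s'")
        case False
        have "\<exists>x\<in>{s<..<s'}. norm ((\<gamma> s' - s' *\<^sub>R D s) - (\<gamma> s - s *\<^sub>R D s)) \<le> norm ((s' - s) *\<^sub>R (D x - D s))"
        proof (rule mvt_general[where f="\<lambda>x. \<gamma> x - x *\<^sub>R D s" and f'="\<lambda>x h. h *\<^sub>R (D x - D s)"])
          show "s < s'" using False that by simp
          show "continuous_on {s..s'} (\<lambda>x. \<gamma> x - x *\<^sub>R D s)"
            using that by (intro continuous_intros continuous_on_subset[OF gc]) auto
          fix x assume x: "s < x" "x < s'"
          then have "((\<lambda>x. \<gamma> x - x *\<^sub>R D s) has_vector_derivative D x - D s) (at x)"
            using that by (auto intro!: derivative_eq_intros der)
          then show "((\<lambda>x. \<gamma> x - x *\<^sub>R D s) has_derivative (\<lambda>h. h *\<^sub>R (D x - D s))) (at x)"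
            by (simp add: has_vector_derivative_def)
        qed
        then obtain x where x: "x\<in>{s<..<s'}" and le: "norm ((\<gamma> s' - s' *\<^sub>R D s) - (\<gamma> s - s *\<^sub>R D s)) \<le> norm ((s' - s) *\<^sub>R (D x - D s))" by blast
        have "norm (D x - D s) \<le> e" using d(2)[of s x] x that by (auto simp: dist_norm intro: less_imp_le)
        then have "norm ((s' - s) *\<^sub>R (D x - D s)) \<le> e * (s' - s)"
          using that mult_right_mono[of "norm (D x - D s)" e "s' - s"] by (simp add: mult.commute)
        then show ?thesis using le by simp
      qed (simp)
      moreover have "(\<gamma> s' - s' *\<^sub>R D s) - (\<gamma> s - s *\<^sub>R D s) = (\<gamma> s' - \<gamma> s) - (s' - s) *\<^sub>R D s" by (simp add: algebra_simps)
      ultimately have "norm ((s' - s) *\<^sub>R D s) - norm (\<gamma> s' - \<gamma> s) \<le> e * (s' - s)"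
        by (metis norm_triangle_ineq2 norm_minus_commute order_trans)
      moreover have "norm ((s' - s) *\<^sub>R D s) = s' - s" using unit[of s] that by simp
      ultimately show ?thesis by (simp add: dist_norm norm_minus_commute left_diff_distrib)
    qed
    show ?thesis
    proof (intro exI[of _ d] conjI ballI impI)
      fix s s' assume s: "s \<in> {a..b}" "s' \<in> {a..b}" "dist s s' < d"
      show "(1 - e) * dist s s' \<le> dist (\<gamma> s) (\<gamma> s')"
      proof (cases "s \<le> s'")
        case True then show ?thesis using *[of s s'] s by (auto simp: dist_real_def)
      next
        case False then show ?thesis using *[of s' s] s by (auto simp: dist_real_def dist_commute)
      qed
    qed (use d in auto)
  qed
  obtain G where G: "homeomorphism {a..b} (\<gamma> ` {a..b}) \<gamma> G"
    using homeomorphism_compact[OF _ gc refl inj] by auto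
  then have "continuous_on (\<gamma> ` {a..b}) G" by (simp add: homeomorphism_def)
  then have "uniformly_continuous_on (\<gamma> ` {a..b}) G"
    using gc by (intro compact_uniformly_continuous compact_continuous_image) auto
  \<comment> \<open>The chord estimate says nothing about parameters far apart. Uniform continuity
    of the inverse on the compact image excludes a near return of the arc: points close in space
    have close parameters.\<close>
  then have Gu: "\<exists>d>0. \<forall>s\<in>{a..b}. \<forall>s'\<in>{a..b}. dist (\<gamma> s) (\<gamma> s') < d \<longrightarrow> dist s s' < e" if "e > 0" for e
    using that G unfolding uniformly_continuous_on_def homeomorphism_def
    by (metis (no_types, opaque_lifting) image_eqI dist_commute)
  have main: "ennreal (b - a) \<le> ennreal (1 / (1 - e)) * ennreal K" if e: "0 < e" "e < 1" for e
  proof -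
    obtain d1 where d1: "d1 > 0" "\<And>s s'. s\<in>{a..b} \<Longrightarrow> s'\<in>{a..b} \<Longrightarrow> dist s s' < d1 \<Longrightarrow> (1 - e) * dist s s' \<le> dist (\<gamma> s) (\<gamma> s')"
      using chord[OF e(1)] by blast
    obtain d2 where d2: "d2 > 0" "\<And>s s'. s\<in>{a..b} \<Longrightarrow> s'\<in>{a..b} \<Longrightarrow> dist (\<gamma> s) (\<gamma> s') < d2 \<Longrightarrow> dist s s' < d1"
      using Gu[OF d1(1)] by blast
    define c where "c = 1 / (1 - e)"
    have c: "c > 0" using e by (simp add: c_def)
    have lip: "dist s s' \<le> c * dist (\<gamma> s) (\<gamma> s')" if "s\<in>{a..b}" "s'\<in>{a..b}" "dist (\<gamma> s) (\<gamma> s') < d2" for s s'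
      using d1(2)[OF that(1,2) d2(2)[OF that]] e by (simp add: c_def field_simps)
    have cov: "ennreal (b - a) \<le> ennreal c * (\<Sum>i. ennreal (diameter (U i)))"
      if U: "A \<subseteq> (\<Union>i. U i)" "\<forall>i. bounded (U i) \<and> diameter (U i) \<le> d2 / 2" for U :: "nat \<Rightarrow> 'a set"
    proof -
      define V where "V i = {s\<in>{a..b}. \<gamma> s \<in> U i}" for i
      \<comment> \<open>The preimage \<open>V i\<close> of an arbitrary covering set may fail to be
        measurable; the interval spanned by it has the same diameter.\<close>
      define I where "I i = (if V i = {} then {} else {Inf (V i)..Sup (V i)})" for i
      have VI: "V i \<subseteq> I i" for i
        by (auto simp: I_def V_def intro!: cInf_lower cSup_upper bdd_belowI[of _ a] bdd_aboveI[of _ b])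
      have di: "dist s s' \<le> c * diameter (U i)" if "s \<in> V i" "s' \<in> V i" for s s' i
      proof -
        have "dist (\<gamma> s) (\<gamma> s') \<le> diameter (U i)" using U(2) that by (auto simp: V_def intro: diameter_bounded_bound)
        moreover have "diameter (U i) < d2" using U(2)[rule_format, of i] d2(1) by linarith
        moreover have "c * dist (\<gamma> s) (\<gamma> s') \<le> c * diameter (U i)"
          using c calculation(1) by (intro mult_left_mono) auto
        ultimately show ?thesis using lip[of s s'] that by (auto simp: V_def)
      qed
      have len: "emeasure lborel (I i) \<le> ennreal c * ennreal (diameter (U i))" for i
      proof (cases "V i = {}")
        case False
        have bd: "bdd_below (V i)" "bdd_above (V i)" by (auto simp: V_def)
        have "Sup (V i) \<le> Inf (V i) + c * diameter (U i)"
        proof (rule cSup_least[OF False])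
          fix s assume s: "s \<in> V i"
          have "s - c * diameter (U i) \<le> Inf (V i)"
          proof (rule cInf_greatest[OF False])
            fix s' assume "s' \<in> V i"
            then show "s - c * diameter (U i) \<le> s'" using di[OF s, of s'] by (auto simp: dist_real_def)
          qed
          then show "s \<le> Inf (V i) + c * diameter (U i)" by simp
        qed
        moreover have "Inf (V i) \<le> Sup (V i)" using False bd by (meson all_not_in_conv cInf_lower cSup_upper order_trans)
        ultimately have "emeasure lborel (I i) \<le> ennreal (c * diameter (U i))"
          using False by (auto simp: I_def intro!: ennreal_leI)
        then show ?thesis using c by (simp add: ennreal_mult' U diameter_ge_0)
      qed (simp add: I_def)
      have "{a..b} \<subseteq> (\<Union>i. I i)"
      proof
        fix s assume s: "s \<in> {a..b}"
        then obtain i where "\<gamma> s \<in> U i" using sub U(1) by blast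
        then show "s \<in> (\<Union>i. I i)" using VI[of i] s by (auto simp: V_def)
      qed
      then have "emeasure lborel {a..b} \<le> emeasure lborel (\<Union>i. I i)"
        by (intro emeasure_mono) (auto simp: I_def)
      also have "\<dots> \<le> (\<Sum>i. emeasure lborel (I i))"
        by (intro emeasure_subadditive_countably) (auto simp: I_def)
      also have "\<dots> \<le> (\<Sum>i. ennreal c * ennreal (diameter (U i)))"
        by (intro suminf_le len) auto
      also have "\<dots> = ennreal c * (\<Sum>i. ennreal (diameter (U i)))" by simp
      finally show ?thesis using ab by simp
    qed
    let ?\<U> = "{U :: nat \<Rightarrow> 'a set. A \<subseteq> (\<Union>i. U i) \<and> (\<forall>i. bounded (U i) \<and> diameter (U i) \<le> d2 / 2)}"
    have "ennreal ((b - a) / c) \<le> (INF U\<in>?\<U>. \<Sum>i. ennreal (diameter (U i)))"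
    proof (rule INF_greatest)
      fix U assume "U \<in> ?\<U>"
      then have le: "ennreal (b - a) \<le> ennreal c * (\<Sum>i. ennreal (diameter (U i)))" using cov by blast
      have "ennreal ((b - a) / c) = ennreal (b - a) / ennreal c" using ab c by (simp add: divide_ennreal)
      also have "\<dots> \<le> (\<Sum>i. ennreal (diameter (U i)))"
        using le c by (simp add: divide_le_posI_ennreal mult.commute)
      finally show "ennreal ((b - a) / c) \<le> (\<Sum>i. ennreal (diameter (U i)))" .
    qed
    also have "\<dots> \<le> hausdorff1 A" unfolding hausdorff1_def
      by (rule SUP_upper2[where i="d2/2"]) (use d2 in auto)
    also have "\<dots> \<le> ennreal K" by (rule K)
    finally have "ennreal c * ennreal ((b - a) / c) \<le> ennreal c * ennreal K" by (rule mult_left_mono) simp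
    moreover have "ennreal c * ennreal ((b - a) / c) = ennreal (b - a)"
      using c ab by (simp add: ennreal_mult'[symmetric])
    ultimately show ?thesis by (simp add: c_def)
  qed
    have le: "(1 - e) * (b - a) \<le> K" if "0 < e" "e < 1" for e
    proof -
      have "0 < 1 - e" using that by simp
      have "ennreal (b - a) \<le> ennreal (K / (1 - e))"
        using main[OF that] that by (simp add: ennreal_mult'[symmetric])
      moreover have "0 < b - a" using ab by simp
      ultimately have "b - a \<le> K / (1 - e)" by (simp add: ennreal_le_iff2)
      then show ?thesis using that by (simp add: field_simps)
    qed
    show ?thesis
    proof (rule field_le_epsilon)
      fix x :: real assume x: "0 < x"
      define e where "e = min (1/2) (x / (b - a))"
      have "0 < e" "e < 1" "e * (b - a) \<le> x" using ab x by (auto simp: e_def min_def field_simps)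
      then show "b - a \<le> K + x" using le[of e] by (simp add: algebra_simps)
    qed
qed


section \<open>The coarea formula in a chart\<close>

definition straighten :: "('a \<times> real \<Rightarrow> real) \<Rightarrow> 'a \<times> real \<Rightarrow> 'a \<times> real" where
  "straighten \<phi> x = (fst x, \<phi> x)"

text \<open>Convexity makes every vertical slice of \<open>U\<close> an interval, so that a
  nonvanishing vertical derivative gives injectivity of \<open>straighten \<phi>\<close> on all of
  \<open>U\<close> and not only locally. The bound \<open>B\<close> serves the change of variables
  on the slices.\<close>

locale vertical_chart =
  fixes U :: "('a::euclidean_space \<times> real) set" and \<phi> :: "'a \<times> real \<Rightarrow> real"
    and D\<phi> :: "'a \<times> real \<Rightarrow> 'a \<times> real" and B :: real
  assumes open_U: "open U" and bounded_U: "bounded U" and convex_U: "convex U"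
    and der: "\<And>x. x \<in> U \<Longrightarrow> (\<phi> has_derivative (\<lambda>h. D\<phi> x \<bullet> h)) (at x)"
    and cont_D: "continuous_on U D\<phi>"
    and nz: "\<And>x. x \<in> U \<Longrightarrow> snd (D\<phi> x) \<noteq> 0"
    and bd: "\<And>x. x \<in> U \<Longrightarrow> \<bar>snd (D\<phi> x)\<bar> \<le> B"
begin

definition img :: "('a \<times> real) set" where "img = straighten \<phi> ` U"
definition pt :: "'a \<times> real \<Rightarrow> 'a \<times> real" where "pt = inv_into U (straighten \<phi>)"
text \<open>The coarea density in graph coordinates: the area element |D\<phi>| / |\<partial>\<phi>|
  of the level set over the base, divided by |D\<phi>|, where \<partial> is the derivative in the
  last coordinate.\<close>

definition jac :: "'a \<times> real \<Rightarrow> real" where "jac y = 1 / \<bar>snd (D\<phi> (pt y))\<bar>"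

lemma cont_phi: "continuous_on U \<phi>"
  by (intro continuous_at_imp_continuous_on ballI has_derivative_continuous[OF der])

lemma der_vert:
  assumes "(p, z) \<in> U"
  shows "((\<lambda>z. \<phi> (p, z)) has_real_derivative snd (D\<phi> (p, z))) (at z)"
proof -
  have "((\<lambda>z. \<phi> (p, z)) has_derivative (\<lambda>h. D\<phi> (p, z) \<bullet> (0, h))) (at z)"
    by (rule has_derivative_compose[of "\<lambda>z. (p, z)" _ _ _ \<phi>, OF _ der[OF assms]])
      (auto intro!: derivative_eq_intros)
  then show ?thesis
    by (simp add: has_field_derivative_def inner_prod_def)
qed

lemma inj_straighten: "inj_on (straighten \<phi>) U"
proof (rule inj_onI)
  have *: "z = z'" if U: "(p, z) \<in> U" "(p, z') \<in> U" and eq: "\<phi> (p, z) = \<phi> (p, z')" and "z \<le> z'" for p z z'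
  proof (rule ccontr)
    assume "z \<noteq> z'"
    then have "z < z'" using \<open>z \<le> z'\<close> by simp
    have "convex {z. (p, z) \<in> U}"
    proof (rule convexI)
      fix x y u v :: real assume *: "x \<in> {z. (p, z) \<in> U}" "y \<in> {z. (p, z) \<in> U}" "0 \<le> u" "0 \<le> v" "u + v = 1"
      have "u *\<^sub>R (p, x) + v *\<^sub>R (p, y) \<in> U" using * by (intro convexD[OF convex_U]) auto
      moreover have "u *\<^sub>R p + v *\<^sub>R p = p" using * by (simp add: scaleR_add_left[symmetric])
      ultimately show "u *\<^sub>R x + v *\<^sub>R y \<in> {z. (p, z) \<in> U}" by simp
    qed
    then have seg: "(p, s) \<in> U" if "z \<le> s" "s \<le> z'" for s
      using U that unfolding is_interval_convex_1[symmetric] is_interval_1 by blast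
    have "\<exists>s. z < s \<and> s < z' \<and> \<phi> (p, z') - \<phi> (p, z) = (z' - z) * snd (D\<phi> (p, s))"
      by (rule MVT2[OF \<open>z < z'\<close>]) (use der_vert seg in blast)
    then obtain s where s: "z < s" "s < z'" "\<phi> (p, z') - \<phi> (p, z) = (z' - z) * snd (D\<phi> (p, s))" by blast
    then show False using eq nz[of "(p, s)"] seg[of s] \<open>z < z'\<close> by auto
  qed
  fix x y assume xy: "x \<in> U" "y \<in> U" "straighten \<phi> x = straighten \<phi> y"
  then have f: "fst x = fst y" "\<phi> x = \<phi> y" by (auto simp: straighten_def)
  have "(fst x, snd x) \<in> U" "(fst x, snd y) \<in> U" "\<phi> (fst x, snd x) = \<phi> (fst x, snd y)"
    using xy f by (metis prod.collapse)+
  note z = this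
  have "snd x = snd y"
  proof (cases "snd x \<le> snd y")
    case True then show ?thesis using *[OF z] by blast
  next
    case False then show ?thesis using *[OF z(2,1) z(3)[symmetric]] by simp
  qed
  then show "x = y" using f by (simp add: prod_eq_iff)
qed

lemma cont_straighten: "continuous_on U (straighten \<phi>)"
  unfolding straighten_def[abs_def] by (intro continuous_intros cont_phi)

lemma open_img: "open img"
  unfolding img_def using invariance_of_domain[OF cont_straighten open_U inj_straighten] .

lemma cont_pt: "continuous_on img pt"
proof -
  obtain g where g: "homeomorphism U (straighten \<phi> ` U) (straighten \<phi>) g"
    by (rule invariance_of_domain_homeomorphism[OF open_U cont_straighten order_refl inj_straighten])
  have "continuous_on img g" using g by (simp add: homeomorphism_def img_def)
  moreover have "g y = pt y" if "y \<in> img" for y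
    using g that inj_straighten by (auto simp: homeomorphism_def img_def pt_def inv_into_f_f)
  ultimately show ?thesis using continuous_on_cong[OF refl, of img g pt] by simp
qed

lemma pt_in: "y \<in> img \<Longrightarrow> pt y \<in> U"
  unfolding img_def pt_def by (rule inv_into_into)

lemma straighten_pt: "y \<in> img \<Longrightarrow> straighten \<phi> (pt y) = y"
  unfolding img_def pt_def by (rule f_inv_into_f)

lemma fst_pt: "y \<in> img \<Longrightarrow> fst (pt y) = fst y" and phi_pt: "y \<in> img \<Longrightarrow> \<phi> (pt y) = snd y"
  using straighten_pt[of y] by (auto simp: straighten_def prod_eq_iff)

lemma pt_straighten: "x \<in> U \<Longrightarrow> pt (straighten \<phi> x) = x"
  unfolding pt_def by (simp add: inj_straighten)

lemma straighten_in: "x \<in> U \<Longrightarrow> straighten \<phi> x \<in> img"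
  by (simp add: img_def)

text \<open>Implicit differentiation. The derivative of \<open>straighten \<phi>\<close> is
  triangular and has an explicit inverse because \<open>snd N\<close> is nonzero; together with the
  continuity of \<open>pt\<close>, which comes from invariance of domain, this gives the derivative
  of the inverse map, here restricted to the slice of constant \<open>t\<close>.\<close>

lemma has_derivative_pt:
  assumes y: "(p, t) \<in> img"
  defines "N \<equiv> D\<phi> (pt (p, t))"
  shows "((\<lambda>p. pt (p, t)) has_derivative (\<lambda>h. (h, - (fst N \<bullet> h) / snd N))) (at p)"
proof -
  let ?x = "pt (p, t)"
  have x: "?x \<in> U" by (rule pt_in[OF y])
  have n: "snd N \<noteq> 0" unfolding N_def by (rule nz[OF x])
  let ?g = "\<lambda>k. (fst k, (snd k - fst N \<bullet> fst k) / snd N)"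
  have "(pt has_derivative ?g) (at (p, t))"
  proof (rule has_derivative_inverse_basic[where f="straighten \<phi>" and f'="\<lambda>h. (fst h, N \<bullet> h)" and T=img])
    show "(straighten \<phi> has_derivative (\<lambda>h. (fst h, N \<bullet> h))) (at ?x)"
      unfolding straighten_def[abs_def] N_def
      by (intro has_derivative_Pair has_derivative_fst has_derivative_ident der x)
    show "bounded_linear ?g"
      unfolding divide_inverse
      by (intro bounded_linear_Pair bounded_linear_fst bounded_linear_compose[OF bounded_linear_mult_left]
          bounded_linear_sub bounded_linear_snd bounded_linear_compose[OF bounded_linear_inner_right])
    show "?g \<circ> (\<lambda>h. (fst h, N \<bullet> h)) = id"
      using n by (auto simp: fun_eq_iff inner_prod_def)
    show "continuous (at (p, t)) pt"
      using cont_pt open_img y by (simp add: continuous_on_eq_continuous_at)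
  qed (use y open_img straighten_pt in auto)
  then have "((\<lambda>p. pt (p, t)) has_derivative (\<lambda>h. ?g (h, 0))) (at p)"
    by (rule has_derivative_compose[rotated]) (auto intro!: derivative_eq_intros)
  then show ?thesis by simp
qed

lemma cont_jac: "continuous_on img jac"
  unfolding jac_def[abs_def]
  by (intro continuous_intros continuous_on_compose2[OF cont_D cont_pt]) (auto simp: pt_in nz)

lemma borel_pt: "(\<lambda>y. indicator img y *\<^sub>R pt y) \<in> borel_measurable borel"
  using borel_measurable_continuous_on_indicator[OF _ cont_pt] open_img by simp

lemma borel_jac: "(\<lambda>y. indicator img y *\<^sub>R jac y) \<in> borel_measurable borel"
  using borel_measurable_continuous_on_indicator[OF _ cont_jac] open_img by simp

text \<open>\<open>pt\<close> is unspecified outside \<open>img\<close>, so measurability is stated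
  after multiplication with the indicator; where that is nonzero, \<open>pt\<close> agrees with its
  Borel cut-off.\<close>

lemma borel_img_pt:
  assumes f: "f \<in> borel_measurable borel"
  shows "(\<lambda>y. indicator img y * (f (pt y) :: ennreal)) \<in> borel_measurable borel"
proof -
  have "(\<lambda>y. indicator img y * f (indicator img y *\<^sub>R pt y)) \<in> borel_measurable borel"
    using open_img by (intro borel_measurable_times_ennreal borel_measurable_indicator measurable_compose[OF borel_pt f]) simp
  also have "(\<lambda>y. indicator img y * f (indicator img y *\<^sub>R pt y)) = (\<lambda>y. indicator img y * f (pt y))"
    by (auto simp: indicator_def fun_eq_iff)
  finally show ?thesis .
qed

lemma borel_coarea_integrand:
  assumes f: "f \<in> borel_measurable borel"
  shows "(\<lambda>y. indicator img y * (f (pt y) * ennreal (jac y))) \<in> borel_measurable borel"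
proof -
  have "(\<lambda>y. (indicator img y * f (pt y)) * ennreal (indicator img y *\<^sub>R jac y)) \<in> borel_measurable borel"
    using borel_img_pt[OF f] borel_jac by measurable
  also have "(\<lambda>y. (indicator img y * f (pt y)) * ennreal (indicator img y *\<^sub>R jac y)) = (\<lambda>y. indicator img y * (f (pt y) * ennreal (jac y)))"
    by (auto simp: indicator_def fun_eq_iff)
  finally show ?thesis .
qed

text \<open>On each vertical line the substitution t = \<phi> (p, z) turns dz into
  \<open>jac\<close> dt, since \<open>jac\<close> is the reciprocal of the absolute slope. Tonelli
  then lets the integration over the base be done for fixed \<open>t\<close>.\<close>

lemma coarea:
  assumes f: "f \<in> borel_measurable borel"
  shows "(\<integral>\<^sup>+x\<in>U. f x \<partial>lborel)
    = (\<integral>\<^sup>+t. \<integral>\<^sup>+p. indicator img (p, t) * (f (pt (p, t)) * ennreal (jac (p, t))) \<partial>lborel \<partial>lborel)"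
proof -
  define F where "F y = indicator img y * (f (pt y) * ennreal (jac y))" for y
  have F: "F \<in> borel_measurable borel"
    unfolding F_def[abs_def] by (rule borel_coarea_integrand[OF f])
  have fU: "(\<lambda>x. f x * indicator U x) \<in> borel_measurable borel"
    using f open_U by simp
  have slice: "(\<integral>\<^sup>+z. f (p, z) * indicator U (p, z) \<partial>lborel) = (\<integral>\<^sup>+t. F (p, t) \<partial>lborel)" for p
  proof -
    let ?S = "{z. (p, z) \<in> U}"
    let ?h = "\<lambda>z. \<phi> (p, z)"
    have S: "open ?S" using open_vimage[OF open_U, of "Pair p"] by (simp add: vimage_def continuous_intros)
    have im: "?h ` ?S = {t. (p, t) \<in> img}"
      unfolding img_def straighten_def by (force simp: image_iff)
    have im_open: "open {t. (p, t) \<in> img}"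
      using open_vimage[OF open_img, of "Pair p"] by (simp add: vimage_def continuous_intros)
    have bS: "bounded ?S" by (rule bounded_subset[OF bounded_snd[OF bounded_U]]) force
    have Fp: "(\<lambda>t. F (p, t)) \<in> borel_measurable borel"
      using F by (rule measurable_compose[rotated]) (simp add: borel_prod[symmetric])
    have "(\<integral>\<^sup>+t. F (p, t) \<partial>lborel) = (\<integral>\<^sup>+t\<in>?h ` ?S. F (p, t) \<partial>lborel)"
      unfolding im by (intro nn_integral_cong) (auto simp: F_def indicator_def)
    also have "\<dots> = (\<integral>\<^sup>+z\<in>?S. F (p, \<phi> (p, z)) * ennreal \<bar>snd (D\<phi> (p, z))\<bar> \<partial>lborel)"
    proof (rule nn_integral_image_derivative[where B=B])
      show "inj_on ?h ?S" using inj_onD[OF inj_straighten, of "(p, _)" "(p, _)"] by (auto simp: inj_on_def straighten_def)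
      show "continuous_on ?S (\<lambda>z. snd (D\<phi> (p, z)))"
        by (intro continuous_intros continuous_on_compose2[OF cont_D]) auto
      show "?h ` ?S \<in> sets borel" unfolding im using im_open by simp
      show "\<And>z. z \<in> ?S \<Longrightarrow> (?h has_real_derivative snd (D\<phi> (p, z))) (at z within ?S)"
        using der_vert has_field_derivative_at_within by blast
      show "?S \<in> sets borel" using S by simp
      show "bounded ?S" by (rule bS)
      show "\<And>z. z \<in> ?S \<Longrightarrow> \<bar>snd (D\<phi> (p, z))\<bar> \<le> B" using bd by blast
      show "(\<lambda>t. F (p, t)) \<in> borel_measurable borel" by (rule Fp)
    qed
    also have "\<dots> = (\<integral>\<^sup>+z. f (p, z) * indicator U (p, z) \<partial>lborel)"
    proof (intro nn_integral_cong)
      fix z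
      show "F (p, \<phi> (p, z)) * ennreal \<bar>snd (D\<phi> (p, z))\<bar> * indicator ?S z = f (p, z) * indicator U (p, z)"
      proof (cases "(p, z) \<in> U")
        case True
        have eq: "(p, \<phi> (p, z)) = straighten \<phi> (p, z)" by (simp add: straighten_def)
        have "ennreal (jac (p, \<phi> (p, z))) * ennreal \<bar>snd (D\<phi> (p, z))\<bar> = 1"
          unfolding eq jac_def pt_straighten[OF True] using nz[OF True] by (simp add: ennreal_mult'[symmetric])
        then show ?thesis
          using True straighten_in[OF True] pt_straighten[OF True] by (simp add: F_def eq mult.assoc)
      qed simp
    qed
    finally show ?thesis by simp
  qed
  have "(\<integral>\<^sup>+x\<in>U. f x \<partial>lborel) = (\<integral>\<^sup>+x. f x * indicator U x \<partial>(lborel \<Otimes>\<^sub>M lborel))"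
    by (simp add: lborel_prod)
  also have "\<dots> = (\<integral>\<^sup>+p. \<integral>\<^sup>+z. f (p, z) * indicator U (p, z) \<partial>lborel \<partial>lborel)"
    using fU by (subst lborel.nn_integral_fst[symmetric]) (auto simp: lborel_prod)
  also have "\<dots> = (\<integral>\<^sup>+p. \<integral>\<^sup>+t. F (p, t) \<partial>lborel \<partial>lborel)" by (simp add: slice)
  also have "\<dots> = (\<integral>\<^sup>+t. \<integral>\<^sup>+p. F (p, t) \<partial>lborel \<partial>lborel)"
    using F by (intro lborel_pair.Fubini'[symmetric]) (auto simp: lborel_prod)
  finally show ?thesis by (simp add: F_def)
qed

end


section \<open>Estimate on a one-dimensional level set\<close>

lemma vector_diff_between:
  fixes f :: "real \<Rightarrow> real" assumes "a \<le> b" and "\<And>s. s \<in> {a..b} \<Longrightarrow> (f has_real_derivative f' s) (at s)"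
    and "continuous_on {a..b} g" and "\<And>s. s \<in> {a..b} \<Longrightarrow> \<bar>f' s\<bar> \<le> g s"
  shows "ennreal \<bar>f b - f a\<bar> \<le> (\<integral>\<^sup>+s\<in>{a..b}. ennreal (g s) \<partial>lborel)"
proof -
  have I: "(f' has_integral f b - f a) {a..b}"
    using assms(1,2) by (intro fundamental_theorem_of_calculus)
      (auto simp: has_real_derivative_iff_has_vector_derivative intro: has_vector_derivative_at_within)
  have gi: "g integrable_on {a..b}" using assms(3) by (rule integrable_continuous_real)
  have "norm (integral {a..b} f') \<le> integral {a..b} g"
    using I gi assms(4) by (intro integral_norm_bound_integral) (auto simp: has_integral_integrable)
  then have "\<bar>f b - f a\<bar> \<le> integral {a..b} g" using I by (simp add: integral_unique)
  also have "integral {a..b} g = (LBINT s:{a..b}. g s)"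
    using borel_integrable_atLeastAtMost'[OF assms(3)] by (rule set_borel_integral_eq_integral(2)[symmetric])
  finally have "ennreal \<bar>f b - f a\<bar> \<le> ennreal (LBINT s:{a..b}. g s)" by (rule ennreal_leI)
  also have "\<dots> = (\<integral>\<^sup>+s. ennreal (indicator {a..b} s * g s) \<partial>lborel)"
  proof -
    have "integrable lborel (\<lambda>s. indicator {a..b} s * g s)"
      using borel_integrable_atLeastAtMost'[OF assms(3)] by (simp add: set_integrable_def)
    moreover have "0 \<le> indicator {a..b} s * g s" for s
      using assms(4)[of s] abs_ge_zero order_trans by (fastforce simp: indicator_def)
    ultimately show ?thesis
      by (simp add: set_lebesgue_integral_def nn_integral_eq_integral)
  qed
  also have "\<dots> = (\<integral>\<^sup>+s\<in>{a..b}. ennreal (g s) \<partial>lborel)"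
    by (intro nn_integral_cong) (auto simp: indicator_def)
  finally show ?thesis .
qed

lemma nn_integral_count_space_single:
  assumes "a \<in> A" and "\<And>x. x \<in> A \<Longrightarrow> x \<noteq> a \<Longrightarrow> f x = 0"
  shows "(\<integral>\<^sup>+x. f x \<partial>count_space A) = (f a :: ennreal)"
proof -
  have "(\<integral>\<^sup>+x. f x \<partial>count_space A) = (\<integral>\<^sup>+x. f a * indicator {a} x \<partial>count_space A)"
    using assms by (intro nn_integral_cong) (auto simp: indicator_def)
  also have "\<dots> = f a" using assms(1) by (simp add: nn_integral_cmult_indicator)
  finally show ?thesis .
qed

lemma nn_integral_countable_partition:
  fixes Y :: "'i \<Rightarrow> 'a set"
  assumes "countable I" and f: "f \<in> borel_measurable M" and Y: "\<And>i. i \<in> I \<Longrightarrow> Y i \<in> sets M"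
    and disj: "disjoint_family_on Y I"
  shows "(\<integral>\<^sup>+x\<in>(\<Union>i\<in>I. Y i). f x \<partial>M) = (\<integral>\<^sup>+i. (\<integral>\<^sup>+x\<in>Y i. f x \<partial>M) \<partial>count_space I)"
proof -
  have "(\<integral>\<^sup>+i. (\<integral>\<^sup>+x\<in>Y i. f x \<partial>M) \<partial>count_space I) = (\<integral>\<^sup>+x. \<integral>\<^sup>+i. f x * indicator (Y i) x \<partial>count_space I \<partial>M)"
    using assms by (intro nn_integral_count_space_nn_integral[symmetric]) auto
  also have "\<dots> = (\<integral>\<^sup>+x\<in>(\<Union>i\<in>I. Y i). f x \<partial>M)"
  proof (intro nn_integral_cong)
    fix x
    show "(\<integral>\<^sup>+i. f x * indicator (Y i) x \<partial>count_space I) = f x * indicator (\<Union>i\<in>I. Y i) x"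
    proof (cases "\<exists>i\<in>I. x \<in> Y i")
      case True
      then obtain i where i: "i \<in> I" "x \<in> Y i" by blast
      have "x \<notin> Y j" if "j \<in> I" "j \<noteq> i" for j
        using disj i that by (auto simp: disjoint_family_on_def)
      then have "(\<integral>\<^sup>+i. f x * indicator (Y i) x \<partial>count_space I) = f x * indicator (Y i) x"
        using i by (intro nn_integral_count_space_single) auto
      then show ?thesis using i by (auto simp: indicator_def)
    next
      case False
      then have "(\<integral>\<^sup>+i. f x * indicator (Y i) x \<partial>count_space I) = (\<integral>\<^sup>+i. 0 \<partial>count_space I)"
        by (intro nn_integral_cong) auto
      then show ?thesis using False by auto
    qed
  qed
  finally show ?thesis by simp
qed

text \<open>Finite sums of the measures of disjoint subsets of \<open>Q\<close> stay below the
  finite measure of \<open>Q\<close>, and a summable family of reals has countable support.\<close>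

lemma countable_disjoint_positive_measure:
  assumes disj: "disjoint_family_on Y I" and Y: "\<And>i. i \<in> I \<Longrightarrow> Y i \<in> sets M"
    and sub: "\<And>i. i \<in> I \<Longrightarrow> Y i \<subseteq> Q" and Q: "Q \<in> sets M" "emeasure M Q < \<infinity>"
  shows "countable {i\<in>I. emeasure M (Y i) \<noteq> 0}"
proof -
  have fin: "emeasure M (Y i) < \<infinity>" if "i \<in> I" for i
    using emeasure_mono[OF sub[OF that] Q(1)] Q(2) by (rule order_le_less_trans)
  have "(\<lambda>i. measure M (Y i)) summable_on I"
  proof (rule nonneg_bdd_above_summable_on)
    show "bdd_above (sum (\<lambda>i. measure M (Y i)) ` {F. F \<subseteq> I \<and> finite F})"
    proof (rule bdd_aboveI2)
      fix F assume F: "F \<in> {F. F \<subseteq> I \<and> finite F}"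
      have "(\<Sum>i\<in>F. measure M (Y i)) = measure M (\<Union>i\<in>F. Y i)"
        using F Y fin disj
        by (intro measure_finite_Union[symmetric]) (auto simp: less_top[symmetric] intro: disjoint_family_on_mono)
      also have "\<dots> \<le> measure M Q"
        using F Y sub Q by (intro measure_mono_fmeasurable sets.finite_UN) (auto simp: fmeasurable_def)
      finally show "(\<Sum>i\<in>F. measure M (Y i)) \<le> measure M Q" .
    qed
  qed simp
  then have "(\<lambda>i. norm (measure M (Y i))) summable_on I" by simp
  then have "countable {i\<in>I. measure M (Y i) \<noteq> 0}" by (rule abs_summable_countable)
  moreover have "{i\<in>I. emeasure M (Y i) \<noteq> 0} \<subseteq> {i\<in>I. measure M (Y i) \<noteq> 0}"
    using fin by (fastforce simp: measure_def enn2real_eq_0_iff)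
  ultimately show ?thesis by (rule countable_subset[rotated])
qed

text \<open>The level set \<open>L\<close> is the disjoint union of the pieces \<open>X m ` Q m\<close>, each a graph over the
  coordinate in direction \<open>e m\<close>; \<open>\<rho>\<close> is the density that the coarea formula puts on them. The relation
  \<open>tan\<close> stands for tangency to \<open>L\<close> (the kernel of the derivatives of \<open>v\<close> and \<open>g\<close>), which by \<open>X_tan\<close> is
  transversal to the coordinate hyperplanes.\<close>

locale curve_pieces =
  fixes \<Omega> L :: "'a::euclidean_space set" and w G :: "'a \<Rightarrow> real" and Dw :: "'a \<Rightarrow> 'a"
    and tan :: "'a \<Rightarrow> 'a \<Rightarrow> bool" and K c c1 c2 :: real
    and Q :: "'i::countable \<Rightarrow> real set" and X :: "'i \<Rightarrow> real \<Rightarrow> 'a" and e :: "'i \<Rightarrow> 'a" and \<rho> :: "'i \<Rightarrow> real \<Rightarrow> real"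
  assumes open_Om: "open \<Omega>" and bounded_Om: "bounded \<Omega>" and L_sub: "L \<subseteq> \<Omega>"
    and w_cont: "continuous_on (closure \<Omega>) w" and w0: "\<And>x. x \<in> frontier \<Omega> \<Longrightarrow> w x = 0"
    and w_der: "\<And>x. x \<in> \<Omega> \<Longrightarrow> (w has_derivative (\<lambda>h. Dw x \<bullet> h)) (at x)"
    and G_cont: "continuous_on \<Omega> G" and G_nonneg: "\<And>x. x \<in> \<Omega> \<Longrightarrow> 0 \<le> G x"
    and curves: "\<And>C. C \<in> components L \<Longrightarrow> C1_curve_reaching_boundary \<Omega> C"
    and length_le: "hausdorff1 L \<le> ennreal K"
    and tanI: "\<And>\<gamma> \<gamma>' a b s. s \<in> {a<..<b} \<Longrightarrow> \<gamma> ` {a<..<b} \<subseteq> L \<Longrightarrow>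
      (\<gamma> has_vector_derivative \<gamma>') (at s) \<Longrightarrow> tan (\<gamma> s) \<gamma>'"
    and w_tan: "\<And>x h. x \<in> L \<Longrightarrow> tan x h \<Longrightarrow> \<bar>Dw x \<bullet> h\<bar> \<le> G x * norm h"
    and Q_borel: "\<And>m. Q m \<in> sets borel" and X_borel: "\<And>m. X m \<in> borel_measurable borel"
    and X_in: "\<And>m q. q \<in> Q m \<Longrightarrow> X m q \<in> L" and X_coord: "\<And>m q. q \<in> Q m \<Longrightarrow> X m q \<bullet> e m = q"
    and e_unit: "\<And>m. norm (e m) = 1"
    and X_disj: "\<And>m m' q q'. q \<in> Q m \<Longrightarrow> q' \<in> Q m' \<Longrightarrow> X m q = X m' q' \<Longrightarrow> m = m'"
    and X_cover: "\<And>x. x \<in> L \<Longrightarrow> \<exists>m. \<exists>q\<in>Q m. X m q = x"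
    and X_tan: "\<And>m q h. q \<in> Q m \<Longrightarrow> tan (X m q) h \<Longrightarrow> norm h \<le> c * \<bar>h \<bullet> e m\<bar>"
    and \<rho>_borel: "\<And>m. \<rho> m \<in> borel_measurable borel"
    and \<rho>_bounds: "\<And>m q. q \<in> Q m \<Longrightarrow> c1 \<le> \<rho> m q \<and> \<rho> m q \<le> c2"
    and pos: "0 < c" "0 < c1" "0 < c2"
begin

definition Y :: "'i \<Rightarrow> 'a set \<Rightarrow> real set" where "Y m C = {q\<in>Q m. X m q \<in> C}"

text \<open>The bound on \<open>l\<close> comes from compact subarcs: [a, b] with 0 < a maps into
  \<open>L\<close>, whereas \<open>\<gamma> 0\<close> lies on the frontier and hence outside
  \<open>L\<close>. \<open>hausdorff1_arc_ge\<close> bounds b - a by \<open>K\<close>, and the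
  subarcs exhaust the leaf.\<close>

lemma component:
  assumes C: "C \<in> components L"
  obtains l \<gamma> D where "0 < l" "l \<le> K" "\<And>s. s \<in> {0..<l} \<Longrightarrow> (\<gamma> has_vector_derivative D s) (at s)"
    "continuous_on {0..<l} D" "\<And>s. s \<in> {0..<l} \<Longrightarrow> norm (D s) = 1" "inj_on \<gamma> {0..<l}"
    "\<gamma> 0 \<in> frontier \<Omega>" "\<gamma> ` {0<..<l} = C"
proof -
  obtain \<gamma> l where l: "0 < l" and g: "\<gamma> C1_differentiable_on {0..<l}"
    "\<forall>s\<in>{0..<l}. norm (vector_derivative \<gamma> (at s)) = 1" "inj_on \<gamma> {0..<l}" "\<gamma> 0 \<in> frontier \<Omega>" "\<gamma> ` {0<..<l} = C"
    using curves[OF C] unfolding C1_curve_reaching_boundary_def by blast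
  obtain D where D: "\<And>s. s \<in> {0..<l} \<Longrightarrow> (\<gamma> has_vector_derivative D s) (at s)" "continuous_on {0..<l} D"
    using g(1) unfolding C1_differentiable_on_def by blast
  have n: "norm (D s) = 1" if "s \<in> {0..<l}" for s
    using g(2) D(1)[OF that] that by (metis vector_derivative_at)
  have CL: "C \<subseteq> L" using C by (rule in_components_subset)
  have le: "b - a \<le> K" if ab: "0 < a" "a < b" "b < l" for a b
  proof (rule hausdorff1_arc_ge[OF ab(2) _ _ _ _ _ length_le])
    show "\<gamma> ` {a..b} \<subseteq> L" using CL g(5) ab by force
    show "continuous_on {a..b} D" using ab by (intro continuous_on_subset[OF D(2)]) auto
    show "inj_on \<gamma> {a..b}" using ab by (intro inj_on_subset[OF g(3)]) auto
  qed (use D n ab in auto)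
  have "l \<le> K"
  proof (rule field_le_epsilon)
    fix x :: real assume "0 < x"
    \<comment> \<open>a \<le> l / 3 keeps the subarc from a to l - a nondegenerate, and a \<le> x /
      2 makes the loss 2 a at most x.\<close>
    define a where "a = min (l / 3) (x / 2)"
    have "0 < a" "a \<le> l/3" "a \<le> x/2" using l \<open>0 < x\<close> by (auto simp: a_def)
    then show "l \<le> K + x" using le[of a "l - a"] l by auto
  qed
  then show thesis using that l D n g by blast
qed

text \<open>The image of the open parameter interval is a countable union of compact arcs.\<close>

lemma component_borel: assumes "C \<in> components L" shows "C \<in> sets borel"
proof -
  obtain \<gamma> D l where g: "0 < (l::real)" "\<And>s. s \<in> {0..<l} \<Longrightarrow> (\<gamma> has_vector_derivative D s) (at s)" "\<gamma> ` {0<..<l} = C"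
    using component[OF assms] by metis
  have c: "continuous_on {0<..<l} \<gamma>"
    by (intro continuous_at_imp_continuous_on ballI has_vector_derivative_continuous[OF g(2)]) auto
  have eq: "{0<..<l} = (\<Union>n. {l / real (n + 2) .. l - l / real (n + 2)})" 
  proof (intro equalityI subsetI)
    fix s assume s: "s \<in> {0<..<l}"
    define d where "d = min s (l - s)"
    have d: "0 < d" using s by (auto simp: d_def)
    obtain n where "l / d < real n" using reals_Archimedean2 by blast
    then have "l < d * real n" using d by (simp add: field_simps)
    also have "\<dots> \<le> d * real (n + 2)" using d by (intro mult_left_mono) auto
    finally have "l / real (n + 2) \<le> d" by (simp add: field_simps)
    then show "s \<in> (\<Union>n. {l / real (n + 2) .. l - l / real (n + 2)})" by (auto simp: d_def intro!: exI[of _ n])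
  next
    fix s assume "s \<in> (\<Union>n. {l / real (n + 2) .. l - l / real (n + 2)})"
    then obtain n where n: "s \<in> {l / real (n + 2) .. l - l / real (n + 2)}" by blast
    have "0 < l / real (n + 2)" using g(1) by simp
    then show "s \<in> {0<..<l}" using n by (simp only: greaterThanLessThan_iff atLeastAtMost_iff) linarith
  qed
  then have "C = (\<Union>n. \<gamma> ` {l / real (n + 2) .. l - l / real (n + 2)})"
    using g(3) eq by (metis image_UN)
  moreover have "\<gamma> ` {l / real (n + 2) .. l - l / real (n + 2)} \<in> sets borel" for n
    by (intro borel_compact compact_continuous_image continuous_on_subset[OF c] compact_Icc) (use eq in blast)
  ultimately show ?thesis by auto
qed

lemma Y_borel: assumes "C \<in> components L" shows "Y m C \<in> sets borel"
  using measurable_sets[OF X_borel component_borel[OF assms], of m] Q_borel[of m]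
  unfolding Y_def by (simp add: Collect_conj_eq vimage_def Int_def[symmetric])

lemma Y_disj: "disjoint_family_on (Y m) (components L)"
  unfolding disjoint_family_on_def Y_def
  by (auto dest: components_nonoverlap)

lemma Y_Un: "(\<Union>C\<in>components L. Y m C) = Q m"
  using X_in Union_components[of L] unfolding Y_def by blast

lemma Q_finite: "emeasure lborel (Q m) < \<infinity>"
proof -
  have "Q m \<subseteq> (\<lambda>x. x \<bullet> e m) ` \<Omega>" using X_in X_coord L_sub by force
  moreover have "bounded ((\<lambda>x. x \<bullet> e m) ` \<Omega>)"
    by (intro bounded_linear_image[OF bounded_Om] bounded_linear_inner_left)
  ultimately have "bounded (Q m)" by (rule bounded_subset[rotated])
  then show ?thesis using emeasure_bounded_finite[of "Q m"] by simp
qed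


text \<open>The dictionary between arc length and graph coordinate on one leaf. By
  \<open>X_tan\<close> the unit tangent satisfies 1 \<le> c |D s \<bullet> e m| on piece
  \<open>m\<close>, so s and the coordinate q = \<gamma> s \<bullet> e m are related by a
  substitution whose Jacobian lies between 1 / c and 1.\<close>

lemma component_data:
  assumes C: "C \<in> components L"
  obtains l \<gamma> D S where "0 < l" "l \<le> K" "\<And>s. s \<in> {0..<l} \<Longrightarrow> (\<gamma> has_vector_derivative D s) (at s)"
    "continuous_on {0..<l} D" "\<And>s. s \<in> {0..<l} \<Longrightarrow> norm (D s) = 1" "\<gamma> 0 \<in> frontier \<Omega>" "\<gamma> ` {0<..<l} = C"
    "\<And>m. S m \<in> sets borel" "(\<Union>m. S m) = {0<..<l}" "disjoint_family S"
    "\<And>s. s \<in> {0<..<l} \<Longrightarrow> tan (\<gamma> s) (D s)"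
    "\<And>m s. s \<in> S m \<Longrightarrow> 1 \<le> c * \<bar>D s \<bullet> e m\<bar>" "\<And>m s. s \<in> S m \<Longrightarrow> \<bar>D s \<bullet> e m\<bar> \<le> 1"
    "\<And>m s. s \<in> S m \<Longrightarrow> X m (\<gamma> s \<bullet> e m) = \<gamma> s"
    "\<And>m F. F \<in> borel_measurable borel \<Longrightarrow> (\<integral>\<^sup>+q\<in>Y m C. F q \<partial>lborel)
       = (\<integral>\<^sup>+s\<in>S m. F (\<gamma> s \<bullet> e m) * ennreal \<bar>D s \<bullet> e m\<bar> \<partial>lborel)"
    "\<And>m s. s \<in> S m \<Longrightarrow> \<gamma> s \<bullet> e m \<in> Y m C"
proof -
  obtain \<gamma> D l where l: "0 < l" "l \<le> K" and der: "\<And>s. s \<in> {0..<l} \<Longrightarrow> (\<gamma> has_vector_derivative D s) (at s)"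
    and D: "continuous_on {0..<l} D" "\<And>s. s \<in> {0..<l} \<Longrightarrow> norm (D s) = 1"
    and inj: "inj_on \<gamma> {0..<l}" and g0: "\<gamma> 0 \<in> frontier \<Omega>" and im: "\<gamma> ` {0<..<l} = C"
  proof (rule component[OF C], goal_cases)
    case (1 l \<gamma> D) show ?case by (rule that[OF 1(2-)])
  qed
  have CL: "C \<subseteq> L" using C by (rule in_components_subset)
  \<comment> \<open>The parameters at which the leaf runs through piece \<open>m\<close>. That
    \<open>X m\<close> recovers the point from its coordinate makes the coordinate an injective
    function of \<open>s\<close> on this set.\<close>
  define S where "S m = {s\<in>{0<..<l}. \<gamma> s \<bullet> e m \<in> Q m \<and> X m (\<gamma> s \<bullet> e m) = \<gamma> s}" for m
  have Ssub: "S m \<subseteq> {0<..<l}" for m by (auto simp: S_def)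
  have gc: "continuous_on {0<..<l} \<gamma>"
    by (intro continuous_at_imp_continuous_on ballI has_vector_derivative_continuous[OF der]) auto
  have tn: "tan (\<gamma> s) (D s)" if "s \<in> {0<..<l}" for s
    using that im CL der[of s] by (intro tanI[of s 0 l]) auto
  have S_borel: "S m \<in> sets borel" for m
  proof -
    define g where "g s = indicator {0<..<l} s *\<^sub>R \<gamma> s" for s
    have g: "g \<in> borel_measurable borel"
      unfolding g_def[abs_def] by (intro borel_measurable_continuous_on_indicator gc) simp
    have h: "(\<lambda>s. g s \<bullet> e m) \<in> borel_measurable borel" using g by simp
    have "{s. g s \<bullet> e m \<in> Q m} \<in> sets borel"
      using measurable_sets[OF h Q_borel[of m]] by (simp add: vimage_def)
    moreover have "{s. X m (g s \<bullet> e m) = g s} \<in> sets borel"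
    proof -
      have "(\<lambda>s. X m (g s \<bullet> e m)) \<in> borel_measurable borel"
        by (rule measurable_compose[OF h X_borel])
      then have "(\<lambda>s. norm (X m (g s \<bullet> e m) - g s)) \<in> borel_measurable borel"
        using g by simp
      from measurable_sets[OF this, of "{0}"] show ?thesis by (simp add: vimage_def)
    qed
    ultimately have "{0<..<l} \<inter> ({s. g s \<bullet> e m \<in> Q m} \<inter> {s. X m (g s \<bullet> e m) = g s}) \<in> sets borel"
      by (intro sets.Int) simp_all
    also have "{0<..<l} \<inter> ({s. g s \<bullet> e m \<in> Q m} \<inter> {s. X m (g s \<bullet> e m) = g s}) = S m"
      by (auto simp: S_def g_def)
    finally show ?thesis .
  qed
  have cov: "(\<Union>m. S m) = {0<..<l}"
  proof (intro equalityI subsetI)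
    fix s assume s: "s \<in> {0<..<l}"
    then obtain m q where "q \<in> Q m" "X m q = \<gamma> s" using X_cover[of "\<gamma> s"] im CL by blast
    then have "s \<in> S m" using s X_coord[of q m] by (simp add: S_def)
    then show "s \<in> (\<Union>m. S m)" by blast
  qed (use Ssub in blast)
  have disj: "disjoint_family S"
    unfolding disjoint_family_on_def S_def using X_disj by fastforce
  have lower: "1 \<le> c * \<bar>D s \<bullet> e m\<bar>" if "s \<in> S m" for m s
    using X_tan[of "\<gamma> s \<bullet> e m" m "D s"] tn[of s] D(2)[of s] that by (simp add: S_def)
  have upper: "\<bar>D s \<bullet> e m\<bar> \<le> 1" if "s \<in> S m" for m s
    using Cauchy_Schwarz_ineq2[of "D s" "e m"] e_unit D(2)[of s] that by (simp add: S_def)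
  have XS: "X m (\<gamma> s \<bullet> e m) = \<gamma> s" if "s \<in> S m" for m s
    using that by (simp add: S_def)
  have im2: "(\<lambda>s. \<gamma> s \<bullet> e m) ` S m = Y m C" for m
  proof (intro equalityI subsetI)
    fix q assume "q \<in> Y m C"
    then have q: "q \<in> Q m" "X m q \<in> C" by (auto simp: Y_def)
    then obtain s where s: "s \<in> {0<..<l}" "\<gamma> s = X m q" using im by force
    then have "s \<in> S m" using q X_coord[OF q(1)] by (simp add: S_def)
    moreover have "q = \<gamma> s \<bullet> e m" using s X_coord[OF q(1)] by simp
    ultimately show "q \<in> (\<lambda>s. \<gamma> s \<bullet> e m) ` S m" by blast
  qed (use im in \<open>auto simp: S_def Y_def\<close>)
  have cv: "(\<integral>\<^sup>+q\<in>Y m C. F q \<partial>lborel) = (\<integral>\<^sup>+s\<in>S m. F (\<gamma> s \<bullet> e m) * ennreal \<bar>D s \<bullet> e m\<bar> \<partial>lborel)"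
    if F: "F \<in> borel_measurable borel" for m F
    unfolding im2[symmetric]
  proof (rule nn_integral_image_derivative[where B=1])
    show "bounded (S m)" using Ssub by (rule bounded_subset[rotated]) simp
    show "((\<lambda>s. \<gamma> s \<bullet> e m) has_real_derivative D s \<bullet> e m) (at s within S m)" if "s \<in> S m" for s
    proof -
      have "((\<lambda>s. \<gamma> s \<bullet> e m) has_vector_derivative D s \<bullet> e m) (at s within S m)"
        using that Ssub[of m] by (intro bounded_linear.has_vector_derivative[OF bounded_linear_inner_left]
            has_vector_derivative_at_within[OF der]) auto
      then show ?thesis by (simp add: has_real_derivative_iff_has_vector_derivative)
    qed
    show "inj_on (\<lambda>s. \<gamma> s \<bullet> e m) (S m)"
    proof (rule inj_onI)
      fix s s' assume s: "s \<in> S m" "s' \<in> S m" "\<gamma> s \<bullet> e m = \<gamma> s' \<bullet> e m"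
      then have "\<gamma> s = \<gamma> s'" by (auto simp: S_def)
      then show "s = s'" using s by (intro inj_onD[OF inj]) (auto simp: S_def)
    qed
    show "continuous_on (S m) (\<lambda>s. D s \<bullet> e m)"
      by (intro continuous_intros continuous_on_subset[OF D(1)]) (auto simp: S_def)
    show "(\<lambda>s. \<gamma> s \<bullet> e m) ` S m \<in> sets borel" unfolding im2 by (rule Y_borel[OF C])
  qed (use S_borel upper F in auto)
  have inY: "\<gamma> s \<bullet> e m \<in> Y m C" if "s \<in> S m" for m s
    using that im2[of m] by blast
  show thesis
    by (rule that[OF l der D g0 im S_borel cov disj tn lower upper XS cv inY])
qed

text \<open>Every component occupies a set of positive measure in one of the countably many pieces, and
  distinct components occupy disjoint sets.\<close>

lemma countable_components: "countable (components L)"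
proof -
  have "components L \<subseteq> (\<Union>m. {C\<in>components L. emeasure lborel (Y m C) \<noteq> 0})"
  proof
    fix C assume C: "C \<in> components L"
    obtain \<gamma> D l S where l: "0 < l" "l \<le> K" and der: "\<And>s. s \<in> {0..<l} \<Longrightarrow> (\<gamma> has_vector_derivative D s) (at s)"
      and D: "continuous_on {0..<l} D" "\<And>s. s \<in> {0..<l} \<Longrightarrow> norm (D s) = 1" and g0: "\<gamma> 0 \<in> frontier \<Omega>" and im: "\<gamma> ` {0<..<l} = C"
      and S: "\<And>m. S m \<in> sets borel" "(\<Union>m. S m) = {0<..<l}" "disjoint_family S"
      and tn: "\<And>s. s \<in> {0<..<l} \<Longrightarrow> tan (\<gamma> s) (D s)"
      and low: "\<And>m s. s \<in> S m \<Longrightarrow> 1 \<le> c * \<bar>D s \<bullet> e m\<bar>" and upp: "\<And>m s. s \<in> S m \<Longrightarrow> \<bar>D s \<bullet> e m\<bar> \<le> 1"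
      and XS: "\<And>m s. s \<in> S m \<Longrightarrow> X m (\<gamma> s \<bullet> e m) = \<gamma> s"
      and cv: "\<And>m F. F \<in> borel_measurable borel \<Longrightarrow> (\<integral>\<^sup>+q\<in>Y m C. F q \<partial>lborel)
       = (\<integral>\<^sup>+s\<in>S m. F (\<gamma> s \<bullet> e m) * ennreal \<bar>D s \<bullet> e m\<bar> \<partial>lborel)"
    and inY: "\<And>m s. s \<in> S m \<Longrightarrow> \<gamma> s \<bullet> e m \<in> Y m C"
  proof (rule component_data[OF C], goal_cases)
    case (1 l \<gamma> D S) show ?case by (rule that[OF 1(2-)])
  qed
    have "\<exists>m. emeasure lborel (S m) \<noteq> 0"
    proof (rule ccontr)
      assume "\<not> ?thesis"
      then have "\<And>m. S m \<in> null_sets lborel" using S by (auto simp: null_sets_def)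
      then have "{0<..<l} \<in> null_sets lborel" unfolding S(2)[symmetric] by (rule null_sets_UN)
      then have "emeasure lborel {0<..<l} = 0" by (rule null_setsD1)
      moreover have "emeasure lborel {0<..<l} = ennreal l" using l by simp
      ultimately show False using l by (simp add: ennreal_eq_0_iff)
    qed
    then obtain m where m: "emeasure lborel (S m) \<noteq> 0" by blast
    have "emeasure lborel (S m) = (\<integral>\<^sup>+s\<in>S m. 1 \<partial>lborel)" using S by simp
    \<comment> \<open>The lower bound on the slope carries positive length of \<open>S m\<close>
      over to positive measure of \<open>Y m C\<close>.\<close>
    also have "\<dots> \<le> (\<integral>\<^sup>+s\<in>S m. ennreal c * ennreal \<bar>D s \<bullet> e m\<bar> \<partial>lborel)"
    proof (intro nn_integral_mono)
      fix s show "1 * indicator (S m) s \<le> ennreal c * ennreal \<bar>D s \<bullet> e m\<bar> * indicator (S m) s"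
        using low[of s m] pos by (auto simp: indicator_def ennreal_mult'[symmetric] simp flip: ennreal_1 intro: ennreal_leI)
    qed
    also have "\<dots> = (\<integral>\<^sup>+q\<in>Y m C. ennreal c \<partial>lborel)" by (rule cv[symmetric]) simp
    also have "\<dots> = ennreal c * emeasure lborel (Y m C)"
      using Y_borel[OF C] by (simp add: nn_integral_cmult_indicator)
    finally have "emeasure lborel (Y m C) \<noteq> 0" using m by auto
    then show "C \<in> (\<Union>m. {C\<in>components L. emeasure lborel (Y m C) \<noteq> 0})" using C by blast
  qed
  moreover have "countable {C\<in>components L. emeasure lborel (Y m C) \<noteq> 0}" for m
    using Y_borel Q_borel Q_finite
    by (intro countable_disjoint_positive_measure[OF Y_disj, of _ _ "Q m"]) (auto simp: Y_def)
  ultimately show ?thesis by (meson countable_UN countable_subset countableI_type)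
qed

definition Gx :: "'a \<Rightarrow> real" where "Gx x = indicator \<Omega> x * G x"
definition wx :: "'a \<Rightarrow> real" where "wx x = indicator (closure \<Omega>) x * w x"

lemma Gx_borel: "Gx \<in> borel_measurable borel"
  using borel_measurable_continuous_on_indicator[OF _ G_cont] open_Om by (simp add: Gx_def[abs_def])

lemma wx_borel: "wx \<in> borel_measurable borel"
  using borel_measurable_continuous_on_indicator[OF _ w_cont] by (simp add: wx_def[abs_def])

text \<open>\<open>I\<close> is the integral of \<open>G\<close> over the whole leaf. It bounds |w|
  everywhere on the leaf, and the total weight of the leaf is at most c2 times its length, hence at
  most c2 K. Conversely \<open>I\<close> is at most c / c1 times the weighted graph integral of
  \<open>G\<close>: the slope costs \<open>c\<close>, the density 1 / c1. The product of both
  factors is the constant.\<close>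

lemma component_estimate:
  assumes C: "C \<in> components L"
  shows "(\<integral>\<^sup>+m. (\<integral>\<^sup>+q\<in>Y m C. ennreal (\<bar>wx (X m q)\<bar> * \<rho> m q) \<partial>lborel) \<partial>count_space UNIV)
    \<le> ennreal (c * c2 * K / c1) * (\<integral>\<^sup>+m. (\<integral>\<^sup>+q\<in>Y m C. ennreal (Gx (X m q) * \<rho> m q) \<partial>lborel) \<partial>count_space UNIV)"
proof -
  obtain \<gamma> D l S where l: "0 < l" "l \<le> K" and der: "\<And>s. s \<in> {0..<l} \<Longrightarrow> (\<gamma> has_vector_derivative D s) (at s)"
    and D: "continuous_on {0..<l} D" "\<And>s. s \<in> {0..<l} \<Longrightarrow> norm (D s) = 1" and g0: "\<gamma> 0 \<in> frontier \<Omega>" and im: "\<gamma> ` {0<..<l} = C"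
    and S: "\<And>m. S m \<in> sets borel" "(\<Union>m. S m) = {0<..<l}" "disjoint_family S"
    and tn: "\<And>s. s \<in> {0<..<l} \<Longrightarrow> tan (\<gamma> s) (D s)"
    and low: "\<And>m s. s \<in> S m \<Longrightarrow> 1 \<le> c * \<bar>D s \<bullet> e m\<bar>" and upp: "\<And>m s. s \<in> S m \<Longrightarrow> \<bar>D s \<bullet> e m\<bar> \<le> 1"
    and XS: "\<And>m s. s \<in> S m \<Longrightarrow> X m (\<gamma> s \<bullet> e m) = \<gamma> s"
    and cv: "\<And>m F. F \<in> borel_measurable borel \<Longrightarrow> (\<integral>\<^sup>+q\<in>Y m C. F q \<partial>lborel)
       = (\<integral>\<^sup>+s\<in>S m. F (\<gamma> s \<bullet> e m) * ennreal \<bar>D s \<bullet> e m\<bar> \<partial>lborel)"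
    and inY: "\<And>m s. s \<in> S m \<Longrightarrow> \<gamma> s \<bullet> e m \<in> Y m C"
  proof (rule component_data[OF C], goal_cases)
    case (1 l \<gamma> D S) show ?case by (rule that[OF 1(2-)])
  qed
  have CO: "C \<subseteq> \<Omega>" using in_components_subset[OF C] L_sub by blast
  have gin: "\<gamma> s \<in> \<Omega>" "\<gamma> s \<in> L" if "s \<in> {0<..<l}" for s using that im CO in_components_subset[OF C] by auto
  have gc: "continuous_on {0..<l} \<gamma>"
    by (intro continuous_at_imp_continuous_on ballI has_vector_derivative_continuous[OF der]) auto
  define I where "I = (\<integral>\<^sup>+s\<in>{0<..<l}. ennreal (G (\<gamma> s)) \<partial>lborel)"
  have wI: "ennreal \<bar>w (\<gamma> s)\<bar> \<le> I" if s: "s \<in> {0<..<l}" for s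
  proof -
    \<comment> \<open>\<open>w\<close> is differentiable only inside \<open>\<Omega>\<close>, so the
      leaf is followed from a > 0, and the boundary value 0 is reached as a tends to 0, by
      continuity of \<open>w\<close> on the closure.\<close>
    have "ennreal \<bar>w (\<gamma> s) - w (\<gamma> a)\<bar> \<le> I" if a: "0 < a" "a < s" for a
    proof -
      have "ennreal \<bar>w (\<gamma> s) - w (\<gamma> a)\<bar> \<le> (\<integral>\<^sup>+x\<in>{a..s}. ennreal (G (\<gamma> x)) \<partial>lborel)"
      proof (rule vector_diff_between[where f'="\<lambda>x. Dw (\<gamma> x) \<bullet> D x"])
        show "continuous_on {a..s} (\<lambda>x. G (\<gamma> x))"
          using a s gin by (intro continuous_on_compose2[OF G_cont] continuous_on_subset[OF gc]) auto
        fix x assume x: "x \<in> {a..s}"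
        then have x': "x \<in> {0<..<l}" "x \<in> {0..<l}" using a s by auto
        have "((\<lambda>x. w (\<gamma> x)) has_derivative (\<lambda>h. Dw (\<gamma> x) \<bullet> (h *\<^sub>R D x))) (at x)"
          using der[OF x'(2)] unfolding has_vector_derivative_def
          by (rule has_derivative_compose) (rule w_der[OF gin(1)[OF x'(1)]])
        then show "((\<lambda>x. w (\<gamma> x)) has_real_derivative Dw (\<gamma> x) \<bullet> D x) (at x)"
          by (simp add: has_field_derivative_def mult_commute_abs)
        show "\<bar>Dw (\<gamma> x) \<bullet> D x\<bar> \<le> G (\<gamma> x)"
          using w_tan[OF gin(2)[OF x'(1)] tn[OF x'(1)]] D(2)[OF x'(2)] by simp
      qed (use a in simp)
      also have "\<dots> \<le> I" unfolding I_def
        using a s by (intro nn_integral_mono) (auto simp: indicator_def)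
      finally show ?thesis .
    qed
    then have ev: "\<forall>\<^sub>F a in at_right 0. ennreal \<bar>w (\<gamma> s) - w (\<gamma> a)\<bar> \<le> I"
      using eventually_at_right_less[of 0] eventually_at_right_field[of _ 0] s
      by (auto simp: eventually_at_right_field intro!: exI[of _ s])
    have "continuous_on {0..<l} (\<lambda>a. w (\<gamma> a))"
    proof (rule continuous_on_compose2[OF w_cont gc])
      show "\<gamma> ` {0..<l} \<subseteq> closure \<Omega>"
      proof
        fix y assume "y \<in> \<gamma> ` {0..<l}"
        then obtain a where a: "a \<in> {0..<l}" "y = \<gamma> a" by blast
        show "y \<in> closure \<Omega>"
        proof (cases "a = 0")
          case True then show ?thesis using g0 a by (simp add: frontier_def)
        next
          case False then show ?thesis using gin(1)[of a] a closure_subset by auto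
        qed
      qed
    qed
    then have "continuous_on {0..l/2} (\<lambda>a. w (\<gamma> a))"
      by (rule continuous_on_subset) (use l in auto)
    then have "((\<lambda>a. w (\<gamma> a)) \<longlongrightarrow> w (\<gamma> 0)) (at 0 within {0..l/2})"
      using l by (simp add: continuous_on)
    then have "((\<lambda>a. w (\<gamma> a)) \<longlongrightarrow> 0) (at_right 0)"
      using l w0[OF g0] by (simp add: at_within_Icc_at_right)
    then have "((\<lambda>a. ennreal \<bar>w (\<gamma> s) - w (\<gamma> a)\<bar>) \<longlongrightarrow> ennreal \<bar>w (\<gamma> s) - 0\<bar>) (at_right 0)"
      by (intro tendsto_intros)
    then show ?thesis using ev by (intro tendsto_upperbound[of _ "ennreal \<bar>w (\<gamma> s)\<bar>" "at_right 0"]) auto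
  qed
  have E1: "(\<integral>\<^sup>+m. (\<integral>\<^sup>+q\<in>Y m C. ennreal (\<bar>wx (X m q)\<bar> * \<rho> m q) \<partial>lborel) \<partial>count_space UNIV) \<le> I * ennreal (c2 * K)"
  proof -
    have "(\<integral>\<^sup>+q\<in>Y m C. ennreal (\<bar>wx (X m q)\<bar> * \<rho> m q) \<partial>lborel) \<le> I * ennreal c2 * emeasure lborel (S m)" for m
    proof -
      have "(\<integral>\<^sup>+q\<in>Y m C. ennreal (\<bar>wx (X m q)\<bar> * \<rho> m q) \<partial>lborel) \<le> (\<integral>\<^sup>+q\<in>Y m C. I * ennreal c2 \<partial>lborel)"
      proof (intro nn_integral_mono)
        fix q show "ennreal (\<bar>wx (X m q)\<bar> * \<rho> m q) * indicator (Y m C) q \<le> I * ennreal c2 * indicator (Y m C) q"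
        proof (cases "q \<in> Y m C")
          case True
          then have q: "q \<in> Q m" "X m q \<in> C" by (auto simp: Y_def)
          then obtain s where s: "s \<in> {0<..<l}" "X m q = \<gamma> s" using im by force
          have "\<bar>wx (X m q)\<bar> = \<bar>w (\<gamma> s)\<bar>" using s subsetD[OF closure_subset gin(1)[OF s(1)]] by (simp add: wx_def)
          then have "ennreal (\<bar>wx (X m q)\<bar> * \<rho> m q) = ennreal \<bar>w (\<gamma> s)\<bar> * ennreal (\<rho> m q)" by (simp add: ennreal_mult')
          also have "\<dots> \<le> I * ennreal c2" using wI[OF s(1)] \<rho>_bounds[OF q(1)] by (intro mult_mono ennreal_leI) auto
          finally show ?thesis using True by simp
        qed simp
      qed
      also have "\<dots> = (\<integral>\<^sup>+s\<in>S m. I * ennreal c2 * ennreal \<bar>D s \<bullet> e m\<bar> \<partial>lborel)" by (rule cv) simp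
      also have "\<dots> \<le> (\<integral>\<^sup>+s\<in>S m. I * ennreal c2 \<partial>lborel)"
      proof (intro nn_integral_mono)
        fix s show "I * ennreal c2 * ennreal \<bar>D s \<bullet> e m\<bar> * indicator (S m) s \<le> I * ennreal c2 * indicator (S m) s"
          using upp[of s m] mult_left_mono[of "ennreal \<bar>D s \<bullet> e m\<bar>" 1 "I * ennreal c2"] by (auto simp: indicator_def)
      qed
      also have "\<dots> = I * ennreal c2 * emeasure lborel (S m)" using S by (simp add: nn_integral_cmult_indicator)
      finally show ?thesis .
    qed
    then have "(\<integral>\<^sup>+m. (\<integral>\<^sup>+q\<in>Y m C. ennreal (\<bar>wx (X m q)\<bar> * \<rho> m q) \<partial>lborel) \<partial>count_space UNIV) \<le> (\<integral>\<^sup>+m. I * ennreal c2 * emeasure lborel (S m) \<partial>count_space UNIV)"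
      by (rule nn_integral_mono)
    also have "\<dots> = I * ennreal c2 * (\<integral>\<^sup>+m. emeasure lborel (S m) \<partial>count_space UNIV)"
      by (rule nn_integral_cmult) simp
    also have "(\<integral>\<^sup>+m. emeasure lborel (S m) \<partial>count_space UNIV) = emeasure lborel {0<..<l}"
      using emeasure_UN_countable[of UNIV S lborel] S by simp
    also have "\<dots> = ennreal l" using l by simp
    also have "I * ennreal c2 * ennreal l \<le> I * ennreal c2 * ennreal K" using l by (intro mult_left_mono ennreal_leI) auto
    finally show ?thesis using pos by (simp add: ennreal_mult' mult.assoc)
  qed
  have E2: "I \<le> ennreal (c / c1) * (\<integral>\<^sup>+m. (\<integral>\<^sup>+q\<in>Y m C. ennreal (Gx (X m q) * \<rho> m q) \<partial>lborel) \<partial>count_space UNIV)"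
  proof -
    have GX: "(\<lambda>q. ennreal (Gx (X m q) * \<rho> m q)) \<in> borel_measurable borel" for m
      using measurable_compose[OF X_borel Gx_borel] \<rho>_borel by simp
    define f where "f s = ennreal (indicator {0<..<l} s * G (\<gamma> s))" for s
    have f: "f \<in> borel_measurable borel"
    proof -
      have "continuous_on {0<..<l} (\<lambda>s. G (\<gamma> s))"
        using gin by (intro continuous_on_compose2[OF G_cont] continuous_on_subset[OF gc]) auto
      then show ?thesis
        using borel_measurable_continuous_on_indicator[of "{0<..<l}" "\<lambda>s. G (\<gamma> s)"] by (simp add: f_def[abs_def])
    qed
    have "I = (\<integral>\<^sup>+s\<in>(\<Union>m. S m). f s \<partial>lborel)"
      unfolding I_def S(2) by (intro nn_integral_cong) (auto simp: f_def indicator_def)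
    also have "\<dots> = (\<integral>\<^sup>+m. (\<integral>\<^sup>+s\<in>S m. f s \<partial>lborel) \<partial>count_space UNIV)"
      using f S by (intro nn_integral_countable_partition) auto
    also have "\<dots> \<le> (\<integral>\<^sup>+m. ennreal (c / c1) * (\<integral>\<^sup>+q\<in>Y m C. ennreal (Gx (X m q) * \<rho> m q) \<partial>lborel) \<partial>count_space UNIV)"
    proof (intro nn_integral_mono)
      fix m
      have "(\<integral>\<^sup>+s\<in>S m. f s \<partial>lborel) \<le> (\<integral>\<^sup>+s\<in>S m. (ennreal (c / c1) * ennreal (Gx (X m (\<gamma> s \<bullet> e m)) * \<rho> m (\<gamma> s \<bullet> e m))) * ennreal \<bar>D s \<bullet> e m\<bar> \<partial>lborel)"
      proof (intro nn_integral_mono)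
        fix s
        show "f s * indicator (S m) s \<le> (ennreal (c / c1) * ennreal (Gx (X m (\<gamma> s \<bullet> e m)) * \<rho> m (\<gamma> s \<bullet> e m))) * ennreal \<bar>D s \<bullet> e m\<bar> * indicator (S m) s"
        proof (cases "s \<in> S m")
          case True
          have sl: "s \<in> {0<..<l}" using True S(2) by blast
          let ?q = "\<gamma> s \<bullet> e m"
          have "?q \<in> Y m C" by (rule inY[OF True])
          then have r: "c1 \<le> \<rho> m ?q" using \<rho>_bounds by (auto simp: Y_def)
          have g: "0 \<le> G (\<gamma> s)" using gin(1)[OF sl] by (rule G_nonneg)
          \<comment> \<open>Both factors are at least 1; multiplying \<open>G\<close> by them
            exchanges ds for the weighted measure \<rho> dq, up to c / c1.\<close>
          have "1 \<le> (c * \<bar>D s \<bullet> e m\<bar>) * (\<rho> m ?q / c1)"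
            using low[OF True] r pos mult_mono[of 1 "c * \<bar>D s \<bullet> e m\<bar>" 1 "\<rho> m ?q / c1"] by simp
          then have "G (\<gamma> s) * 1 \<le> G (\<gamma> s) * ((c * \<bar>D s \<bullet> e m\<bar>) * (\<rho> m ?q / c1))" using g by (rule mult_left_mono)
          then have "G (\<gamma> s) \<le> (c / c1) * (G (\<gamma> s) * \<rho> m ?q) * \<bar>D s \<bullet> e m\<bar>" by (simp add: field_simps)
          then have "ennreal (G (\<gamma> s)) \<le> ennreal (c / c1) * ennreal (G (\<gamma> s) * \<rho> m ?q) * ennreal \<bar>D s \<bullet> e m\<bar>"
            using pos g r by (simp add: ennreal_mult'[symmetric] ennreal_leI)
          then show ?thesis using True sl XS[OF True] gin(1)[OF sl] by (simp add: f_def Gx_def)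
        qed simp
      qed
      also have "\<dots> = (\<integral>\<^sup>+q\<in>Y m C. (ennreal (c / c1) * ennreal (Gx (X m q) * \<rho> m q)) \<partial>lborel)"
        using GX by (intro cv[symmetric]) auto
      also have "\<dots> = ennreal (c / c1) * (\<integral>\<^sup>+q\<in>Y m C. ennreal (Gx (X m q) * \<rho> m q) \<partial>lborel)"
        unfolding mult.assoc using GX Y_borel[OF C] by (intro nn_integral_cmult) auto
      finally show "(\<integral>\<^sup>+s\<in>S m. f s \<partial>lborel) \<le> ennreal (c / c1) * (\<integral>\<^sup>+q\<in>Y m C. ennreal (Gx (X m q) * \<rho> m q) \<partial>lborel)" .
    qed
    also have "\<dots> = ennreal (c / c1) * (\<integral>\<^sup>+m. (\<integral>\<^sup>+q\<in>Y m C. ennreal (Gx (X m q) * \<rho> m q) \<partial>lborel) \<partial>count_space UNIV)"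
      by (intro nn_integral_cmult) simp
    finally show ?thesis .
  qed
  have K0: "0 < K" using l by simp
  have "(\<integral>\<^sup>+m. (\<integral>\<^sup>+q\<in>Y m C. ennreal (\<bar>wx (X m q)\<bar> * \<rho> m q) \<partial>lborel) \<partial>count_space UNIV)
      \<le> (ennreal (c / c1) * (\<integral>\<^sup>+m. (\<integral>\<^sup>+q\<in>Y m C. ennreal (Gx (X m q) * \<rho> m q) \<partial>lborel) \<partial>count_space UNIV)) * ennreal (c2 * K)"
    using E1 mult_right_mono[OF E2, of "ennreal (c2 * K)"] by (rule order_trans) simp
  also have "\<dots> = (ennreal (c2 * K) * ennreal (c / c1)) * (\<integral>\<^sup>+m. (\<integral>\<^sup>+q\<in>Y m C. ennreal (Gx (X m q) * \<rho> m q) \<partial>lborel) \<partial>count_space UNIV)"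
    by (simp only: ac_simps)
  also have "ennreal (c2 * K) * ennreal (c / c1) = ennreal (c * c2 * K / c1)"
    using pos K0 by (simp add: ennreal_mult'[symmetric] mult.commute mult.left_commute)
  finally show ?thesis .
qed

text \<open>\<open>component_estimate\<close> summed over the leaves. Countability of
  \<open>components L\<close> is what allows the sum over leaves to be interchanged with the
  integrals over the pieces.\<close>

lemma estimate:
  "(\<integral>\<^sup>+m. (\<integral>\<^sup>+q\<in>Q m. ennreal (\<bar>w (X m q)\<bar> * \<rho> m q) \<partial>lborel) \<partial>count_space UNIV)
    \<le> ennreal (c * c2 * K / c1) * (\<integral>\<^sup>+m. (\<integral>\<^sup>+q\<in>Q m. ennreal (G (X m q) * \<rho> m q) \<partial>lborel) \<partial>count_space UNIV)"
proof -
  have part: "(\<integral>\<^sup>+m. (\<integral>\<^sup>+q\<in>Q m. F m q \<partial>lborel) \<partial>count_space UNIV)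
     = (\<integral>\<^sup>+C. (\<integral>\<^sup>+m. (\<integral>\<^sup>+q\<in>Y m C. F m q \<partial>lborel) \<partial>count_space UNIV) \<partial>count_space (components L))"
    if F: "\<And>m. F m \<in> borel_measurable borel" for F :: "'i \<Rightarrow> real \<Rightarrow> ennreal"
  proof -
    have "(\<integral>\<^sup>+q\<in>Q m. F m q \<partial>lborel) = (\<integral>\<^sup>+C. (\<integral>\<^sup>+q\<in>Y m C. F m q \<partial>lborel) \<partial>count_space (components L))" for m
      unfolding Y_Un[of m, symmetric]
      using F Y_borel by (intro nn_integral_countable_partition countable_components Y_disj) auto
    then show ?thesis
      by (simp add: nn_integral_count_space_nn_integral[of UNIV, symmetric] nn_integral_count_space_nn_integral[OF countable_components])
  qed
  have "(\<integral>\<^sup>+m. (\<integral>\<^sup>+q\<in>Q m. ennreal (\<bar>w (X m q)\<bar> * \<rho> m q) \<partial>lborel) \<partial>count_space UNIV)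
      = (\<integral>\<^sup>+m. (\<integral>\<^sup>+q\<in>Q m. ennreal (\<bar>wx (X m q)\<bar> * \<rho> m q) \<partial>lborel) \<partial>count_space UNIV)"
    using subsetD[OF closure_subset subsetD[OF L_sub X_in]]
    by (intro nn_integral_cong) (auto simp: indicator_def wx_def)
  also have "\<dots> = (\<integral>\<^sup>+C. (\<integral>\<^sup>+m. (\<integral>\<^sup>+q\<in>Y m C. ennreal (\<bar>wx (X m q)\<bar> * \<rho> m q) \<partial>lborel) \<partial>count_space UNIV) \<partial>count_space (components L))"
    using measurable_compose[OF X_borel wx_borel] \<rho>_borel by (intro part) simp
  also have "\<dots> \<le> (\<integral>\<^sup>+C. ennreal (c * c2 * K / c1) * (\<integral>\<^sup>+m. (\<integral>\<^sup>+q\<in>Y m C. ennreal (Gx (X m q) * \<rho> m q) \<partial>lborel) \<partial>count_space UNIV) \<partial>count_space (components L))"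
    by (intro nn_integral_mono component_estimate) simp
  also have "\<dots> = ennreal (c * c2 * K / c1) * (\<integral>\<^sup>+C. (\<integral>\<^sup>+m. (\<integral>\<^sup>+q\<in>Y m C. ennreal (Gx (X m q) * \<rho> m q) \<partial>lborel) \<partial>count_space UNIV) \<partial>count_space (components L))"
    by (intro nn_integral_cmult) simp
  also have "(\<integral>\<^sup>+C. (\<integral>\<^sup>+m. (\<integral>\<^sup>+q\<in>Y m C. ennreal (Gx (X m q) * \<rho> m q) \<partial>lborel) \<partial>count_space UNIV) \<partial>count_space (components L))
      = (\<integral>\<^sup>+m. (\<integral>\<^sup>+q\<in>Q m. ennreal (Gx (X m q) * \<rho> m q) \<partial>lborel) \<partial>count_space UNIV)"
    using measurable_compose[OF X_borel Gx_borel] \<rho>_borel by (intro part[symmetric]) simp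
  also have "\<dots> = (\<integral>\<^sup>+m. (\<integral>\<^sup>+q\<in>Q m. ennreal (G (X m q) * \<rho> m q) \<partial>lborel) \<partial>count_space UNIV)"
    using X_in L_sub by (intro nn_integral_cong) (auto simp: indicator_def Gx_def)
  finally show ?thesis .
qed

end


section \<open>Decomposition of regular level sets into graphs\<close>

text \<open>Boxes rather than arbitrary open sets, because the charts need convex domains;
  \<open>\<kappa> n\<close> remembers for which of the sets \<open>R k\<close> the box
  qualifies.\<close>

lemma open_box_cover:
  fixes R :: "'k::countable \<Rightarrow> 'a::euclidean_space set"
  assumes "\<And>k. open (R k)"
  shows "\<exists>B \<kappa>. (\<forall>n::nat. (\<exists>a b. B n = box a b) \<and> B n \<subseteq> R (\<kappa> n)) \<and> (\<Union>n. B n) = (\<Union>k. R k)"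
proof -
  have "\<forall>k. \<exists>D. countable D \<and> (\<forall>X\<in>D. \<exists>a b. X = box a b) \<and> \<Union>D = R k"
    using open_countable_Union_open_box[OF assms] by metis
  then obtain D where D: "\<And>k. countable (D k)" "\<And>k X. X \<in> D k \<Longrightarrow> \<exists>a b. X = box a b" "\<And>k. \<Union>(D k) = R k"
    by metis
  \<comment> \<open>The dummy pair makes the index set nonempty, as an enumeration by
    \<open>nat\<close> requires; its second component, the empty set, is a box.\<close>
  define p where "p = insert (undefined, {}) (SIGMA k:UNIV. D k)"
  have p: "countable p" "p \<noteq> {}" unfolding p_def using D(1) by auto
  define h where "h = from_nat_into p"
  have h: "range h = p" unfolding h_def using p by simp
  have 1: "(\<exists>a b. snd (h n) = box a b) \<and> snd (h n) \<subseteq> R (fst (h n))" for n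
  proof -
    have "h n \<in> p" using h by blast
    then consider "snd (h n) = {}" | "snd (h n) \<in> D (fst (h n))" unfolding p_def by auto
    then show ?thesis
    proof cases
      case 1 then show ?thesis by (metis box_eq_empty(1) empty_subsetI inner_zero_left less_irrefl order_refl box_idem)
    next
      case 2 then show ?thesis using D(2,3) by blast
    qed
  qed
  have "(\<Union>n. snd (h n)) = \<Union>(snd ` p)" unfolding h[symmetric] by auto
  also have "\<dots> = (\<Union>k. R k)" unfolding p_def D(3)[symmetric] by force
  finally show ?thesis using 1 by (intro exI[of _ "\<lambda>n. snd (h n)"] exI[of _ "\<lambda>n. fst (h n)"]) blast
qed

lemma disjointed_borel: "(\<And>n. B n \<in> sets M) \<Longrightarrow> disjointed B n \<in> sets M"
  using sets.range_disjointed_sets[of B M] by auto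

lemma open_Collect_less_on:
  fixes f g :: "'a::topological_space \<Rightarrow> real"
  assumes "open P" "continuous_on P f" "continuous_on P g"
  shows "open {x\<in>P. f x < g x}"
proof -
  have "open (P \<inter> (\<lambda>x. g x - f x) -` {0<..})"
    using assms by (intro continuous_open_preimage continuous_intros) auto
  also have "P \<inter> (\<lambda>x. g x - f x) -` {0<..} = {x\<in>P. f x < g x}" by auto
  finally show ?thesis .
qed

section \<open>Exchange of the coordinates in the plane\<close>

definition flip :: "bool \<Rightarrow> real \<times> real \<Rightarrow> real \<times> real" where
  "flip b p = (if b then prod.swap p else p)"

lemma flip_flip [simp]: "flip b (flip b p) = p"
  by (simp add: flip_def)

lemma flip_inner: "flip b p \<bullet> q = p \<bullet> flip b q"
  by (cases p, cases q) (simp add: flip_def)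

lemma bounded_linear_flip: "bounded_linear (flip b)"
  by (cases b) (auto simp: flip_def[abs_def] prod.swap_def[abs_def] intro!: bounded_linear_intros bounded_linear_ident)

lemma continuous_on_flip [continuous_intros]: "continuous_on S f \<Longrightarrow> continuous_on S (\<lambda>x. flip b (f x))"
  using bounded_linear.continuous_on[OF bounded_linear_flip] .

lemma borel_flip: "flip b \<in> borel_measurable borel"
  by (intro borel_measurable_continuous_onI continuous_intros)

lemma nn_integral_flip:
  assumes f: "f \<in> borel_measurable borel"
  shows "(\<integral>\<^sup>+y. f (flip b y) \<partial>lborel) = (\<integral>\<^sup>+y. f y \<partial>lborel)"
proof (cases b)
  case True
  have "(\<integral>\<^sup>+y. f (flip b y) \<partial>lborel) = (\<integral>\<^sup>+y. (\<lambda>(x, z). f (z, x)) y \<partial>(lborel \<Otimes>\<^sub>M lborel))"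
    using True by (auto simp: lborel_prod flip_def prod.swap_def case_prod_unfold)
  also have "\<dots> = (\<integral>\<^sup>+y. f y \<partial>(lborel \<Otimes>\<^sub>M lborel))"
  proof -
    have "(\<integral>\<^sup>+y. f y \<partial>(lborel \<Otimes>\<^sub>M lborel)) = (\<integral>\<^sup>+y. f y \<partial>distr (lborel \<Otimes>\<^sub>M lborel) (lborel \<Otimes>\<^sub>M lborel) (\<lambda>(x, y). (y, x)))"
      using lborel_pair.distr_pair_swap by metis
    also have "\<dots> = (\<integral>\<^sup>+y. f (case y of (x, z) \<Rightarrow> (z, x)) \<partial>(lborel \<Otimes>\<^sub>M lborel))"
      by (rule nn_integral_distr[OF measurable_pair_swap']) (use f in \<open>simp add: lborel_prod\<close>)
    finally show ?thesis by (simp add: case_prod_unfold)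
  qed
  finally show ?thesis by (simp add: lborel_prod)
qed (simp add: flip_def)

text \<open>The coarea formula for \<open>\<phi>\<close> with gradient \<open>\<alpha>\<close> on \<open>P\<close>: the piece \<open>X m r ` Q m r\<close> of the level set
  \<open>{\<phi> = r}\<close> is a graph over the first coordinate after exchanging the coordinates if \<open>sw m\<close>.\<close>

locale planar_pieces =
  fixes P :: "(real \<times> real) set" and \<phi> :: "real \<times> real \<Rightarrow> real" and \<alpha> :: "real \<times> real \<Rightarrow> real \<times> real"
    and c0 Bd :: real and sw :: "nat \<Rightarrow> bool" and Q :: "nat \<Rightarrow> real \<Rightarrow> real set"
    and X :: "nat \<Rightarrow> real \<Rightarrow> real \<Rightarrow> real \<times> real" and \<rho> :: "nat \<Rightarrow> real \<Rightarrow> real \<Rightarrow> real"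
  assumes formula: "\<And>f. f \<in> borel_measurable borel \<Longrightarrow> (\<integral>\<^sup>+p\<in>P. f p \<partial>lborel)
      = (\<integral>\<^sup>+r. \<integral>\<^sup>+m. (\<integral>\<^sup>+q\<in>Q m r. f (X m r q) * ennreal (\<rho> m r q) \<partial>lborel) \<partial>count_space UNIV \<partial>lborel)"
    and meas: "\<And>f. f \<in> borel_measurable borel \<Longrightarrow>
      (\<lambda>r. \<integral>\<^sup>+m. (\<integral>\<^sup>+q\<in>Q m r. f (X m r q) * ennreal (\<rho> m r q) \<partial>lborel) \<partial>count_space UNIV) \<in> borel_measurable borel"
    and Q_borel: "\<And>m r. Q m r \<in> sets borel" and X_borel: "\<And>m r. X m r \<in> borel_measurable borel"
    and \<rho>_borel: "\<And>m r. \<rho> m r \<in> borel_measurable borel"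
    and X_in: "\<And>m r q. q \<in> Q m r \<Longrightarrow> X m r q \<in> P" and X_level: "\<And>m r q. q \<in> Q m r \<Longrightarrow> \<phi> (X m r q) = r"
    and X_coord: "\<And>m r q. q \<in> Q m r \<Longrightarrow> fst (flip (sw m) (X m r q)) = q"
    and X_disj: "\<And>m m' r q q'. q \<in> Q m r \<Longrightarrow> q' \<in> Q m' r \<Longrightarrow> X m r q = X m' r q' \<Longrightarrow> m = m'"
    and X_cover: "\<And>p r. p \<in> P \<Longrightarrow> \<phi> p = r \<Longrightarrow> \<exists>m. \<exists>q\<in>Q m r. X m r q = p"
    and \<rho>_bounds: "\<And>m r q. q \<in> Q m r \<Longrightarrow> 1 / Bd \<le> \<rho> m r q \<and> \<rho> m r q \<le> 1 / c0"
    and X_dominant: "\<And>m r q. q \<in> Q m r \<Longrightarrow>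
      \<bar>fst (flip (sw m) (\<alpha> (X m r q)))\<bar> < 2 * \<bar>snd (flip (sw m) (\<alpha> (X m r q)))\<bar>"

text \<open>The region is covered by boxes on each of which one fixed partial derivative of \<phi>
  exceeds \<open>c0\<close> in absolute value; after \<open>flip\<close> it is the vertical one.
  Charts live on the full boxes, which are convex, while only the parts selected by
  \<open>disjointed\<close> enter the formula, so that every point is counted once.\<close>

lemma planar_pieces_exist:
  fixes P :: "(real \<times> real) set"
  assumes P: "open P" "bounded P"
    and der: "\<And>p. p \<in> P \<Longrightarrow> (\<phi> has_derivative (\<lambda>h. \<alpha> p \<bullet> h)) (at p)"
    and cont: "continuous_on P \<alpha>" and c0: "0 < c0"
    and upper: "\<And>p. p \<in> P \<Longrightarrow> \<bar>fst (\<alpha> p)\<bar> \<le> Bd \<and> \<bar>snd (\<alpha> p)\<bar> \<le> Bd"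
    and lower: "\<And>p. p \<in> P \<Longrightarrow> c0 < \<bar>fst (\<alpha> p)\<bar> \<or> c0 < \<bar>snd (\<alpha> p)\<bar>"
  shows "\<exists>sw Q X \<rho>. planar_pieces P \<phi> \<alpha> c0 Bd sw Q X \<rho>"
proof -
  \<comment> \<open>The strict inequality with factor 2 keeps the condition open and still lets the
    larger of the two partial derivatives qualify at every point, so that the two sets cover
    \<open>P\<close>.\<close>
  define R where "R b = {p\<in>P. c0 < \<bar>snd (flip b (\<alpha> p))\<bar>} \<inter> {p\<in>P. \<bar>fst (flip b (\<alpha> p))\<bar> < 2 * \<bar>snd (flip b (\<alpha> p))\<bar>}" for b
  have R_open: "open (R b)" for b
    unfolding R_def using P cont by (intro open_Int open_Collect_less_on continuous_intros)
  have R_Un: "(\<Union>b. R b) = P"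
  proof (intro equalityI subsetI)
    fix p assume p: "p \<in> P"
    have "p \<in> R (\<bar>snd (\<alpha> p)\<bar> < \<bar>fst (\<alpha> p)\<bar>)"
      using p lower[OF p] c0 by (auto simp: R_def flip_def)
    then show "p \<in> (\<Union>b. R b)" by blast
  qed (auto simp: R_def)
  obtain V sw where V: "\<And>n::nat. \<exists>a b. V n = box a b" "\<And>n. V n \<subseteq> R (sw n)" and V_Un: "(\<Union>n. V n) = P"
    using open_box_cover[of R, OF R_open] R_Un by metis
  have VP: "V n \<subseteq> P" for n using V_Un by blast
  have V_open: "open (V n)" for n using V(1)[of n] open_box by metis
  define U where "U n = flip (sw n) ` V n" for n
  have U_iff: "y \<in> U n \<longleftrightarrow> flip (sw n) y \<in> V n" for y n
    unfolding U_def by (metis flip_flip image_iff)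
  define \<psi> where "\<psi> n y = \<phi> (flip (sw n) y)" for n y
  define D where "D n y = flip (sw n) (\<alpha> (flip (sw n) y))" for n y
  have chart: "vertical_chart (U n) (\<psi> n) (D n) Bd" for n
  proof
    have "U n = flip (sw n) -` V n" using U_iff by auto
    then show "open (U n)" using open_vimage[OF V_open continuous_on_flip[OF continuous_on_id]] by simp
    show "bounded (U n)" unfolding U_def using V(1)[of n]
      by (auto intro!: bounded_linear_image[OF _ bounded_linear_flip])
    show "convex (U n)" unfolding U_def using V(1)[of n] bounded_linear_flip
      by (auto intro!: convex_linear_image bounded_linear.linear)
    show "continuous_on (U n) (D n)" unfolding D_def
      by (intro continuous_intros continuous_on_compose2[OF cont]) (use U_iff VP in blast)
    fix y assume y: "y \<in> U n"
    then have p: "flip (sw n) y \<in> V n" using U_iff by blast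
    then have p2: "flip (sw n) y \<in> P" using VP by blast
    have "((\<lambda>y. \<phi> (flip (sw n) y)) has_derivative (\<lambda>h. \<alpha> (flip (sw n) y) \<bullet> flip (sw n) h)) (at y)"
      by (rule has_derivative_compose[OF bounded_linear_imp_has_derivative[OF bounded_linear_flip] der[OF p2]])
    then show "(\<psi> n has_derivative (\<lambda>h. D n y \<bullet> h)) (at y)"
      by (simp add: \<psi>_def[abs_def] D_def flip_inner)
    have "c0 < \<bar>snd (flip (sw n) (\<alpha> (flip (sw n) y)))\<bar>" using V(2)[of n] p by (auto simp: R_def)
    then show "snd (D n y) \<noteq> 0" using c0 by (auto simp: D_def)
    show "\<bar>snd (D n y)\<bar> \<le> Bd" using upper[OF p2] by (auto simp: D_def flip_def)
  qed
  interpret C: vertical_chart "U n" "\<psi> n" "D n" Bd for n by (rule chart)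
  define Z where "Z n r q = indicator (C.img n) (q, r) *\<^sub>R flip (sw n) (C.pt n (q, r))" for n r q
  define Q where "Q n r = {q. (q, r) \<in> C.img n \<and> flip (sw n) (C.pt n (q, r)) \<in> disjointed V n}" for n r
  define \<rho> where "\<rho> n r q = indicator (C.img n) (q, r) * C.jac n (q, r)" for n r q
  have dV: "disjointed V n \<in> sets borel" for n
    using V_open by (intro disjointed_borel) auto
  have pr: "Pair q \<in> borel_measurable borel" "(\<lambda>q. (q, r)) \<in> borel_measurable borel" for q r :: real
    by (intro borel_measurable_continuous_onI continuous_intros)+
  have img_b: "C.img n \<in> sets borel" for n using C.open_img by simp
  have Zb: "Z n r \<in> borel_measurable borel" for n r
  proof -
    have "(\<lambda>q. flip (sw n) (indicator (C.img n) (q, r) *\<^sub>R C.pt n (q, r))) \<in> borel_measurable borel"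
      by (intro measurable_compose[OF _ borel_flip] measurable_compose[OF pr(2) C.borel_pt])
    then show ?thesis by (simp add: Z_def[abs_def] linear_simps(5)[OF bounded_linear_flip])
  qed
  have \<rho>b: "\<rho> n r \<in> borel_measurable borel" for n r
    using measurable_compose[OF pr(2) C.borel_jac] by (simp add: \<rho>_def[abs_def])
  have Qb: "Q n r \<in> sets borel" for n r
  proof -
    have "{q. (q, r) \<in> C.img n} \<inter> {q. Z n r q \<in> disjointed V n} \<in> sets borel"
      using measurable_sets[OF pr(2) img_b] measurable_sets[OF Zb dV] by (simp add: vimage_def)
    also have "{q. (q, r) \<in> C.img n} \<inter> {q. Z n r q \<in> disjointed V n} = Q n r"
      by (auto simp: Q_def Z_def)
    finally show ?thesis .
  qed
  have F: "(\<lambda>y. indicator (C.img n) y * ((f (flip (sw n) (C.pt n y)) * indicator (disjointed V n) (flip (sw n) (C.pt n y))) * ennreal (C.jac n y))) \<in> borel_measurable borel"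
    if f: "f \<in> borel_measurable borel" for f :: "real \<times> real \<Rightarrow> ennreal" and n
    using f dV by (intro C.borel_coarea_integrand[of "\<lambda>y. f (flip (sw n) y) * indicator (disjointed V n) (flip (sw n) y)"]
        borel_measurable_times_ennreal measurable_compose[OF borel_flip] borel_measurable_indicator) auto
  have FQ: "indicator (C.img n) (q, r) * ((f (flip (sw n) (C.pt n (q, r))) * indicator (disjointed V n) (flip (sw n) (C.pt n (q, r)))) * ennreal (C.jac n (q, r)))
      = f (Z n r q) * ennreal (\<rho> n r q) * indicator (Q n r) q" for f n q r
    by (auto simp: Z_def \<rho>_def Q_def indicator_def)
  have meas1: "(\<lambda>r. (\<integral>\<^sup>+q\<in>Q n r. f (Z n r q) * ennreal (\<rho> n r q) \<partial>lborel)) \<in> borel_measurable borel"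
    if f: "f \<in> borel_measurable borel" for f n
  proof -
    have sp: "(\<lambda>(r, q). (q, r)) \<in> borel \<Otimes>\<^sub>M lborel \<rightarrow>\<^sub>M (borel :: (real \<times> real) measure)"
      unfolding borel_prod[symmetric] by measurable
    have "(\<lambda>(r, q). f (Z n r q) * ennreal (\<rho> n r q) * indicator (Q n r) q) \<in> borel_measurable (borel \<Otimes>\<^sub>M lborel)"
      using measurable_compose[OF sp F[OF f, of n]] by (simp add: case_prod_unfold FQ)
    then show ?thesis using lborel.borel_measurable_nn_integral by fastforce
  qed
  have "planar_pieces P \<phi> \<alpha> c0 Bd sw Q Z \<rho>"
  proof
    fix f :: "real \<times> real \<Rightarrow> ennreal" assume f: "f \<in> borel_measurable borel"
    have piece: "(\<integral>\<^sup>+p\<in>disjointed V n. f p \<partial>lborel) = (\<integral>\<^sup>+r. (\<integral>\<^sup>+q\<in>Q n r. f (Z n r q) * ennreal (\<rho> n r q) \<partial>lborel) \<partial>lborel)" for n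
    proof -
      have "(\<integral>\<^sup>+p\<in>disjointed V n. f p \<partial>lborel) = (\<integral>\<^sup>+y. f (flip (sw n) y) * indicator (disjointed V n) (flip (sw n) y) \<partial>lborel)"
        using f dV by (intro nn_integral_flip[symmetric, of "\<lambda>y. f y * indicator (disjointed V n) y"]) auto
      also have "\<dots> = (\<integral>\<^sup>+y\<in>U n. f (flip (sw n) y) * indicator (disjointed V n) (flip (sw n) y) \<partial>lborel)"
        using disjointed_subset[of V n] U_iff by (intro nn_integral_cong) (auto simp: indicator_def)
      also have "\<dots> = (\<integral>\<^sup>+r. \<integral>\<^sup>+q. indicator (C.img n) (q, r) * ((f (flip (sw n) (C.pt n (q, r))) * indicator (disjointed V n) (flip (sw n) (C.pt n (q, r)))) * ennreal (C.jac n (q, r))) \<partial>lborel \<partial>lborel)"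
        using f dV by (intro C.coarea borel_measurable_times_ennreal measurable_compose[OF borel_flip] borel_measurable_indicator) auto
      finally show ?thesis by (simp only: FQ)
    qed
    have "(\<integral>\<^sup>+p\<in>P. f p \<partial>lborel) = (\<integral>\<^sup>+p\<in>(\<Union>n. disjointed V n). f p \<partial>lborel)"
      by (simp add: UN_disjointed_eq V_Un)
    also have "\<dots> = (\<integral>\<^sup>+n. (\<integral>\<^sup>+p\<in>disjointed V n. f p \<partial>lborel) \<partial>count_space UNIV)"
      using f dV by (intro nn_integral_countable_partition disjoint_family_disjointed) auto
    also have "\<dots> = (\<integral>\<^sup>+r. \<integral>\<^sup>+m. (\<integral>\<^sup>+q\<in>Q m r. f (Z m r q) * ennreal (\<rho> m r q) \<partial>lborel) \<partial>count_space UNIV \<partial>lborel)"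
      unfolding piece using meas1[OF f] by (intro nn_integral_count_space_nn_integral[symmetric]) auto
    finally show "(\<integral>\<^sup>+p\<in>P. f p \<partial>lborel) = (\<integral>\<^sup>+r. \<integral>\<^sup>+m. (\<integral>\<^sup>+q\<in>Q m r. f (Z m r q) * ennreal (\<rho> m r q) \<partial>lborel) \<partial>count_space UNIV \<partial>lborel)" .
    show "(\<lambda>r. \<integral>\<^sup>+m. (\<integral>\<^sup>+q\<in>Q m r. f (Z m r q) * ennreal (\<rho> m r q) \<partial>lborel) \<partial>count_space UNIV) \<in> borel_measurable borel"
      unfolding nn_integral_count_space_nat by (rule borel_measurable_suminf_order) (rule meas1[OF f])
  next
    fix m r show "Q m r \<in> sets borel" by (rule Qb)
    show "Z m r \<in> borel_measurable borel" by (rule Zb)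
    show "\<rho> m r \<in> borel_measurable borel" by (rule \<rho>b)
  next
    fix m r q assume q: "q \<in> Q m r"
    then have y: "(q, r) \<in> C.img m" and z: "Z m r q = flip (sw m) (C.pt m (q, r))"
      and zV: "Z m r q \<in> disjointed V m" by (auto simp: Q_def Z_def)
    have zV': "Z m r q \<in> V m" by (rule subsetD[OF disjointed_subset zV])
    then show zP: "Z m r q \<in> P" using VP by blast
    show "\<phi> (Z m r q) = r" using C.phi_pt[OF y] by (simp add: z \<psi>_def)
    show "fst (flip (sw m) (Z m r q)) = q" using C.fst_pt[OF y] by (simp add: z)
    have "Z m r q \<in> R (sw m)" using zV' V(2) by blast
    then have dom: "c0 < \<bar>snd (flip (sw m) (\<alpha> (Z m r q)))\<bar>" "\<bar>fst (flip (sw m) (\<alpha> (Z m r q)))\<bar> < 2 * \<bar>snd (flip (sw m) (\<alpha> (Z m r q)))\<bar>"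
      by (auto simp: R_def)
    then show "\<bar>fst (flip (sw m) (\<alpha> (Z m r q)))\<bar> < 2 * \<bar>snd (flip (sw m) (\<alpha> (Z m r q)))\<bar>" by simp
    have "\<rho> m r q = 1 / \<bar>snd (flip (sw m) (\<alpha> (Z m r q)))\<bar>"
      using y by (simp add: \<rho>_def C.jac_def D_def z)
    moreover have "\<bar>snd (flip (sw m) (\<alpha> (Z m r q)))\<bar> \<le> Bd" using upper[OF zP] by (auto simp: flip_def)
    ultimately show "1 / Bd \<le> \<rho> m r q \<and> \<rho> m r q \<le> 1 / c0"
      using dom c0 by (auto intro!: divide_left_mono)
    fix m' q' assume q': "q' \<in> Q m' r" "Z m r q = Z m' r q'"
    then have "Z m r q \<in> disjointed V m'" by (auto simp: Q_def Z_def)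
    then show "m = m'" using zV disjoint_family_disjointed[of V] by (auto simp: disjoint_family_on_def)
  next
    fix p r assume p: "p \<in> P" "\<phi> p = r"
    then obtain m where m: "p \<in> disjointed V m" using V_Un UN_disjointed_eq[of V] by blast
    let ?y = "flip (sw m) p"
    have yU: "?y \<in> U m" using m disjointed_subset[of V m] U_iff by auto
    have s: "straighten (\<psi> m) ?y = (fst ?y, r)" using p by (simp add: straighten_def \<psi>_def)
    have "(fst ?y, r) \<in> C.img m" using C.straighten_in[OF yU] by (simp add: s)
    moreover have "C.pt m (fst ?y, r) = ?y" using C.pt_straighten[OF yU] by (simp add: s)
    ultimately have "fst ?y \<in> Q m r" "Z m r (fst ?y) = p" using m by (auto simp: Q_def Z_def)
    then show "\<exists>m. \<exists>q\<in>Q m r. Z m r q = p" by blast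
  qed
  then show ?thesis by blast
qed

text \<open>Coordinates of \<open>real^3\<close> in the cyclic order \<open>k + 1, k + 2, k\<close>; index arithmetic in the type \<open>3\<close> is
  modulo 3.\<close>

definition emb :: "3 \<Rightarrow> (real \<times> real) \<times> real \<Rightarrow> real^3" where
  "emb k y = (\<chi> l. if l = k then snd y else if l = k + 1 then fst (fst y) else snd (fst y))"

definition proj :: "3 \<Rightarrow> real^3 \<Rightarrow> (real \<times> real) \<times> real" where
  "proj k x = ((x $ (k + 1), x $ (k + 2)), x $ k)"

lemma UNIV_shift3: "UNIV = {k, k + 1, k + (2::3)}" "k + 1 \<noteq> k" "k + 2 \<noteq> k" "k + 1 \<noteq> k + 2" for k :: 3
proof -
  show ne: "k + 1 \<noteq> k" "k + 2 \<noteq> k" "k + 1 \<noteq> k + 2" by simp_all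
  then have "card {k, k + 1, k + (2::3)} = 3" by auto
  then show "UNIV = {k, k + 1, k + (2::3)}" by (intro card_subset_eq[symmetric]) auto
qed

lemma emb_nth [simp]: "emb k y $ k = snd y" "emb k y $ (k + 1) = fst (fst y)" "emb k y $ (k + 2) = snd (fst y)"
  using UNIV_shift3[of k] by (simp_all add: emb_def)

lemma vec_eqI_shift3: "x $ k = y $ k \<Longrightarrow> x $ (k + 1) = y $ (k + 1) \<Longrightarrow> x $ (k + 2) = y $ (k + 2) \<Longrightarrow> x = y" for x y :: "real^3"
proof -
  assume *: "x $ k = y $ k" "x $ (k + 1) = y $ (k + 1)" "x $ (k + 2) = y $ (k + 2)"
  have "x $ l = y $ l" for l
  proof -
    have "l \<in> {k, k + 1, k + 2}" using UNIV_shift3(1)[of k] by blast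
    then show ?thesis using * by auto
  qed
  then show "x = y" by (simp add: vec_eq_iff)
qed

lemma emb_proj [simp]: "emb k (proj k x) = x"
  by (rule vec_eqI_shift3[of _ k]) (simp_all add: proj_def)

lemma proj_emb [simp]: "proj k (emb k y) = y"
  by (simp add: proj_def)

lemma sum_shift3: "(\<Sum>l\<in>UNIV. f l) = f k + f (k + 1) + (f (k + 2) :: real)" for k :: 3
  unfolding UNIV_shift3(1)[of k] using UNIV_shift3(2,3,4)[of k] by auto

lemma prod_shift3: "(\<Prod>l\<in>UNIV. f l) = f k * f (k + 1) * (f (k + 2) :: real)" for k :: 3
  unfolding UNIV_shift3(1)[of k] using UNIV_shift3(2,3,4)[of k] by auto

lemma inner_emb: "x \<bullet> emb k y = proj k x \<bullet> y"
  unfolding inner_vec_def sum_shift3[of _ k] by (simp add: proj_def inner_prod_def)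

lemma bounded_linear_proj: "bounded_linear (proj k)"
  unfolding proj_def[abs_def] by (intro bounded_linear_Pair bounded_linear_vec_nth)

lemma bounded_linear_emb: "bounded_linear (emb k)"
proof -
  have "linear (emb k)"
    by (rule linearI) (rule vec_eqI_shift3[of _ k]; simp)+
  then show ?thesis by (rule linear_conv_bounded_linear[THEN iffD1])
qed

lemma continuous_on_emb [continuous_intros]: "continuous_on S f \<Longrightarrow> continuous_on S (\<lambda>x. emb k (f x))"
  using bounded_linear.continuous_on[OF bounded_linear_emb] .

lemma continuous_on_proj [continuous_intros]: "continuous_on S f \<Longrightarrow> continuous_on S (\<lambda>x. proj k (f x))"
  using bounded_linear.continuous_on[OF bounded_linear_proj] .

lemma borel_emb: "emb k \<in> borel_measurable borel"
  by (intro borel_measurable_continuous_onI continuous_intros)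

text \<open>A permutation of coordinates takes boxes to boxes of the same volume, and the volumes of
  boxes determine Lebesgue measure.\<close>

lemma distr_emb: "distr lborel borel (emb k) = lborel"
proof (rule lborel_eqI[symmetric])
  fix l u :: "real^3" assume lu: "\<And>b. b \<in> Basis \<Longrightarrow> l \<bullet> b \<le> u \<bullet> b"
  have le: "l $ i \<le> u $ i" for i using lu[of "axis i 1"] by (simp add: inner_axis axis_in_Basis_iff)
  have box: "emb k -` box l u = box ((l $ (k+1), l $ (k+2)), l $ k) ((u $ (k+1), u $ (k+2)), u $ k)"
  proof -
    have "emb k y \<in> box l u \<longleftrightarrow> y \<in> box ((l $ (k+1), l $ (k+2)), l $ k) ((u $ (k+1), u $ (k+2)), u $ k)" for y
    proof -
      have "emb k y \<in> box l u \<longleftrightarrow> (\<forall>i\<in>{k, k+1, k+2}. l $ i < emb k y $ i \<and> emb k y $ i < u $ i)"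
        unfolding mem_box_cart UNIV_shift3(1)[of k, symmetric] by simp
      also have "\<dots> \<longleftrightarrow> y \<in> box ((l $ (k+1), l $ (k+2)), l $ k) ((u $ (k+1), u $ (k+2)), u $ k)"
        by (auto simp: mem_box Basis_prod_def inner_prod_def)
      finally show ?thesis .
    qed
    then show ?thesis by blast
  qed
  have "emeasure (distr lborel borel (emb k)) (box l u) = emeasure lborel (emb k -` box l u)"
    using borel_emb by (subst emeasure_distr) auto
  also have "\<dots> = ennreal ((u $ k - l $ k) * (u $ (k+1) - l $ (k+1)) * (u $ (k+2) - l $ (k+2)))"
  proof -
    have b3: "box ((l $ (k+1), l $ (k+2)), l $ k) ((u $ (k+1), u $ (k+2)), u $ k)
        = (box (l $ (k+1)) (u $ (k+1)) \<times> box (l $ (k+2)) (u $ (k+2))) \<times> box (l $ k) (u $ k)"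
      by (auto simp: mem_box Basis_prod_def inner_prod_def)
    have "emeasure lborel ((box (l $ (k+1)) (u $ (k+1)) \<times> box (l $ (k+2)) (u $ (k+2))) \<times> box (l $ k) (u $ k))
      = emeasure (lborel \<Otimes>\<^sub>M lborel) ((box (l $ (k+1)) (u $ (k+1)) \<times> box (l $ (k+2)) (u $ (k+2))) \<times> box (l $ k) (u $ k))"
      by (simp only: lborel_prod)
    also have "\<dots> = emeasure lborel (box (l $ (k+1)) (u $ (k+1)) \<times> box (l $ (k+2)) (u $ (k+2))) * emeasure lborel (box (l $ k) (u $ k))"
      by (intro lborel.emeasure_pair_measure_Times) (auto simp: open_Times)
    also have "emeasure lborel (box (l $ (k+1)) (u $ (k+1)) \<times> box (l $ (k+2)) (u $ (k+2)))
      = emeasure (lborel \<Otimes>\<^sub>M lborel) (box (l $ (k+1)) (u $ (k+1)) \<times> box (l $ (k+2)) (u $ (k+2)))"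
      by (simp only: lborel_prod)
    also have "\<dots> = emeasure lborel (box (l $ (k+1)) (u $ (k+1))) * emeasure lborel (box (l $ (k+2)) (u $ (k+2)))"
      by (intro lborel.emeasure_pair_measure_Times) auto
    finally show ?thesis
      unfolding box b3 using le by (simp add: ennreal_mult'[symmetric] mult.commute mult.left_commute)
  qed
  also have "(u $ k - l $ k) * (u $ (k+1) - l $ (k+1)) * (u $ (k+2) - l $ (k+2)) = prod ((\<bullet>) (u - l)) Basis"
  proof -
    have "prod ((\<bullet>) (u - l)) Basis = (\<Prod>i\<in>UNIV. (u - l) $ i)"
      unfolding Basis_vec_def
      by (subst prod.reindex_cong[where l="\<lambda>i. axis i 1" and B=UNIV and h="\<lambda>i. (u - l) $ i"])
        (auto simp: inj_on_def axis_eq_axis inner_axis)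
    then show ?thesis by (simp add: prod_shift3[of _ k])
  qed
  finally show "emeasure (distr lborel borel (emb k)) (box l u) = ennreal (prod ((\<bullet>) (u - l)) Basis)" .
qed simp

lemma nn_integral_emb:
  assumes f: "f \<in> borel_measurable borel"
  shows "(\<integral>\<^sup>+y. f (emb k y) \<partial>lborel) = (\<integral>\<^sup>+x. f x \<partial>lborel)"
  using f borel_emb[of k] by (subst distr_emb[of k, symmetric], subst nn_integral_distr) auto

text \<open>If all components were at most half the norm, the three squares would add up to at most
  3/4 of the squared norm. Because 2 exceeds the square root of 3, the inequality can be strict, and
  the sets on which it holds for a continuous field form an open cover.\<close>

lemma norm_less_twice_nth: "x \<noteq> 0 \<Longrightarrow> \<exists>k. norm x < 2 * \<bar>x $ k\<bar>" for x :: "real^3"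
proof (rule ccontr)
  assume "x \<noteq> 0" and n: "\<nexists>k. norm x < 2 * \<bar>x $ k\<bar>"
  have "(x $ k)\<^sup>2 \<le> (norm x)\<^sup>2 / 4" for k
  proof -
    have "\<bar>x $ k\<bar> \<le> norm x / 2" using n[simplified, rule_format, of k] by simp
    then have "\<bar>x $ k\<bar>\<^sup>2 \<le> (norm x / 2)\<^sup>2" by (intro power_mono) auto
    then show ?thesis by (simp add: power_divide)
  qed
  then have "(\<Sum>k\<in>UNIV. (x $ k)\<^sup>2) \<le> (\<Sum>k\<in>(UNIV::3 set). (norm x)\<^sup>2 / 4)" by (intro sum_mono)
  then have "(norm x)\<^sup>2 \<le> 3 * (norm x)\<^sup>2 / 4"
    by (simp add: norm_vec_def L2_set_def sum_nonneg)
  then show False using \<open>x \<noteq> 0\<close> by simp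
qed

text \<open>The coarea formula for \<open>v\<close> with gradient \<open>N\<close>: the surface \<open>{v = t}\<close> is covered by the graphs
  \<open>s n t\<close> in direction \<open>\<kappa> n\<close>, where the disjoint sets \<open>A n\<close> avoid double counting; \<open>P n t\<close> itself is
  kept open so that \<open>s n t\<close> can be differentiated.\<close>

locale spatial_pieces =
  fixes \<Omega> :: "(real^3) set" and v :: "real^3 \<Rightarrow> real" and N :: "real^3 \<Rightarrow> real^3" and m0 M0 :: real
    and \<kappa> :: "nat \<Rightarrow> 3" and A :: "nat \<Rightarrow> (real^3) set" and P :: "nat \<Rightarrow> real \<Rightarrow> (real \<times> real) set"
    and s :: "nat \<Rightarrow> real \<Rightarrow> real \<times> real \<Rightarrow> real^3" and J :: "nat \<Rightarrow> real \<Rightarrow> real \<times> real \<Rightarrow> real"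
  assumes formula: "\<And>f. f \<in> borel_measurable borel \<Longrightarrow> (\<integral>\<^sup>+x\<in>\<Omega>. f x \<partial>lborel)
      = (\<integral>\<^sup>+t. \<integral>\<^sup>+n. (\<integral>\<^sup>+p\<in>P n t. f (s n t p) * indicator (A n) (s n t p) * ennreal (J n t p) \<partial>lborel) \<partial>count_space UNIV \<partial>lborel)"
    and meas: "\<And>f. f \<in> borel_measurable borel \<Longrightarrow>
      (\<lambda>t. \<integral>\<^sup>+n. (\<integral>\<^sup>+p\<in>P n t. f (s n t p) * indicator (A n) (s n t p) * ennreal (J n t p) \<partial>lborel) \<partial>count_space UNIV) \<in> borel_measurable borel"
    and A_borel: "\<And>n. A n \<in> sets borel" and A_disj: "disjoint_family A" and A_Un: "(\<Union>n. A n) = \<Omega>"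
    and P_open: "\<And>n t. open (P n t)" and P_bounded: "\<And>n t. bounded (P n t)"
    and s_borel: "\<And>n t. s n t \<in> borel_measurable borel" and J_borel: "\<And>n t. J n t \<in> borel_measurable borel"
    and s_cont: "\<And>n t. continuous_on (P n t) (s n t)"
    and s_in: "\<And>n t p. p \<in> P n t \<Longrightarrow> s n t p \<in> \<Omega>" and s_level: "\<And>n t p. p \<in> P n t \<Longrightarrow> v (s n t p) = t"
    and s_coord: "\<And>n t p. p \<in> P n t \<Longrightarrow> fst (proj (\<kappa> n) (s n t p)) = p"
    and s_der: "\<And>n t p. p \<in> P n t \<Longrightarrow> (s n t has_derivative (\<lambda>h. emb (\<kappa> n)
        (h, - (fst (proj (\<kappa> n) (N (s n t p))) \<bullet> h) / N (s n t p) $ \<kappa> n))) (at p)"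
    and s_dominant: "\<And>n t p. p \<in> P n t \<Longrightarrow> norm (N (s n t p)) < 2 * \<bar>N (s n t p) $ \<kappa> n\<bar>"
    and s_cover: "\<And>x n t. x \<in> A n \<Longrightarrow> v x = t \<Longrightarrow> \<exists>p\<in>P n t. s n t p = x"
    and J_bounds: "\<And>n t p. p \<in> P n t \<Longrightarrow> 1 / M0 \<le> J n t p \<and> J n t p \<le> 2 / m0"

text \<open>The sets where component \<open>k\<close> carries more than half of the norm of
  \<open>N\<close> are open and cover \<open>\<Omega>\<close>; boxes inside them are charts in
  direction \<open>k\<close>. There m0 / 2 < |N $ k| \<le> M0, which gives the bounds on
  \<open>J\<close>.\<close>

lemma spatial_pieces_exist:
  fixes \<Omega> :: "(real^3) set"
  assumes O: "open \<Omega>" "bounded \<Omega>"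
    and der: "\<And>x. x \<in> \<Omega> \<Longrightarrow> (v has_derivative (\<lambda>h. N x \<bullet> h)) (at x)"
    and cont: "continuous_on \<Omega> N" and m0: "0 < m0"
    and bnd: "\<And>x. x \<in> \<Omega> \<Longrightarrow> m0 \<le> norm (N x) \<and> norm (N x) \<le> M0"
  shows "\<exists>\<kappa> A P s J. spatial_pieces \<Omega> v N m0 M0 \<kappa> A P s J"
proof -
  define R where "R k = {x\<in>\<Omega>. norm (N x) < 2 * \<bar>N x $ k\<bar>}" for k
  have R_open: "open (R k)" for k
    unfolding R_def using O cont by (intro open_Collect_less_on continuous_intros)
  have R_Un: "(\<Union>k. R k) = \<Omega>"
  proof (intro equalityI subsetI)
    fix x assume x: "x \<in> \<Omega>"
    then have "N x \<noteq> 0" using bnd[OF x] m0 by auto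
    then show "x \<in> (\<Union>k. R k)" using norm_less_twice_nth[of "N x"] x by (auto simp: R_def)
  qed (auto simp: R_def)
  obtain B \<kappa> where B: "\<And>n::nat. \<exists>a b. B n = box a b" "\<And>n. B n \<subseteq> R (\<kappa> n)" and B_Un: "(\<Union>n. B n) = \<Omega>"
    using open_box_cover[of R, OF R_open] R_Un by metis
  have BO: "B n \<subseteq> \<Omega>" for n using B_Un by blast
  have B_open: "open (B n)" for n using B(1)[of n] open_box by metis
  define U where "U n = proj (\<kappa> n) ` B n" for n
  have U_iff: "y \<in> U n \<longleftrightarrow> emb (\<kappa> n) y \<in> B n" for y n
    unfolding U_def by (metis emb_proj proj_emb image_iff)
  define \<psi> where "\<psi> n y = v (emb (\<kappa> n) y)" for n y
  define D where "D n y = proj (\<kappa> n) (N (emb (\<kappa> n) y))" for n y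
  have chart: "vertical_chart (U n) (\<psi> n) (D n) M0" for n
  proof
    have "U n = emb (\<kappa> n) -` B n" using U_iff by auto
    then show "open (U n)" using open_vimage[OF B_open continuous_on_emb[OF continuous_on_id]] by simp
    show "bounded (U n)" unfolding U_def using B(1)[of n]
      by (auto intro!: bounded_linear_image[OF _ bounded_linear_proj])
    show "convex (U n)" unfolding U_def using B(1)[of n] bounded_linear_proj
      by (auto intro!: convex_linear_image bounded_linear.linear)
    show "continuous_on (U n) (D n)" unfolding D_def
      by (intro continuous_intros continuous_on_compose2[OF cont]) (use U_iff BO in blast)
    fix y assume y: "y \<in> U n"
    then have p: "emb (\<kappa> n) y \<in> B n" using U_iff by blast
    then have p2: "emb (\<kappa> n) y \<in> \<Omega>" using BO by blast
    have "((\<lambda>y. v (emb (\<kappa> n) y)) has_derivative (\<lambda>h. N (emb (\<kappa> n) y) \<bullet> emb (\<kappa> n) h)) (at y)"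
      by (rule has_derivative_compose[OF bounded_linear_imp_has_derivative[OF bounded_linear_emb] der[OF p2]])
    then show "(\<psi> n has_derivative (\<lambda>h. D n y \<bullet> h)) (at y)"
      by (simp add: \<psi>_def[abs_def] D_def inner_emb)
    have "norm (N (emb (\<kappa> n) y)) < 2 * \<bar>N (emb (\<kappa> n) y) $ \<kappa> n\<bar>" using B(2)[of n] p by (auto simp: R_def)
    then have "N (emb (\<kappa> n) y) $ \<kappa> n \<noteq> 0" using norm_ge_zero[of "N (emb (\<kappa> n) y)"] by linarith
    then show "snd (D n y) \<noteq> 0" by (simp add: D_def proj_def)
    show "\<bar>snd (D n y)\<bar> \<le> M0" using component_le_norm_cart[of "N (emb (\<kappa> n) y)" "\<kappa> n"] bnd[OF p2]
      by (simp add: D_def proj_def)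
  qed
  interpret C: vertical_chart "U n" "\<psi> n" "D n" M0 for n by (rule chart)
  define A where "A n = disjointed B n" for n
  define P where "P n t = {p. (p, t) \<in> C.img n}" for n t
  define s where "s n t p = indicator (P n t) p *\<^sub>R emb (\<kappa> n) (C.pt n (p, t))" for n t p
  define J where "J n t p = indicator (C.img n) (p, t) * C.jac n (p, t)" for n t p
  have A_borel: "A n \<in> sets borel" for n
    unfolding A_def using B_open by (intro disjointed_borel) auto
  have AB: "A n \<subseteq> B n" for n unfolding A_def by (rule disjointed_subset)
  have A_Un: "(\<Union>n. A n) = \<Omega>" by (simp add: A_def UN_disjointed_eq B_Un)
  have A_disj: "disjoint_family A" unfolding A_def[abs_def] by (rule disjoint_family_disjointed)
  have pr: "(\<lambda>p. (p, t)) \<in> borel_measurable borel" for t :: real and p :: "real \<times> real"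
    by (intro borel_measurable_continuous_onI continuous_intros)
  have P_open: "open (P n t)" for n t
  proof -
    have "P n t = (\<lambda>p. (p, t)) -` C.img n" by (auto simp: P_def)
    then show ?thesis using open_vimage[OF C.open_img, of "\<lambda>p. (p, t)"] by (simp add: continuous_intros)
  qed
  have s_eq: "s n t p = emb (\<kappa> n) (C.pt n (p, t))" if "p \<in> P n t" for n t p using that by (simp add: s_def)
  have s_U: "C.pt n (p, t) \<in> U n" if "p \<in> P n t" for n t p using that C.pt_in by (simp add: P_def)
  have s_B: "s n t p \<in> B n" if "p \<in> P n t" for n t p using s_U[OF that] s_eq[OF that] U_iff by simp
  have "spatial_pieces \<Omega> v N m0 M0 \<kappa> A P s J"
  proof
    fix f :: "real^3 \<Rightarrow> ennreal" assume f: "f \<in> borel_measurable borel"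
    let ?F = "\<lambda>n t p. f (s n t p) * indicator (A n) (s n t p) * ennreal (J n t p) * indicator (P n t) p"
    have fA: "(\<lambda>x. f x * indicator (A n) x) \<in> borel_measurable borel" for n using f A_borel by simp
    have fA': "(\<lambda>y. f (emb (\<kappa> n) y) * indicator (A n) (emb (\<kappa> n) y)) \<in> borel_measurable borel" for n
      using measurable_compose[OF borel_emb fA] .
    have FQ: "indicator (C.img n) (p, t) * ((f (emb (\<kappa> n) (C.pt n (p, t))) * indicator (A n) (emb (\<kappa> n) (C.pt n (p, t)))) * ennreal (C.jac n (p, t))) = ?F n t p" for n t p
      by (auto simp: s_def J_def P_def indicator_def)
    have meas: "(\<lambda>t. (\<integral>\<^sup>+p. ?F n t p \<partial>lborel)) \<in> borel_measurable borel" for n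
    proof -
      have sp: "(\<lambda>(t, p). (p, t)) \<in> borel \<Otimes>\<^sub>M lborel \<rightarrow>\<^sub>M (borel :: ((real \<times> real) \<times> real) measure)"
      proof -
        have "(\<lambda>(t, p). (p, t)) \<in> borel \<rightarrow>\<^sub>M (borel :: ((real \<times> real) \<times> real) measure)"
          unfolding case_prod_unfold by (intro borel_measurable_continuous_onI continuous_intros)
        moreover have "sets (borel \<Otimes>\<^sub>M lborel) = sets (borel :: (real \<times> real \<times> real) measure)"
          by (simp add: borel_prod[symmetric] cong: sets_pair_measure_cong)
        ultimately show ?thesis by (simp cong: measurable_cong_sets)
      qed
      have "(\<lambda>(t, p). ?F n t p) \<in> borel_measurable (borel \<Otimes>\<^sub>M lborel)"
        using measurable_compose[OF sp C.borel_coarea_integrand[OF fA'[of n], of n]] by (simp only: case_prod_unfold FQ)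
      then show ?thesis using lborel.borel_measurable_nn_integral by fastforce
    qed
    have piece: "(\<integral>\<^sup>+x\<in>A n. f x \<partial>lborel) = (\<integral>\<^sup>+t. (\<integral>\<^sup>+p. ?F n t p \<partial>lborel) \<partial>lborel)" for n
    proof -
      have "(\<integral>\<^sup>+x\<in>A n. f x \<partial>lborel) = (\<integral>\<^sup>+y. f (emb (\<kappa> n) y) * indicator (A n) (emb (\<kappa> n) y) \<partial>lborel)"
        by (rule nn_integral_emb[OF fA, symmetric])
      also have "\<dots> = (\<integral>\<^sup>+y\<in>U n. f (emb (\<kappa> n) y) * indicator (A n) (emb (\<kappa> n) y) \<partial>lborel)"
        using AB[of n] U_iff by (intro nn_integral_cong) (auto simp: indicator_def)
      also have "\<dots> = (\<integral>\<^sup>+t. \<integral>\<^sup>+p. indicator (C.img n) (p, t) * ((f (emb (\<kappa> n) (C.pt n (p, t))) * indicator (A n) (emb (\<kappa> n) (C.pt n (p, t)))) * ennreal (C.jac n (p, t))) \<partial>lborel \<partial>lborel)"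
        by (rule C.coarea[OF fA'])
      finally show ?thesis by (simp only: FQ)
    qed
    have "(\<integral>\<^sup>+x\<in>\<Omega>. f x \<partial>lborel) = (\<integral>\<^sup>+x\<in>(\<Union>n. A n). f x \<partial>lborel)" by (simp add: A_Un)
    also have "\<dots> = (\<integral>\<^sup>+n. (\<integral>\<^sup>+x\<in>A n. f x \<partial>lborel) \<partial>count_space UNIV)"
      using f A_borel A_disj by (intro nn_integral_countable_partition) auto
    also have "\<dots> = (\<integral>\<^sup>+t. \<integral>\<^sup>+n. (\<integral>\<^sup>+p. ?F n t p \<partial>lborel) \<partial>count_space UNIV \<partial>lborel)"
      unfolding piece using meas by (intro nn_integral_count_space_nn_integral[symmetric]) auto
    finally show "(\<integral>\<^sup>+x\<in>\<Omega>. f x \<partial>lborel) = (\<integral>\<^sup>+t. \<integral>\<^sup>+n. (\<integral>\<^sup>+p. ?F n t p \<partial>lborel) \<partial>count_space UNIV \<partial>lborel)" .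
    show "(\<lambda>t. \<integral>\<^sup>+n. (\<integral>\<^sup>+p. ?F n t p \<partial>lborel) \<partial>count_space UNIV) \<in> borel_measurable borel"
      unfolding nn_integral_count_space_nat by (rule borel_measurable_suminf_order) (rule meas)
  next
    fix n t
    show "A n \<in> sets borel" by (rule A_borel)
    show "open (P n t)" by (rule P_open)
    show "bounded (P n t)"
    proof (rule bounded_subset[OF bounded_fst[OF C.bounded_U]])
      show "P n t \<subseteq> fst ` U n"
      proof
        fix p assume "p \<in> P n t"
        then have "fst (C.pt n (p, t)) = p" "C.pt n (p, t) \<in> U n" using C.fst_pt C.pt_in by (auto simp: P_def)
        then show "p \<in> fst ` U n" by (metis image_eqI)
      qed
    qed
    show cs: "continuous_on (P n t) (s n t)"
    proof -
      have "continuous_on (P n t) (\<lambda>p. emb (\<kappa> n) (C.pt n (p, t)))"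
        by (intro continuous_intros continuous_on_compose2[OF C.cont_pt]) (auto simp: P_def)
      then show ?thesis using s_eq by (simp cong: continuous_on_cong_simp)
    qed
    show "s n t \<in> borel_measurable borel"
    proof -
      have "(\<lambda>p. indicator (P n t) p *\<^sub>R s n t p) \<in> borel_measurable borel"
        using P_open cs by (intro borel_measurable_continuous_on_indicator) auto
      moreover have "(\<lambda>p. indicator (P n t) p *\<^sub>R s n t p) = s n t"
        by (auto simp: s_def indicator_def fun_eq_iff)
      ultimately show ?thesis by simp
    qed
    show "J n t \<in> borel_measurable borel"
      using measurable_compose[OF pr C.borel_jac] by (simp add: J_def[abs_def])
  next
    show "disjoint_family A" by (rule A_disj)
    show "(\<Union>n. A n) = \<Omega>" by (rule A_Un)
  next
    fix n t p assume p: "p \<in> P n t"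
    then have img: "(p, t) \<in> C.img n" by (simp add: P_def)
    show sO: "s n t p \<in> \<Omega>" using s_B[OF p] BO by blast
    show "v (s n t p) = t" using C.phi_pt[OF img] by (simp add: s_eq[OF p] \<psi>_def)
    show "fst (proj (\<kappa> n) (s n t p)) = p" using C.fst_pt[OF img] by (simp add: s_eq[OF p])
    have "s n t p \<in> R (\<kappa> n)" using s_B[OF p] B(2) by blast
    then show dom: "norm (N (s n t p)) < 2 * \<bar>N (s n t p) $ \<kappa> n\<bar>" by (simp add: R_def)
    have Dpt: "D n (C.pt n (p, t)) = proj (\<kappa> n) (N (s n t p))" by (simp add: D_def s_eq[OF p])
    have "((\<lambda>p. emb (\<kappa> n) (C.pt n (p, t))) has_derivative (\<lambda>h. emb (\<kappa> n) (h, - (fst (D n (C.pt n (p, t))) \<bullet> h) / snd (D n (C.pt n (p, t)))))) (at p)"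
      by (rule bounded_linear.has_derivative[OF bounded_linear_emb C.has_derivative_pt[OF img]])
    then have "((\<lambda>p. emb (\<kappa> n) (C.pt n (p, t))) has_derivative (\<lambda>h. emb (\<kappa> n)
        (h, - (fst (proj (\<kappa> n) (N (s n t p))) \<bullet> h) / N (s n t p) $ \<kappa> n))) (at p)"
      unfolding Dpt by (simp add: proj_def)
    then show "(s n t has_derivative (\<lambda>h. emb (\<kappa> n)
        (h, - (fst (proj (\<kappa> n) (N (s n t p))) \<bullet> h) / N (s n t p) $ \<kappa> n))) (at p)"
      by (rule has_derivative_transform_within_open[OF _ P_open p]) (simp add: s_eq)
    have J: "J n t p = 1 / \<bar>N (s n t p) $ \<kappa> n\<bar>"
      using img by (simp add: J_def C.jac_def Dpt) (simp add: proj_def)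
    have "m0 < 2 * \<bar>N (s n t p) $ \<kappa> n\<bar>" "\<bar>N (s n t p) $ \<kappa> n\<bar> \<le> M0"
      using dom bnd[OF sO] component_le_norm_cart[of "N (s n t p)" "\<kappa> n"] by auto
    then show "1 / M0 \<le> J n t p \<and> J n t p \<le> 2 / m0"
      using m0 unfolding J by (auto simp: field_simps)
  next
    fix x n t assume x: "x \<in> A n" "v x = t"
    let ?y = "proj (\<kappa> n) x"
    have yU: "?y \<in> U n" using x AB[of n] U_iff by auto
    have st: "straighten (\<psi> n) ?y = (fst ?y, t)" using x by (simp add: straighten_def \<psi>_def)
    have "(fst ?y, t) \<in> C.img n" using C.straighten_in[OF yU] by (simp add: st)
    then have p: "fst ?y \<in> P n t" by (simp add: P_def)
    moreover have "s n t (fst ?y) = x" using C.pt_straighten[OF yU] by (simp add: st s_eq[OF p])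
    ultimately show "\<exists>p\<in>P n t. s n t p = x" by blast
  qed
  then show ?thesis by blast
qed

text \<open>The gradient of \<open>p \<mapsto> g (s p)\<close> for a graph \<open>s\<close> in direction \<open>k\<close> over a surface with normal \<open>N\<close>
  on which \<open>g\<close> has the surface gradient \<open>D\<close>; see \<open>inner_tgrad\<close>.\<close>

definition tgrad :: "3 \<Rightarrow> real^3 \<Rightarrow> real^3 \<Rightarrow> real \<times> real" where
  "tgrad k N D = fst (proj k D) - (D $ k / N $ k) *\<^sub>R fst (proj k N)"

section \<open>Gradients and tangent vectors in graph coordinates\<close>

lemma abs_ratio_le: "norm N < 2 * \<bar>N $ k\<bar> \<Longrightarrow> \<bar>a * (N $ i / N $ k)\<bar> \<le> 2 * \<bar>a\<bar>" for N :: "real^3"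
proof -
  assume N: "norm N < 2 * \<bar>N $ k\<bar>"
  then have nz: "0 < \<bar>N $ k\<bar>" using norm_ge_zero[of N] by linarith
  have "\<bar>N $ i\<bar> \<le> 2 * \<bar>N $ k\<bar>" using N component_le_norm_cart[of N i] by linarith
  then have "\<bar>N $ i / N $ k\<bar> \<le> 2" using nz by (simp add: field_simps)
  then have "\<bar>a\<bar> * \<bar>N $ i / N $ k\<bar> \<le> \<bar>a\<bar> * 2" by (intro mult_left_mono) auto
  then show ?thesis by (simp add: abs_mult mult.commute)
qed

lemma inner_shift3: "x \<bullet> y = x $ k * y $ k + x $ (k + 1) * y $ (k + 1) + x $ (k + 2) * y $ (k + 2)" for x y :: "real^3"
  by (simp add: inner_vec_def sum_shift3[of _ k])

lemma fst_tgrad: "fst (tgrad k N D) = D $ (k + 1) - D $ k * (N $ (k + 1) / N $ k)"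
  and snd_tgrad: "snd (tgrad k N D) = D $ (k + 2) - D $ k * (N $ (k + 2) / N $ k)"
  by (simp_all add: tgrad_def proj_def)

lemma inner_tgrad:
  assumes "N $ k \<noteq> 0"
  shows "D \<bullet> emb k (h, - (fst (proj k N) \<bullet> h) / N $ k) = tgrad k N D \<bullet> h"
  unfolding inner_emb using assms by (simp add: tgrad_def proj_def inner_prod_def field_simps)

lemma tgrad_upper:
  assumes N: "norm N < 2 * \<bar>N $ k\<bar>"
  shows "\<bar>fst (tgrad k N D)\<bar> \<le> 3 * norm D" "\<bar>snd (tgrad k N D)\<bar> \<le> 3 * norm D"
proof -
  have *: "\<bar>a - b\<bar> \<le> 3 * n" if "\<bar>a\<bar> \<le> n" "\<bar>b\<bar> \<le> 2 * \<bar>c\<bar>" "\<bar>c\<bar> \<le> n" for a b c n :: real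
    using that by linarith
  show "\<bar>fst (tgrad k N D)\<bar> \<le> 3 * norm D" "\<bar>snd (tgrad k N D)\<bar> \<le> 3 * norm D"
    unfolding fst_tgrad snd_tgrad
    by (rule *[OF component_le_norm_cart abs_ratio_le[OF N] component_le_norm_cart])+
qed

text \<open>Orthogonality of \<open>D\<close> and \<open>N\<close> turns |D|^2 into the inner
  product of the pair D $ (k + 1), D $ (k + 2) with \<open>tgrad k N D\<close>. So |D| is at most
  the sum of the absolute values of the two components of \<open>tgrad k N D\<close>, and one of
  them is at least c / 2.\<close>

lemma tgrad_lower:
  assumes N: "norm N < 2 * \<bar>N $ k\<bar>" and ND: "D \<bullet> N = 0" and D: "0 < c" "c \<le> norm D"
  shows "c / 3 < \<bar>fst (tgrad k N D)\<bar> \<or> c / 3 < \<bar>snd (tgrad k N D)\<bar>"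
proof -
  let ?a = "fst (tgrad k N D)" and ?b = "snd (tgrad k N D)"
  have nz: "N $ k \<noteq> 0" using N norm_ge_zero[of N] by linarith
  have "D $ k * (N $ (k + 1) / N $ k * D $ (k + 1) + N $ (k + 2) / N $ k * D $ (k + 2)) = - (D $ k)\<^sup>2"
  proof -
    have "N $ (k + 1) * D $ (k + 1) + N $ (k + 2) * D $ (k + 2) = - (D $ k * N $ k)"
      using ND unfolding inner_shift3[of D N k] by (simp add: mult.commute)
    then have "(N $ (k + 1) * D $ (k + 1) + N $ (k + 2) * D $ (k + 2)) / N $ k = - D $ k"
      using nz by (simp add: field_simps)
    then show ?thesis by (simp add: add_divide_distrib power2_eq_square)
  qed
  then have "(norm D)\<^sup>2 = D $ (k + 1) * ?a + D $ (k + 2) * ?b"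
    unfolding power2_norm_eq_inner inner_shift3[of D D k] fst_tgrad snd_tgrad
    by (simp add: algebra_simps power2_eq_square)
  also have "\<dots> \<le> \<bar>D $ (k + 1)\<bar> * \<bar>?a\<bar> + \<bar>D $ (k + 2)\<bar> * \<bar>?b\<bar>"
    by (intro add_mono) (auto simp: abs_mult[symmetric])
  also have "\<dots> \<le> norm D * \<bar>?a\<bar> + norm D * \<bar>?b\<bar>"
    by (intro add_mono mult_right_mono component_le_norm_cart) auto
  finally have "norm D * norm D \<le> norm D * (\<bar>?a\<bar> + \<bar>?b\<bar>)" by (simp add: power2_eq_square distrib_left)
  then have "norm D \<le> \<bar>?a\<bar> + \<bar>?b\<bar>" by (rule mult_left_le_imp_le) (use D in linarith)
  then show ?thesis using D by linarith
qed

lemma norm_le_shift3: "norm x \<le> \<bar>x $ k\<bar> + \<bar>x $ (k + 1)\<bar> + \<bar>x $ (k + 2)\<bar>" for x :: "real^3"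
  using norm_le_l1_cart[of x] by (simp add: sum_shift3[of _ k])

text \<open>For \<open>h\<close> in the kernel of both \<open>N\<close> and \<open>D\<close>, the
  first equation bounds |h $ k| by twice the sum of the other two absolute values, and the second
  makes the pair of these components orthogonal to \<open>tgrad k N D\<close>. By \<open>dom\<close>
  the one along the chosen axis then dominates the other up to the factor 2. Altogether 9 = 3 * (1 +
  2).\<close>

lemma tangent_bound:
  assumes N: "norm N < 2 * \<bar>N $ k\<bar>" and h: "N \<bullet> h = 0" "D \<bullet> h = 0"
    and dom: "\<bar>fst (flip b (tgrad k N D))\<bar> < 2 * \<bar>snd (flip b (tgrad k N D))\<bar>"
  shows "norm h \<le> 9 * \<bar>h $ (k + (if b then 2 else 1))\<bar>"
proof -
  let ?a = "fst (tgrad k N D)" and ?b = "snd (tgrad k N D)"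
  have nz: "N $ k \<noteq> 0" using N norm_ge_zero[of N] by linarith
  have hk: "h $ k = - (h $ (k + 1) * (N $ (k + 1) / N $ k)) - h $ (k + 2) * (N $ (k + 2) / N $ k)"
    using h(1) nz unfolding inner_shift3[of N h k] by (simp add: field_simps)
  have "\<bar>h $ k\<bar> \<le> 2 * \<bar>h $ (k + 1)\<bar> + 2 * \<bar>h $ (k + 2)\<bar>"
    using abs_ratio_le[OF N, of "h $ (k + 1)" "k + 1"] abs_ratio_le[OF N, of "h $ (k + 2)" "k + 2"] unfolding hk by linarith
  with norm_le_shift3[of h k] have n: "norm h \<le> 3 * (\<bar>h $ (k + 1)\<bar> + \<bar>h $ (k + 2)\<bar>)" by argo
  have "?a * h $ (k + 1) + ?b * h $ (k + 2) = 0"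
  proof -
    have *: "(a - d * r) * x + (b - d * s) * y = d * (- (x * r) - y * s) + a * x + b * y" for a b d r s x y :: real
      by (simp add: algebra_simps)
    show ?thesis using h(2)[unfolded inner_shift3[of D h k], unfolded hk] unfolding fst_tgrad snd_tgrad * .
  qed
  then have "?a * h $ (k + 1) = - (?b * h $ (k + 2))" by linarith
  then have eq: "\<bar>?a\<bar> * \<bar>h $ (k + 1)\<bar> = \<bar>?b\<bar> * \<bar>h $ (k + 2)\<bar>" by (metis abs_minus abs_mult)
  have *: "y \<le> 2 * x" if "p * x = q * y" "p < 2 * q" "0 \<le> p" "0 \<le> x" for p q x y :: real
  proof -
    have "q * y \<le> (2 * q) * x" using that mult_right_mono[of p "2 * q" x] by linarith
    then have "q * y \<le> q * (2 * x)" by simp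
    moreover have "0 < q" using that by linarith
    ultimately show ?thesis by (simp only: mult_le_cancel_left_pos)
  qed
  show ?thesis
  proof (cases b)
    case True
    then have "\<bar>h $ (k + 1)\<bar> \<le> 2 * \<bar>h $ (k + 2)\<bar>" using dom eq by (intro *[of "\<bar>?b\<bar>" _ "\<bar>?a\<bar>"]) (auto simp: flip_def)
    then show ?thesis using n True by simp
  next
    case False
    then have "\<bar>h $ (k + 2)\<bar> \<le> 2 * \<bar>h $ (k + 1)\<bar>" using dom eq by (intro *[of "\<bar>?a\<bar>" _ "\<bar>?b\<bar>"]) (auto simp: flip_def)
    then show ?thesis using n False by simp
  qed
qed


section \<open>Integration along the leaves\<close>

text \<open>The geometric half of the argument on its own: \<open>w\<close> vanishes on the
  boundary, and \<open>G\<close> controls its derivatives only in directions tangent to the level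
  surfaces of \<open>v\<close>.\<close>

locale transport_problem =
  fixes \<Omega> :: "(real^3) set" and v w G :: "real^3 \<Rightarrow> real" and N Dw :: "real^3 \<Rightarrow> real^3"
    and g :: "real \<Rightarrow> real^3 \<Rightarrow> real" and m0 M0 cg Cg K :: real
  assumes open_Om: "open \<Omega>" and bounded_Om: "bounded \<Omega>"
    and v_der: "\<And>x. x \<in> \<Omega> \<Longrightarrow> (v has_derivative (\<lambda>h. N x \<bullet> h)) (at x)"
    and N_cont: "continuous_on \<Omega> N" and m0: "0 < m0"
    and N_bounds: "\<And>x. x \<in> \<Omega> \<Longrightarrow> m0 \<le> norm (N x) \<and> norm (N x) \<le> M0"
    and N_grad: "\<And>x. x \<in> \<Omega> \<Longrightarrow> grad v x = N x"
    and fol: "foliated \<Omega> v g cg Cg K"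
    and w_cont: "continuous_on (closure \<Omega>) w" and w0: "\<And>x. x \<in> frontier \<Omega> \<Longrightarrow> w x = 0"
    and w_der: "\<And>x. x \<in> \<Omega> \<Longrightarrow> (w has_derivative (\<lambda>h. Dw x \<bullet> h)) (at x)"
    and G_cont: "continuous_on \<Omega> G" and G_nonneg: "\<And>x. x \<in> \<Omega> \<Longrightarrow> 0 \<le> G x"
    and w_tangential: "\<And>x h. x \<in> \<Omega> \<Longrightarrow> N x \<bullet> h = 0 \<Longrightarrow> \<bar>Dw x \<bullet> h\<bar> \<le> G x * norm h"
begin

text \<open>9 is the slope constant of \<open>tangent_bound\<close>; 2 / m0 and 3 / cg bound the
  densities of the surface and curve coarea formulas from above, 1 / M0 and 1 / (3 * max Cg 1) from
  below; \<open>K\<close> bounds the length of a leaf. The maximum with 1 makes the last lower bound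
  positive whatever the sign of \<open>Cg\<close>.\<close>

definition Cst :: real where
  "Cst = 9 * (2 / m0 * (3 / cg)) * K / (1 / M0 * (1 / (3 * max Cg 1)))"

lemma M0: "x \<in> \<Omega> \<Longrightarrow> 0 < M0"
  using N_bounds m0 by force

definition wx :: "real^3 \<Rightarrow> real" where "wx x = indicator \<Omega> x * w x"
definition Gx :: "real^3 \<Rightarrow> real" where "Gx x = indicator \<Omega> x * G x"

lemma wx_borel: "wx \<in> borel_measurable borel"
  using borel_measurable_continuous_on_indicator[OF _ continuous_on_subset[OF w_cont closure_subset]] open_Om
  by (simp add: wx_def[abs_def])

lemma Gx_borel: "Gx \<in> borel_measurable borel"
  using borel_measurable_continuous_on_indicator[OF _ G_cont] open_Om by (simp add: Gx_def[abs_def])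

lemma cg: "0 < cg" using fol by (simp add: foliated_def)

text \<open>Coarea inside a fixed surface {v = t}: in each graph parameter domain the function p
  \<mapsto> g t (s n t p) has gradient \<open>tgrad\<close>, whose size is controlled by
  \<open>cg\<close> and \<open>Cg\<close>, and \<open>planar_pieces_exist\<close> splits its level
  sets into curves. For almost every \<open>r\<close> the resulting pieces satisfy
  \<open>curve_pieces\<close>, and integration over \<open>r\<close> restores the surface
  integral.\<close>

lemma level_estimate:
  assumes S: "spatial_pieces \<Omega> v N m0 M0 \<kappa> A P s J" and ne: "\<Omega> \<noteq> {}"
    and D: "surface_C1_grad {x\<in>\<Omega>. v x = t} (grad v) (g t) D"
      "\<And>x. x \<in> \<Omega> \<Longrightarrow> v x = t \<Longrightarrow> cg \<le> norm (D x) \<and> norm (D x) \<le> Cg"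
    and comp: "AE r in lborel. \<forall>C\<in>components (level_curve_set \<Omega> v g t r). C1_curve_reaching_boundary \<Omega> C"
    and len: "\<And>r. hausdorff1 (level_curve_set \<Omega> v g t r) \<le> ennreal K"
  shows "(\<integral>\<^sup>+n. (\<integral>\<^sup>+p\<in>P n t. ennreal \<bar>wx (s n t p)\<bar> * indicator (A n) (s n t p) * ennreal (J n t p) \<partial>lborel) \<partial>count_space UNIV)
    \<le> ennreal Cst * (\<integral>\<^sup>+n. (\<integral>\<^sup>+p\<in>P n t. ennreal (Gx (s n t p)) * indicator (A n) (s n t p) * ennreal (J n t p) \<partial>lborel) \<partial>count_space UNIV)"
proof -
  interpret S: spatial_pieces \<Omega> v N m0 M0 \<kappa> A P s J by (rule S)
  have M0': "0 < M0" using ne M0 by blast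
  define T where "T = {x\<in>\<Omega>. v x = t}"
  define Bd where "Bd = 3 * max Cg 1"
  have Bd: "0 < Bd" by (simp add: Bd_def)
  have D_cont: "continuous_on T D" and D_der: "\<And>x. x \<in> T \<Longrightarrow> (g t has_derivative (\<lambda>h. D x \<bullet> h)) (at x within T)"
    and DN: "\<And>x. x \<in> T \<Longrightarrow> D x \<bullet> N x = 0"
    using D(1) N_grad by (auto simp: surface_C1_grad_def T_def)
  have sT: "s n t p \<in> T" if "p \<in> P n t" for n p using S.s_in S.s_level that by (simp add: T_def)
  have Nk: "N (s n t p) $ \<kappa> n \<noteq> 0" if "p \<in> P n t" for n p
    using S.s_dominant[OF that] norm_ge_zero[of "N (s n t p)"] by linarith
  define \<alpha> where "\<alpha> n p = tgrad (\<kappa> n) (N (s n t p)) (D (s n t p))" for n p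
  have "\<exists>sw Q X \<rho>. planar_pieces (P n t) (\<lambda>p. g t (s n t p)) (\<alpha> n) (cg / 3) Bd sw Q X \<rho>" for n
  proof (rule planar_pieces_exist[OF S.P_open S.P_bounded])
    fix p assume p: "p \<in> P n t"
    let ?ds = "\<lambda>h. emb (\<kappa> n) (h, - (fst (proj (\<kappa> n) (N (s n t p))) \<bullet> h) / N (s n t p) $ \<kappa> n)"
    \<comment> \<open>\<open>g t\<close> has a derivative only within the surface \<open>T\<close>;
      as \<open>s n t\<close> maps the open set \<open>P n t\<close> into \<open>T\<close>, the
      chain rule applies within \<open>P n t\<close>, and at points of an open set this is the full
      derivative.\<close>
    have "(g t \<circ> s n t has_derivative (\<lambda>h. D (s n t p) \<bullet> h) \<circ> ?ds) (at p within P n t)"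
      by (rule diff_chain_within[OF has_derivative_at_withinI[OF S.s_der[OF p]]
            has_derivative_subset[OF D_der[OF sT[OF p]]]]) (use sT in blast)
    then show "((\<lambda>p. g t (s n t p)) has_derivative (\<lambda>h. \<alpha> n p \<bullet> h)) (at p)"
      using at_within_open[OF p S.P_open] inner_tgrad[OF Nk[OF p]] by (simp add: o_def \<alpha>_def)
    have "norm (D (s n t p)) \<le> Cg" "cg \<le> norm (D (s n t p))" using D(2) sT[OF p] by (auto simp: T_def)
    then show "\<bar>fst (\<alpha> n p)\<bar> \<le> Bd \<and> \<bar>snd (\<alpha> n p)\<bar> \<le> Bd"
      using tgrad_upper[OF S.s_dominant[OF p], of "D (s n t p)"] by (auto simp: \<alpha>_def Bd_def)
    show "cg / 3 < \<bar>fst (\<alpha> n p)\<bar> \<or> cg / 3 < \<bar>snd (\<alpha> n p)\<bar>"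
      unfolding \<alpha>_def by (rule tgrad_lower[OF S.s_dominant[OF p] DN[OF sT[OF p]] cg]) fact
  next
    have "continuous_on (P n t) (\<lambda>p. N (s n t p))" "continuous_on (P n t) (\<lambda>p. D (s n t p))"
      using sT S.s_in by (auto intro: continuous_on_compose2[OF N_cont S.s_cont] continuous_on_compose2[OF D_cont S.s_cont])
    then show "continuous_on (P n t) (\<alpha> n)"
      unfolding \<alpha>_def tgrad_def using Nk by (intro continuous_intros) auto
  qed (use cg in simp)
  then obtain sw Q X \<rho> where PP: "\<And>n. planar_pieces (P n t) (\<lambda>p. g t (s n t p)) (\<alpha> n) (cg / 3) Bd (sw n) (Q n) (X n) (\<rho> n)"
    by metis
  \<comment> \<open>The graphs \<open>s n t\<close> live on open sets and overlap; a curve piece is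
    cut down to the part that lies in \<open>A n\<close>, so that each point of the level curve
    belongs to one pair \<open>nm\<close> only.\<close>
  define Q' where "Q' r nm = {q\<in>Q (fst nm) (snd nm) r. s (fst nm) t (X (fst nm) (snd nm) r q) \<in> A (fst nm)}" for r nm
  define X' where "X' r nm q = s (fst nm) t (X (fst nm) (snd nm) r q)" for r nm q
  define \<rho>' where "\<rho>' r nm q = J (fst nm) t (X (fst nm) (snd nm) r q) * \<rho> (fst nm) (snd nm) r q" for r nm q
  \<comment> \<open>The base coordinate of a piece as a direction in space: the plane coordinates of
    \<open>proj\<close> are k + 1 and k + 2, and after a swap the second one is the
    parameter.\<close>
  define e where "e nm = axis (\<kappa> (fst nm) + (if sw (fst nm) (snd nm) then 2 else 1)) (1::real)" for nm :: "nat \<times> nat"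
  define \<tau> where "\<tau> x h \<longleftrightarrow> N x \<bullet> h = 0 \<and> D x \<bullet> h = 0" for x h
  have X'b: "X' r nm \<in> borel_measurable borel" for r nm
    unfolding X'_def using measurable_compose[OF planar_pieces.X_borel[OF PP] S.s_borel] .
  have \<rho>'b: "\<rho>' r nm \<in> borel_measurable borel" for r nm
    unfolding \<rho>'_def using measurable_compose[OF planar_pieces.X_borel[OF PP] S.J_borel] planar_pieces.\<rho>_borel[OF PP]
    by (intro borel_measurable_times)
  have Q'b: "Q' r nm \<in> sets borel" for r nm
  proof -
    have "Q (fst nm) (snd nm) r \<inter> X' r nm -` A (fst nm) \<in> sets borel"
      using planar_pieces.Q_borel[OF PP] measurable_sets[OF X'b S.A_borel, of r nm] by auto
    moreover have "Q (fst nm) (snd nm) r \<inter> X' r nm -` A (fst nm) = Q' r nm" by (auto simp: Q'_def X'_def)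
    ultimately show ?thesis by simp
  qed
  have bounds: "X (fst nm) (snd nm) r q \<in> P (fst nm) t" "0 \<le> J (fst nm) t (X (fst nm) (snd nm) r q)"
    "1 / M0 * (1 / Bd) \<le> \<rho>' r nm q \<and> \<rho>' r nm q \<le> 2 / m0 * (3 / cg)" "0 \<le> \<rho>' r nm q"
    if q: "q \<in> Q (fst nm) (snd nm) r" for r nm q
  proof -
    show p: "X (fst nm) (snd nm) r q \<in> P (fst nm) t" by (rule planar_pieces.X_in[OF PP q])
    have J: "1 / M0 \<le> J (fst nm) t (X (fst nm) (snd nm) r q)" "J (fst nm) t (X (fst nm) (snd nm) r q) \<le> 2 / m0"
      using S.J_bounds[OF p] by auto
    have r: "1 / Bd \<le> \<rho> (fst nm) (snd nm) r q" "\<rho> (fst nm) (snd nm) r q \<le> 3 / cg"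
      using planar_pieces.\<rho>_bounds[OF PP q] by auto
    show J0: "0 \<le> J (fst nm) t (X (fst nm) (snd nm) r q)" using J(1) M0' order_trans[of 0 "1 / M0"] by simp
    have r0: "0 \<le> \<rho> (fst nm) (snd nm) r q" using r(1) Bd order_trans[of 0 "1 / Bd"] by simp
    show "1 / M0 * (1 / Bd) \<le> \<rho>' r nm q \<and> \<rho>' r nm q \<le> 2 / m0 * (3 / cg)"
      unfolding \<rho>'_def using J r J0 r0 Bd m0 M0' by (intro conjI mult_mono) auto
    show "0 \<le> \<rho>' r nm q" unfolding \<rho>'_def using J0 r0 by (rule mult_nonneg_nonneg)
  qed
  \<comment> \<open>The two densities multiply to \<open>\<rho>'\<close>, \<open>J\<close> being
    nonnegative on the pieces, and the double sum becomes one sum over pairs.\<close>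
  have split: "(\<integral>\<^sup>+n. \<integral>\<^sup>+m. (\<integral>\<^sup>+q\<in>Q n m r. f (s n t (X n m r q)) * indicator (A n) (s n t (X n m r q)) * ennreal (J n t (X n m r q)) * ennreal (\<rho> n m r q) \<partial>lborel) \<partial>count_space UNIV \<partial>count_space UNIV)
     = (\<integral>\<^sup>+nm. (\<integral>\<^sup>+q\<in>Q' r nm. f (X' r nm q) * ennreal (\<rho>' r nm q) \<partial>lborel) \<partial>count_space UNIV)"
    for f :: "real^3 \<Rightarrow> ennreal" and r
  proof -
    have "(\<integral>\<^sup>+n. \<integral>\<^sup>+m. (\<integral>\<^sup>+q\<in>Q n m r. f (s n t (X n m r q)) * indicator (A n) (s n t (X n m r q)) * ennreal (J n t (X n m r q)) * ennreal (\<rho> n m r q) \<partial>lborel) \<partial>count_space UNIV \<partial>count_space UNIV)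
      = (\<integral>\<^sup>+n. \<integral>\<^sup>+m. (\<integral>\<^sup>+q\<in>Q' r (n, m). f (X' r (n, m) q) * ennreal (\<rho>' r (n, m) q) \<partial>lborel) \<partial>count_space UNIV \<partial>count_space UNIV)"
    proof (intro nn_integral_cong)
      fix n m q
      show "f (s n t (X n m r q)) * indicator (A n) (s n t (X n m r q)) * ennreal (J n t (X n m r q)) * ennreal (\<rho> n m r q) * indicator (Q n m r) q
        = f (X' r (n, m) q) * ennreal (\<rho>' r (n, m) q) * indicator (Q' r (n, m)) q"
      proof (cases "q \<in> Q n m r")
        case True
        then show ?thesis using bounds(2)[of q "(n, m)" r]
          by (auto simp: X'_def \<rho>'_def Q'_def indicator_def ennreal_mult' mult.assoc)
      qed (simp add: Q'_def)
    qed
    also have "\<dots> = (\<integral>\<^sup>+nm. (\<integral>\<^sup>+q\<in>Q' r nm. f (X' r nm q) * ennreal (\<rho>' r nm q) \<partial>lborel) \<partial>count_space UNIV)"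
      by (rule nn_integral_fst_count_space[of "\<lambda>nm. (\<integral>\<^sup>+q\<in>Q' r nm. f (X' r nm q) * ennreal (\<rho>' r nm q) \<partial>lborel)"])
    finally show ?thesis .
  qed
  have expand: "(\<integral>\<^sup>+n. (\<integral>\<^sup>+p\<in>P n t. f (s n t p) * indicator (A n) (s n t p) * ennreal (J n t p) \<partial>lborel) \<partial>count_space UNIV)
     = (\<integral>\<^sup>+r. \<integral>\<^sup>+nm. (\<integral>\<^sup>+q\<in>Q' r nm. f (X' r nm q) * ennreal (\<rho>' r nm q) \<partial>lborel) \<partial>count_space UNIV \<partial>lborel)"
    and measurable: "(\<lambda>r. \<integral>\<^sup>+nm. (\<integral>\<^sup>+q\<in>Q' r nm. f (X' r nm q) * ennreal (\<rho>' r nm q) \<partial>lborel) \<partial>count_space UNIV) \<in> borel_measurable lborel"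
    if f: "f \<in> borel_measurable borel" for f :: "real^3 \<Rightarrow> ennreal"
  proof -
    define F where "F n p = f (s n t p) * indicator (A n) (s n t p) * ennreal (J n t p)" for n p
    have F: "F n \<in> borel_measurable borel" for n
      unfolding F_def using measurable_compose[OF S.s_borel f] S.J_borel measurable_compose[OF S.s_borel borel_measurable_indicator[OF S.A_borel]]
      by (intro borel_measurable_times_ennreal measurable_compose[OF _ measurable_ennreal]) auto
    have "(\<integral>\<^sup>+n. (\<integral>\<^sup>+p\<in>P n t. F n p \<partial>lborel) \<partial>count_space UNIV)
      = (\<integral>\<^sup>+n. \<integral>\<^sup>+r. \<integral>\<^sup>+m. (\<integral>\<^sup>+q\<in>Q n m r. F n (X n m r q) * ennreal (\<rho> n m r q) \<partial>lborel) \<partial>count_space UNIV \<partial>lborel \<partial>count_space UNIV)"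
      by (intro nn_integral_cong planar_pieces.formula[OF PP F])
    also have "\<dots> = (\<integral>\<^sup>+r. \<integral>\<^sup>+n. \<integral>\<^sup>+m. (\<integral>\<^sup>+q\<in>Q n m r. F n (X n m r q) * ennreal (\<rho> n m r q) \<partial>lborel) \<partial>count_space UNIV \<partial>count_space UNIV \<partial>lborel)"
      using planar_pieces.meas[OF PP F] by (intro nn_integral_count_space_nn_integral[symmetric]) auto
    also have "\<dots> = (\<integral>\<^sup>+r. \<integral>\<^sup>+nm. (\<integral>\<^sup>+q\<in>Q' r nm. f (X' r nm q) * ennreal (\<rho>' r nm q) \<partial>lborel) \<partial>count_space UNIV \<partial>lborel)"
      by (simp only: F_def split)
    finally show "(\<integral>\<^sup>+n. (\<integral>\<^sup>+p\<in>P n t. f (s n t p) * indicator (A n) (s n t p) * ennreal (J n t p) \<partial>lborel) \<partial>count_space UNIV)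
     = (\<integral>\<^sup>+r. \<integral>\<^sup>+nm. (\<integral>\<^sup>+q\<in>Q' r nm. f (X' r nm q) * ennreal (\<rho>' r nm q) \<partial>lborel) \<partial>count_space UNIV \<partial>lborel)"
      by (simp only: F_def)
    have "(\<lambda>r. \<integral>\<^sup>+n. \<integral>\<^sup>+m. (\<integral>\<^sup>+q\<in>Q n m r. F n (X n m r q) * ennreal (\<rho> n m r q) \<partial>lborel) \<partial>count_space UNIV \<partial>count_space UNIV) \<in> borel_measurable borel"
      by (subst nn_integral_count_space_nat) (rule borel_measurable_suminf_order, rule planar_pieces.meas[OF PP F])
    then show "(\<lambda>r. \<integral>\<^sup>+nm. (\<integral>\<^sup>+q\<in>Q' r nm. f (X' r nm q) * ennreal (\<rho>' r nm q) \<partial>lborel) \<partial>count_space UNIV) \<in> borel_measurable lborel"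
      by (simp only: F_def split measurable_lborel1 measurable_lborel2)
  qed
  have AEr: "AE r in lborel. (\<integral>\<^sup>+nm. (\<integral>\<^sup>+q\<in>Q' r nm. ennreal \<bar>wx (X' r nm q)\<bar> * ennreal (\<rho>' r nm q) \<partial>lborel) \<partial>count_space UNIV)
     \<le> ennreal Cst * (\<integral>\<^sup>+nm. (\<integral>\<^sup>+q\<in>Q' r nm. ennreal (Gx (X' r nm q)) * ennreal (\<rho>' r nm q) \<partial>lborel) \<partial>count_space UNIV)"
    using comp
  proof (rule AE_mp, intro AE_I2 impI)
    fix r assume cr: "\<forall>C\<in>components (level_curve_set \<Omega> v g t r). C1_curve_reaching_boundary \<Omega> C"
    define L where "L = level_curve_set \<Omega> v g t r"
    have LT: "L \<subseteq> T" "L \<subseteq> \<Omega>" by (auto simp: L_def level_curve_set_def T_def)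
    have X'L: "X' r nm q \<in> L" if q: "q \<in> Q (fst nm) (snd nm) r" for nm q
      using bounds(1)[OF q] S.s_in S.s_level planar_pieces.X_level[OF PP q] by (simp add: L_def level_curve_set_def X'_def)
    interpret CP: curve_pieces \<Omega> L w G Dw \<tau> K 9 "1 / M0 * (1 / Bd)" "2 / m0 * (3 / cg)" "Q' r" "X' r" e "\<rho>' r"
    proof
      show "open \<Omega>" by (rule open_Om)
      show "bounded \<Omega>" by (rule bounded_Om)
      show "L \<subseteq> \<Omega>" by (rule LT)
      show "continuous_on (closure \<Omega>) w" by (rule w_cont)
      show "continuous_on \<Omega> G" by (rule G_cont)
      show "\<And>x. x \<in> frontier \<Omega> \<Longrightarrow> w x = 0" by (rule w0)
      show "\<And>x. x \<in> \<Omega> \<Longrightarrow> (w has_derivative (\<lambda>h. Dw x \<bullet> h)) (at x)" by (rule w_der)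
      show "\<And>x. x \<in> \<Omega> \<Longrightarrow> 0 \<le> G x" by (rule G_nonneg)
      show "\<And>C. C \<in> components L \<Longrightarrow> C1_curve_reaching_boundary \<Omega> C" using cr by (simp add: L_def)
      show "hausdorff1 L \<le> ennreal K" unfolding L_def by (rule len)
      show "\<And>m. Q' r m \<in> sets borel" "\<And>m. X' r m \<in> borel_measurable borel" "\<And>m. \<rho>' r m \<in> borel_measurable borel"
        by (rule Q'b X'b \<rho>'b)+
      show "\<And>m. norm (e m) = 1" by (simp add: e_def)
      show "0 < (9::real)" "0 < 1 / M0 * (1 / Bd)" "0 < 2 / m0 * (3 / cg)" using M0' Bd m0 cg by auto
    next
      fix x h assume "x \<in> L" "\<tau> x h"
      then show "\<bar>Dw x \<bullet> h\<bar> \<le> G x * norm h" using w_tangential LT by (auto simp: \<tau>_def)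
    next
      fix nm q assume q': "q \<in> Q' r nm"
      then have q: "q \<in> Q (fst nm) (snd nm) r" by (simp add: Q'_def)
      show "X' r nm q \<in> L" by (rule X'L[OF q])
      have "fst (proj (\<kappa> (fst nm)) (X' r nm q)) = X (fst nm) (snd nm) r q"
        unfolding X'_def by (rule S.s_coord[OF bounds(1)[OF q]])
      then have "X' r nm q $ (\<kappa> (fst nm) + 1) = fst (X (fst nm) (snd nm) r q)" "X' r nm q $ (\<kappa> (fst nm) + 2) = snd (X (fst nm) (snd nm) r q)"
        unfolding proj_def by (metis fst_conv snd_conv)+
      then show "X' r nm q \<bullet> e nm = q"
        using planar_pieces.X_coord[OF PP q] by (auto simp: e_def inner_axis flip_def split: if_splits)
      show "1 / M0 * (1 / Bd) \<le> \<rho>' r nm q \<and> \<rho>' r nm q \<le> 2 / m0 * (3 / cg)" by (rule bounds(3)[OF q])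
      fix h assume "\<tau> (X' r nm q) h"
      then have "N (X' r nm q) \<bullet> h = 0" "D (X' r nm q) \<bullet> h = 0" by (auto simp: \<tau>_def)
      then have "norm h \<le> 9 * \<bar>h $ (\<kappa> (fst nm) + (if sw (fst nm) (snd nm) then 2 else 1))\<bar>"
        using S.s_dominant[OF bounds(1)[OF q]] planar_pieces.X_dominant[OF PP q]
        unfolding X'_def \<alpha>_def by (intro tangent_bound)
      then show "norm h \<le> 9 * \<bar>h \<bullet> e nm\<bar>" by (simp add: e_def inner_axis)
    next
      fix nm nm' q q' assume q: "q \<in> Q' r nm" "q' \<in> Q' r nm'" and eq: "X' r nm q = X' r nm' q'"
      have "X' r nm q \<in> A (fst nm)" "X' r nm' q' \<in> A (fst nm')" using q by (auto simp: Q'_def X'_def)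
      then have f: "fst nm = fst nm'" using eq S.A_disj by (auto simp: disjoint_family_on_def)
      have Q: "q \<in> Q (fst nm) (snd nm) r" "q' \<in> Q (fst nm) (snd nm') r" using q f by (auto simp: Q'_def)
      have "X (fst nm) (snd nm) r q = X (fst nm) (snd nm') r q'"
        using eq f S.s_coord[OF planar_pieces.X_in[OF PP Q(1)]] S.s_coord[OF planar_pieces.X_in[OF PP Q(2)]]
        by (simp add: X'_def)
      then have "snd nm = snd nm'" using planar_pieces.X_disj[OF PP Q] by blast
      then show "nm = nm'" using f by (simp add: prod_eq_iff)
    next
      fix x assume x: "x \<in> L"
      then have xO: "x \<in> \<Omega>" "v x = t" "g t x = r" by (auto simp: L_def level_curve_set_def)
      then obtain n where n: "x \<in> A n" using S.A_Un by blast
      obtain p where p: "p \<in> P n t" "s n t p = x" using S.s_cover[OF n xO(2)] by blast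
      then obtain m q where q: "q \<in> Q n m r" "X n m r q = p"
        using planar_pieces.X_cover[OF PP p(1), of r] xO(3) by blast
      then have "q \<in> Q' r (n, m)" "X' r (n, m) q = x" using p n by (auto simp: Q'_def X'_def)
      then show "\<exists>m. \<exists>q\<in>Q' r m. X' r m q = x" by blast
    next
      \<comment> \<open>A curve inside \<open>L\<close> keeps both \<open>v\<close> and
        \<open>g t\<close> constant, so its tangent is annihilated by \<open>N\<close> and by
        \<open>D\<close>. As \<open>g t\<close> is differentiable only within \<open>T\<close>, the
        derivatives are taken within the open parameter interval, where they are unique.\<close>
      fix \<gamma> \<gamma>' a b \<sigma> assume \<sigma>: "\<sigma> \<in> {a<..<b::real}" and sub: "\<gamma> ` {a<..<b} \<subseteq> L"
        and der: "(\<gamma> has_vector_derivative \<gamma>') (at \<sigma>)"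
      have \<gamma>L: "\<gamma> x \<in> L" if "x \<in> {a<..<b}" for x using subsetD[OF sub imageI[OF that]] .
      have gO: "\<gamma> \<sigma> \<in> \<Omega>" "\<gamma> \<sigma> \<in> T" using \<gamma>L[OF \<sigma>] LT by auto
      have at: "at \<sigma> within {a<..<b} = at \<sigma>" using \<sigma> by (intro at_within_open) auto
      have \<gamma>d: "(\<gamma> has_derivative (\<lambda>h. h *\<^sub>R \<gamma>')) (at \<sigma> within {a<..<b})"
        using der unfolding at by (simp add: has_vector_derivative_def)
      have const0: "D' = (\<lambda>h. 0)" if "(F has_derivative D') (at \<sigma> within {a<..<b})" and "\<And>x. x \<in> {a<..<b} \<Longrightarrow> F x = k"
        for F :: "real \<Rightarrow> real" and D' k
      proof -
        have "((\<lambda>x. k) has_derivative D') (at \<sigma> within {a<..<b})"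
          by (rule has_derivative_transform[OF \<sigma> _ that(1)]) (use that(2) in simp)
        then show ?thesis unfolding at by (rule has_derivative_unique) (rule has_derivative_const)
      qed
      have "(v \<circ> \<gamma> has_derivative (\<lambda>h. N (\<gamma> \<sigma>) \<bullet> h) \<circ> (\<lambda>h. h *\<^sub>R \<gamma>')) (at \<sigma> within {a<..<b})"
        by (rule diff_chain_within[OF \<gamma>d has_derivative_at_withinI[OF v_der[OF gO(1)]]])
      then have "(\<lambda>h. N (\<gamma> \<sigma>) \<bullet> h) \<circ> (\<lambda>h. h *\<^sub>R \<gamma>') = (\<lambda>h. 0)"
        by (rule const0[where k=t]) (use \<gamma>L in \<open>auto simp: L_def level_curve_set_def\<close>)
      then have 1: "N (\<gamma> \<sigma>) \<bullet> \<gamma>' = 0" by (auto simp: fun_eq_iff dest: spec[of _ 1])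
      have "(g t \<circ> \<gamma> has_derivative (\<lambda>h. D (\<gamma> \<sigma>) \<bullet> h) \<circ> (\<lambda>h. h *\<^sub>R \<gamma>')) (at \<sigma> within {a<..<b})"
        by (rule diff_chain_within[OF \<gamma>d has_derivative_subset[OF D_der[OF gO(2)]]]) (use sub LT in blast)
      then have "(\<lambda>h. D (\<gamma> \<sigma>) \<bullet> h) \<circ> (\<lambda>h. h *\<^sub>R \<gamma>') = (\<lambda>h. 0)"
        by (rule const0[where k=r]) (use \<gamma>L in \<open>auto simp: L_def level_curve_set_def\<close>)
      then have "D (\<gamma> \<sigma>) \<bullet> \<gamma>' = 0" by (auto simp: fun_eq_iff dest: spec[of _ 1])
      then show "\<tau> (\<gamma> \<sigma>) \<gamma>'" using 1 by (simp add: \<tau>_def)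
    qed
    have X'O: "X' r nm q \<in> \<Omega>" if "q \<in> Q' r nm" for nm q
      using X'L[of q nm] that LT by (auto simp: Q'_def)
    have "(\<integral>\<^sup>+nm. (\<integral>\<^sup>+q\<in>Q' r nm. ennreal \<bar>wx (X' r nm q)\<bar> * ennreal (\<rho>' r nm q) \<partial>lborel) \<partial>count_space UNIV)
      = (\<integral>\<^sup>+nm. (\<integral>\<^sup>+q\<in>Q' r nm. ennreal (\<bar>w (X' r nm q)\<bar> * \<rho>' r nm q) \<partial>lborel) \<partial>count_space UNIV)"
      using X'O by (intro nn_integral_cong) (auto simp: indicator_def wx_def ennreal_mult')
    also have "\<dots> \<le> ennreal Cst * (\<integral>\<^sup>+nm. (\<integral>\<^sup>+q\<in>Q' r nm. ennreal (G (X' r nm q) * \<rho>' r nm q) \<partial>lborel) \<partial>count_space UNIV)"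
      using CP.estimate by (simp add: Cst_def Bd_def)
    also have "(\<integral>\<^sup>+nm. (\<integral>\<^sup>+q\<in>Q' r nm. ennreal (G (X' r nm q) * \<rho>' r nm q) \<partial>lborel) \<partial>count_space UNIV)
      = (\<integral>\<^sup>+nm. (\<integral>\<^sup>+q\<in>Q' r nm. ennreal (Gx (X' r nm q)) * ennreal (\<rho>' r nm q) \<partial>lborel) \<partial>count_space UNIV)"
      using X'O G_nonneg by (intro nn_integral_cong) (auto simp: indicator_def Gx_def ennreal_mult')
    finally show "(\<integral>\<^sup>+nm. (\<integral>\<^sup>+q\<in>Q' r nm. ennreal \<bar>wx (X' r nm q)\<bar> * ennreal (\<rho>' r nm q) \<partial>lborel) \<partial>count_space UNIV)
     \<le> ennreal Cst * (\<integral>\<^sup>+nm. (\<integral>\<^sup>+q\<in>Q' r nm. ennreal (Gx (X' r nm q)) * ennreal (\<rho>' r nm q) \<partial>lborel) \<partial>count_space UNIV)" .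
  qed
  have measG: "(\<lambda>r. \<integral>\<^sup>+nm. (\<integral>\<^sup>+q\<in>Q' r nm. ennreal (Gx (X' r nm q)) * ennreal (\<rho>' r nm q) \<partial>lborel) \<partial>count_space UNIV) \<in> borel_measurable lborel"
    using Gx_borel by (intro measurable[of "\<lambda>x. ennreal (Gx x)"]) simp
  have "(\<integral>\<^sup>+n. (\<integral>\<^sup>+p\<in>P n t. ennreal \<bar>wx (s n t p)\<bar> * indicator (A n) (s n t p) * ennreal (J n t p) \<partial>lborel) \<partial>count_space UNIV)
    = (\<integral>\<^sup>+r. \<integral>\<^sup>+nm. (\<integral>\<^sup>+q\<in>Q' r nm. ennreal \<bar>wx (X' r nm q)\<bar> * ennreal (\<rho>' r nm q) \<partial>lborel) \<partial>count_space UNIV \<partial>lborel)"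
    using wx_borel by (intro expand[of "\<lambda>x. ennreal \<bar>wx x\<bar>"]) simp
  also have "\<dots> \<le> (\<integral>\<^sup>+r. ennreal Cst * (\<integral>\<^sup>+nm. (\<integral>\<^sup>+q\<in>Q' r nm. ennreal (Gx (X' r nm q)) * ennreal (\<rho>' r nm q) \<partial>lborel) \<partial>count_space UNIV) \<partial>lborel)"
    by (rule nn_integral_mono_AE[OF AEr])
  also have "\<dots> = ennreal Cst * (\<integral>\<^sup>+r. \<integral>\<^sup>+nm. (\<integral>\<^sup>+q\<in>Q' r nm. ennreal (Gx (X' r nm q)) * ennreal (\<rho>' r nm q) \<partial>lborel) \<partial>count_space UNIV \<partial>lborel)"
    by (rule nn_integral_cmult[OF measG])
  also have "(\<integral>\<^sup>+r. \<integral>\<^sup>+nm. (\<integral>\<^sup>+q\<in>Q' r nm. ennreal (Gx (X' r nm q)) * ennreal (\<rho>' r nm q) \<partial>lborel) \<partial>count_space UNIV \<partial>lborel)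
    = (\<integral>\<^sup>+n. (\<integral>\<^sup>+p\<in>P n t. ennreal (Gx (s n t p)) * indicator (A n) (s n t p) * ennreal (J n t p) \<partial>lborel) \<partial>count_space UNIV)"
    using Gx_borel by (intro expand[of "\<lambda>x. ennreal (Gx x)", symmetric]) simp
  finally show ?thesis .
qed

text \<open>\<open>level_estimate\<close> integrated over \<open>t\<close> by the coarea formula for
  \<open>v\<close>. For values \<open>t\<close> outside the range of \<open>v\<close>, about which
  \<open>foliated\<close> asserts nothing, the pieces are empty.\<close>

lemma estimate: "(\<integral>\<^sup>+x\<in>\<Omega>. ennreal \<bar>w x\<bar> \<partial>lborel) \<le> ennreal Cst * (\<integral>\<^sup>+x\<in>\<Omega>. ennreal (G x) \<partial>lborel)"
proof (cases "\<Omega> = {}")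
  case False
  obtain \<kappa> A P s J where S: "spatial_pieces \<Omega> v N m0 M0 \<kappa> A P s J"
    using spatial_pieces_exist[OF open_Om bounded_Om v_der N_cont m0 N_bounds] by blast
  interpret S: spatial_pieces \<Omega> v N m0 M0 \<kappa> A P s J by (rule S)
  let ?I = "\<lambda>f t. \<integral>\<^sup>+n. (\<integral>\<^sup>+p\<in>P n t. f (s n t p) * indicator (A n) (s n t p) * ennreal (J n t p) \<partial>lborel) \<partial>count_space UNIV"
  have AEt: "AE t in lborel. ?I (\<lambda>x. ennreal \<bar>wx x\<bar>) t \<le> ennreal Cst * ?I (\<lambda>x. ennreal (Gx x)) t"
  proof (rule AE_mp)
    show "AE t in lborel. t \<in> v ` \<Omega> \<longrightarrow>
       (\<exists>D. surface_C1_grad {x\<in>\<Omega>. v x = t} (grad v) (g t) D \<and>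
            (\<forall>x\<in>\<Omega>. v x = t \<longrightarrow> cg \<le> norm (D x) \<and> norm (D x) \<le> Cg)) \<and>
       (AE r in lborel. \<forall>C\<in>components (level_curve_set \<Omega> v g t r). C1_curve_reaching_boundary \<Omega> C) \<and>
       (\<forall>r. hausdorff1 (level_curve_set \<Omega> v g t r) \<le> ennreal K)"
      using fol by (simp only: foliated_def)
  next
    show "AE t in lborel. (t \<in> v ` \<Omega> \<longrightarrow>
       (\<exists>D. surface_C1_grad {x\<in>\<Omega>. v x = t} (grad v) (g t) D \<and>
            (\<forall>x\<in>\<Omega>. v x = t \<longrightarrow> cg \<le> norm (D x) \<and> norm (D x) \<le> Cg)) \<and>
       (AE r in lborel. \<forall>C\<in>components (level_curve_set \<Omega> v g t r). C1_curve_reaching_boundary \<Omega> C) \<and>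
       (\<forall>r. hausdorff1 (level_curve_set \<Omega> v g t r) \<le> ennreal K)) \<longrightarrow> ?I (\<lambda>x. ennreal \<bar>wx x\<bar>) t \<le> ennreal Cst * ?I (\<lambda>x. ennreal (Gx x)) t"
    proof (intro AE_I2 impI)
    fix t assume H: "t \<in> v ` \<Omega> \<longrightarrow>
       (\<exists>D. surface_C1_grad {x\<in>\<Omega>. v x = t} (grad v) (g t) D \<and>
            (\<forall>x\<in>\<Omega>. v x = t \<longrightarrow> cg \<le> norm (D x) \<and> norm (D x) \<le> Cg)) \<and>
       (AE r in lborel. \<forall>C\<in>components (level_curve_set \<Omega> v g t r). C1_curve_reaching_boundary \<Omega> C) \<and>
       (\<forall>r. hausdorff1 (level_curve_set \<Omega> v g t r) \<le> ennreal K)"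
    show "?I (\<lambda>x. ennreal \<bar>wx x\<bar>) t \<le> ennreal Cst * ?I (\<lambda>x. ennreal (Gx x)) t"
    proof (cases "t \<in> v ` \<Omega>")
      case True
      then obtain D where "surface_C1_grad {x\<in>\<Omega>. v x = t} (grad v) (g t) D"
        "\<And>x. x \<in> \<Omega> \<Longrightarrow> v x = t \<Longrightarrow> cg \<le> norm (D x) \<and> norm (D x) \<le> Cg" using H by blast
      then show ?thesis by (rule level_estimate[OF S False]) (use H True in auto)
    next
      case f: False
      have "p \<notin> P n t" for n p using S.s_in S.s_level f by (metis imageI)
      then have "P n t = {}" for n by blast
      then show ?thesis by simp
    qed
    qed
  qed
  have measG: "(\<lambda>t. ?I (\<lambda>x. ennreal (Gx x)) t) \<in> borel_measurable lborel"
    using S.meas[of "\<lambda>x. ennreal (Gx x)"] Gx_borel by simp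
  have "(\<integral>\<^sup>+x\<in>\<Omega>. ennreal \<bar>w x\<bar> \<partial>lborel) = (\<integral>\<^sup>+x\<in>\<Omega>. ennreal \<bar>wx x\<bar> \<partial>lborel)"
    by (intro nn_integral_cong) (auto simp: wx_def indicator_def)
  also have "\<dots> = (\<integral>\<^sup>+t. ?I (\<lambda>x. ennreal \<bar>wx x\<bar>) t \<partial>lborel)"
    using wx_borel by (intro S.formula) simp
  also have "\<dots> \<le> (\<integral>\<^sup>+t. ennreal Cst * ?I (\<lambda>x. ennreal (Gx x)) t \<partial>lborel)"
    by (rule nn_integral_mono_AE[OF AEt])
  also have "\<dots> = ennreal Cst * (\<integral>\<^sup>+t. ?I (\<lambda>x. ennreal (Gx x)) t \<partial>lborel)"
    by (rule nn_integral_cmult[OF measG])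
  also have "(\<integral>\<^sup>+t. ?I (\<lambda>x. ennreal (Gx x)) t \<partial>lborel) = (\<integral>\<^sup>+x\<in>\<Omega>. ennreal (Gx x) \<partial>lborel)"
    using Gx_borel by (intro S.formula[symmetric]) simp
  also have "\<dots> = (\<integral>\<^sup>+x\<in>\<Omega>. ennreal (G x) \<partial>lborel)"
    by (intro nn_integral_cong) (auto simp: Gx_def indicator_def)
  finally show ?thesis .
qed simp

end


section \<open>Mollification\<close>

lemma has_derivative_grad:
  assumes "f differentiable (at x)"
  shows "(f has_derivative (\<lambda>h. grad f x \<bullet> h)) (at x)"
proof -
  let ?D = "frechet_derivative f (at x)"
  have D: "(f has_derivative ?D) (at x)" using assms frechet_derivative_works by blast
  then have lin: "linear ?D" by (rule has_derivative_linear)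
  have "?D h = grad f x \<bullet> h" for h
  proof -
    have "?D h = ?D (\<Sum>b\<in>Basis. (h \<bullet> b) *\<^sub>R b)" by (simp add: euclidean_representation)
    also have "\<dots> = (\<Sum>b\<in>Basis. (h \<bullet> b) * ?D b)" using lin by (simp add: linear_sum linear_cmul)
    also have "\<dots> = grad f x \<bullet> h" by (simp add: grad_def inner_sum_left inner_commute[of h] mult.commute)
    finally show ?thesis .
  qed
  then have "?D = (\<lambda>h. grad f x \<bullet> h)" by blast
  then show ?thesis using D by simp
qed

lemma grad_eqI:
  assumes "(f has_derivative (\<lambda>h. d \<bullet> h)) (at x)"
  shows "grad f x = d"
proof -
  have "frechet_derivative f (at x) = (\<lambda>h. d \<bullet> h)" using frechet_derivative_at[OF assms] by simp
  then show ?thesis by (simp add: grad_def euclidean_representation)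
qed

lemma grad_inner_Basis: "b \<in> Basis \<Longrightarrow> grad f x \<bullet> b = frechet_derivative f (at x) b"
  by (simp add: grad_def inner_sum_left inner_Basis if_distrib sum.delta cong: if_cong)

lemma Ck_on_differentiable: "Ck_on k S f \<Longrightarrow> 0 < k \<Longrightarrow> x \<in> S \<Longrightarrow> f differentiable (at x)"
  unfolding Ck_on_def by (metis empty_subsetI iter_partial.simps(1) list.set(1) list.size(3))

lemma Ck_on_continuous: "Ck_on k S f \<Longrightarrow> continuous_on S f"
  unfolding Ck_on_def by (metis empty_subsetI iter_partial.simps(1) list.set(1) list.size(3) zero_le)

lemma Ck_on_partial_continuous:
  assumes "Ck_on k S f" "0 < k" "b \<in> Basis"
  shows "continuous_on S (\<lambda>x. frechet_derivative f (at x) b)"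
proof -
  have "continuous_on S (iter_partial [b] f)"
    using assms unfolding Ck_on_def by (metis One_nat_def Suc_leI empty_set empty_subsetI insert_subset length_Cons list.simps(15) list.size(3))
  then show ?thesis by simp
qed

lemma Ck_on_grad_continuous:
  assumes "Ck_on k S f" "0 < k"
  shows "continuous_on S (grad f)"
  unfolding grad_def[abs_def] using Ck_on_partial_continuous[OF assms] by (intro continuous_intros)

text \<open>The induction over multi-indices is absorbed in the closure of \<F> under partial
  derivatives; continuity of each derivative follows from its own differentiability.\<close>

lemma smooth_family:
  assumes diff: "\<And>f x. f \<in> \<F> \<Longrightarrow> f differentiable (at x)"
    and part: "\<And>f b. f \<in> \<F> \<Longrightarrow> b \<in> Basis \<Longrightarrow> (\<lambda>x. frechet_derivative f (at x) b) \<in> \<F>"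
    and f: "f \<in> \<F>"
  shows "Ck_on k UNIV f"
proof -
  have "iter_partial hs f \<in> \<F>" if "set hs \<subseteq> Basis" for hs
    using that by (induction hs) (auto intro: f part)
  then show ?thesis unfolding Ck_on_def
    using diff by (auto intro!: continuous_at_imp_continuous_on differentiable_imp_continuous_within)
qed

text \<open>The function exp (-1/s), extended by 0 to s \<le> 0, divided by powers of
  \<open>s\<close>: the powers make the linear span of the family closed under
  differentiation.\<close>

definition flat_exp :: "nat \<Rightarrow> real \<Rightarrow> real" where
  "flat_exp k s = (if 0 < s then exp (- (1 / s)) / s ^ k else 0)"

lemma flat_exp_tendsto_0: "(flat_exp k \<longlongrightarrow> 0) (at 0)"
proof -
  have "((\<lambda>s::real. (inverse s) ^ k / exp (inverse s)) \<longlongrightarrow> 0) (at_right 0)"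
    by (rule filterlim_compose[OF tendsto_power_div_exp_0 filterlim_inverse_at_top_right])
  moreover have "\<forall>\<^sub>F s in at_right 0. (inverse s) ^ k / exp (inverse s) = flat_exp k s"
    using eventually_at_right_less[of "0::real"]
    by (rule eventually_mono) (simp add: flat_exp_def exp_minus inverse_eq_divide power_one_over)
  ultimately have "(flat_exp k \<longlongrightarrow> 0) (at_right 0)" by (rule Lim_transform_eventually)
  moreover have "(flat_exp k \<longlongrightarrow> 0) (at_left 0)"
    by (rule Lim_transform_eventually[OF tendsto_const]) (auto simp: flat_exp_def intro!: eventually_at_leftI[of "-1" 0])
  ultimately show ?thesis by (simp add: filterlim_split_at)
qed

lemma flat_exp_derivative: "(flat_exp k has_real_derivative flat_exp (k + 2) s - real k * flat_exp (k + 1) s) (at s)"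
proof (cases s "0::real" rule: linorder_cases)
  case greater
  have "((\<lambda>s. exp (- (1 / s)) / s ^ k) has_real_derivative flat_exp (k + 2) s - real k * flat_exp (k + 1) s) (at s)"
  proof -
    have d1: "((\<lambda>s. exp (- (1 / s))) has_real_derivative exp (- (1 / s)) / s\<^sup>2) (at s)"
      using greater by (auto intro!: derivative_eq_intros simp: power2_eq_square)
    have "real k * s ^ (k - 1) = real k * s ^ k / s" using greater by (cases k) auto
    then have d2: "((\<lambda>s. s ^ k) has_real_derivative real k * s ^ k / s) (at s)"
      using DERIV_pow[of k s] by simp
    have "s ^ k \<noteq> 0" using greater by simp
    then have "(exp (- (1 / s)) / s\<^sup>2 * s ^ k - exp (- (1 / s)) * (real k * s ^ k / s)) / (s ^ k * s ^ k)
        = flat_exp (k + 2) s - real k * flat_exp (k + 1) s"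
      using greater by (simp add: flat_exp_def power_add divide_simps power2_eq_square) (simp add: algebra_simps)
    with DERIV_divide[OF d1 d2 \<open>s ^ k \<noteq> 0\<close>] show ?thesis by (rule DERIV_cong)
  qed
  then show ?thesis
    by (rule has_field_derivative_transform_within_open[of _ _ _ "{0<..}"]) (use greater in \<open>auto simp: flat_exp_def\<close>)
next
  case less
  have "((\<lambda>s. 0) has_real_derivative 0) (at s)" by simp
  then have "(flat_exp k has_real_derivative 0) (at s)"
    by (rule has_field_derivative_transform_within_open[of _ _ _ "{..<0}"]) (use less in \<open>auto simp: flat_exp_def\<close>)
  then show ?thesis using less by (simp add: flat_exp_def)
next
  case equal
  \<comment> \<open>At 0 the difference quotient of \<open>flat_exp k\<close> is
    \<open>flat_exp (k + 1)\<close>, whose limit is 0.\<close>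
  have "((\<lambda>h. (flat_exp k (0 + h) - flat_exp k 0) / h) \<longlongrightarrow> 0) (at 0)"
    by (rule Lim_transform_eventually[OF flat_exp_tendsto_0[of "k + 1"]])
      (auto simp: flat_exp_def eventually_at_filter)
  then have "(flat_exp k has_real_derivative 0) (at 0)" by (simp add: DERIV_def)
  then show ?thesis using equal by (simp add: flat_exp_def)
qed

text \<open>An algebra of functions that contains a bump function and is closed under partial derivatives,
  so that smoothness needs no induction on the order.\<close>

inductive_set bumps :: "('a::euclidean_space \<Rightarrow> real) set" where
  const: "(\<lambda>x. c) \<in> bumps"
| coord: "(\<lambda>x. x \<bullet> c) \<in> bumps"
| exp: "(\<lambda>x. flat_exp k (r - x \<bullet> x)) \<in> bumps"
| add: "f \<in> bumps \<Longrightarrow> g \<in> bumps \<Longrightarrow> (\<lambda>x. f x + g x) \<in> bumps"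
| mult: "f \<in> bumps \<Longrightarrow> g \<in> bumps \<Longrightarrow> (\<lambda>x. f x * g x) \<in> bumps"

lemma bumps_derivative:
  assumes "f \<in> bumps"
  shows "\<exists>f'. (\<forall>x. (f has_derivative f' x) (at x)) \<and> (\<forall>b. (\<lambda>x. f' x b) \<in> bumps)"
  using assms
proof induction
  case (const c)
  show ?case by (intro exI[of _ "\<lambda>x h. 0"] conjI allI has_derivative_const bumps.const)
next
  case (coord c)
  show ?case by (intro exI[of _ "\<lambda>x h. h \<bullet> c"] conjI allI bumps.const) (auto intro!: derivative_eq_intros)
next
  case (exp k r)
  have "((\<lambda>x. flat_exp k (r - x \<bullet> x)) has_derivative
      (\<lambda>h. (flat_exp (k + 2) (r - x \<bullet> x) + (- real k) * flat_exp (k + 1) (r - x \<bullet> x)) * ((-2) * (x \<bullet> h)))) (at x)" for x :: 'a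
  proof -
    have "((\<lambda>x. r - x \<bullet> x) has_derivative (\<lambda>h. (-2) * (x \<bullet> h))) (at x)"
      by (auto intro!: derivative_eq_intros simp: inner_commute)
    from has_derivative_compose[OF this, of "flat_exp k" "\<lambda>y. (flat_exp (k + 2) (r - x \<bullet> x) - real k * flat_exp (k + 1) (r - x \<bullet> x)) * y"]
    show ?thesis using flat_exp_derivative[of k "r - x \<bullet> x"] by (simp add: has_field_derivative_def)
  qed
  moreover have "(\<lambda>x. (flat_exp (k + 2) (r - x \<bullet> x) + (- real k) * flat_exp (k + 1) (r - x \<bullet> x)) * ((-2) * (x \<bullet> b))) \<in> bumps" for b :: 'a
    by (intro bumps.intros)
  ultimately show ?case
    by (intro exI[of _ "\<lambda>x h. (flat_exp (k + 2) (r - x \<bullet> x) + (- real k) * flat_exp (k + 1) (r - x \<bullet> x)) * ((-2) * (x \<bullet> h))"]) blast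
next
  case (add f g)
  then obtain f' g' where d: "\<And>x. (f has_derivative f' x) (at x)" "\<And>x. (g has_derivative g' x) (at x)"
    and b: "\<And>b. (\<lambda>x. f' x b) \<in> bumps" "\<And>b. (\<lambda>x. g' x b) \<in> bumps" by blast
  show ?case
    by (intro exI[of _ "\<lambda>x h. f' x h + g' x h"] conjI allI has_derivative_add d bumps.add b)
next
  case (mult f g)
  then obtain f' g' where d: "\<And>x. (f has_derivative f' x) (at x)" "\<And>x. (g has_derivative g' x) (at x)"
    and b: "\<And>b. (\<lambda>x. f' x b) \<in> bumps" "\<And>b. (\<lambda>x. g' x b) \<in> bumps" by blast
  show ?case
    by (intro exI[of _ "\<lambda>x h. f x * g' x h + f' x h * g x"] conjI allI has_derivative_mult d bumps.add bumps.mult b mult.hyps)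
qed

lemma bumps_differentiable: "f \<in> bumps \<Longrightarrow> f differentiable (at x)"
  using bumps_derivative unfolding differentiable_def by blast

lemma bumps_partial:
  assumes "f \<in> bumps"
  shows "(\<lambda>x. frechet_derivative f (at x) b) \<in> bumps"
proof -
  obtain f' where f': "\<And>x. (f has_derivative f' x) (at x)" "\<And>b. (\<lambda>x. f' x b) \<in> bumps"
    using bumps_derivative[OF assms] by blast
  then have "frechet_derivative f (at x) = f' x" for x using frechet_derivative_at by metis
  then show ?thesis using f'(2) by simp
qed

lemma bumps_continuous: "f \<in> bumps \<Longrightarrow> continuous_on S f"
  using bumps_differentiable by (auto intro!: continuous_at_imp_continuous_on differentiable_imp_continuous_within)

text \<open>Links the gauge integral over a box, for which differentiation under the integral is
  available, with the Lebesgue integral, for which translation invariance is available.\<close>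

lemma continuous_compact_support_integral:
  fixes f :: "'a::euclidean_space \<Rightarrow> real"
  assumes c: "continuous_on UNIV f" and z: "\<And>x. x \<notin> cbox a b \<Longrightarrow> f x = 0"
  shows "integrable lborel f" "integral (cbox a b) f = (LINT x|lborel. f x)"
proof -
  have "integrable lborel (\<lambda>x. indicator (cbox a b) x *\<^sub>R f x)"
    by (intro borel_integrable_compact continuous_on_subset[OF c]) auto
  also have "(\<lambda>x. indicator (cbox a b) x *\<^sub>R f x) = f" using z by (auto simp: indicator_def fun_eq_iff)
  finally show i: "integrable lborel f" .
  have "integral (cbox a b) f = integral UNIV f"
  proof -
    have "f = (\<lambda>x. if x \<in> cbox a b then f x else 0)" using z by auto
    then show ?thesis using integral_restrict_UNIV[of "cbox a b" f] by simp
  qed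
  then show "integral (cbox a b) f = (LINT x|lborel. f x)" using integral_lborel[OF i] by simp
qed

lemma lborel_integral_translate:
  fixes f :: "'a::euclidean_space \<Rightarrow> real"
  assumes "f \<in> borel_measurable borel"
  shows "(LINT x|lborel. f (c + x)) = (LINT x|lborel. f x)"
proof -
  have "(LINT x|lborel. f x) = (LINT x|distr lborel borel ((+) c). f x)" by (simp only: lborel_distr_plus)
  also have "\<dots> = (LINT x|lborel. f (c + x))" using assms by (intro integral_distr) auto
  finally show ?thesis by simp
qed

lemma mollifier_exists:
  assumes "0 < (\<epsilon>::real)"
  obtains \<rho> :: "'a::euclidean_space \<Rightarrow> real" where "\<rho> \<in> bumps" "\<And>x. 0 \<le> \<rho> x" "\<And>x. \<epsilon> \<le> norm x \<Longrightarrow> \<rho> x = 0"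
    "\<And>x. \<rho> (- x) = \<rho> x" "(LINT x|lborel. \<rho> x) = 1"
proof -
  define f :: "'a \<Rightarrow> real" where "f x = flat_exp 0 (\<epsilon>\<^sup>2 - x \<bullet> x)" for x
  have f: "f \<in> bumps" unfolding f_def[abs_def] by (rule bumps.exp)
  have f0: "0 \<le> f x" for x by (simp add: f_def flat_exp_def)
  have fz: "f x = 0" if "\<epsilon> \<le> norm x" for x
  proof -
    have "\<epsilon>\<^sup>2 \<le> (norm x)\<^sup>2" using that assms by (intro power_mono) auto
    then show ?thesis by (simp add: f_def flat_exp_def power2_norm_eq_inner)
  qed
  have supp: "f x = 0" if out: "x \<notin> cbox (- \<epsilon> *\<^sub>R One) (\<epsilon> *\<^sub>R One)" for x
  proof (rule fz)
    obtain i where i: "i \<in> Basis" "\<not> (- \<epsilon> \<le> x \<bullet> i \<and> x \<bullet> i \<le> \<epsilon>)"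
      using out by (auto simp: mem_box)
    then have "\<epsilon> < \<bar>x \<bullet> i\<bar>" by auto
    then show "\<epsilon> \<le> norm x" using Basis_le_norm[OF i(1), of x] by linarith
  qed
  have int: "integrable lborel f" by (rule continuous_compact_support_integral[OF bumps_continuous[OF f] supp])
  define I where "I = (LINT x|lborel. f x)"
  \<comment> \<open>A zero integral of the nonnegative \<open>f\<close> would make the ball of
    radius \<open>\<epsilon>\<close>, on which \<open>f\<close> is positive, a null set.\<close>
  have I0: "I \<noteq> 0"
  proof
    assume "I = 0"
    then have "AE x in lborel. f x = 0"
      using integral_nonneg_eq_0_iff_AE[OF int] f0 by (simp add: I_def)
    then have "AE x in lborel. x \<notin> ball (0::'a) \<epsilon>"
    proof (rule eventually_mono)
      fix x assume "f x = 0"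
      then have "\<epsilon>\<^sup>2 \<le> (norm x)\<^sup>2" by (simp add: f_def flat_exp_def power2_norm_eq_inner split: if_splits)
      then have "\<epsilon> \<le> norm x" by (rule power2_le_imp_le) simp
      then show "x \<notin> ball (0::'a) \<epsilon>" by simp
    qed
    then have "ball (0::'a) \<epsilon> \<in> null_sets (lborel :: 'a measure)"
      by (subst (asm) AE_iff_null_sets[symmetric]) auto
    then have "negligible (ball (0::'a) \<epsilon>)" by (simp add: negligible_iff_null_sets null_sets_completionI)
    then show False using open_not_negligible[of "ball (0::'a) \<epsilon>"] assms by simp
  qed
  have "0 \<le> I" unfolding I_def using f0 by (intro Bochner_Integration.integral_nonneg)
  then have I: "0 < I" using I0 by simp
  show thesis
  proof (rule that[of "\<lambda>x. (1 / I) * f x"])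
    show "(\<lambda>x. (1 / I) * f x) \<in> bumps" by (intro bumps.mult bumps.const f)
    show "(LINT x|lborel. (1 / I) * f x) = 1" using I0 by (subst integral_mult_right_zero) (simp add: I_def[symmetric])
  qed (use I f0 fz in \<open>auto simp: f_def\<close>)
qed

text \<open>By translation invariance every difference quotient of \<xi> in direction
  \<open>e\<close> has integral 0; dominated convergence passes to the directional
  derivative.\<close>

lemma grad_integral_zero:
  fixes \<xi> :: "'a::euclidean_space \<Rightarrow> real"
  assumes d: "\<And>x. \<xi> differentiable (at x)" and c: "continuous_on UNIV (grad \<xi>)"
    and z: "\<And>x. x \<notin> cbox p q \<Longrightarrow> \<xi> x = 0"
  shows "(LINT x|lborel. grad \<xi> x \<bullet> e) = 0"
proof -
  have D: "(\<xi> has_derivative (\<lambda>h. grad \<xi> x \<bullet> h)) (at x)" for x by (rule has_derivative_grad[OF d])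
  have \<xi>c: "continuous_on UNIV \<xi>"
    using d by (auto intro!: continuous_at_imp_continuous_on differentiable_imp_continuous_within)
  have \<xi>i: "integrable lborel \<xi>" by (rule continuous_compact_support_integral[OF \<xi>c z])
  have gz: "grad \<xi> x = 0" if "x \<notin> cbox p q" for x
  proof (rule grad_eqI)
    have "((\<lambda>x. 0) has_derivative (\<lambda>h. 0 \<bullet> h)) (at x)" by simp
    then show "(\<xi> has_derivative (\<lambda>h. 0 \<bullet> h)) (at x)"
      by (rule has_derivative_transform_within_open[of _ _ _ _ "- cbox p q"]) (use that z in auto)
  qed
  have "bounded (grad \<xi> ` cbox p q)"
    by (intro compact_imp_bounded compact_continuous_image continuous_on_subset[OF c]) auto
  then obtain B where "\<And>x. x \<in> cbox p q \<Longrightarrow> norm (grad \<xi> x) \<le> B" "0 < B" unfolding bounded_pos by auto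
  then have B: "norm (grad \<xi> x) \<le> B" for x using gz[of x] by (cases "x \<in> cbox p q") auto
  define t where "t n = 1 / real (Suc n)" for n
  have t: "0 < t n" "t n \<le> 1" for n by (auto simp: t_def)
  have t0: "t \<longlonglongrightarrow> 0" unfolding t_def[abs_def] using LIMSEQ_inverse_real_of_nat by (simp add: inverse_eq_divide)
  define s where "s n x = (\<xi> (t n *\<^sub>R e + x) - \<xi> x) / t n" for n x
  have tr: "integrable lborel (\<lambda>x. \<xi> (c + x))" for c
  proof -
    have "integrable (distr lborel borel ((+) c)) \<xi>" using \<xi>i by (simp add: lborel_distr_plus)
    then show ?thesis by (subst (asm) integrable_distr_eq) (use \<xi>c borel_measurable_continuous_onI in auto)
  qed
  have s0: "(LINT x|lborel. s n x) = 0" for n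
    unfolding s_def using tr \<xi>i lborel_integral_translate[of \<xi> "t n *\<^sub>R e"] \<xi>c
    by (simp add: borel_measurable_continuous_onI)
  obtain R where R: "0 < R" "cbox p q \<subseteq> ball 0 R" using bounded_cbox[of p q] bounded_subset_ballD[of "cbox p q" 0] by blast
  \<comment> \<open>All steps \<open>t n\<close> are at most 1, so every difference quotient
    vanishes outside this ball, and the constant B |e| on the ball is an integrable
    majorant.\<close>
  define W where "W = cball (0::'a) (R + norm e)"
  have lip: "\<bar>\<xi> y - \<xi> x\<bar> \<le> B * norm (y - x)" for x y
  proof -
    have "norm (\<xi> y - \<xi> x) \<le> B * norm (y - x)"
    proof (rule differentiable_bound[where S=UNIV and f'="\<lambda>x h. grad \<xi> x \<bullet> h"])
      fix x show "(\<xi> has_derivative (\<lambda>h. grad \<xi> x \<bullet> h)) (at x within UNIV)" using D by simp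
      show "onorm (\<lambda>h. grad \<xi> x \<bullet> h) \<le> B"
        by (rule onorm_le) (simp, rule order_trans[OF Cauchy_Schwarz_ineq2 mult_right_mono[OF B norm_ge_zero]])
    qed auto
    then show ?thesis by simp
  qed
  have "(\<lambda>n. LINT x|lborel. s n x) \<longlonglongrightarrow> (LINT x|lborel. grad \<xi> x \<bullet> e)"
  proof (rule integral_dominated_convergence[where w="\<lambda>x. B * norm e * indicator W x"])
    show "(\<lambda>x. grad \<xi> x \<bullet> e) \<in> borel_measurable lborel"
      using c by (auto intro!: borel_measurable_continuous_onI continuous_intros)
    show "s n \<in> borel_measurable lborel" for n
      unfolding s_def[abs_def] using \<xi>c t(1)[of n] by (auto intro!: borel_measurable_continuous_onI continuous_intros continuous_on_compose2[OF \<xi>c])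
    show "integrable lborel (\<lambda>x. B * norm e * indicator W x)"
      using emeasure_bounded_finite[of W] by (intro integrable_mult_right integrable_real_indicator) (auto simp: W_def)
    show "AE x in lborel. (\<lambda>n. s n x) \<longlonglongrightarrow> grad \<xi> x \<bullet> e"
    proof (intro AE_I2)
      fix x
      have "((\<lambda>r. \<xi> (x + r *\<^sub>R e)) has_derivative (\<lambda>r. grad \<xi> x \<bullet> (r *\<^sub>R e))) (at 0)"
        by (rule has_derivative_compose[of "\<lambda>r. x + r *\<^sub>R e"]) (use D in \<open>auto intro!: derivative_eq_intros\<close>)
      then have "((\<lambda>r. \<xi> (x + r *\<^sub>R e)) has_real_derivative grad \<xi> x \<bullet> e) (at 0)"
        by (simp add: has_field_derivative_def mult_commute_abs)
      then have "(\<lambda>r. (\<xi> (x + r *\<^sub>R e) - \<xi> x) / r) \<midarrow>0\<rightarrow> grad \<xi> x \<bullet> e" by (simp add: DERIV_def)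
      then have "(\<lambda>n. (\<xi> (x + t n *\<^sub>R e) - \<xi> x) / t n) \<longlonglongrightarrow> grad \<xi> x \<bullet> e"
        using t0 t by (intro LIMSEQ_SEQ_conv[THEN iffD2, rule_format]) (auto simp: less_imp_neq[symmetric])
      then show "(\<lambda>n. s n x) \<longlonglongrightarrow> grad \<xi> x \<bullet> e" by (simp add: s_def add.commute)
    qed
    show "AE x in lborel. norm (s n x) \<le> B * norm e * indicator W x" for n
    proof (intro AE_I2)
      fix x
      show "norm (s n x) \<le> B * norm e * indicator W x"
      proof (cases "x \<in> W")
        case True
        have "\<bar>\<xi> (t n *\<^sub>R e + x) - \<xi> x\<bar> \<le> B * (t n * norm e)" using lip[of "t n *\<^sub>R e + x" x] t[of n] by simp
        then show ?thesis using True t[of n] by (simp add: s_def abs_divide divide_le_eq mult.commute mult.left_commute)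
      next
        case False
        then have "R + norm e < norm x" by (simp add: W_def)
        also have "norm x \<le> norm (t n *\<^sub>R e + x) + norm (t n *\<^sub>R e)"
          using norm_triangle_ineq4[of "t n *\<^sub>R e + x" "t n *\<^sub>R e"] by simp
        also have "\<dots> \<le> norm (t n *\<^sub>R e + x) + norm e"
          using t[of n] mult_right_mono[of "t n" 1 "norm e"] by simp
        finally have "R \<le> norm (t n *\<^sub>R e + x)" by simp
        moreover have "R \<le> norm x"
        proof -
          have "R + norm e < norm x" using False by (simp add: W_def)
          then show ?thesis using norm_ge_zero[of e] by linarith
        qed
        ultimately have "R \<le> norm x" "R \<le> norm (t n *\<^sub>R e + x)" by simp_all
        then have "x \<notin> cbox p q" "t n *\<^sub>R e + x \<notin> cbox p q" using R by auto
        then show ?thesis using z False by (simp add: s_def)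
      qed
    qed
  qed
  then show ?thesis by (simp add: s0 LIMSEQ_const_iff)
qed

text \<open>Convolution of \<open>\<rho>\<close> with a function supported in the box. The fixed
  compact domain of integration is what the rule for differentiation under the integral asks for,
  and with \<open>\<psi>\<close> fixed, differentiation becomes an operation on
  \<open>\<rho>\<close> alone.\<close>

definition convolve :: "'a \<Rightarrow> 'a \<Rightarrow> ('a::euclidean_space \<Rightarrow> real) \<Rightarrow> ('a \<Rightarrow> real) \<Rightarrow> 'a \<Rightarrow> real" where
  "convolve p q \<psi> \<rho> x = integral (cbox p q) (\<lambda>y. \<rho> (x - y) * \<psi> y)"

lemma convolve_derivative:
  assumes \<rho>: "\<rho> \<in> bumps" and \<psi>: "continuous_on (cbox p q) \<psi>"
  shows "(convolve p q \<psi> \<rho> has_derivative (\<lambda>h. convolve p q \<psi> (\<lambda>z. grad \<rho> z \<bullet> h) x)) (at x)"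
proof -
  have gc: "continuous_on UNIV (grad \<rho>)"
    unfolding grad_def[abs_def] using bumps_continuous[OF bumps_partial[OF \<rho>]] by (intro continuous_intros)
  let ?fx = "\<lambda>x y. \<psi> y *\<^sub>R blinfun_inner_right (grad \<rho> (x - y))"
  have cy: "continuous_on (cbox p q) (\<lambda>y. ?fx x y)"
    by (intro continuous_intros \<psi> bounded_linear.continuous_on[OF bounded_linear_blinfun_inner_right] continuous_on_compose2[OF gc]) auto
  have "((\<lambda>x. integral (cbox p q) (\<lambda>y. \<rho> (x - y) * \<psi> y)) has_derivative integral (cbox p q) (?fx x)) (at x within UNIV)"
  proof (rule leibniz_rule)
    fix x y assume "y \<in> cbox p q"
    have "((\<lambda>x. \<rho> (x - y)) has_derivative (\<lambda>h. grad \<rho> (x - y) \<bullet> h)) (at x)"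
      by (rule has_derivative_compose[of "\<lambda>x. x - y" "\<lambda>h. h"]) (use has_derivative_grad[OF bumps_differentiable[OF \<rho>]] in \<open>auto intro!: derivative_eq_intros\<close>)
    then show "((\<lambda>x. \<rho> (x - y) * \<psi> y) has_derivative blinfun_apply (?fx x y)) (at x within UNIV)"
      by (auto intro!: derivative_eq_intros simp: blinfun.scaleR_left)
  next
    fix x show "(\<lambda>y. \<rho> (x - y) * \<psi> y) integrable_on cbox p q"
      by (intro integrable_continuous continuous_intros \<psi> continuous_on_compose2[OF bumps_continuous[OF \<rho>, of UNIV]]) auto
  next
    have "continuous_on (UNIV \<times> cbox p q) (\<lambda>z. \<psi> (snd z) *\<^sub>R blinfun_inner_right (grad \<rho> (fst z - snd z)))"
      by (intro continuous_intros bounded_linear.continuous_on[OF bounded_linear_blinfun_inner_right]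
          continuous_on_compose2[OF gc] continuous_on_compose2[OF \<psi>]) auto
    then show "continuous_on (UNIV \<times> cbox p q) (\<lambda>(x, y). ?fx x y)" by (simp add: case_prod_unfold)
  qed auto
  moreover have "blinfun_apply (integral (cbox p q) (?fx x)) = (\<lambda>h. convolve p q \<psi> (\<lambda>z. grad \<rho> z \<bullet> h) x)"
  proof
    fix h
    have "blinfun_apply (integral (cbox p q) (?fx x)) h = integral (cbox p q) (\<lambda>y. blinfun_apply (?fx x y) h)"
      by (rule blinfun_apply_integral[OF integrable_continuous[OF cy]])
    then show "blinfun_apply (integral (cbox p q) (?fx x)) h = convolve p q \<psi> (\<lambda>z. grad \<rho> z \<bullet> h) x"
      by (simp add: convolve_def blinfun.scaleR_left mult.commute)
  qed
  ultimately show ?thesis by (simp add: convolve_def[abs_def])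
qed

text \<open>Differentiation replaces \<open>\<rho>\<close> by one of its partial derivatives, which
  is again in \<open>bumps\<close>; so the convolutions form a family as in
  \<open>smooth_family\<close>.\<close>

lemma convolve_smooth:
  assumes \<rho>: "\<rho> \<in> bumps" and \<psi>: "continuous_on (cbox p q) \<psi>"
  shows "Ck_on k UNIV (convolve p q \<psi> \<rho>)"
proof (rule smooth_family[where \<F>="convolve p q \<psi> ` bumps"])
  fix f x assume "f \<in> convolve p q \<psi> ` bumps"
  then show "f differentiable (at x)" using convolve_derivative[OF _ \<psi>] unfolding differentiable_def by blast
next
  fix f and b :: 'a assume "f \<in> convolve p q \<psi> ` bumps" and b: "b \<in> Basis"
  then obtain r where r: "r \<in> bumps" "f = convolve p q \<psi> r" by blast
  have "frechet_derivative f (at x) b = convolve p q \<psi> (\<lambda>z. frechet_derivative r (at z) b) x" for x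
    unfolding r(2) frechet_derivative_at[OF convolve_derivative[OF r(1) \<psi>], symmetric]
    using b by (simp add: grad_inner_Basis)
  then have "(\<lambda>x. frechet_derivative f (at x) b) = convolve p q \<psi> (\<lambda>z. frechet_derivative r (at z) b)" by blast
  then show "(\<lambda>x. frechet_derivative f (at x) b) \<in> convolve p q \<psi> ` bumps"
    using bumps_partial[OF r(1)] by blast
qed (use \<rho> in blast)

lemma convolve_lborel:
  assumes \<rho>: "continuous_on UNIV \<rho>" and \<psi>: "continuous_on UNIV \<psi>" and z: "\<And>x. x \<notin> cbox p q \<Longrightarrow> \<psi> x = 0"
  shows "convolve p q \<psi> \<rho> x = (LINT y|lborel. \<rho> (x - y) * \<psi> y)" "integrable lborel (\<lambda>y. \<rho> (x - y) * \<psi> y)"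
proof -
  have "continuous_on UNIV (\<lambda>y. \<rho> (x - y) * \<psi> y)"
    by (intro continuous_intros \<psi> continuous_on_compose2[OF \<rho>]) auto
  from continuous_compact_support_integral[OF this, of p q]
  show "convolve p q \<psi> \<rho> x = (LINT y|lborel. \<rho> (x - y) * \<psi> y)" "integrable lborel (\<lambda>y. \<rho> (x - y) * \<psi> y)"
    using z by (auto simp: convolve_def)
qed

text \<open>The gradient falls on \<open>\<rho>\<close> by \<open>convolve_derivative\<close> and is
  moved to \<open>\<psi>\<close> by parts: y \<mapsto> \<rho> (x - y) * \<psi> y has compact
  support, so its gradient integrates to 0.\<close>

lemma convolve_grad:
  assumes \<rho>: "\<rho> \<in> bumps" and d: "\<And>x. \<psi> differentiable (at x)" and c: "continuous_on UNIV (grad \<psi>)"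
    and z: "\<And>x. x \<notin> cbox p q \<Longrightarrow> \<psi> x = 0"
  shows "grad (convolve p q \<psi> \<rho>) x \<bullet> e = convolve p q (\<lambda>y. grad \<psi> y \<bullet> e) \<rho> x"
proof -
  have \<psi>c: "continuous_on UNIV \<psi>"
    using d by (auto intro!: continuous_at_imp_continuous_on differentiable_imp_continuous_within)
  have gc: "continuous_on UNIV (grad \<rho>)"
    unfolding grad_def[abs_def] using bumps_continuous[OF bumps_partial[OF \<rho>]] by (intro continuous_intros)
  have gz: "grad \<psi> x = 0" if "x \<notin> cbox p q" for x
  proof (rule grad_eqI)
    have "((\<lambda>x. 0) has_derivative (\<lambda>h. 0 \<bullet> h)) (at x)" by simp
    then show "(\<psi> has_derivative (\<lambda>h. 0 \<bullet> h)) (at x)"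
      by (rule has_derivative_transform_within_open[of _ _ _ _ "- cbox p q"]) (use that z in auto)
  qed
  have D: "(convolve p q \<psi> \<rho> has_derivative (\<lambda>h. convolve p q \<psi> (\<lambda>z. grad \<rho> z \<bullet> h) x)) (at x)"
    by (rule convolve_derivative[OF \<rho> continuous_on_subset[OF \<psi>c]]) simp
  have g: "grad (convolve p q \<psi> \<rho>) x \<bullet> e = convolve p q \<psi> (\<lambda>z. grad \<rho> z \<bullet> e) x"
    using has_derivative_unique[OF has_derivative_grad[of "convolve p q \<psi> \<rho>" x] D] D
    unfolding differentiable_def by metis
  let ?\<xi> = "\<lambda>y. \<rho> (x - y) * \<psi> y"
  have \<xi>: "(?\<xi> has_derivative (\<lambda>h. (\<rho> (x - y) *\<^sub>R grad \<psi> y - \<psi> y *\<^sub>R grad \<rho> (x - y)) \<bullet> h)) (at y)" for y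
  proof -
    have "((\<lambda>y. \<rho> (x - y)) has_derivative (\<lambda>h. grad \<rho> (x - y) \<bullet> (- h))) (at y)"
      by (rule has_derivative_compose[of "\<lambda>y. x - y" "\<lambda>h. - h"]) (use has_derivative_grad[OF bumps_differentiable[OF \<rho>]] in \<open>auto intro!: derivative_eq_intros\<close>)
    from has_derivative_mult[OF this has_derivative_grad[OF d]]
    show ?thesis by (rule has_derivative_eq_rhs) (auto simp: algebra_simps fun_eq_iff)
  qed
  have gr: "grad ?\<xi> y = \<rho> (x - y) *\<^sub>R grad \<psi> y - \<psi> y *\<^sub>R grad \<rho> (x - y)" for y by (rule grad_eqI[OF \<xi>])
  have "(LINT y|lborel. grad ?\<xi> y \<bullet> e) = 0"
  proof (rule grad_integral_zero[where p=p and q=q])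
    show "?\<xi> differentiable (at y)" for y using \<xi> unfolding differentiable_def by blast
    show "continuous_on UNIV (grad ?\<xi>)" unfolding gr[abs_def]
      by (intro continuous_intros \<psi>c c continuous_on_compose2[OF gc] continuous_on_compose2[OF bumps_continuous[OF \<rho>, of UNIV]]) auto
  qed (use z in auto)
  also have "(LINT y|lborel. grad ?\<xi> y \<bullet> e) = (LINT y|lborel. \<rho> (x - y) * (grad \<psi> y \<bullet> e) - (grad \<rho> (x - y) \<bullet> e) * \<psi> y)"
    by (intro Bochner_Integration.integral_cong) (auto simp: gr inner_diff_left)
  also have "\<dots> = convolve p q (\<lambda>y. grad \<psi> y \<bullet> e) \<rho> x - convolve p q \<psi> (\<lambda>z. grad \<rho> z \<bullet> e) x"
  proof -
    have 1: "continuous_on UNIV \<rho>" by (rule bumps_continuous[OF \<rho>])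
    have 2: "continuous_on UNIV (\<lambda>z. grad \<rho> z \<bullet> e)" by (intro continuous_intros gc)
    have 3: "continuous_on UNIV (\<lambda>y. grad \<psi> y \<bullet> e)" by (intro continuous_intros c)
    have 4: "\<And>y. y \<notin> cbox p q \<Longrightarrow> grad \<psi> y \<bullet> e = 0" by (simp add: gz)
    show ?thesis
      using convolve_lborel[OF 1 3 4] convolve_lborel[OF 2 \<psi>c z] by simp
  qed
  finally show ?thesis using g by simp
qed

text \<open>The error is the average of \<psi> y - \<psi> x with weight \<rho> (x - y), which lives
  on the ball of radius \<epsilon> around x. Symmetry of \<open>\<rho>\<close> turns the weight into
  a translate of \<open>\<rho>\<close>, so its total mass is 1.\<close>

lemma convolve_approx:
  assumes \<rho>: "\<rho> \<in> bumps" "\<And>x. 0 \<le> \<rho> x" "\<And>x. \<epsilon> \<le> norm x \<Longrightarrow> \<rho> x = 0" "\<And>x. \<rho> (- x) = \<rho> x" "(LINT x|lborel. \<rho> x) = 1"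
    and \<psi>: "continuous_on UNIV \<psi>" "\<And>x. x \<notin> cbox p q \<Longrightarrow> \<psi> x = 0"
    and \<eta>: "\<And>y. norm (y - x) < \<epsilon> \<Longrightarrow> \<bar>\<psi> y - \<psi> x\<bar> \<le> \<eta>"
  shows "\<bar>convolve p q \<psi> \<rho> x - \<psi> x\<bar> \<le> \<eta>"
proof -
  have \<rho>c: "continuous_on UNIV \<rho>" by (rule bumps_continuous[OF \<rho>(1)])
  \<comment> \<open>The integral of a non-integrable function is 0 by convention, so the value 1
    implies integrability.\<close>
  have \<rho>i: "integrable lborel \<rho>" using \<rho>(5) not_integrable_integral_eq by fastforce
  have sym: "\<rho> (x - y) = \<rho> (- x + y)" for y using \<rho>(4)[of "x - y"] by simp
  have \<rho>xi: "integrable lborel (\<lambda>y. \<rho> (x - y))"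
  proof -
    have "integrable (distr lborel borel ((+) (- x))) \<rho>" using \<rho>i by (simp add: lborel_distr_plus)
    then show ?thesis unfolding sym by (subst (asm) integrable_distr_eq) (use \<rho>c borel_measurable_continuous_onI in auto)
  qed
  have \<rho>x1: "(LINT y|lborel. \<rho> (x - y)) = 1"
    unfolding sym using lborel_integral_translate[of \<rho> "- x"] \<rho>(5) \<rho>c by (simp add: borel_measurable_continuous_onI)
  have cl: "convolve p q \<psi> \<rho> x = (LINT y|lborel. \<rho> (x - y) * \<psi> y)"
    by (rule convolve_lborel(1)[OF \<rho>c \<psi>])
  have cl2: "integrable lborel (\<lambda>y. \<rho> (x - y) * \<psi> y)" by (rule convolve_lborel(2)[OF \<rho>c \<psi>])
  have "convolve p q \<psi> \<rho> x - \<psi> x = (LINT y|lborel. \<rho> (x - y) * \<psi> y) - (LINT y|lborel. \<rho> (x - y) * \<psi> x)"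
    using \<rho>x1 by (simp add: cl)
  also have "\<dots> = (LINT y|lborel. \<rho> (x - y) * \<psi> y - \<rho> (x - y) * \<psi> x)"
    using cl2 \<rho>xi by simp
  finally have eq: "convolve p q \<psi> \<rho> x - \<psi> x = (LINT y|lborel. \<rho> (x - y) * \<psi> y - \<rho> (x - y) * \<psi> x)" .
  have "norm (LINT y|lborel. \<rho> (x - y) * \<psi> y - \<rho> (x - y) * \<psi> x) \<le> (LINT y|lborel. \<rho> (x - y) * \<eta>)"
  proof (rule Bochner_Integration.integral_norm_bound_integral)
    show "integrable lborel (\<lambda>y. \<rho> (x - y) * \<psi> y - \<rho> (x - y) * \<psi> x)" using cl2 \<rho>xi by simp
    show "integrable lborel (\<lambda>y. \<rho> (x - y) * \<eta>)" using \<rho>xi by simp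
    fix y
    show "norm (\<rho> (x - y) * \<psi> y - \<rho> (x - y) * \<psi> x) \<le> \<rho> (x - y) * \<eta>"
    proof (cases "norm (x - y) < \<epsilon>")
      case True
      then have "\<rho> (x - y) * \<bar>\<psi> y - \<psi> x\<bar> \<le> \<rho> (x - y) * \<eta>" using \<eta>[of y] \<rho>(2) by (intro mult_left_mono) (auto simp: norm_minus_commute)
      moreover have "\<bar>\<rho> (x - y) * \<psi> y - \<rho> (x - y) * \<psi> x\<bar> = \<rho> (x - y) * \<bar>\<psi> y - \<psi> x\<bar>"
        using \<rho>(2)[of "x - y"] by (simp add: right_diff_distrib[symmetric] abs_mult)
      ultimately show ?thesis by simp
    qed (use \<rho>(3) in simp)
  qed
  then show ?thesis using \<rho>x1 eq by simp
qed

lemma uniformly_continuous_compact_support: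
  fixes f :: "'a::euclidean_space \<Rightarrow> 'b::real_normed_vector"
  assumes c: "continuous_on UNIV f" and S: "bounded S" and z: "\<And>x. x \<notin> S \<Longrightarrow> f x = 0"
  shows "uniformly_continuous_on UNIV f"
proof -
  obtain R where R: "S \<subseteq> ball 0 R" using bounded_subset_ballD[OF S, of 0] by blast
  have "uniformly_continuous_on (cball 0 (R + 1)) f"
    by (intro compact_uniformly_continuous continuous_on_subset[OF c]) auto
  then have uc: "\<exists>d>0. \<forall>x\<in>cball 0 (R + 1). \<forall>y\<in>cball 0 (R + 1). dist y x < d \<longrightarrow> dist (f y) (f x) < e" if "0 < e" for e
    using that unfolding uniformly_continuous_on_def by blast
  show ?thesis unfolding uniformly_continuous_on_def
  proof (intro allI impI)
    fix e :: real assume e: "0 < e"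
    obtain d where d: "0 < d" "\<And>x y. x \<in> cball 0 (R + 1) \<Longrightarrow> y \<in> cball 0 (R + 1) \<Longrightarrow> dist y x < d \<Longrightarrow> dist (f y) (f x) < e"
      using uc[OF e] by blast
    have out: "f y = 0" if "R \<le> norm y" for y using z[of y] R that by force
    \<comment> \<open>A step below 1 cannot lead from inside the ball of radius R to outside the
      ball of radius R + 1; so either the compact case covers both points, or \<open>f\<close>
      vanishes at both.\<close>
    show "\<exists>d>0. \<forall>x\<in>UNIV. \<forall>y\<in>UNIV. dist y x < d \<longrightarrow> dist (f y) (f x) < e"
    proof (intro exI[of _ "min d 1"] conjI ballI impI)
      fix x y :: 'a assume xy: "dist y x < min d 1"
      show "dist (f y) (f x) < e"
      proof (cases "norm x \<le> R + 1 \<and> norm y \<le> R + 1")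
        case True then show ?thesis using d(2)[of x y] xy by simp
      next
        case False
        have "norm x \<le> norm y + dist y x" "norm y \<le> norm x + dist y x"
          using norm_triangle_ineq2[of x y] norm_triangle_ineq2[of y x] by (auto simp: dist_norm norm_minus_commute)
        then have "R \<le> norm x" "R \<le> norm y" using False xy by auto
        then show ?thesis using out e by simp
      qed
    qed (use d in auto)
  qed
qed


section \<open>The space \<open>H10\<close>\<close>

lemma finite_measure_lebesgue_on:
  fixes S :: "'a::euclidean_space set"
  assumes "open S" "bounded S"
  shows "finite_measure (lebesgue_on S)"
  using assms emeasure_bounded_finite[OF assms(2)]
  by (intro finite_measureI) (simp add: emeasure_restrict_space)

lemma borel_measurable_lebesgue_on:
  fixes S :: "'a::euclidean_space set" and f :: "'a \<Rightarrow> 'b::euclidean_space"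
  assumes "open S" "continuous_on S f"
  shows "f \<in> borel_measurable (lebesgue_on S)"
  using assms by (intro continuous_imp_measurable_on_sets_lebesgue) auto

lemma integrable_lebesgue_on_bounded:
  fixes S :: "'a::euclidean_space set" and f :: "'a \<Rightarrow> 'b::euclidean_space"
  assumes S: "open S" "bounded S" and f: "f \<in> borel_measurable (lebesgue_on S)" and B: "\<And>x. x \<in> S \<Longrightarrow> norm (f x) \<le> B"
  shows "integrable (lebesgue_on S) f"
proof -
  interpret finite_measure "lebesgue_on S" by (rule finite_measure_lebesgue_on[OF S])
  show ?thesis by (rule integrable_const_bound[of _ B]) (use f B in auto)
qed

lemma L2_on_bounded:
  fixes S :: "'a::euclidean_space set" and f :: "'a \<Rightarrow> 'b::euclidean_space"
  assumes S: "open S" "bounded S" and f: "f \<in> borel_measurable (lebesgue_on S)" and B: "\<And>x. x \<in> S \<Longrightarrow> norm (f x) \<le> B"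
  shows "L2_on S f"
proof -
  have "integrable (lebesgue_on S) (\<lambda>x. (norm (f x))\<^sup>2)"
  proof (rule integrable_lebesgue_on_bounded[OF S])
    show "(\<lambda>x. (norm (f x))\<^sup>2) \<in> borel_measurable (lebesgue_on S)" using f by simp
    show "norm ((norm (f x))\<^sup>2) \<le> B\<^sup>2" if "x \<in> S" for x using B[OF that] by (auto intro: power_mono)
  qed
  then show ?thesis using f by (simp add: L2_on_def)
qed

lemma L2_on_integrable:
  fixes f :: "'a::euclidean_space \<Rightarrow> 'b::euclidean_space"
  assumes S: "open S" "bounded S" and f: "L2_on S f"
  shows "integrable (lebesgue_on S) f"
proof -
  interpret finite_measure "lebesgue_on S" by (rule finite_measure_lebesgue_on[OF S])
  have i: "integrable (lebesgue_on S) (\<lambda>x. 1 + (norm (f x))\<^sup>2)"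
    using f by (intro Bochner_Integration.integrable_add integrable_const) (simp add: L2_on_def)
  show ?thesis
  proof (rule Bochner_Integration.integrable_bound[OF i])
    show "f \<in> borel_measurable (lebesgue_on S)" using f by (simp add: L2_on_def)
    have "y \<le> 1 + y\<^sup>2" for y :: real
    proof -
      have "0 \<le> (y - 1/2)\<^sup>2" by simp
      then show ?thesis by (simp add: power2_eq_square algebra_simps)
    qed
    then show "AE x in lebesgue_on S. norm (f x) \<le> norm (1 + (norm (f x))\<^sup>2)"
      by (intro AE_I2) (simp add: abs_of_nonneg)
  qed
qed

lemma compact_support_bounded:
  fixes f :: "'a::euclidean_space \<Rightarrow> 'b::real_normed_vector"
  assumes "continuous_on UNIV f" "compact S" "\<And>x. x \<notin> S \<Longrightarrow> f x = 0"
  shows "\<exists>B. \<forall>x. norm (f x) \<le> B"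
proof -
  have "bounded (f ` S)" using assms by (intro compact_imp_bounded compact_continuous_image continuous_on_subset[OF assms(1)]) auto
  then obtain B where "0 < B" "\<And>x. x \<in> S \<Longrightarrow> norm (f x) \<le> B" unfolding bounded_pos by auto
  then have "norm (f x) \<le> B" for x using assms(3)[of x] by (cases "x \<in> S") auto
  then show ?thesis by blast
qed

lemma grad_zero_outside:
  assumes "closed S" "\<And>x. x \<notin> S \<Longrightarrow> f x = 0" "x \<notin> S"
  shows "grad f x = 0"
proof (rule grad_eqI)
  have "((\<lambda>x. 0) has_derivative (\<lambda>h. 0 \<bullet> h)) (at x)" by simp
  then show "(f has_derivative (\<lambda>h. 0 \<bullet> h)) (at x)"
    by (rule has_derivative_transform_within_open[of _ _ _ _ "- S"]) (use assms in auto)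
qed

lemma test_function_D:
  assumes "test_function S \<phi>"
  shows "\<phi> differentiable (at x)" "continuous_on UNIV \<phi>" "continuous_on UNIV (grad \<phi>)"
    "compact (closure {x. \<phi> x \<noteq> 0})" "closure {x. \<phi> x \<noteq> 0} \<subseteq> S"
    "x \<notin> closure {x. \<phi> x \<noteq> 0} \<Longrightarrow> \<phi> x = 0" "x \<notin> closure {x. \<phi> x \<noteq> 0} \<Longrightarrow> grad \<phi> x = 0"
proof -
  have k: "Ck_on 1 UNIV \<phi>" using assms by (simp add: test_function_def)
  show "\<phi> differentiable (at x)" using Ck_on_differentiable[OF k] by simp
  show "continuous_on UNIV \<phi>" by (rule Ck_on_continuous[OF k])
  show "continuous_on UNIV (grad \<phi>)" using Ck_on_grad_continuous[OF k] by simp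
  show "compact (closure {x. \<phi> x \<noteq> 0})" "closure {x. \<phi> x \<noteq> 0} \<subseteq> S" using assms by (auto simp: test_function_def)
  have z: "\<phi> x = 0" if "x \<notin> closure {x. \<phi> x \<noteq> 0}" for x using that closure_subset[of "{x. \<phi> x \<noteq> 0}"] by blast
  show "x \<notin> closure {x. \<phi> x \<noteq> 0} \<Longrightarrow> \<phi> x = 0" by (rule z)
  show "x \<notin> closure {x. \<phi> x \<noteq> 0} \<Longrightarrow> grad \<phi> x = 0" by (rule grad_zero_outside[OF closed_closure z])
qed

lemma test_function_L2:
  fixes S :: "'a::euclidean_space set"
  assumes S: "open S" "bounded S" and \<phi>: "test_function S \<phi>"
  shows "L2_on S \<phi>" "L2_on S (grad \<phi>)"
proof -
  note D = test_function_D[OF \<phi>]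
  obtain B where "\<And>x. norm (\<phi> x) \<le> B" using compact_support_bounded[OF D(2,4,6)] by blast
  then show "L2_on S \<phi>"
    by (intro L2_on_bounded[OF S] borel_measurable_lebesgue_on[OF S(1)] continuous_on_subset[OF D(2)]) auto
  obtain B where "\<And>x. norm (grad \<phi> x) \<le> B" using compact_support_bounded[OF D(3,4,7)] by blast
  then show "L2_on S (grad \<phi>)"
    by (intro L2_on_bounded[OF S] borel_measurable_lebesgue_on[OF S(1)] continuous_on_subset[OF D(3)]) auto
qed

text \<open>\<open>\<psi>\<close> and its gradient are both uniformly continuous, so mollification
  at a small scale changes either of them by little everywhere; the factor \<open>DIM('a)\<close>
  comes from adding up the components of the gradient.\<close>

lemma mollified_test_function:
  fixes \<Omega> :: "'a::euclidean_space set" and \<eta> :: real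
  assumes O: "open \<Omega>" and S: "compact S" "S \<noteq> {}" "S \<subseteq> \<Omega>"
    and d: "\<And>x. \<psi> differentiable (at x)" and c: "continuous_on UNIV (grad \<psi>)"
    and z: "\<And>x. x \<notin> S \<Longrightarrow> \<psi> x = 0" and \<eta>: "0 < \<eta>"
  shows "\<exists>\<phi>. test_function \<Omega> \<phi> \<and> (\<forall>x. \<bar>\<phi> x - \<psi> x\<bar> \<le> \<eta> \<and> norm (grad \<phi> x - grad \<psi> x) \<le> DIM('a) * \<eta>)"
proof -
  have \<psi>c: "continuous_on UNIV \<psi>"
    using d by (auto intro!: continuous_at_imp_continuous_on differentiable_imp_continuous_within)
  have gz: "grad \<psi> x = 0" if "x \<notin> S" for x
    by (rule grad_zero_outside[OF compact_imp_closed[OF S(1)] z that])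
  obtain d1 where d1: "0 < d1" "\<And>x y. dist y x < d1 \<Longrightarrow> dist (\<psi> y) (\<psi> x) < \<eta>"
    using uniformly_continuous_compact_support[OF \<psi>c compact_imp_bounded[OF S(1)] z] \<eta>
    unfolding uniformly_continuous_on_def by (metis UNIV_I)
  obtain d2 where d2: "0 < d2" "\<And>x y. dist y x < d2 \<Longrightarrow> dist (grad \<psi> y) (grad \<psi> x) < \<eta>"
    using uniformly_continuous_compact_support[OF c compact_imp_bounded[OF S(1)] gz] \<eta>
    unfolding uniformly_continuous_on_def by (metis UNIV_I)
  obtain d3 where d3: "0 < d3" "{x. infdist x S \<le> d3} \<subseteq> \<Omega>"
    by (rule compact_in_open_separated[OF S(2,1) O S(3)])
  obtain a where a: "S \<subseteq> cbox (- a) a" using bounded_subset_cbox_symmetric[OF compact_imp_bounded[OF S(1)]] by blast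
  \<comment> \<open>\<open>d1\<close> and \<open>d2\<close> control the oscillation of
    \<open>\<psi>\<close> and of its gradient, \<open>d3\<close> keeps the enlarged support inside
    \<open>\<Omega>\<close>.\<close>
  define \<epsilon> where "\<epsilon> = min d1 (min d2 d3)"
  have \<epsilon>: "0 < \<epsilon>" "\<epsilon> \<le> d1" "\<epsilon> \<le> d2" "\<epsilon> \<le> d3" using d1 d2 d3 by (auto simp: \<epsilon>_def)
  obtain \<rho> :: "'a \<Rightarrow> real" where \<rho>: "\<rho> \<in> bumps" "\<And>x. 0 \<le> \<rho> x" "\<And>x. \<epsilon> \<le> norm x \<Longrightarrow> \<rho> x = 0"
    "\<And>x. \<rho> (- x) = \<rho> x" "(LINT x|lborel. \<rho> x) = 1"
    using mollifier_exists[OF \<epsilon>(1)] by metis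
  define \<phi> where "\<phi> = convolve (- a) a \<psi> \<rho>"
  have z': "\<psi> x = 0" if "x \<notin> cbox (- a) a" for x using z a that by blast
  have gz': "grad \<psi> x = 0" if "x \<notin> cbox (- a) a" for x using gz a that by blast
  have supp: "infdist x S \<le> d3" if "\<phi> x \<noteq> 0" for x
  proof (rule ccontr)
    assume far: "\<not> infdist x S \<le> d3"
    have "\<rho> (x - y) * \<psi> y = 0" for y
    proof (cases "y \<in> S")
      case True
      have "d3 < dist x y" using far infdist_le[OF True, of x] by simp
      then show ?thesis using \<rho>(3)[of "x - y"] \<epsilon> by (simp add: dist_norm)
    qed (simp add: z)
    then have "(\<lambda>y. \<rho> (x - y) * \<psi> y) = (\<lambda>y. 0)" by blast
    then have "\<phi> x = 0" by (simp add: \<phi>_def convolve_def)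
    then show False using that by simp
  qed
  have "test_function \<Omega> \<phi>"
    unfolding test_function_def
  proof (intro conjI allI)
    show "Ck_on k UNIV \<phi>" for k unfolding \<phi>_def by (rule convolve_smooth[OF \<rho>(1) continuous_on_subset[OF \<psi>c]]) simp
    have sub: "closure {x. \<phi> x \<noteq> 0} \<subseteq> {x. infdist x S \<le> d3}"
      by (rule closure_minimal) (use supp in \<open>auto intro!: closed_Collect_le continuous_intros\<close>)
    then show "closure {x. \<phi> x \<noteq> 0} \<subseteq> \<Omega>" using d3 by blast
    have "compact {x. infdist x S \<le> d3}" using compact_infdist_le[OF S(2,1) d3(1)] .
    then show "compact (closure {x. \<phi> x \<noteq> 0})" using sub compact_closure by (meson bounded_subset compact_imp_bounded compact_eq_bounded_closed closed_closure)
  qed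
  moreover have "\<bar>\<phi> x - \<psi> x\<bar> \<le> \<eta>" for x
    unfolding \<phi>_def
  proof (rule convolve_approx[OF \<rho> \<psi>c z'])
    fix y assume "norm (y - x) < \<epsilon>"
    then have "dist (\<psi> y) (\<psi> x) < \<eta>" using \<epsilon> by (intro d1(2)) (simp add: dist_norm)
    then show "\<bar>\<psi> y - \<psi> x\<bar> \<le> \<eta>" by (simp add: dist_real_def)
  qed
  moreover have "norm (grad \<phi> x - grad \<psi> x) \<le> DIM('a) * \<eta>" for x
  proof -
    have "\<bar>(grad \<phi> x - grad \<psi> x) \<bullet> b\<bar> \<le> \<eta>" if b: "b \<in> Basis" for b
    proof -
      have "\<bar>convolve (- a) a (\<lambda>y. grad \<psi> y \<bullet> b) \<rho> x - grad \<psi> x \<bullet> b\<bar> \<le> \<eta>"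
      proof (rule convolve_approx[OF \<rho>])
        show "continuous_on UNIV (\<lambda>y. grad \<psi> y \<bullet> b)" by (intro continuous_intros c)
        show "\<And>x. x \<notin> cbox (- a) a \<Longrightarrow> grad \<psi> x \<bullet> b = 0" by (simp add: gz')
        fix y assume "norm (y - x) < \<epsilon>"
        then have "dist (grad \<psi> y) (grad \<psi> x) < \<eta>" using \<epsilon> by (intro d2(2)) (simp add: dist_norm)
        then show "\<bar>grad \<psi> y \<bullet> b - grad \<psi> x \<bullet> b\<bar> \<le> \<eta>"
          using Basis_le_norm[OF b, of "grad \<psi> y - grad \<psi> x"] by (simp add: dist_norm inner_diff_left)
      qed
      moreover have "grad \<phi> x \<bullet> b = convolve (- a) a (\<lambda>y. grad \<psi> y \<bullet> b) \<rho> x"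
        unfolding \<phi>_def by (rule convolve_grad[OF \<rho>(1) d c z'])
      ultimately show ?thesis by (simp add: inner_diff_left)
    qed
    then have "(\<Sum>b\<in>Basis. \<bar>(grad \<phi> x - grad \<psi> x) \<bullet> b\<bar>) \<le> (\<Sum>b\<in>(Basis::'a set). \<eta>)" by (intro sum_mono)
    then show ?thesis using norm_le_l1[of "grad \<phi> x - grad \<psi> x"] by simp
  qed
  ultimately show ?thesis by blast
qed

text \<open>The natural function to insert into the flux equation is \<phi> / \<sigma>, which is
  only as regular as \<sigma>, while \<open>H10\<close> is defined through smooth functions. On a
  bounded set, uniform approximation of function and gradient implies approximation in the H^1
  norm.\<close>

lemma H10_C1_compact_support:
  fixes \<Omega> :: "'a::euclidean_space set"
  assumes O: "open \<Omega>" "bounded \<Omega>" and S: "compact S" "S \<noteq> {}" "S \<subseteq> \<Omega>"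
    and d: "\<And>x. \<psi> differentiable (at x)" and c: "continuous_on UNIV (grad \<psi>)"
    and z: "\<And>x. x \<notin> S \<Longrightarrow> \<psi> x = 0"
  shows "H10 \<Omega> \<psi> (grad \<psi>)"
proof -
  have \<psi>c: "continuous_on UNIV \<psi>"
    using d by (auto intro!: continuous_at_imp_continuous_on differentiable_imp_continuous_within)
  have gz: "grad \<psi> x = 0" if "x \<notin> S" for x
    by (rule grad_zero_outside[OF compact_imp_closed[OF S(1)] z that])
  define \<eta> where "\<eta> k = 1 / real (Suc k)" for k
  have \<eta>: "0 < \<eta> k" for k by (simp add: \<eta>_def)
  have \<eta>0: "\<eta> \<longlonglongrightarrow> 0" unfolding \<eta>_def[abs_def] using LIMSEQ_inverse_real_of_nat by (simp add: inverse_eq_divide)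
  have "\<forall>k. \<exists>\<phi>. test_function \<Omega> \<phi> \<and> (\<forall>x. \<bar>\<phi> x - \<psi> x\<bar> \<le> \<eta> k \<and> norm (grad \<phi> x - grad \<psi> x) \<le> DIM('a) * \<eta> k)"
    using mollified_test_function[OF O(1) S d c z \<eta>] by blast
  then obtain \<phi> where \<phi>: "\<And>k. test_function \<Omega> (\<phi> k)" "\<And>k x. \<bar>\<phi> k x - \<psi> x\<bar> \<le> \<eta> k"
    "\<And>k x. norm (grad (\<phi> k) x - grad \<psi> x) \<le> DIM('a) * \<eta> k" by metis
  interpret finite_measure "lebesgue_on \<Omega>" by (rule finite_measure_lebesgue_on[OF O])
  let ?M = "measure (lebesgue_on \<Omega>) (space (lebesgue_on \<Omega>))"
  let ?I = "\<lambda>k. LINT x|lebesgue_on \<Omega>. (\<phi> k x - \<psi> x)\<^sup>2 + (norm (grad (\<phi> k) x - grad \<psi> x))\<^sup>2"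
  have pw: "(\<phi> k x - \<psi> x)\<^sup>2 + (norm (grad (\<phi> k) x - grad \<psi> x))\<^sup>2 \<le> (\<eta> k)\<^sup>2 + (DIM('a) * \<eta> k)\<^sup>2" for k x
  proof (intro add_mono)
    show "(\<phi> k x - \<psi> x)\<^sup>2 \<le> (\<eta> k)\<^sup>2" using power_mono[OF \<phi>(2)[of k x], of 2] by simp
    show "(norm (grad (\<phi> k) x - grad \<psi> x))\<^sup>2 \<le> (DIM('a) * \<eta> k)\<^sup>2" by (intro power_mono \<phi>(3)) simp
  qed
  have "?I \<longlonglongrightarrow> 0"
  proof (rule tendsto_sandwich[of "\<lambda>_. 0" _ _ "\<lambda>k. ?M * ((\<eta> k)\<^sup>2 + (DIM('a) * \<eta> k)\<^sup>2)"])
    show "\<forall>\<^sub>F k in sequentially. 0 \<le> ?I k" by (intro always_eventually allI Bochner_Integration.integral_nonneg) simp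
    show "\<forall>\<^sub>F k in sequentially. ?I k \<le> ?M * ((\<eta> k)\<^sup>2 + (DIM('a) * \<eta> k)\<^sup>2)"
    proof (intro always_eventually allI)
      fix k
      have "?I k \<le> (LINT x|lebesgue_on \<Omega>. (\<eta> k)\<^sup>2 + (DIM('a) * \<eta> k)\<^sup>2)"
      proof (rule integral_mono')
        show "integrable (lebesgue_on \<Omega>) (\<lambda>x. (\<eta> k)\<^sup>2 + (DIM('a) * \<eta> k)\<^sup>2)" by simp
      qed (use pw in auto)
      then show "?I k \<le> ?M * ((\<eta> k)\<^sup>2 + (DIM('a) * \<eta> k)\<^sup>2)" by simp
    qed
    have "(\<lambda>k. ?M * ((\<eta> k)\<^sup>2 + (DIM('a) * \<eta> k)\<^sup>2)) \<longlonglongrightarrow> ?M * (0\<^sup>2 + (DIM('a) * (0::real))\<^sup>2)" by (intro tendsto_intros \<eta>0)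
    then show "(\<lambda>k. ?M * ((\<eta> k)\<^sup>2 + (DIM('a) * \<eta> k)\<^sup>2)) \<longlonglongrightarrow> 0" by simp
  qed simp
  moreover obtain B1 where "\<And>x. norm (\<psi> x) \<le> B1" using compact_support_bounded[OF \<psi>c S(1) z] by blast
  then have "L2_on \<Omega> \<psi>"
    by (intro L2_on_bounded[OF O] borel_measurable_lebesgue_on[OF O(1)] continuous_on_subset[OF \<psi>c]) auto
  moreover obtain B2 where "\<And>x. norm (grad \<psi> x) \<le> B2" using compact_support_bounded[OF c S(1) gz] by blast
  then have "L2_on \<Omega> (grad \<psi>)"
    by (intro L2_on_bounded[OF O] borel_measurable_lebesgue_on[OF O(1)] continuous_on_subset[OF c]) auto
  ultimately show ?thesis unfolding H10_def using \<phi>(1) by blast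
qed

lemma L2_on_diff_square_integrable:
  fixes f g :: "'a::euclidean_space \<Rightarrow> 'b::euclidean_space"
  assumes "L2_on S f" "L2_on S g"
  shows "integrable (lebesgue_on S) (\<lambda>x. (norm (f x - g x))\<^sup>2)"
proof (rule Bochner_Integration.integrable_bound)
  show "integrable (lebesgue_on S) (\<lambda>x. 2 * (norm (f x))\<^sup>2 + 2 * (norm (g x))\<^sup>2)" using assms by (simp add: L2_on_def)
  have "f \<in> borel_measurable (lebesgue_on S)" "g \<in> borel_measurable (lebesgue_on S)" using assms by (auto simp: L2_on_def)
  then show "(\<lambda>x. (norm (f x - g x))\<^sup>2) \<in> borel_measurable (lebesgue_on S)" by measurable
  have "(norm (a - b))\<^sup>2 \<le> 2 * (norm a)\<^sup>2 + 2 * (norm b)\<^sup>2" for a b :: 'b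
  proof -
    have "(norm (a - b))\<^sup>2 \<le> (norm a + norm b)\<^sup>2" by (intro power_mono norm_triangle_ineq4) simp
    also have "\<dots> \<le> 2 * (norm a)\<^sup>2 + 2 * (norm b)\<^sup>2"
      using zero_le_power2[of "norm a - norm b"] by (simp add: power2_eq_square algebra_simps)
    finally show ?thesis .
  qed
  then show "AE x in lebesgue_on S. norm ((norm (f x - g x))\<^sup>2) \<le> norm (2 * (norm (f x))\<^sup>2 + 2 * (norm (g x))\<^sup>2)"
    by (intro AE_I2) (simp add: abs_of_nonneg)
qed

text \<open>With bounded coefficients on a bounded set the functional is continuous in the H^1 norm,
  so its vanishing passes from test functions to their closure.\<close>

lemma H10_functional_zero:
  fixes \<Omega> :: "'a::euclidean_space set" and X :: "'a \<Rightarrow> 'a" and Y :: "'a \<Rightarrow> real"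
  assumes O: "open \<Omega>" "bounded \<Omega>"
    and X: "X \<in> borel_measurable (lebesgue_on \<Omega>)" and Y: "Y \<in> borel_measurable (lebesgue_on \<Omega>)"
    and B: "\<And>x. x \<in> \<Omega> \<Longrightarrow> norm (X x) \<le> B \<and> \<bar>Y x\<bar> \<le> B"
    and test: "\<And>\<phi>. test_function \<Omega> \<phi> \<Longrightarrow> (LINT x|lebesgue_on \<Omega>. grad \<phi> x \<bullet> X x + Y x * \<phi> x) = 0"
    and w: "H10 \<Omega> w Gw"
  shows "(LINT x|lebesgue_on \<Omega>. Gw x \<bullet> X x + Y x * w x) = 0"
    and "integrable (lebesgue_on \<Omega>) (\<lambda>x. Gw x \<bullet> X x + Y x * w x)"
proof -
  let ?M = "lebesgue_on \<Omega>"
  interpret finite_measure ?M by (rule finite_measure_lebesgue_on[OF O])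
  have wL: "L2_on \<Omega> w" "L2_on \<Omega> Gw" using w by (auto simp: H10_def)
  obtain \<phi> where \<phi>: "\<And>k::nat. test_function \<Omega> (\<phi> k)"
    "(\<lambda>k. LINT x|?M. (\<phi> k x - w x)\<^sup>2 + (norm (grad (\<phi> k) x - Gw x))\<^sup>2) \<longlonglongrightarrow> 0"
    using w unfolding H10_def by blast
  have int: "integrable ?M (\<lambda>x. Q x \<bullet> X x + Y x * q x)" if "L2_on \<Omega> q" "L2_on \<Omega> Q" for q Q
  proof (rule Bochner_Integration.integrable_bound)
    show "integrable ?M (\<lambda>x. B * (norm (Q x) + norm (q x)))"
      using L2_on_integrable[OF O that(1)] L2_on_integrable[OF O that(2)] by simp
    show "(\<lambda>x. Q x \<bullet> X x + Y x * q x) \<in> borel_measurable ?M"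
    proof -
      have "q \<in> borel_measurable ?M" "Q \<in> borel_measurable ?M" using that by (auto simp: L2_on_def)
      then show ?thesis using X Y by measurable
    qed
    show "AE x in ?M. norm (Q x \<bullet> X x + Y x * q x) \<le> norm (B * (norm (Q x) + norm (q x)))"
    proof (rule AE_I2)
      fix x assume "x \<in> space ?M"
      then have b: "norm (X x) \<le> B" "\<bar>Y x\<bar> \<le> B" using B by auto
      have B0: "0 \<le> B" using b(2) by linarith
      have "\<bar>Q x \<bullet> X x\<bar> \<le> norm (Q x) * B" using Cauchy_Schwarz_ineq2[of "Q x" "X x"] mult_left_mono[OF b(1), of "norm (Q x)"] by simp
      moreover have "\<bar>Y x * q x\<bar> \<le> B * \<bar>q x\<bar>" using mult_right_mono[OF b(2), of "\<bar>q x\<bar>"] by (simp add: abs_mult)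
      ultimately have "\<bar>Q x \<bullet> X x + Y x * q x\<bar> \<le> norm (Q x) * B + B * \<bar>q x\<bar>" by linarith
      also have "\<dots> = norm (B * (norm (Q x) + norm (q x)))" using B0 by (simp add: abs_mult distrib_left mult.commute)
      finally show "norm (Q x \<bullet> X x + Y x * q x) \<le> norm (B * (norm (Q x) + norm (q x)))" by simp
    qed
  qed
  show iw: "integrable ?M (\<lambda>x. Gw x \<bullet> X x + Y x * w x)" by (rule int[OF wL])
  let ?L = "LINT x|?M. Gw x \<bullet> X x + Y x * w x"
  let ?I = "\<lambda>k. LINT x|?M. (\<phi> k x - w x)\<^sup>2 + (norm (grad (\<phi> k) x - Gw x))\<^sup>2"
  define B' where "B' = \<bar>B\<bar>"
  have est: "\<bar>?L\<bar> \<le> B' * (2 * \<eta> * measure ?M \<Omega> + ?I k / \<eta>)" if \<eta>: "0 < \<eta>" for \<eta> k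
  proof -
    note T = test_function_L2[OF O \<phi>(1)[of k]]
    have sq: "integrable ?M (\<lambda>x. (\<phi> k x - w x)\<^sup>2 + (norm (grad (\<phi> k) x - Gw x))\<^sup>2)"
      using L2_on_diff_square_integrable[OF T(1) wL(1)] L2_on_diff_square_integrable[OF T(2) wL(2)] by simp
    have "?L = ?L - (LINT x|?M. grad (\<phi> k) x \<bullet> X x + Y x * \<phi> k x)" using test[OF \<phi>(1)] by simp
    also have "\<dots> = (LINT x|?M. (Gw x \<bullet> X x + Y x * w x) - (grad (\<phi> k) x \<bullet> X x + Y x * \<phi> k x))"
      by (rule Bochner_Integration.integral_diff[symmetric, OF iw int[OF T]])
    finally have eq: "?L = (LINT x|?M. (Gw x \<bullet> X x + Y x * w x) - (grad (\<phi> k) x \<bullet> X x + Y x * \<phi> k x))" .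
    have "norm (LINT x|?M. (Gw x \<bullet> X x + Y x * w x) - (grad (\<phi> k) x \<bullet> X x + Y x * \<phi> k x))
      \<le> (LINT x|?M. B' * (2 * \<eta> + ((\<phi> k x - w x)\<^sup>2 + (norm (grad (\<phi> k) x - Gw x))\<^sup>2) / \<eta>))"
    proof (rule Bochner_Integration.integral_norm_bound_integral)
      show "integrable ?M (\<lambda>x. (Gw x \<bullet> X x + Y x * w x) - (grad (\<phi> k) x \<bullet> X x + Y x * \<phi> k x))"
        by (intro Bochner_Integration.integrable_diff iw int[OF T])
      show "integrable ?M (\<lambda>x. B' * (2 * \<eta> + ((\<phi> k x - w x)\<^sup>2 + (norm (grad (\<phi> k) x - Gw x))\<^sup>2) / \<eta>))"
        by (intro integrable_mult_right Bochner_Integration.integrable_add[OF integrable_const] integrable_divide sq)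
      fix x assume "x \<in> space ?M"
      then have b: "norm (X x) \<le> B'" "\<bar>Y x\<bar> \<le> B'" using B by (auto simp: B'_def intro: order_trans[OF _ abs_ge_self])
      \<comment> \<open>A pointwise substitute for Cauchy-Schwarz: after integration it bounds an
        L^1 norm by \<eta> times the measure plus the squared L^2 norm divided by \<eta>. The index
        k goes to infinity before \<eta> goes to 0.\<close>
      have young: "a \<le> \<eta> + a\<^sup>2 / \<eta>" if "0 \<le> a" for a :: real
      proof (cases "a \<le> \<eta>")
        case True then show ?thesis using \<eta> by (simp add: add_increasing2)
      next
        case False
        then have "\<eta> * a \<le> a * a" using that \<eta> by (intro mult_right_mono) auto
        then have "a \<le> a\<^sup>2 / \<eta>" using \<eta> by (simp add: field_simps power2_eq_square)
        then show ?thesis using \<eta> by simp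
      qed
      let ?p = "norm (grad (\<phi> k) x - Gw x)" and ?q = "\<bar>\<phi> k x - w x\<bar>"
      have "(Gw x \<bullet> X x + Y x * w x) - (grad (\<phi> k) x \<bullet> X x + Y x * \<phi> k x)
          = - ((grad (\<phi> k) x - Gw x) \<bullet> X x + Y x * (\<phi> k x - w x))" by (simp add: inner_diff_left algebra_simps)
      then have "norm ((Gw x \<bullet> X x + Y x * w x) - (grad (\<phi> k) x \<bullet> X x + Y x * \<phi> k x))
          \<le> \<bar>(grad (\<phi> k) x - Gw x) \<bullet> X x\<bar> + \<bar>Y x * (\<phi> k x - w x)\<bar>"
        by (metis abs_minus abs_triangle_ineq real_norm_def)
      also have "\<dots> \<le> ?p * B' + B' * ?q"
      proof (intro add_mono)
        show "\<bar>(grad (\<phi> k) x - Gw x) \<bullet> X x\<bar> \<le> ?p * B'"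
          by (rule order_trans[OF Cauchy_Schwarz_ineq2 mult_left_mono[OF b(1)]]) simp
        show "\<bar>Y x * (\<phi> k x - w x)\<bar> \<le> B' * ?q" unfolding abs_mult by (intro mult_right_mono b(2)) simp
      qed
      also have "\<dots> = B' * (?p + ?q)" by (simp add: algebra_simps)
      also have "\<dots> \<le> B' * ((\<eta> + ?p\<^sup>2 / \<eta>) + (\<eta> + ?q\<^sup>2 / \<eta>))"
        by (intro mult_left_mono add_mono young) (auto simp: B'_def)
      also have "(\<eta> + ?p\<^sup>2 / \<eta>) + (\<eta> + ?q\<^sup>2 / \<eta>) = 2 * \<eta> + ((\<phi> k x - w x)\<^sup>2 + ?p\<^sup>2) / \<eta>"
        by (simp add: add_divide_distrib)
      finally show "norm ((Gw x \<bullet> X x + Y x * w x) - (grad (\<phi> k) x \<bullet> X x + Y x * \<phi> k x))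
        \<le> B' * (2 * \<eta> + ((\<phi> k x - w x)\<^sup>2 + ?p\<^sup>2) / \<eta>)" .
    qed
    also have "\<dots> = B' * (2 * \<eta> * measure ?M \<Omega> + ?I k / \<eta>)"
      using sq by (simp add: Bochner_Integration.integral_add integrable_const mult.commute)
    finally show ?thesis using eq by simp
  qed
  have "\<bar>?L\<bar> \<le> B' * (2 * \<eta> * measure ?M \<Omega>)" if \<eta>: "0 < \<eta>" for \<eta>
  proof -
    have "(\<lambda>k. B' * (2 * \<eta> * measure ?M \<Omega> + ?I k / \<eta>)) \<longlonglongrightarrow> B' * (2 * \<eta> * measure ?M \<Omega> + 0 / \<eta>)"
      using \<eta> by (intro tendsto_intros \<phi>(2)) auto
    then show ?thesis using est[OF \<eta>] by (intro LIMSEQ_le_const) auto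
  qed
  then have "\<forall>\<^sub>F \<eta> in at_right 0. \<bar>?L\<bar> \<le> B' * (2 * \<eta> * measure ?M \<Omega>)"
    using eventually_at_right_less[of "0::real"] by (auto elim: eventually_mono)
  moreover have "((\<lambda>\<eta>. B' * (2 * \<eta> * measure ?M \<Omega>)) \<longlongrightarrow> B' * (2 * 0 * measure ?M \<Omega>)) (at_right 0)"
    by (intro tendsto_intros)
  ultimately have "\<bar>?L\<bar> \<le> B' * (2 * 0 * measure ?M \<Omega>)"
    by (intro tendsto_lowerbound[of _ _ "at_right 0"]) auto
  then show "?L = 0" by simp
qed

text \<open>The product extended by 0 is C^1 on the whole space because \<open>\<Omega>\<close> and
  the complement of the support of \<phi> are open and cover it; on the second set the product is
  identically 0.\<close>

lemma H10_cutoff_product: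
  fixes \<Omega> :: "'a::euclidean_space set"
  assumes O: "open \<Omega>" "bounded \<Omega>" and \<phi>: "test_function \<Omega> \<phi>"
    and \<eta>: "\<And>x. x \<in> \<Omega> \<Longrightarrow> (\<eta> has_derivative (\<lambda>h. D\<eta> x \<bullet> h)) (at x)" and D\<eta>: "continuous_on \<Omega> D\<eta>"
  defines "\<psi> \<equiv> \<lambda>x. if x \<in> \<Omega> then \<phi> x * \<eta> x else 0"
  shows "\<psi> differentiable (at x)" "continuous_on UNIV (grad \<psi>)"
    "x \<in> \<Omega> \<Longrightarrow> grad \<psi> x = \<phi> x *\<^sub>R D\<eta> x + \<eta> x *\<^sub>R grad \<phi> x"
    "x \<notin> closure {x. \<phi> x \<noteq> 0} \<Longrightarrow> \<psi> x = 0"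
proof -
  note T = test_function_D[OF \<phi>]
  let ?S = "closure {x. \<phi> x \<noteq> 0}"
  have \<eta>c: "continuous_on \<Omega> \<eta>"
    using \<eta> by (intro continuous_at_imp_continuous_on ballI has_derivative_continuous)
  have z: "\<psi> x = 0" if "x \<notin> ?S" for x using T(6)[OF that] by (simp add: \<psi>_def)
  then show "x \<notin> ?S \<Longrightarrow> \<psi> x = 0" .
  have in_der: "(\<psi> has_derivative (\<lambda>h. (\<phi> x *\<^sub>R D\<eta> x + \<eta> x *\<^sub>R grad \<phi> x) \<bullet> h)) (at x)" if x: "x \<in> \<Omega>" for x
  proof -
    have "((\<lambda>x. \<phi> x * \<eta> x) has_derivative (\<lambda>h. (\<phi> x *\<^sub>R D\<eta> x + \<eta> x *\<^sub>R grad \<phi> x) \<bullet> h)) (at x)"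
      by (rule has_derivative_eq_rhs[OF has_derivative_mult[OF has_derivative_grad[OF T(1)] \<eta>[OF x]]])
        (auto simp: fun_eq_iff inner_add_left)
    then show ?thesis by (rule has_derivative_transform_within_open[OF _ O(1) x]) (simp add: \<psi>_def)
  qed
  have out_der: "(\<psi> has_derivative (\<lambda>h. 0 \<bullet> h)) (at x)" if x: "x \<notin> ?S" for x
  proof -
    have "((\<lambda>x. 0) has_derivative (\<lambda>h. 0 \<bullet> h)) (at x)" by simp
    then show ?thesis by (rule has_derivative_transform_within_open[of _ _ _ _ "- ?S"]) (use x z in auto)
  qed
  show "\<psi> differentiable (at x)"
    using in_der out_der T(5) unfolding differentiable_def by blast
  have g_in: "grad \<psi> x = \<phi> x *\<^sub>R D\<eta> x + \<eta> x *\<^sub>R grad \<phi> x" if "x \<in> \<Omega>" for x by (rule grad_eqI[OF in_der[OF that]])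
  then show "x \<in> \<Omega> \<Longrightarrow> grad \<psi> x = \<phi> x *\<^sub>R D\<eta> x + \<eta> x *\<^sub>R grad \<phi> x" .
  have "continuous_on (\<Omega> \<union> - ?S) (grad \<psi>)"
  proof (rule continuous_on_open_Un[OF O(1)])
    have "continuous_on \<Omega> (\<lambda>x. \<phi> x *\<^sub>R D\<eta> x + \<eta> x *\<^sub>R grad \<phi> x)"
      by (intro continuous_intros D\<eta> \<eta>c continuous_on_subset[OF T(2)] continuous_on_subset[OF T(3)]) auto
    then show "continuous_on \<Omega> (grad \<psi>)" by (rule continuous_on_eq) (simp add: g_in)
    have "continuous_on (- ?S) (\<lambda>x. 0 :: 'a)" by simp
    then show "continuous_on (- ?S) (grad \<psi>)" by (rule continuous_on_eq) (use grad_eqI[OF out_der] in auto)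
  qed auto
  moreover have "\<Omega> \<union> - ?S = UNIV" using T(5) by blast
  ultimately show "continuous_on UNIV (grad \<psi>)" by simp
qed


section \<open>The Euler-Lagrange equation\<close>

lemma iter_partial_append:
  "iter_partial (hs @ [b]) f = iter_partial hs (\<lambda>x. frechet_derivative f (at x) b)"
  by (induction hs) auto

lemma smooth_differentiable: "(\<And>k. Ck_on k UNIV f) \<Longrightarrow> f differentiable (at x)"
  using Ck_on_differentiable[of 1 UNIV f x] by simp

lemma smooth_partial:
  fixes f :: "'a::euclidean_space \<Rightarrow> 'b::real_normed_vector"
  assumes f: "\<And>k. Ck_on k UNIV f" and b: "b \<in> Basis"
  shows "Ck_on k UNIV (\<lambda>x. frechet_derivative f (at x) b)"
  unfolding Ck_on_def
proof (intro allI impI conjI)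
  fix hs :: "'a list" assume hs: "set hs \<subseteq> Basis"
  have s: "set (hs @ [b]) \<subseteq> Basis" using hs b by auto
  have d: "iter_partial (hs @ [b]) f differentiable (at x)" for x
    using f[of "Suc (length (hs @ [b]))"] s unfolding Ck_on_def by (metis UNIV_I lessI)
  then show "\<forall>x\<in>UNIV. iter_partial hs (\<lambda>x. frechet_derivative f (at x) b) differentiable (at x)"
    unfolding iter_partial_append by blast
  show "continuous_on UNIV (iter_partial hs (\<lambda>x. frechet_derivative f (at x) b))"
    using d unfolding iter_partial_append
    by (auto intro!: continuous_at_imp_continuous_on differentiable_imp_continuous_within)
qed

lemma smooth_add_scale:
  fixes f g :: "'a::euclidean_space \<Rightarrow> real"
  assumes "\<And>k. Ck_on k UNIV f" "\<And>k. Ck_on k UNIV g"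
  shows "Ck_on k UNIV (\<lambda>x. f x + t * g x)"
proof (rule smooth_family[where \<F>="{\<lambda>x. f x + t * g x | f g. (\<forall>k. Ck_on k UNIV f) \<and> (\<forall>k. Ck_on k UNIV g)}"])
  fix h :: "'a \<Rightarrow> real" and x
  assume "h \<in> {\<lambda>x. f x + t * g x | f g. (\<forall>k. Ck_on k UNIV f) \<and> (\<forall>k. Ck_on k UNIV g)}"
  then obtain f g where h: "h = (\<lambda>x. f x + t * g x)" and fg: "\<And>k. Ck_on k UNIV f" "\<And>k. Ck_on k UNIV g" by blast
  show "h differentiable (at x)" unfolding h
    using smooth_differentiable[OF fg(1)] smooth_differentiable[OF fg(2)] by (intro derivative_intros) auto
next
  fix h :: "'a \<Rightarrow> real" and b :: 'a
  assume "h \<in> {\<lambda>x. f x + t * g x | f g. (\<forall>k. Ck_on k UNIV f) \<and> (\<forall>k. Ck_on k UNIV g)}" and b: "b \<in> Basis"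
  then obtain f g where h: "h = (\<lambda>x. f x + t * g x)" and fg: "\<And>k. Ck_on k UNIV f" "\<And>k. Ck_on k UNIV g" by blast
  have "frechet_derivative h (at x) b = frechet_derivative f (at x) b + t * frechet_derivative g (at x) b" for x
  proof -
    have "(f has_derivative frechet_derivative f (at x)) (at x)" "(g has_derivative frechet_derivative g (at x)) (at x)"
      by (rule frechet_derivative_works[THEN iffD1, OF smooth_differentiable[OF fg(1)]]
          frechet_derivative_works[THEN iffD1, OF smooth_differentiable[OF fg(2)]])+
    then have "(h has_derivative (\<lambda>k. frechet_derivative f (at x) k + t * frechet_derivative g (at x) k)) (at x)"
      unfolding h by (intro has_derivative_add has_derivative_mult_right)
    from frechet_derivative_at[OF this, symmetric] show ?thesis by simp
  qed
  then have "(\<lambda>x. frechet_derivative h (at x) b) = (\<lambda>x. frechet_derivative f (at x) b + t * frechet_derivative g (at x) b)" by blast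
  then show "(\<lambda>x. frechet_derivative h (at x) b) \<in> {\<lambda>x. f x + t * g x | f g. (\<forall>k. Ck_on k UNIV f) \<and> (\<forall>k. Ck_on k UNIV g)}"
    by (intro CollectI exI[of _ "\<lambda>x. frechet_derivative f (at x) b"] exI[of _ "\<lambda>x. frechet_derivative g (at x) b"]
        conjI allI smooth_partial fg b)
qed (use assms in blast)

lemma test_function_add_scale:
  fixes f g :: "'a::euclidean_space \<Rightarrow> real"
  assumes f: "test_function S f" and g: "test_function S g"
  shows "test_function S (\<lambda>x. f x + t * g x)"
  unfolding test_function_def
proof (intro conjI allI)
  show "Ck_on k UNIV (\<lambda>x. f x + t * g x)" for k using f g by (intro smooth_add_scale) (auto simp: test_function_def)
  let ?T = "closure {x. f x \<noteq> 0} \<union> closure {x. g x \<noteq> 0}"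
  have sub: "closure {x. f x + t * g x \<noteq> 0} \<subseteq> ?T"
  proof (rule closure_minimal)
    have "{x. f x + t * g x \<noteq> 0} \<subseteq> {x. f x \<noteq> 0} \<union> {x. g x \<noteq> 0}" by auto
    then show "{x. f x + t * g x \<noteq> 0} \<subseteq> ?T" using closure_subset by blast
  qed (intro closed_Un closed_closure)
  then show "closure {x. f x + t * g x \<noteq> 0} \<subseteq> S" using test_function_D(5)[OF f] test_function_D(5)[OF g] by blast
  have "compact ?T" using test_function_D(4)[OF f] test_function_D(4)[OF g] by (rule compact_Un)
  then show "compact (closure {x. f x + t * g x \<noteq> 0})"
    using sub by (meson bounded_subset compact_imp_bounded compact_eq_bounded_closed closed_closure)
qed

lemma grad_add_scale:
  assumes "f differentiable (at x)" "g differentiable (at x)"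
  shows "grad (\<lambda>x. f x + t * g x) x = grad f x + t *\<^sub>R grad g x"
  by (rule grad_eqI, rule has_derivative_eq_rhs[OF has_derivative_add[OF has_derivative_grad[OF assms(1)]
        has_derivative_mult_right[OF has_derivative_grad[OF assms(2)]]]]) (simp add: inner_add_left fun_eq_iff)

text \<open>Supplies the competitors u + t \<phi> of the minimization problem: the approximating
  sequence is shifted by the fixed function t \<phi>, which leaves the errors unchanged.\<close>

lemma H10_add_test:
  fixes \<Omega> :: "'a::euclidean_space set"
  assumes O: "open \<Omega>" "bounded \<Omega>" and w: "H10 \<Omega> w G" and \<phi>: "test_function \<Omega> \<phi>"
  shows "H10 \<Omega> (\<lambda>x. w x + t * \<phi> x) (\<lambda>x. G x + t *\<^sub>R grad \<phi> x)"
proof -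
  obtain f where f: "\<And>k::nat. test_function \<Omega> (f k)"
    "(\<lambda>k. LINT x|lebesgue_on \<Omega>. (f k x - w x)\<^sup>2 + (norm (grad (f k) x - G x))\<^sup>2) \<longlonglongrightarrow> 0"
    and L: "L2_on \<Omega> w" "L2_on \<Omega> G"
    using w unfolding H10_def by blast
  note P = test_function_L2[OF O \<phi>]
  have L2: "L2_on \<Omega> (\<lambda>x. q x + t *\<^sub>R r x)" if "L2_on \<Omega> q" "L2_on \<Omega> r" for q r :: "'a \<Rightarrow> 'b::euclidean_space"
  proof -
    have m: "q \<in> borel_measurable (lebesgue_on \<Omega>)" "r \<in> borel_measurable (lebesgue_on \<Omega>)" using that by (auto simp: L2_on_def)
    have "L2_on \<Omega> (\<lambda>x. (- t) *\<^sub>R r x)"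
      using that(2) m(2) by (simp add: L2_on_def power_mult_distrib)
    from L2_on_diff_square_integrable[OF that(1) this] show ?thesis using m by (simp add: L2_on_def)
  qed
  have g: "grad (\<lambda>x. f k x + t * \<phi> x) x = grad (f k) x + t *\<^sub>R grad \<phi> x" for k x
    by (rule grad_add_scale[OF test_function_D(1)[OF f(1)] test_function_D(1)[OF \<phi>]])
  show ?thesis unfolding H10_def
  proof (intro conjI exI[of _ "\<lambda>k x. f k x + t * \<phi> x"] allI)
    show "L2_on \<Omega> (\<lambda>x. w x + t * \<phi> x)" using L2[OF L(1) P(1)] by simp
    show "L2_on \<Omega> (\<lambda>x. G x + t *\<^sub>R grad \<phi> x)" by (rule L2[OF L(2) P(2)])
    show "test_function \<Omega> (\<lambda>x. f k x + t * \<phi> x)" for k by (rule test_function_add_scale[OF f(1) \<phi>])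
    show "(\<lambda>k. LINT x|lebesgue_on \<Omega>. (f k x + t * \<phi> x - (w x + t * \<phi> x))\<^sup>2
        + (norm (grad (\<lambda>x. f k x + t * \<phi> x) x - (G x + t *\<^sub>R grad \<phi> x)))\<^sup>2) \<longlonglongrightarrow> 0"
      using f(2) by (simp add: g)
  qed
qed

lemma norm_directional_derivative:
  fixes p v :: "'a::real_inner"
  assumes "p \<noteq> 0"
  shows "((\<lambda>t. norm (p + t *\<^sub>R v)) has_real_derivative (p \<bullet> v) / norm p) (at 0)"
proof -
  have 1: "((\<lambda>t. p + t *\<^sub>R v) has_derivative (\<lambda>t. t *\<^sub>R v)) (at 0)"
    by (auto intro!: derivative_eq_intros)
  have 2: "(norm has_derivative (\<lambda>h. h \<bullet> sgn p)) (at (p + 0 *\<^sub>R v))"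
    using has_derivative_norm[OF assms] by simp
  have "((\<lambda>t. norm (p + t *\<^sub>R v)) has_derivative (\<lambda>t. (t *\<^sub>R v) \<bullet> sgn p)) (at 0)"
    by (rule has_derivative_compose[OF 1 2])
  then show ?thesis unfolding has_field_derivative_def
    by (rule has_derivative_eq_rhs) (simp add: fun_eq_iff sgn_div_norm inner_commute divide_inverse)
qed

section \<open>Variational equation and flux of a single admissible solution\<close>

locale admissible_solution =
  fixes \<Omega> :: "'a::euclidean_space set" and \<sigma>0 \<sigma>1 m M B :: real and a H u \<sigma> :: "'a \<Rightarrow> real" and F :: "'a \<Rightarrow> 'a"
  assumes open_Om: "open \<Omega>" and bounded_Om: "bounded \<Omega>"
    and a_meas: "a \<in> borel_measurable (lebesgue_on \<Omega>)" and a_bounds: "AE x in lebesgue_on \<Omega>. m \<le> a x \<and> a x \<le> M"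
    and pos: "0 < m" "0 < \<sigma>0" "0 < \<sigma>1"
    and adm: "admissible \<Omega> \<sigma>0 \<sigma>1 m M a F H u \<sigma>"
    and F_cont: "continuous_on \<Omega> F" and H_cont: "continuous_on \<Omega> H"
    and FH_bounds: "\<And>x. x \<in> \<Omega> \<Longrightarrow> norm (F x) \<le> B \<and> \<bar>H x\<bar> \<le> B"
begin

definition P :: "'a \<Rightarrow> 'a" where "P x = grad u x + F x"
definition flux :: "'a \<Rightarrow> 'a" where "flux x = \<sigma> x *\<^sub>R P x"

lemma u_C1: "Ck_on 1 \<Omega> u" "continuous_on (closure \<Omega>) u"
  and u_H10: "H10 \<Omega> u (grad u)"
  and u_min: "\<And>w G. H10 \<Omega> w G \<Longrightarrow> energy \<Omega> a F H u (grad u) \<le> energy \<Omega> a F H w G"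
  and \<sigma>_cont: "continuous_on \<Omega> \<sigma>" and \<sigma>_bounds: "\<And>x. x \<in> \<Omega> \<Longrightarrow> \<sigma>0 \<le> \<sigma> x \<and> \<sigma> x \<le> \<sigma>1"
  using adm by (auto simp: admissible_def Ck_closure_def)

lemma obtain_dual:
  obtains J where "dual_solution \<Omega> a F H J" "\<And>x. x \<in> \<Omega> \<Longrightarrow> J x = flux x"
    "\<And>x. x \<in> \<Omega> \<Longrightarrow> m \<le> norm (flux x) \<and> norm (flux x) \<le> M"
  using adm unfolding admissible_def flux_def P_def by metis

lemma flux_bounds: "x \<in> \<Omega> \<Longrightarrow> m \<le> norm (flux x)" "x \<in> \<Omega> \<Longrightarrow> norm (flux x) \<le> M"
  by (rule obtain_dual, blast)+

lemma grad_u_cont: "continuous_on \<Omega> (grad u)"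
  using Ck_on_grad_continuous[OF u_C1(1)] by simp

lemma P_cont: "continuous_on \<Omega> P"
  unfolding P_def[abs_def] by (intro continuous_intros grad_u_cont F_cont)

lemma flux_cont: "continuous_on \<Omega> flux"
  unfolding flux_def[abs_def] by (intro continuous_intros \<sigma>_cont P_cont)

lemma P_bounds: assumes "x \<in> \<Omega>" shows "m / \<sigma>1 \<le> norm (P x)" "norm (P x) \<le> M / \<sigma>0"
proof -
  have s: "\<sigma>0 \<le> \<sigma> x" "\<sigma> x \<le> \<sigma>1" using \<sigma>_bounds[OF assms] by auto
  have n: "norm (flux x) = \<sigma> x * norm (P x)" using s pos by (simp add: flux_def)
  have "m \<le> \<sigma>1 * norm (P x)" using flux_bounds(1)[OF assms] mult_right_mono[OF s(2), of "norm (P x)"] n by simp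
  then show "m / \<sigma>1 \<le> norm (P x)" using pos by (simp add: field_simps)
  have "\<sigma>0 * norm (P x) \<le> M" using flux_bounds(2)[OF assms] mult_right_mono[OF s(1), of "norm (P x)"] n by simp
  then show "norm (P x) \<le> M / \<sigma>0" using pos by (simp add: field_simps)
qed

lemma P_nz: "x \<in> \<Omega> \<Longrightarrow> P x \<noteq> 0"
  using P_bounds(1)[of x] pos by (auto simp: divide_le_0_iff)

lemma grad_u_bound: "x \<in> \<Omega> \<Longrightarrow> norm (grad u x) \<le> M / \<sigma>0 + B"
  using P_bounds(2)[of x] FH_bounds[of x] norm_triangle_ineq4[of "P x" "F x"] by (simp add: P_def)

lemma feasible: assumes "H10 \<Omega> w G" shows "(LINT x|lebesgue_on \<Omega>. G x \<bullet> flux x + H x * w x) = 0"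
proof -
  obtain J where J: "dual_solution \<Omega> a F H J" "\<And>x. x \<in> \<Omega> \<Longrightarrow> J x = flux x"
  proof (rule obtain_dual, goal_cases)
    case (1 J) show ?case by (rule that[OF 1(2,3)])
  qed
  have "(LINT x|lebesgue_on \<Omega>. G x \<bullet> J x + H x * w x) = 0"
    using J(1) assms by (auto simp: dual_solution_def dual_feasible_def)
  moreover have "(LINT x|lebesgue_on \<Omega>. G x \<bullet> J x + H x * w x) = (LINT x|lebesgue_on \<Omega>. G x \<bullet> flux x + H x * w x)"
    by (rule Bochner_Integration.integral_cong) (use J(2) in auto)
  ultimately show ?thesis by simp
qed

text \<open>\<open>a\<close> is bounded only almost everywhere.\<close>

definition ac :: "'a \<Rightarrow> real" where "ac x = max m (min (a x) M)"

lemma ac_AE: "AE x in lebesgue_on \<Omega>. ac x = a x"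
  using a_bounds by (rule eventually_mono) (auto simp: ac_def)

lemma ac_meas: "ac \<in> borel_measurable (lebesgue_on \<Omega>)"
  unfolding ac_def[abs_def] using a_meas by measurable

lemma m_le_M: "x \<in> \<Omega> \<Longrightarrow> m \<le> M"
  using flux_bounds[of x] by linarith

lemma ac_bounds: "x \<in> \<Omega> \<Longrightarrow> m \<le> ac x" "x \<in> \<Omega> \<Longrightarrow> ac x \<le> M"
  using m_le_M[of x] by (auto simp: ac_def)

text \<open>The gradient of p \<mapsto> a |p| at p = P, with the truncated \<open>a\<close>: the
  flux that the Euler-Lagrange equation of the energy produces.\<close>

definition J0 :: "'a \<Rightarrow> 'a" where "J0 x = (ac x / norm (P x)) *\<^sub>R P x"

lemma norm_J0: "x \<in> \<Omega> \<Longrightarrow> norm (J0 x) = ac x"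
  using P_nz[of x] ac_bounds[of x] pos by (simp add: J0_def)

lemma P_meas: "P \<in> borel_measurable (lebesgue_on \<Omega>)"
  and flux_meas: "flux \<in> borel_measurable (lebesgue_on \<Omega>)"
  and H_meas: "H \<in> borel_measurable (lebesgue_on \<Omega>)" and F_meas: "F \<in> borel_measurable (lebesgue_on \<Omega>)"
  and u_meas: "u \<in> borel_measurable (lebesgue_on \<Omega>)" and grad_u_meas: "grad u \<in> borel_measurable (lebesgue_on \<Omega>)"
  using P_cont flux_cont H_cont F_cont grad_u_cont continuous_on_subset[OF u_C1(2) closure_subset]
  by (auto intro: borel_measurable_lebesgue_on[OF open_Om])

lemma J0_meas: "J0 \<in> borel_measurable (lebesgue_on \<Omega>)"
  unfolding J0_def[abs_def] using ac_meas P_meas by measurable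

lemma u_bound: "\<exists>U. \<forall>x\<in>\<Omega>. \<bar>u x\<bar> \<le> U"
proof -
  have "compact (u ` closure \<Omega>)"
    using bounded_Om by (intro compact_continuous_image u_C1(2)) (simp add: compact_closure)
  then have "bounded (u ` closure \<Omega>)" by (rule compact_imp_bounded)
  then show ?thesis unfolding bounded_iff using closure_subset[of \<Omega>] by auto
qed

lemma integrable_bounded:
  fixes f :: "'a \<Rightarrow> 'b::euclidean_space"
  shows "f \<in> borel_measurable (lebesgue_on \<Omega>) \<Longrightarrow> (\<And>x. x \<in> \<Omega> \<Longrightarrow> norm (f x) \<le> c) \<Longrightarrow> integrable (lebesgue_on \<Omega>) f"
  by (rule integrable_lebesgue_on_bounded[OF open_Om bounded_Om])

text \<open>\<open>P\<close> is nowhere 0, so the integrand is differentiable along u + t \<phi>,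
  and its difference quotients are dominated because the norm is Lipschitz. Minimality makes the
  one-sided derivatives in the directions \<phi> and -\<phi> nonnegative, so the derivative is
  0.\<close>

lemma euler_lagrange_test:
  assumes \<phi>: "test_function \<Omega> \<phi>"
  shows "(LINT x|lebesgue_on \<Omega>. grad \<phi> x \<bullet> J0 x + H x * \<phi> x) = 0"
proof -
  let ?M = "lebesgue_on \<Omega>"
  interpret finite_measure ?M by (rule finite_measure_lebesgue_on[OF open_Om bounded_Om])
  note T = test_function_D[OF \<phi>]
  obtain B1 where B1: "\<And>x. norm (\<phi> x) \<le> B1" using compact_support_bounded[OF T(2,4,6)] by blast
  obtain B2 where B2: "\<And>x. norm (grad \<phi> x) \<le> B2" using compact_support_bounded[OF T(3,4,7)] by blast
  obtain U where U: "\<And>x. x \<in> \<Omega> \<Longrightarrow> \<bar>u x\<bar> \<le> U" using u_bound by blast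
  have \<phi>m: "\<phi> \<in> borel_measurable ?M" "grad \<phi> \<in> borel_measurable ?M"
    using T(2,3) by (auto intro!: borel_measurable_lebesgue_on[OF open_Om] intro: continuous_on_subset)
  have energy_eq: "energy \<Omega> a F H (\<lambda>x. u x + t * \<phi> x) (\<lambda>x. grad u x + t *\<^sub>R grad \<phi> x)
      = (LINT x|?M. ac x * norm (P x + t *\<^sub>R grad \<phi> x) + H x * (u x + t * \<phi> x))" for t
    unfolding energy_def
  proof (rule integral_cong_AE)
    show "(\<lambda>x. a x * norm (grad u x + t *\<^sub>R grad \<phi> x + F x) + H x * (u x + t * \<phi> x)) \<in> borel_measurable ?M"
      using a_meas grad_u_meas \<phi>m F_meas H_meas u_meas by measurable
    show "(\<lambda>x. ac x * norm (P x + t *\<^sub>R grad \<phi> x) + H x * (u x + t * \<phi> x)) \<in> borel_measurable ?M"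
      using ac_meas P_meas \<phi>m H_meas u_meas by measurable
    show "AE x in ?M. a x * norm (grad u x + t *\<^sub>R grad \<phi> x + F x) + H x * (u x + t * \<phi> x)
        = ac x * norm (P x + t *\<^sub>R grad \<phi> x) + H x * (u x + t * \<phi> x)"
      using ac_AE by (rule eventually_mono) (simp add: P_def add.commute add.left_commute)
  qed
  have int: "integrable ?M (\<lambda>x. ac x * norm (P x + t *\<^sub>R grad \<phi> x) + H x * (u x + t * \<phi> x))" for t
  proof (rule integrable_bounded)
    show "(\<lambda>x. ac x * norm (P x + t *\<^sub>R grad \<phi> x) + H x * (u x + t * \<phi> x)) \<in> borel_measurable ?M"
      using ac_meas P_meas \<phi>m H_meas u_meas by measurable
    fix x assume x: "x \<in> \<Omega>"
    have "\<bar>ac x * norm (P x + t *\<^sub>R grad \<phi> x)\<bar> \<le> M * (M / \<sigma>0 + \<bar>t\<bar> * B2)"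
    proof -
      have "norm (P x + t *\<^sub>R grad \<phi> x) \<le> M / \<sigma>0 + \<bar>t\<bar> * B2"
        using norm_triangle_ineq[of "P x" "t *\<^sub>R grad \<phi> x"] P_bounds(2)[OF x] mult_left_mono[OF B2[of x], of "\<bar>t\<bar>"] by simp
      then show ?thesis using ac_bounds[OF x] pos by (simp add: abs_mult mult_mono)
    qed
    moreover have "\<bar>H x * (u x + t * \<phi> x)\<bar> \<le> B * (U + \<bar>t\<bar> * B1)"
    proof -
      have "\<bar>u x + t * \<phi> x\<bar> \<le> U + \<bar>t\<bar> * B1"
        using abs_triangle_ineq[of "u x" "t * \<phi> x"] U[OF x] mult_left_mono[OF B1[of x], of "\<bar>t\<bar>"] by (simp add: abs_mult)
      then show ?thesis using FH_bounds[OF x] by (simp add: abs_mult mult_mono')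
    qed
    ultimately show "norm (ac x * norm (P x + t *\<^sub>R grad \<phi> x) + H x * (u x + t * \<phi> x)) \<le> M * (M / \<sigma>0 + \<bar>t\<bar> * B2) + B * (U + \<bar>t\<bar> * B1)"
      unfolding real_norm_def by (rule order_trans[OF abs_triangle_ineq add_mono])
  qed
  have key: "0 \<le> (LINT x|?M. \<kappa> * (grad \<phi> x \<bullet> J0 x + H x * \<phi> x))" if \<kappa>: "\<bar>\<kappa>\<bar> = 1" for \<kappa> :: real
  proof -
    define t where "t n = 1 / real (Suc n)" for n
    have t: "0 < t n" for n by (simp add: t_def)
    have t0: "t \<longlonglongrightarrow> 0" unfolding t_def[abs_def] using LIMSEQ_inverse_real_of_nat by (simp add: inverse_eq_divide)
    define q where "q n x = ac x * ((norm (P x + t n *\<^sub>R (\<kappa> *\<^sub>R grad \<phi> x)) - norm (P x)) / t n) + \<kappa> * (H x * \<phi> x)" for n x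
    have q0: "0 \<le> (LINT x|?M. q n x)" for n
    proof -
      have "energy \<Omega> a F H u (grad u) \<le> energy \<Omega> a F H (\<lambda>x. u x + (t n * \<kappa>) * \<phi> x) (\<lambda>x. grad u x + (t n * \<kappa>) *\<^sub>R grad \<phi> x)"
        by (rule u_min[OF H10_add_test[OF open_Om bounded_Om u_H10 \<phi>]])
      moreover have "energy \<Omega> a F H u (grad u) = (LINT x|?M. ac x * norm (P x + 0 *\<^sub>R grad \<phi> x) + H x * (u x + 0 * \<phi> x))"
        using energy_eq[of 0] by simp
      ultimately have "0 \<le> (LINT x|?M. ac x * norm (P x + (t n * \<kappa>) *\<^sub>R grad \<phi> x) + H x * (u x + (t n * \<kappa>) * \<phi> x))
          - (LINT x|?M. ac x * norm (P x + 0 *\<^sub>R grad \<phi> x) + H x * (u x + 0 * \<phi> x))"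
        by (simp add: energy_eq)
      also have "\<dots> = (LINT x|?M. (ac x * norm (P x + (t n * \<kappa>) *\<^sub>R grad \<phi> x) + H x * (u x + (t n * \<kappa>) * \<phi> x))
          - (ac x * norm (P x + 0 *\<^sub>R grad \<phi> x) + H x * (u x + 0 * \<phi> x)))"
        by (rule Bochner_Integration.integral_diff[symmetric, OF int int])
      also have "\<dots> = (LINT x|?M. t n * q n x)"
        by (rule Bochner_Integration.integral_cong) (use t[of n] in \<open>auto simp: q_def field_simps\<close>)
      also have "\<dots> = t n * (LINT x|?M. q n x)" by simp
      finally show ?thesis using t[of n] by (simp add: zero_le_mult_iff)
    qed
    have "(\<lambda>n. LINT x|?M. q n x) \<longlonglongrightarrow> (LINT x|?M. \<kappa> * (grad \<phi> x \<bullet> J0 x + H x * \<phi> x))"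
    proof (rule integral_dominated_convergence[where w="\<lambda>x. M * B2 + B * B1"])
      show "(\<lambda>x. \<kappa> * (grad \<phi> x \<bullet> J0 x + H x * \<phi> x)) \<in> borel_measurable ?M"
        using \<phi>m J0_meas H_meas by measurable
      show "q n \<in> borel_measurable ?M" for n unfolding q_def[abs_def]
        using ac_meas P_meas \<phi>m H_meas by measurable
      show "integrable ?M (\<lambda>x. M * B2 + B * B1)" by (rule integrable_const)
      show "AE x in ?M. (\<lambda>n. q n x) \<longlonglongrightarrow> \<kappa> * (grad \<phi> x \<bullet> J0 x + H x * \<phi> x)"
      proof (rule AE_I2)
        fix x assume "x \<in> space ?M"
        then have x: "x \<in> \<Omega>" by simp
        have "(\<lambda>r. (norm (P x + r *\<^sub>R (\<kappa> *\<^sub>R grad \<phi> x)) - norm (P x)) / r) \<midarrow>0\<rightarrow> (P x \<bullet> (\<kappa> *\<^sub>R grad \<phi> x)) / norm (P x)"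
          using norm_directional_derivative[OF P_nz[OF x], of "\<kappa> *\<^sub>R grad \<phi> x"] by (simp add: DERIV_def)
        then have "(\<lambda>n. (norm (P x + t n *\<^sub>R (\<kappa> *\<^sub>R grad \<phi> x)) - norm (P x)) / t n) \<longlonglongrightarrow> (P x \<bullet> (\<kappa> *\<^sub>R grad \<phi> x)) / norm (P x)"
          using t0 t by (intro LIMSEQ_SEQ_conv[THEN iffD2, rule_format]) (auto simp: less_imp_neq[symmetric])
        then have "(\<lambda>n. q n x) \<longlonglongrightarrow> ac x * ((P x \<bullet> (\<kappa> *\<^sub>R grad \<phi> x)) / norm (P x)) + \<kappa> * (H x * \<phi> x)"
          unfolding q_def by (intro tendsto_add tendsto_mult tendsto_const)
        moreover have "ac x * ((P x \<bullet> (\<kappa> *\<^sub>R grad \<phi> x)) / norm (P x)) + \<kappa> * (H x * \<phi> x) = \<kappa> * (grad \<phi> x \<bullet> J0 x + H x * \<phi> x)"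
          by (simp add: J0_def inner_commute distrib_left)
        ultimately show "(\<lambda>n. q n x) \<longlonglongrightarrow> \<kappa> * (grad \<phi> x \<bullet> J0 x + H x * \<phi> x)" by simp
      qed
      show "AE x in ?M. norm (q n x) \<le> M * B2 + B * B1" for n
      proof (rule AE_I2)
        fix x assume "x \<in> space ?M"
        then have x: "x \<in> \<Omega>" by simp
        have "\<bar>norm (P x + t n *\<^sub>R (\<kappa> *\<^sub>R grad \<phi> x)) - norm (P x)\<bar> \<le> norm (t n *\<^sub>R (\<kappa> *\<^sub>R grad \<phi> x))"
          using norm_triangle_ineq3[of "P x + t n *\<^sub>R (\<kappa> *\<^sub>R grad \<phi> x)" "P x"] by simp
        also have "\<dots> \<le> t n * B2" using B2[of x] t[of n] \<kappa> by (simp add: abs_mult)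
        finally have "\<bar>(norm (P x + t n *\<^sub>R (\<kappa> *\<^sub>R grad \<phi> x)) - norm (P x)) / t n\<bar> \<le> B2"
          using t[of n] by (simp add: abs_divide divide_le_eq mult.commute)
        then have "\<bar>ac x * ((norm (P x + t n *\<^sub>R (\<kappa> *\<^sub>R grad \<phi> x)) - norm (P x)) / t n)\<bar> \<le> M * B2"
          unfolding abs_mult using ac_bounds[OF x] pos by (intro mult_mono) auto
        moreover have "\<bar>\<kappa> * (H x * \<phi> x)\<bar> \<le> B * B1"
        proof -
          have "\<bar>H x\<bar> * \<bar>\<phi> x\<bar> \<le> B * B1"
            using FH_bounds[OF x] B1[of x] order_trans[OF norm_ge_zero, of "F x" B] by (intro mult_mono) auto
          then show ?thesis by (simp add: abs_mult \<kappa>)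
        qed
        ultimately show "norm (q n x) \<le> M * B2 + B * B1"
          unfolding q_def real_norm_def by (rule order_trans[OF abs_triangle_ineq add_mono])
      qed
    qed
    then show ?thesis using q0 by (intro LIMSEQ_le_const) auto
  qed
  show ?thesis using key[of 1] key[of "-1"] unfolding integral_mult_right_zero by simp
qed

lemma J0_feasible: assumes "H10 \<Omega> w G" shows "(LINT x|lebesgue_on \<Omega>. G x \<bullet> J0 x + H x * w x) = 0"
proof (rule H10_functional_zero[OF open_Om bounded_Om J0_meas H_meas _ euler_lagrange_test assms])
  show "norm (J0 x) \<le> max M B \<and> \<bar>H x\<bar> \<le> max M B" if "x \<in> \<Omega>" for x
    using norm_J0[OF that] ac_bounds[OF that] FH_bounds[OF that] by auto
qed

text \<open>Tested with \<open>u\<close> itself, feasibility turns the integral of P \<bullet> J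
  into that of F \<bullet> J minus that of H u, for \<open>J0\<close> as for the flux. Dual
  maximality thus says that P \<bullet> J0 - P \<bullet> flux has nonpositive integral, while
  pointwise it is (ac - |flux|) |P|, which is nonnegative almost everywhere by the constraint |flux|
  \<le> a. Hence it vanishes almost everywhere, and \<open>P\<close> is nowhere 0.\<close>

lemma flux_norm: "AE x in lebesgue_on \<Omega>. norm (flux x) = a x"
proof -
  let ?M = "lebesgue_on \<Omega>"
  obtain J where J: "dual_solution \<Omega> a F H J" "\<And>x. x \<in> \<Omega> \<Longrightarrow> J x = flux x"
  proof (rule obtain_dual, goal_cases)
    case (1 J) show ?case by (rule that[OF 1(2,3)])
  qed
  have "dual_feasible \<Omega> a H J0"
    unfolding dual_feasible_def
  proof (intro conjI allI impI)
    show "L2_on \<Omega> J0"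
      by (rule L2_on_bounded[OF open_Om bounded_Om J0_meas, of M]) (use norm_J0 ac_bounds in auto)
    show "AE x in ?M. norm (J0 x) \<le> a x"
      using ac_AE AE_space by (rule eventually_elim2) (use norm_J0 in simp)
  qed (use J0_feasible in blast)
  then have "(LINT x|?M. F x \<bullet> J0 x) \<le> (LINT x|?M. F x \<bullet> J x)"
    using J(1) by (simp add: dual_solution_def)
  also have "\<dots> = (LINT x|?M. F x \<bullet> flux x)"
    by (rule Bochner_Integration.integral_cong) (use J(2) in auto)
  finally have le: "(LINT x|?M. F x \<bullet> J0 x) \<le> (LINT x|?M. F x \<bullet> flux x)" .
  obtain U where U: "\<And>x. x \<in> \<Omega> \<Longrightarrow> \<bar>u x\<bar> \<le> U" using u_bound by blast
  have int: "integrable ?M (\<lambda>x. Q x \<bullet> R x)" if q: "Q \<in> borel_measurable ?M" and r: "R \<in> borel_measurable ?M"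
    and c: "\<And>x. x \<in> \<Omega> \<Longrightarrow> norm (Q x) \<le> c" and d: "\<And>x. x \<in> \<Omega> \<Longrightarrow> norm (R x) \<le> d" for Q R :: "'a \<Rightarrow> 'a" and c d
  proof (rule integrable_bounded)
    show "(\<lambda>x. Q x \<bullet> R x) \<in> borel_measurable ?M" using q r by measurable
    show "norm (Q x \<bullet> R x) \<le> c * d" if x: "x \<in> \<Omega>" for x
      unfolding real_norm_def
      by (rule order_trans[OF Cauchy_Schwarz_ineq2 mult_mono[OF c[OF x] d[OF x] order_trans[OF norm_ge_zero c[OF x]] norm_ge_zero]])
  qed
  have J0b: "norm (J0 x) \<le> M" if "x \<in> \<Omega>" for x using norm_J0[OF that] ac_bounds[OF that] by simp
  have Fb: "norm (F x) \<le> B" if "x \<in> \<Omega>" for x using FH_bounds[OF that] by simp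
  have Hu: "integrable ?M (\<lambda>x. H x * u x)"
  proof (rule integrable_bounded)
    show "(\<lambda>x. H x * u x) \<in> borel_measurable ?M" using H_meas u_meas by measurable
    show "norm (H x * u x) \<le> B * U" if "x \<in> \<Omega>" for x
      using FH_bounds[OF that] U[OF that] by (simp add: abs_mult mult_mono')
  qed
  have 1: "(LINT x|?M. P x \<bullet> J0 x) = (LINT x|?M. F x \<bullet> J0 x) - (LINT x|?M. H x * u x)"
  proof -
    have "(LINT x|?M. P x \<bullet> J0 x) = (LINT x|?M. (F x \<bullet> J0 x - H x * u x) + (grad u x \<bullet> J0 x + H x * u x))"
      by (rule Bochner_Integration.integral_cong) (auto simp: P_def inner_add_left)
    also have "\<dots> = (LINT x|?M. F x \<bullet> J0 x - H x * u x) + (LINT x|?M. grad u x \<bullet> J0 x + H x * u x)"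
      by (intro Bochner_Integration.integral_add Bochner_Integration.integrable_diff Bochner_Integration.integrable_add Hu
          int[OF F_meas J0_meas Fb J0b] int[OF grad_u_meas J0_meas grad_u_bound J0b])
    also have "\<dots> = (LINT x|?M. F x \<bullet> J0 x) - (LINT x|?M. H x * u x)"
      using J0_feasible[OF u_H10] Bochner_Integration.integral_diff[OF int[OF F_meas J0_meas Fb J0b] Hu] by simp
    finally show ?thesis .
  qed
  have 2: "(LINT x|?M. P x \<bullet> flux x) = (LINT x|?M. F x \<bullet> flux x) - (LINT x|?M. H x * u x)"
  proof -
    have "(LINT x|?M. P x \<bullet> flux x) = (LINT x|?M. (F x \<bullet> flux x - H x * u x) + (grad u x \<bullet> flux x + H x * u x))"
      by (rule Bochner_Integration.integral_cong) (auto simp: P_def inner_add_left)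
    also have "\<dots> = (LINT x|?M. F x \<bullet> flux x - H x * u x) + (LINT x|?M. grad u x \<bullet> flux x + H x * u x)"
      by (intro Bochner_Integration.integral_add Bochner_Integration.integrable_diff Bochner_Integration.integrable_add Hu
          int[OF F_meas flux_meas Fb flux_bounds(2)] int[OF grad_u_meas flux_meas grad_u_bound flux_bounds(2)])
    also have "\<dots> = (LINT x|?M. F x \<bullet> flux x) - (LINT x|?M. H x * u x)"
      using feasible[OF u_H10] Bochner_Integration.integral_diff[OF int[OF F_meas flux_meas Fb flux_bounds(2)] Hu] by simp
    finally show ?thesis .
  qed
  have i1: "integrable ?M (\<lambda>x. P x \<bullet> J0 x)" "integrable ?M (\<lambda>x. P x \<bullet> flux x)"
    by (rule int[OF P_meas J0_meas P_bounds(2) J0b] int[OF P_meas flux_meas P_bounds(2) flux_bounds(2)]; assumption)+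
  have le0: "(LINT x|?M. P x \<bullet> J0 x - P x \<bullet> flux x) \<le> 0"
    using le 1 2 Bochner_Integration.integral_diff[OF i1] by simp
  have pw: "P x \<bullet> J0 x - P x \<bullet> flux x = (ac x - norm (flux x)) * norm (P x)" if x: "x \<in> \<Omega>" for x
  proof -
    have "P x \<bullet> J0 x = ac x * norm (P x)"
      using P_nz[OF x] by (simp add: J0_def power2_norm_eq_inner[symmetric] power2_eq_square)
    moreover have "P x \<bullet> flux x = norm (flux x) * norm (P x)"
      using \<sigma>_bounds[OF x] pos by (simp add: flux_def power2_norm_eq_inner[symmetric] power2_eq_square)
    ultimately show ?thesis by (simp add: left_diff_distrib)
  qed
  have Ja: "AE x in ?M. norm (flux x) \<le> a x"
    using J by (auto simp: dual_solution_def dual_feasible_def elim!: AE_mp)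
  have nn: "AE x in ?M. 0 \<le> P x \<bullet> J0 x - P x \<bullet> flux x"
    using Ja ac_AE AE_space
  proof eventually_elim
    case (elim x)
    then show ?case using pw[of x] by simp
  qed
  have "(LINT x|?M. P x \<bullet> J0 x - P x \<bullet> flux x) = 0"
    using le0 integral_nonneg_AE[OF nn] by linarith
  then have "AE x in ?M. P x \<bullet> J0 x - P x \<bullet> flux x = 0"
    using integral_nonneg_eq_0_iff_AE[OF Bochner_Integration.integrable_diff[OF i1] nn] by blast
  then show ?thesis using ac_AE AE_space
  proof eventually_elim
    case (elim x)
    then show ?case using pw[of x] P_nz[of x] by simp
  qed
qed

end


section \<open>The gradient estimate\<close>

lemma integral_lebesgue_on_extend:
  fixes f :: "'a::euclidean_space \<Rightarrow> real"
  assumes "open S" "f \<in> borel_measurable borel" "\<And>x. x \<notin> S \<Longrightarrow> f x = 0"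
  shows "(LINT x|lebesgue_on S. f x) = (LINT x|lborel. f x)"
proof -
  have "(LINT x|lebesgue_on S. f x) = (LINT x|lebesgue. indicator S x *\<^sub>R f x)"
    using assms(1) by (subst integral_restrict_space) auto
  also have "(\<lambda>x. indicator S x *\<^sub>R f x) = f" using assms(3) by (auto simp: fun_eq_iff indicator_def)
  also have "(LINT x|lebesgue. f x) = (LINT x|lborel. f x)" by (rule integral_completion) (use assms(2) in simp)
  finally show ?thesis .
qed

text \<open>Integration by parts in direction \<open>b\<close>: the product \<phi> f, extended by 0,
  is C^1 with compact support, so the integral of its gradient vanishes.\<close>

lemma divergence_test:
  fixes \<Omega> :: "'a::euclidean_space set"
  assumes O: "open \<Omega>" "bounded \<Omega>" and \<phi>: "test_function \<Omega> \<phi>"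
    and f: "\<And>x. x \<in> \<Omega> \<Longrightarrow> (f has_derivative (\<lambda>h. Df x \<bullet> h)) (at x)" and Df: "continuous_on \<Omega> Df"
  shows "(LINT x|lebesgue_on \<Omega>. \<phi> x * (Df x \<bullet> b) + f x * (grad \<phi> x \<bullet> b)) = 0"
proof -
  define \<psi> where "\<psi> x = (if x \<in> \<Omega> then \<phi> x * f x else 0)" for x
  have R: "\<psi> differentiable (at x)" "continuous_on UNIV (grad \<psi>)"
    "x \<in> \<Omega> \<Longrightarrow> grad \<psi> x = \<phi> x *\<^sub>R Df x + f x *\<^sub>R grad \<phi> x"
    "x \<notin> closure {x. \<phi> x \<noteq> 0} \<Longrightarrow> \<psi> x = 0" for x
    using H10_cutoff_product[OF O \<phi> f Df] by (simp_all add: \<psi>_def[abs_def])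
  note T = test_function_D[OF \<phi>]
  have gz: "grad \<psi> x = 0" if "x \<notin> \<Omega>" for x
    by (rule grad_zero_outside[OF closed_closure R(4)]) (use T(5) that in auto)
  obtain a where a: "closure {x. \<phi> x \<noteq> 0} \<subseteq> cbox (- a) a"
    using bounded_subset_cbox_symmetric[OF compact_imp_bounded[OF T(4)]] by blast
  have "(LINT x|lebesgue_on \<Omega>. \<phi> x * (Df x \<bullet> b) + f x * (grad \<phi> x \<bullet> b)) = (LINT x|lebesgue_on \<Omega>. grad \<psi> x \<bullet> b)"
    by (rule Bochner_Integration.integral_cong) (auto simp: R(3) inner_add_left)
  also have "\<dots> = (LINT x|lborel. grad \<psi> x \<bullet> b)"
    by (rule integral_lebesgue_on_extend[OF O(1)])
      (use gz R(2) in \<open>auto intro!: borel_measurable_continuous_onI continuous_intros\<close>)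
  also have "\<dots> = 0"
    by (rule grad_integral_zero[OF R(1,2), of "- a" a]) (use R(4) a in blast)
  finally show ?thesis .
qed

text \<open>Cauchy-Schwarz against the constant 1, obtained from the nonnegative integral of (f -
  c)^2 with the mean value for c; a space of measure 0 has no mean value and is treated
  apart.\<close>

lemma square_integral_le:
  fixes f :: "'a \<Rightarrow> real"
  assumes M: "finite_measure M" and f: "integrable M f" "integrable M (\<lambda>x. (f x)\<^sup>2)"
  shows "(LINT x|M. f x)\<^sup>2 \<le> measure M (space M) * (LINT x|M. (f x)\<^sup>2)"
proof -
  interpret finite_measure M by (rule M)
  let ?V = "measure M (space M)" and ?I = "LINT x|M. f x" and ?Q = "LINT x|M. (f x)\<^sup>2"
  have ge: "0 \<le> ?Q - 2 * c * ?I + c\<^sup>2 * ?V" for c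
  proof -
    have "0 \<le> (LINT x|M. (f x - c)\<^sup>2)" by (rule Bochner_Integration.integral_nonneg) simp
    also have "\<dots> = (LINT x|M. ((f x)\<^sup>2 - 2 * c * f x) + c\<^sup>2)"
      by (rule Bochner_Integration.integral_cong) (auto simp: power2_eq_square algebra_simps)
    also have "\<dots> = ?Q - 2 * c * ?I + c\<^sup>2 * ?V"
      using f by (simp add: mult.commute)
    finally show ?thesis .
  qed
  show ?thesis
  proof (cases "?V = 0")
    case True
    have "?I = 0"
    proof (rule ccontr)
      assume n: "?I \<noteq> 0"
      \<comment> \<open>In measure 0 the expression is affine in c, and this c gives it the value
        -1.\<close>
      have "0 \<le> ?Q - 2 * ((?Q + 1) / (2 * ?I)) * ?I" using ge[of "(?Q + 1) / (2 * ?I)"] True by simp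
      then show False using n by simp
    qed
    then show ?thesis using True by simp
  next
    case False
    then have V: "0 < ?V" by (simp add: zero_less_measure_iff)
    have "0 \<le> ?V * (?Q - 2 * (?I / ?V) * ?I + (?I / ?V)\<^sup>2 * ?V)" using ge[of "?I / ?V"] V by (intro mult_nonneg_nonneg) auto
    also have "\<dots> = ?V * ?Q - ?I\<^sup>2" using V by (simp add: field_simps power2_eq_square)
    finally show ?thesis by simp
  qed
qed

section \<open>The weak equation for the Laplacian\<close>

context admissible_solution
begin

text \<open>Expanding \<open>\<nabla> \<bullet> (\<sigma> (\<nabla>u + F)) = H\<close> yields \<open>\<Delta>u = H / \<sigma> - \<nabla>\<sigma> \<bullet> P / \<sigma> - \<nabla> \<bullet> F\<close>.\<close>

definition weak_rhs :: "('a \<Rightarrow> 'a) \<Rightarrow> ('a \<Rightarrow> 'a \<Rightarrow> 'a) \<Rightarrow> 'a \<Rightarrow> real" where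
  "weak_rhs D\<sigma> DF x = - (P x \<bullet> D\<sigma> x) / \<sigma> x + H x / \<sigma> x - (\<Sum>b\<in>Basis. DF b x \<bullet> b)"

text \<open>The flux equation is tested with \<phi> / \<sigma>: the factor \<sigma> of the flux
  cancels in the term with grad \<phi>, and the derivative of 1 / \<sigma> leaves -(P \<bullet>
  D\<sigma>) / \<sigma>, which multiplies \<phi> without derivatives. The part F of P = grad u + F
  is integrated by parts with \<open>divergence_test\<close>, component by component. All
  coefficients are bounded, so the identity extends from test functions to
  \<open>H10\<close>.\<close>

lemma
  assumes D\<sigma>: "\<And>x. x \<in> \<Omega> \<Longrightarrow> (\<sigma> has_derivative (\<lambda>h. D\<sigma> x \<bullet> h)) (at x)" "continuous_on \<Omega> D\<sigma>"
      "\<And>x. x \<in> \<Omega> \<Longrightarrow> norm (D\<sigma> x) \<le> S2"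
    and DF: "\<And>b x. b \<in> Basis \<Longrightarrow> x \<in> \<Omega> \<Longrightarrow> ((\<lambda>x. F x \<bullet> b) has_derivative (\<lambda>h. DF b x \<bullet> h)) (at x)"
      "\<And>b. b \<in> Basis \<Longrightarrow> continuous_on \<Omega> (DF b)" "\<And>b x. b \<in> Basis \<Longrightarrow> x \<in> \<Omega> \<Longrightarrow> \<bar>DF b x \<bullet> b\<bar> \<le> B"
  shows weak_rhs_bound: "\<And>x. x \<in> \<Omega> \<Longrightarrow> \<bar>weak_rhs D\<sigma> DF x\<bar> \<le> M / \<sigma>0 * S2 / \<sigma>0 + B / \<sigma>0 + DIM('a) * B"
    and weak_rhs_cont: "continuous_on \<Omega> (weak_rhs D\<sigma> DF)"
    and weak_laplacian: "\<And>w G. H10 \<Omega> w G \<Longrightarrow> (LINT x|lebesgue_on \<Omega>. G x \<bullet> grad u x + weak_rhs D\<sigma> DF x * w x) = 0"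
      "\<And>w G. H10 \<Omega> w G \<Longrightarrow> integrable (lebesgue_on \<Omega>) (\<lambda>x. G x \<bullet> grad u x + weak_rhs D\<sigma> DF x * w x)"
proof -
  let ?M = "lebesgue_on \<Omega>"
  let ?Y = "weak_rhs D\<sigma> DF"
  let ?CY = "M / \<sigma>0 * S2 / \<sigma>0 + B / \<sigma>0 + DIM('a) * B"
  have \<sigma>nz: "\<sigma> x \<noteq> 0" if "x \<in> \<Omega>" for x using \<sigma>_bounds[OF that] pos by auto
  show bound: "\<bar>?Y x\<bar> \<le> ?CY" if x: "x \<in> \<Omega>" for x
  proof -
    have s: "0 < \<sigma> x" "\<sigma>0 \<le> \<sigma> x" using \<sigma>_bounds[OF x] pos by auto
    have M0: "0 \<le> M / \<sigma>0" by (rule order_trans[OF norm_ge_zero P_bounds(2)[OF x]])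
    have "\<bar>P x \<bullet> D\<sigma> x\<bar> \<le> M / \<sigma>0 * S2"
      by (rule order_trans[OF Cauchy_Schwarz_ineq2 mult_mono[OF P_bounds(2)[OF x] D\<sigma>(3)[OF x] M0 norm_ge_zero]])
    then have 1: "\<bar>(P x \<bullet> D\<sigma> x) / \<sigma> x\<bar> \<le> M / \<sigma>0 * S2 / \<sigma>0"
      unfolding abs_divide using s pos by (intro frac_le) auto
    have 2: "\<bar>H x / \<sigma> x\<bar> \<le> B / \<sigma>0"
      unfolding abs_divide using s pos FH_bounds[OF x] by (intro frac_le) auto
    have "\<bar>\<Sum>b\<in>Basis. DF b x \<bullet> b\<bar> \<le> (\<Sum>b\<in>Basis. \<bar>DF b x \<bullet> b\<bar>)" by (rule sum_abs)
    also have "\<dots> \<le> (\<Sum>b\<in>(Basis::'a set). B)" by (intro sum_mono DF(3) x)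
    finally have 3: "\<bar>\<Sum>b\<in>Basis. DF b x \<bullet> b\<bar> \<le> DIM('a) * B" by simp
    have "\<bar>- p + q - r\<bar> \<le> \<bar>p\<bar> + \<bar>q\<bar> + \<bar>r\<bar>" for p q r :: real by linarith
    from this[of "(P x \<bullet> D\<sigma> x) / \<sigma> x" "H x / \<sigma> x" "\<Sum>b\<in>Basis. DF b x \<bullet> b"] 1 2 3
    show ?thesis by (simp add: weak_rhs_def)
  qed
  show cont: "continuous_on \<Omega> ?Y"
    unfolding weak_rhs_def[abs_def] using \<sigma>nz
    by (intro continuous_intros P_cont D\<sigma>(2) \<sigma>_cont H_cont DF(2)) auto
  define \<eta> where "\<eta> x = 1 / \<sigma> x" for x
  define D\<eta> where "D\<eta> x = (- 1 / (\<sigma> x)\<^sup>2) *\<^sub>R D\<sigma> x" for x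
  have \<eta>d: "(\<eta> has_derivative (\<lambda>h. D\<eta> x \<bullet> h)) (at x)" if x: "x \<in> \<Omega>" for x
  proof -
    have "((\<lambda>x. inverse (\<sigma> x)) has_derivative (\<lambda>h. - (inverse (\<sigma> x) * (D\<sigma> x \<bullet> h) * inverse (\<sigma> x)))) (at x)"
      by (rule Deriv.has_derivative_inverse[OF \<sigma>nz[OF x] D\<sigma>(1)[OF x]])
    then show ?thesis unfolding \<eta>_def[abs_def]
      by (simp add: D\<eta>_def divide_inverse power2_eq_square mult.commute mult.left_commute)
  qed
  have D\<eta>c: "continuous_on \<Omega> D\<eta>"
    unfolding D\<eta>_def[abs_def] using \<sigma>nz by (intro continuous_intros D\<sigma>(2) \<sigma>_cont) auto
  have test: "(LINT x|?M. grad \<phi> x \<bullet> grad u x + ?Y x * \<phi> x) = 0" if \<phi>: "test_function \<Omega> \<phi>" for \<phi>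
  proof -
    note T = test_function_D[OF \<phi>]
    \<comment> \<open>\<open>\<psi>\<close> is C^1 but in general not smooth, so
      \<open>feasible\<close> is reached through \<open>H10_C1_compact_support\<close>; the case of
      empty support, which that lemma excludes, is trivial.\<close>
    define \<psi> where "\<psi> x = (if x \<in> \<Omega> then \<phi> x * \<eta> x else 0)" for x
    have R: "\<psi> differentiable (at x)" "continuous_on UNIV (grad \<psi>)"
      "x \<in> \<Omega> \<Longrightarrow> grad \<psi> x = \<phi> x *\<^sub>R D\<eta> x + \<eta> x *\<^sub>R grad \<phi> x"
      "x \<notin> closure {x. \<phi> x \<noteq> 0} \<Longrightarrow> \<psi> x = 0" for x
      using H10_cutoff_product[OF open_Om bounded_Om \<phi> \<eta>d D\<eta>c] by (simp_all add: \<psi>_def[abs_def])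
    show ?thesis
    proof (cases "closure {x. \<phi> x \<noteq> 0} = {}")
      case True
      then have "grad \<phi> x = 0" "\<phi> x = 0" for x using T(6,7)[of x] by auto
      then show ?thesis by simp
    next
      case False
      have "H10 \<Omega> \<psi> (grad \<psi>)"
        by (rule H10_C1_compact_support[OF open_Om bounded_Om T(4) False T(5) R(1,2,4)])
      then have "(LINT x|?M. grad \<psi> x \<bullet> flux x + H x * \<psi> x) = 0" by (rule feasible)
      also have "(LINT x|?M. grad \<psi> x \<bullet> flux x + H x * \<psi> x)
          = (LINT x|?M. grad \<phi> x \<bullet> P x + \<phi> x * (- (P x \<bullet> D\<sigma> x) / \<sigma> x + H x / \<sigma> x))"
      proof (rule Bochner_Integration.integral_cong)
        fix x assume "x \<in> space ?M"
        then have x: "x \<in> \<Omega>" by simp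
        have "grad \<psi> x \<bullet> flux x = grad \<phi> x \<bullet> P x - \<phi> x * (P x \<bullet> D\<sigma> x) / \<sigma> x"
          using \<sigma>nz[OF x] unfolding R(3)[OF x] flux_def D\<eta>_def \<eta>_def
          by (simp only: inner_add_left inner_scaleR_left inner_scaleR_right)
            (simp add: field_simps power2_eq_square inner_commute)
        then show "grad \<psi> x \<bullet> flux x + H x * \<psi> x = grad \<phi> x \<bullet> P x + \<phi> x * (- (P x \<bullet> D\<sigma> x) / \<sigma> x + H x / \<sigma> x)"
          using x by (simp add: \<psi>_def \<eta>_def algebra_simps)
      qed simp
      finally have 1: "(LINT x|?M. grad \<phi> x \<bullet> P x + \<phi> x * (- (P x \<bullet> D\<sigma> x) / \<sigma> x + H x / \<sigma> x)) = 0" .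
      obtain B1 where B1: "\<And>x. norm (\<phi> x) \<le> B1" using compact_support_bounded[OF T(2,4,6)] by blast
      obtain B2 where B2: "\<And>x. norm (grad \<phi> x) \<le> B2" using compact_support_bounded[OF T(3,4,7)] by blast
      have B0: "0 \<le> B1" "0 \<le> B2" using order_trans[OF norm_ge_zero B1] order_trans[OF norm_ge_zero B2] by auto
      have \<phi>c: "continuous_on \<Omega> \<phi>" "continuous_on \<Omega> (grad \<phi>)" by (rule continuous_on_subset[OF T(2)] continuous_on_subset[OF T(3)], simp)+
      have i: "integrable ?M (\<lambda>x. \<phi> x * (DF b x \<bullet> b) + (F x \<bullet> b) * (grad \<phi> x \<bullet> b))" if b: "b \<in> Basis" for b
      proof (rule integrable_bounded)
        show "(\<lambda>x. \<phi> x * (DF b x \<bullet> b) + (F x \<bullet> b) * (grad \<phi> x \<bullet> b)) \<in> borel_measurable ?M"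
          by (intro borel_measurable_lebesgue_on[OF open_Om] continuous_intros \<phi>c DF(2)[OF b] F_cont)
        fix x assume x: "x \<in> \<Omega>"
        have "\<bar>\<phi> x * (DF b x \<bullet> b)\<bar> \<le> B1 * B"
          unfolding abs_mult using B1[of x] DF(3)[OF b x] B0 by (intro mult_mono) auto
        moreover have "\<bar>(F x \<bullet> b) * (grad \<phi> x \<bullet> b)\<bar> \<le> B * B2"
          unfolding abs_mult using Basis_le_norm[OF b, of "F x"] Basis_le_norm[OF b, of "grad \<phi> x"] FH_bounds[OF x] B2[of x]
          by (intro mult_mono) (auto intro: order_trans)
        ultimately show "norm (\<phi> x * (DF b x \<bullet> b) + (F x \<bullet> b) * (grad \<phi> x \<bullet> b)) \<le> B1 * B + B * B2"
          unfolding real_norm_def by (rule order_trans[OF abs_triangle_ineq add_mono])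
      qed
      have 2: "(LINT x|?M. (\<Sum>b\<in>Basis. \<phi> x * (DF b x \<bullet> b) + (F x \<bullet> b) * (grad \<phi> x \<bullet> b))) = 0"
      proof -
        have "(LINT x|?M. \<phi> x * (DF b x \<bullet> b) + (F x \<bullet> b) * (grad \<phi> x \<bullet> b)) = 0" if b: "b \<in> Basis" for b
          by (rule divergence_test[OF open_Om bounded_Om \<phi> DF(1)[OF b] DF(2)[OF b]])
        then show ?thesis using i by (subst Bochner_Integration.integral_sum) auto
      qed
      have 3: "(\<Sum>b\<in>Basis. \<phi> x * (DF b x \<bullet> b) + (F x \<bullet> b) * (grad \<phi> x \<bullet> b)) = \<phi> x * (\<Sum>b\<in>Basis. DF b x \<bullet> b) + grad \<phi> x \<bullet> F x" for x
        by (simp add: sum.distrib sum_distrib_left euclidean_inner[of "grad \<phi> x" "F x"] mult.commute)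
      have i3: "integrable ?M (\<lambda>x. \<Sum>b\<in>Basis. \<phi> x * (DF b x \<bullet> b) + (F x \<bullet> b) * (grad \<phi> x \<bullet> b))"
        by (intro Bochner_Integration.integrable_sum i)
      have i1: "integrable ?M (\<lambda>x. grad \<phi> x \<bullet> grad u x + ?Y x * \<phi> x)"
      proof (rule integrable_bounded)
        show "(\<lambda>x. grad \<phi> x \<bullet> grad u x + ?Y x * \<phi> x) \<in> borel_measurable ?M"
          by (intro borel_measurable_lebesgue_on[OF open_Om] continuous_intros \<phi>c grad_u_cont cont)
        fix x assume x: "x \<in> \<Omega>"
        have "\<bar>grad \<phi> x \<bullet> grad u x\<bar> \<le> B2 * (M / \<sigma>0 + B)"
          by (rule order_trans[OF Cauchy_Schwarz_ineq2 mult_mono[OF B2 grad_u_bound[OF x] B0(2) norm_ge_zero]])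
        moreover have "\<bar>?Y x * \<phi> x\<bar> \<le> ?CY * B1"
          unfolding abs_mult using bound[OF x] B1[of x] order_trans[OF abs_ge_zero bound[OF x]] by (intro mult_mono) auto
        ultimately show "norm (grad \<phi> x \<bullet> grad u x + ?Y x * \<phi> x) \<le> B2 * (M / \<sigma>0 + B) + ?CY * B1"
          unfolding real_norm_def by (rule order_trans[OF abs_triangle_ineq add_mono])
      qed
      have "(LINT x|?M. grad \<phi> x \<bullet> P x + \<phi> x * (- (P x \<bullet> D\<sigma> x) / \<sigma> x + H x / \<sigma> x))
          = (LINT x|?M. (grad \<phi> x \<bullet> grad u x + ?Y x * \<phi> x) + (\<Sum>b\<in>Basis. \<phi> x * (DF b x \<bullet> b) + (F x \<bullet> b) * (grad \<phi> x \<bullet> b)))"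
        unfolding 3
        by (rule Bochner_Integration.integral_cong) (auto simp: P_def weak_rhs_def inner_add_right algebra_simps)
      also have "\<dots> = (LINT x|?M. grad \<phi> x \<bullet> grad u x + ?Y x * \<phi> x) + (LINT x|?M. (\<Sum>b\<in>Basis. \<phi> x * (DF b x \<bullet> b) + (F x \<bullet> b) * (grad \<phi> x \<bullet> b)))"
        by (rule Bochner_Integration.integral_add[OF i1 i3])
      also have "\<dots> = (LINT x|?M. grad \<phi> x \<bullet> grad u x + ?Y x * \<phi> x)" by (simp only: 2 add_0_right)
      finally show ?thesis using 1 by simp
    qed
  qed
  have b: "norm (grad u x) \<le> max (M / \<sigma>0 + B) ?CY \<and> \<bar>?Y x\<bar> \<le> max (M / \<sigma>0 + B) ?CY" if "x \<in> \<Omega>" for x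
    using grad_u_bound[OF that] bound[OF that] by auto
  fix w G assume w: "H10 \<Omega> w G"
  note Z = H10_functional_zero[OF open_Om bounded_Om grad_u_meas borel_measurable_lebesgue_on[OF open_Om cont] b test w]
  show "(LINT x|?M. G x \<bullet> grad u x + ?Y x * w x) = 0" by (rule Z(1))
  show "integrable ?M (\<lambda>x. G x \<bullet> grad u x + ?Y x * w x)" by (rule Z(2))
qed

end

section \<open>Comparison of two solutions with the same \<open>a\<close> and
  \<open>H\<close>\<close>

locale two_solutions =
  S: admissible_solution \<Omega> \<sigma>0 \<sigma>1 m M B a H u \<sigma> F + T: admissible_solution \<Omega> \<sigma>0 \<sigma>1 m M B a H ut \<sigma>t Ft
  for \<Omega> :: "'a::euclidean_space set" and \<sigma>0 \<sigma>1 m M B :: real and a H u \<sigma> ut \<sigma>t :: "'a \<Rightarrow> real" and F Ft :: "'a \<Rightarrow> 'a"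
begin

abbreviation \<mu> :: "'a measure" where "\<mu> \<equiv> lebesgue_on \<Omega>"

lemma finite_mu: "finite_measure \<mu>"
  by (rule finite_measure_lebesgue_on[OF S.open_Om S.bounded_Om])

lemma integrable_inner:
  fixes Q R :: "'a \<Rightarrow> 'a"
  assumes "continuous_on \<Omega> Q" "continuous_on \<Omega> R" and b: "\<And>x. x \<in> \<Omega> \<Longrightarrow> norm (Q x) \<le> c" "\<And>x. x \<in> \<Omega> \<Longrightarrow> norm (R x) \<le> d"
  shows "integrable \<mu> (\<lambda>x. Q x \<bullet> R x)"
proof (rule S.integrable_bounded)
  show "(\<lambda>x. Q x \<bullet> R x) \<in> borel_measurable \<mu>"
    using assms by (intro borel_measurable_lebesgue_on[OF S.open_Om] continuous_intros)
  show "norm (Q x \<bullet> R x) \<le> c * d" if x: "x \<in> \<Omega>" for x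
    unfolding real_norm_def
    by (rule order_trans[OF Cauchy_Schwarz_ineq2 mult_mono[OF b(1)[OF x] b(2)[OF x] order_trans[OF norm_ge_zero b(1)[OF x]] norm_ge_zero]])
qed

lemma u_conts: "continuous_on \<Omega> u" "continuous_on \<Omega> ut"
  by (rule continuous_on_subset[OF S.u_C1(2) closure_subset] continuous_on_subset[OF T.u_C1(2) closure_subset])+

lemma integrable_times_u:
  fixes Q :: "'a \<Rightarrow> real"
  assumes Q: "continuous_on \<Omega> Q" "\<And>x. x \<in> \<Omega> \<Longrightarrow> \<bar>Q x\<bar> \<le> c"
  shows "integrable \<mu> (\<lambda>x. Q x * u x)" "integrable \<mu> (\<lambda>x. Q x * ut x)"
proof -
  have i: "integrable \<mu> (\<lambda>x. Q x * z x)" if z: "continuous_on \<Omega> z" "\<exists>U. \<forall>x\<in>\<Omega>. \<bar>z x\<bar> \<le> U" for z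
  proof -
    obtain U where U: "\<And>x. x \<in> \<Omega> \<Longrightarrow> \<bar>z x\<bar> \<le> U" using z(2) by blast
    show ?thesis
    proof (rule S.integrable_bounded)
      show "(\<lambda>x. Q x * z x) \<in> borel_measurable \<mu>"
        by (intro borel_measurable_lebesgue_on[OF S.open_Om] continuous_intros Q z)
      show "norm (Q x * z x) \<le> c * U" if x: "x \<in> \<Omega>" for x
        unfolding real_norm_def abs_mult using Q(2)[OF x] U[OF x] order_trans[OF abs_ge_zero Q(2)[OF x]] by (intro mult_mono) auto
    qed
  qed
  show "integrable \<mu> (\<lambda>x. Q x * u x)" by (rule i[OF u_conts(1) S.u_bound])
  show "integrable \<mu> (\<lambda>x. Q x * ut x)" by (rule i[OF u_conts(2) T.u_bound])
qed

lemma flux_difference: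
  "(LINT x|\<mu>. (norm (S.flux x - T.flux x))\<^sup>2) \<le> 2 * M * \<sigma>1 * (LINT x|\<mu>. norm (F x - Ft x))"
proof -
  let ?J = "\<lambda>x. S.flux x - T.flux x"
  have Jc: "continuous_on \<Omega> ?J" by (intro continuous_intros S.flux_cont T.flux_cont)
  have Jb: "norm (?J x) \<le> 2 * M" if x: "x \<in> \<Omega>" for x
    using norm_triangle_ineq4[of "S.flux x" "T.flux x"] S.flux_bounds(2)[OF x] T.flux_bounds(2)[OF x] by linarith
  have Hb: "\<bar>H x\<bar> \<le> B" if "x \<in> \<Omega>" for x using S.FH_bounds[OF that] by simp
  \<comment> \<open>Both fluxes satisfy the weak equation with the same \<open>H\<close>, so the
    terms with \<open>H\<close> cancel in the difference.\<close>
  have orth: "(LINT x|\<mu>. grad z x \<bullet> ?J x) = 0" and zi: "integrable \<mu> (\<lambda>x. grad z x \<bullet> ?J x)"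
    if z: "H10 \<Omega> z (grad z)" "continuous_on \<Omega> (grad z)" "\<And>x. x \<in> \<Omega> \<Longrightarrow> norm (grad z x) \<le> c"
      and Hz: "integrable \<mu> (\<lambda>x. H x * z x)" for z c
  proof -
    have i1: "integrable \<mu> (\<lambda>x. grad z x \<bullet> S.flux x)" by (rule integrable_inner[OF z(2) S.flux_cont z(3) S.flux_bounds(2)])
    have i2: "integrable \<mu> (\<lambda>x. grad z x \<bullet> T.flux x)" by (rule integrable_inner[OF z(2) T.flux_cont z(3) T.flux_bounds(2)])
    have "(LINT x|\<mu>. grad z x \<bullet> S.flux x) + (LINT x|\<mu>. H x * z x) = 0"
      using S.feasible[OF z(1)] Bochner_Integration.integral_add[OF i1 Hz] by simp
    moreover have "(LINT x|\<mu>. grad z x \<bullet> T.flux x) + (LINT x|\<mu>. H x * z x) = 0"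
      using T.feasible[OF z(1)] Bochner_Integration.integral_add[OF i2 Hz] by simp
    ultimately show "(LINT x|\<mu>. grad z x \<bullet> ?J x) = 0"
      using Bochner_Integration.integral_diff[OF i1 i2] by (simp add: inner_diff_right)
    show "integrable \<mu> (\<lambda>x. grad z x \<bullet> ?J x)"
      using Bochner_Integration.integrable_diff[OF i1 i2] by (simp add: inner_diff_right)
  qed
  note Hu = integrable_times_u[OF S.H_cont Hb]
  note o1 = orth[OF S.u_H10 S.grad_u_cont S.grad_u_bound Hu(1)] zi[OF S.u_H10 S.grad_u_cont S.grad_u_bound Hu(1)]
  note o2 = orth[OF T.u_H10 T.grad_u_cont T.grad_u_bound Hu(2)] zi[OF T.u_H10 T.grad_u_cont T.grad_u_bound Hu(2)]
  have FFc: "continuous_on \<Omega> (\<lambda>x. F x - Ft x)" by (intro continuous_intros S.F_cont T.F_cont)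
  have FFb: "norm (F x - Ft x) \<le> 2 * B" if x: "x \<in> \<Omega>" for x
    using norm_triangle_ineq4[of "F x" "Ft x"] S.FH_bounds[OF x] T.FH_bounds[OF x] by linarith
  have FFi: "integrable \<mu> (\<lambda>x. (F x - Ft x) \<bullet> ?J x)" by (rule integrable_inner[OF FFc Jc FFb Jb])
  have eq: "(LINT x|\<mu>. (S.P x - T.P x) \<bullet> ?J x) = (LINT x|\<mu>. (F x - Ft x) \<bullet> ?J x)"
  proof -
    have "(LINT x|\<mu>. (S.P x - T.P x) \<bullet> ?J x) = (LINT x|\<mu>. (F x - Ft x) \<bullet> ?J x + (grad u x \<bullet> ?J x - grad ut x \<bullet> ?J x))"
      by (rule Bochner_Integration.integral_cong) (auto simp: S.P_def T.P_def inner_diff_left inner_add_left)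
    also have "\<dots> = (LINT x|\<mu>. (F x - Ft x) \<bullet> ?J x) + (LINT x|\<mu>. grad u x \<bullet> ?J x - grad ut x \<bullet> ?J x)"
      by (rule Bochner_Integration.integral_add[OF FFi Bochner_Integration.integrable_diff[OF o1(2) o2(2)]])
    also have "(LINT x|\<mu>. grad u x \<bullet> ?J x - grad ut x \<bullet> ?J x) = 0"
    proof -
      have "(LINT x|\<mu>. grad u x \<bullet> ?J x - grad ut x \<bullet> ?J x) = (LINT x|\<mu>. grad u x \<bullet> ?J x) - (LINT x|\<mu>. grad ut x \<bullet> ?J x)"
        by (rule Bochner_Integration.integral_diff[OF o1(2) o2(2)])
      then show ?thesis using o1(1) o2(1) by linarith
    qed
    finally show ?thesis by simp
  qed
  have FFn: "integrable \<mu> (\<lambda>x. 2 * M * norm (F x - Ft x))"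
    by (intro integrable_mult_right S.integrable_bounded[of _ "2 * B"] borel_measurable_lebesgue_on[OF S.open_Om] continuous_intros S.F_cont T.F_cont)
      (use FFb in auto)
  have upper: "(LINT x|\<mu>. (F x - Ft x) \<bullet> ?J x) \<le> (LINT x|\<mu>. 2 * M * norm (F x - Ft x))"
  proof (rule integral_mono[OF FFi FFn])
    fix x assume "x \<in> space \<mu>"
    then have x: "x \<in> \<Omega>" by simp
    have "(F x - Ft x) \<bullet> ?J x \<le> norm (F x - Ft x) * norm (?J x)" by (rule norm_cauchy_schwarz)
    also have "\<dots> \<le> norm (F x - Ft x) * (2 * M)" by (intro mult_left_mono Jb x) simp
    finally show "(F x - Ft x) \<bullet> ?J x \<le> 2 * M * norm (F x - Ft x)" by (simp add: mult.commute mult.left_commute)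
  qed
  have J2: "integrable \<mu> (\<lambda>x. (norm (?J x))\<^sup>2)"
    using integrable_inner[OF Jc Jc Jb Jb] by (simp add: power2_norm_eq_inner)
  have PPi: "integrable \<mu> (\<lambda>x. \<sigma>1 * ((S.P x - T.P x) \<bullet> ?J x))"
  proof (intro integrable_mult_right integrable_inner[OF _ Jc _ Jb])
    show "continuous_on \<Omega> (\<lambda>x. S.P x - T.P x)" by (intro continuous_intros S.P_cont T.P_cont)
    show "norm (S.P x - T.P x) \<le> 2 * (M / \<sigma>0)" if x: "x \<in> \<Omega>" for x
      using norm_triangle_ineq4[of "S.P x" "T.P x"] S.P_bounds(2)[OF x] T.P_bounds(2)[OF x] by linarith
  qed
  have "(LINT x|\<mu>. (norm (?J x))\<^sup>2) \<le> (LINT x|\<mu>. \<sigma>1 * ((S.P x - T.P x) \<bullet> ?J x))"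
  proof (rule integral_mono_AE[OF J2 PPi])
    show "AE x in \<mu>. (norm (?J x))\<^sup>2 \<le> \<sigma>1 * ((S.P x - T.P x) \<bullet> ?J x)"
      using S.flux_norm T.flux_norm AE_space
    proof eventually_elim
      case (elim x)
      then have x: "x \<in> \<Omega>" and n: "norm (S.flux x) = norm (T.flux x)" by auto
      have s: "0 < \<sigma> x" "\<sigma> x \<le> \<sigma>1" "0 < \<sigma>t x" "\<sigma>t x \<le> \<sigma>1"
        using S.\<sigma>_bounds[OF x] T.\<sigma>_bounds[OF x] S.pos by auto
      define p q where "p = S.flux x" and "q = T.flux x"
      have nn: "p \<bullet> p = q \<bullet> q" using n by (simp add: p_def q_def dot_square_norm)
      have Pp: "S.P x = (1 / \<sigma> x) *\<^sub>R p" "T.P x = (1 / \<sigma>t x) *\<^sub>R q"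
        using s by (auto simp: p_def q_def S.flux_def T.flux_def)
      \<comment> \<open>For vectors of equal length |p - q|^2 = 2 (p \<bullet> p - p \<bullet> q),
        and likewise with q \<bullet> q, so 1 / \<sigma> and 1 / \<sigma>t multiply the same
        quantity D / 2; each of them is at least 1 / \<sigma>1.\<close>
      define D where "D = (norm (p - q))\<^sup>2"
      have D: "D = 2 * (p \<bullet> p - p \<bullet> q)" unfolding D_def power2_norm_eq_inner using nn
        by (simp add: inner_diff_left inner_diff_right inner_commute)
      have "(S.P x - T.P x) \<bullet> (p - q) = (1 / \<sigma> x) * (p \<bullet> p - p \<bullet> q) + (1 / \<sigma>t x) * (q \<bullet> q - p \<bullet> q)"
        unfolding Pp by (simp add: inner_diff_left inner_diff_right inner_commute right_diff_distrib)
      also have "\<dots> = (1 / \<sigma> x) * (D / 2) + (1 / \<sigma>t x) * (D / 2)"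
      proof -
        have "p \<bullet> p - p \<bullet> q = D / 2" "q \<bullet> q - p \<bullet> q = D / 2" unfolding D using nn by auto
        then show ?thesis by (simp only:)
      qed
      finally have eq: "(S.P x - T.P x) \<bullet> (p - q) = (1 / \<sigma> x) * (D / 2) + (1 / \<sigma>t x) * (D / 2)" .
      have "1 \<le> \<sigma>1 * (1 / \<sigma> x)" "1 \<le> \<sigma>1 * (1 / \<sigma>t x)" using s by (auto simp: field_simps)
      moreover have "0 \<le> D / 2" by (simp add: D_def)
      ultimately have "1 * (D / 2) \<le> \<sigma>1 * (1 / \<sigma> x) * (D / 2)" "1 * (D / 2) \<le> \<sigma>1 * (1 / \<sigma>t x) * (D / 2)"
        by (blast intro: mult_right_mono)+
      then have "D \<le> \<sigma>1 * (1 / \<sigma> x) * (D / 2) + \<sigma>1 * (1 / \<sigma>t x) * (D / 2)" by linarith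
      also have "\<dots> = \<sigma>1 * ((1 / \<sigma> x) * (D / 2) + (1 / \<sigma>t x) * (D / 2))" by (simp only: distrib_left mult.assoc)
      finally have "D \<le> \<sigma>1 * ((1 / \<sigma> x) * (D / 2) + (1 / \<sigma>t x) * (D / 2))" .
      then show ?case unfolding p_def[symmetric] q_def[symmetric] eq by (simp add: D_def)
    qed
  qed
  also have "\<dots> = \<sigma>1 * (LINT x|\<mu>. (F x - Ft x) \<bullet> ?J x)" by (simp add: eq)
  also have "\<dots> \<le> \<sigma>1 * (LINT x|\<mu>. 2 * M * norm (F x - Ft x))" using upper S.pos by (intro mult_left_mono) auto
  also have "\<dots> = 2 * M * \<sigma>1 * (LINT x|\<mu>. norm (F x - Ft x))" by simp
  finally show ?thesis .
qed

text \<open>The difference of the two weak Laplace equations, tested with the difference of the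
  solutions. As \<open>u\<close> and \<open>ut\<close> both lie in \<open>H10\<close>, this amounts
  to each of the two equations tested with each of the two functions. The factor 2 arises because
  the two right-hand sides are bounded separately.\<close>

lemma gradient_energy:
  assumes D\<sigma>: "\<And>x. x \<in> \<Omega> \<Longrightarrow> (\<sigma> has_derivative (\<lambda>h. D\<sigma> x \<bullet> h)) (at x)" "continuous_on \<Omega> D\<sigma>"
      "\<And>x. x \<in> \<Omega> \<Longrightarrow> norm (D\<sigma> x) \<le> S2"
    and DF: "\<And>b x. b \<in> Basis \<Longrightarrow> x \<in> \<Omega> \<Longrightarrow> ((\<lambda>x. F x \<bullet> b) has_derivative (\<lambda>h. DF b x \<bullet> h)) (at x)"
      "\<And>b. b \<in> Basis \<Longrightarrow> continuous_on \<Omega> (DF b)" "\<And>b x. b \<in> Basis \<Longrightarrow> x \<in> \<Omega> \<Longrightarrow> \<bar>DF b x \<bullet> b\<bar> \<le> B"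
    and D\<sigma>t: "\<And>x. x \<in> \<Omega> \<Longrightarrow> (\<sigma>t has_derivative (\<lambda>h. D\<sigma>t x \<bullet> h)) (at x)" "continuous_on \<Omega> D\<sigma>t"
      "\<And>x. x \<in> \<Omega> \<Longrightarrow> norm (D\<sigma>t x) \<le> S2"
    and DFt: "\<And>b x. b \<in> Basis \<Longrightarrow> x \<in> \<Omega> \<Longrightarrow> ((\<lambda>x. Ft x \<bullet> b) has_derivative (\<lambda>h. DFt b x \<bullet> h)) (at x)"
      "\<And>b. b \<in> Basis \<Longrightarrow> continuous_on \<Omega> (DFt b)" "\<And>b x. b \<in> Basis \<Longrightarrow> x \<in> \<Omega> \<Longrightarrow> \<bar>DFt b x \<bullet> b\<bar> \<le> B"
  shows "(LINT x|\<mu>. (norm (grad u x - grad ut x))\<^sup>2)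
    \<le> 2 * (M / \<sigma>0 * S2 / \<sigma>0 + B / \<sigma>0 + DIM('a) * B) * (LINT x|\<mu>. \<bar>u x - ut x\<bar>)"
proof -
  let ?CY = "M / \<sigma>0 * S2 / \<sigma>0 + B / \<sigma>0 + DIM('a) * B"
  define Y where "Y = S.weak_rhs D\<sigma> DF"
  define Yt where "Yt = T.weak_rhs D\<sigma>t DFt"
  have Yb: "\<bar>Y x\<bar> \<le> ?CY" and Ytb: "\<bar>Yt x\<bar> \<le> ?CY" if x: "x \<in> \<Omega>" for x
    unfolding Y_def Yt_def by (rule S.weak_rhs_bound[OF D\<sigma> DF x] T.weak_rhs_bound[OF D\<sigma>t DFt x]; assumption)+
  have Yc: "continuous_on \<Omega> Y" unfolding Y_def by (rule S.weak_rhs_cont[OF D\<sigma> DF])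
  have Ytc: "continuous_on \<Omega> Yt" unfolding Yt_def by (rule T.weak_rhs_cont[OF D\<sigma>t DFt])
  have L: "(LINT x|\<mu>. G x \<bullet> grad u x + Y x * z x) = 0" "integrable \<mu> (\<lambda>x. G x \<bullet> grad u x + Y x * z x)"
    and Lt: "(LINT x|\<mu>. G x \<bullet> grad ut x + Yt x * z x) = 0" "integrable \<mu> (\<lambda>x. G x \<bullet> grad ut x + Yt x * z x)"
    if z: "H10 \<Omega> z G" for z G
    unfolding Y_def Yt_def
    by (rule S.weak_laplacian(1)[OF D\<sigma> DF z], assumption+)
      (rule S.weak_laplacian(2)[OF D\<sigma> DF z] T.weak_laplacian[OF D\<sigma>t DFt z]; assumption)+
  \<comment> \<open>Each of the four bracketed sums integrates to 0; only the product of the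
    differences is left.\<close>
  have id: "(norm (grad u x - grad ut x))\<^sup>2 = ((grad u x \<bullet> grad u x + Y x * u x) - (grad ut x \<bullet> grad u x + Y x * ut x))
      - ((grad u x \<bullet> grad ut x + Yt x * u x) - (grad ut x \<bullet> grad ut x + Yt x * ut x)) - (Y x - Yt x) * (u x - ut x)" for x
    by (simp add: power2_norm_eq_inner inner_diff_left inner_diff_right inner_commute algebra_simps)
  have wi: "integrable \<mu> (\<lambda>x. (Y x - Yt x) * (u x - ut x))"
  proof -
    have c: "continuous_on \<Omega> (\<lambda>x. Y x - Yt x)" by (intro continuous_intros Yc Ytc)
    have b: "\<bar>Y x - Yt x\<bar> \<le> 2 * ?CY" if x: "x \<in> \<Omega>" for x
    proof -
      have "\<bar>Y x - Yt x\<bar> \<le> \<bar>Y x\<bar> + \<bar>Yt x\<bar>" by (rule abs_triangle_ineq4)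
      also have "\<dots> \<le> ?CY + ?CY" by (rule add_mono[OF Yb[OF x] Ytb[OF x]])
      finally show ?thesis by (simp only: mult_2)
    qed
    show ?thesis using integrable_times_u[OF c b] unfolding right_diff_distrib by (intro Bochner_Integration.integrable_diff)
  qed
  have ai: "integrable \<mu> (\<lambda>x. 2 * ?CY * \<bar>u x - ut x\<bar>)"
  proof -
    have "integrable \<mu> (\<lambda>x. 1 * u x)" "integrable \<mu> (\<lambda>x. 1 * ut x)"
      by (rule integrable_times_u[of "\<lambda>x. 1" 1]; simp)+
    then show ?thesis by (intro integrable_mult_right integrable_abs Bochner_Integration.integrable_diff) simp_all
  qed
  have "(LINT x|\<mu>. (norm (grad u x - grad ut x))\<^sup>2) = - (LINT x|\<mu>. (Y x - Yt x) * (u x - ut x))"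
    unfolding id
  proof -
    have h: "has_bochner_integral \<mu> (\<lambda>x. grad u x \<bullet> grad u x + Y x * u x) 0" "has_bochner_integral \<mu> (\<lambda>x. grad ut x \<bullet> grad u x + Y x * ut x) 0"
      "has_bochner_integral \<mu> (\<lambda>x. grad u x \<bullet> grad ut x + Yt x * u x) 0" "has_bochner_integral \<mu> (\<lambda>x. grad ut x \<bullet> grad ut x + Yt x * ut x) 0"
      using L[OF S.u_H10] L[OF T.u_H10] Lt[OF S.u_H10] Lt[OF T.u_H10] by (simp_all only: has_bochner_integral_iff simp_thms)
    have hw: "has_bochner_integral \<mu> (\<lambda>x. (Y x - Yt x) * (u x - ut x)) (LINT x|\<mu>. (Y x - Yt x) * (u x - ut x))"
      using wi by (rule has_bochner_integral_integrable)
    from has_bochner_integral_integral_eq[OF has_bochner_integral_diff[OF has_bochner_integral_diff[OF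
          has_bochner_integral_diff[OF h(1,2)] has_bochner_integral_diff[OF h(3,4)]] hw]]
    show "(LINT x|\<mu>. ((grad u x \<bullet> grad u x + Y x * u x) - (grad ut x \<bullet> grad u x + Y x * ut x))
      - ((grad u x \<bullet> grad ut x + Yt x * u x) - (grad ut x \<bullet> grad ut x + Yt x * ut x)) - (Y x - Yt x) * (u x - ut x))
      = - (LINT x|\<mu>. (Y x - Yt x) * (u x - ut x))" by (simp only: diff_self diff_0)
  qed
  also have "\<dots> = (LINT x|\<mu>. - ((Y x - Yt x) * (u x - ut x)))" by simp
  also have "\<dots> \<le> (LINT x|\<mu>. 2 * ?CY * \<bar>u x - ut x\<bar>)"
  proof (rule integral_mono[OF _ ai])
    show "integrable \<mu> (\<lambda>x. - ((Y x - Yt x) * (u x - ut x)))" using wi by simp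
    fix x assume "x \<in> space \<mu>"
    then have x: "x \<in> \<Omega>" by simp
    have "- ((Y x - Yt x) * (u x - ut x)) \<le> \<bar>Y x - Yt x\<bar> * \<bar>u x - ut x\<bar>" by (metis abs_ge_minus_self abs_mult)
    also have "\<dots> \<le> (2 * ?CY) * \<bar>u x - ut x\<bar>"
    proof (intro mult_right_mono)
      have "\<bar>Y x - Yt x\<bar> \<le> \<bar>Y x\<bar> + \<bar>Yt x\<bar>" by (rule abs_triangle_ineq4)
      also have "\<dots> \<le> ?CY + ?CY" by (rule add_mono[OF Yb[OF x] Ytb[OF x]])
      finally show "\<bar>Y x - Yt x\<bar> \<le> 2 * ?CY" by (simp only: mult_2)
    qed simp
    finally show "- ((Y x - Yt x) * (u x - ut x)) \<le> 2 * ?CY * \<bar>u x - ut x\<bar>" .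
  qed
  also have "\<dots> = 2 * ?CY * (LINT x|\<mu>. \<bar>u x - ut x\<bar>)" by (rule integral_mult_right_zero)
  finally show ?thesis .
qed

end


section \<open>Stability\<close>

lemma Ck_norm_bound:
  fixes B :: real
  assumes "Ck_norm k S f \<le> ennreal B" "0 \<le> B" "x \<in> S" "set hs \<subseteq> Basis" "length hs \<le> k"
  shows "norm (iter_partial hs f x) \<le> B"
proof -
  let ?s = "\<lambda>j. SUP hs\<in>{hs. set hs \<subseteq> Basis \<and> length hs = j}. SUP x\<in>S. ennreal (norm (iter_partial hs f x))"
  have "ennreal (norm (iter_partial hs f x)) \<le> (SUP x\<in>S. ennreal (norm (iter_partial hs f x)))"
    using assms(3) by (rule SUP_upper)
  also have "\<dots> \<le> ?s (length hs)" using assms(4) by (intro SUP_upper) auto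
  also have "\<dots> \<le> (\<Sum>j\<le>k. ?s j)" using assms(5) by (intro member_le_sum) auto
  also have "\<dots> = Ck_norm k S f" by (simp add: Ck_norm_def)
  also have "\<dots> \<le> ennreal B" by (rule assms(1))
  finally show ?thesis using assms(2) by simp
qed

lemma norm_grad_le:
  fixes f :: "'a::euclidean_space \<Rightarrow> real" and B :: real
  assumes "Ck_norm k S f \<le> ennreal B" "0 \<le> B" "x \<in> S" "0 < k"
  shows "norm (grad f x) \<le> DIM('a) * B"
proof -
  have "\<bar>grad f x \<bullet> b\<bar> \<le> B" if b: "b \<in> Basis" for b
    using Ck_norm_bound[OF assms(1,2,3), of "[b]"] assms(4) b by (simp add: grad_inner_Basis)
  then have "(\<Sum>b\<in>Basis. \<bar>grad f x \<bullet> b\<bar>) \<le> (\<Sum>b\<in>(Basis::'a set). B)" by (intro sum_mono)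
  then show ?thesis using norm_le_l1[of "grad f x"] by simp
qed

lemma component_derivative:
  fixes F :: "'a::euclidean_space \<Rightarrow> 'b::euclidean_space"
  assumes "F differentiable (at x)"
  shows "((\<lambda>x. F x \<bullet> b) has_derivative (\<lambda>h. grad (\<lambda>x. F x \<bullet> b) x \<bullet> h)) (at x)"
    "frechet_derivative (\<lambda>x. F x \<bullet> b) (at x) = (\<lambda>h. frechet_derivative F (at x) h \<bullet> b)"
proof -
  have d: "((\<lambda>x. F x \<bullet> b) has_derivative (\<lambda>h. frechet_derivative F (at x) h \<bullet> b)) (at x)"
    using assms frechet_derivative_works by (intro has_derivative_inner_left) blast
  show "frechet_derivative (\<lambda>x. F x \<bullet> b) (at x) = (\<lambda>h. frechet_derivative F (at x) h \<bullet> b)"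
    by (rule frechet_derivative_at[OF d, symmetric])
  show "((\<lambda>x. F x \<bullet> b) has_derivative (\<lambda>h. grad (\<lambda>x. F x \<bullet> b) x \<bullet> h)) (at x)"
    by (rule has_derivative_grad) (use d in \<open>auto simp: differentiable_def\<close>)
qed

lemma component_derivative_bounds:
  fixes F :: "'a::euclidean_space \<Rightarrow> 'a"
  assumes C: "Ck_on k S F" "0 < k" and n: "Ck_norm k S F \<le> ennreal B" "0 \<le> B"
  shows "x \<in> S \<Longrightarrow> ((\<lambda>x. F x \<bullet> b) has_derivative (\<lambda>h. grad (\<lambda>x. F x \<bullet> b) x \<bullet> h)) (at x)"
    and "continuous_on S (grad (\<lambda>x. F x \<bullet> b))"
    and "b \<in> Basis \<Longrightarrow> x \<in> S \<Longrightarrow> \<bar>grad (\<lambda>x. F x \<bullet> b) x \<bullet> b\<bar> \<le> B"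
proof -
  have d: "F differentiable (at x)" if "x \<in> S" for x using Ck_on_differentiable[OF C that] .
  show "x \<in> S \<Longrightarrow> ((\<lambda>x. F x \<bullet> b) has_derivative (\<lambda>h. grad (\<lambda>x. F x \<bullet> b) x \<bullet> h)) (at x)"
    by (rule component_derivative(1)[OF d])
  have g: "grad (\<lambda>x. F x \<bullet> b) x = (\<Sum>c\<in>Basis. (frechet_derivative F (at x) c \<bullet> b) *\<^sub>R c)" if "x \<in> S" for x
    unfolding grad_def component_derivative(2)[OF d[OF that]] ..
  have "continuous_on S (\<lambda>x. \<Sum>c\<in>Basis. (frechet_derivative F (at x) c \<bullet> b) *\<^sub>R c)"
    by (intro continuous_intros Ck_on_partial_continuous[OF C])
  then show "continuous_on S (grad (\<lambda>x. F x \<bullet> b))" by (rule continuous_on_eq) (simp add: g)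
  assume b: "b \<in> Basis" and x: "x \<in> S"
  have "\<bar>grad (\<lambda>x. F x \<bullet> b) x \<bullet> b\<bar> = \<bar>frechet_derivative F (at x) b \<bullet> b\<bar>"
    using b component_derivative(2)[OF d[OF x]] by (simp add: grad_inner_Basis)
  also have "\<dots> \<le> norm (frechet_derivative F (at x) b)" by (rule Basis_le_norm[OF b])
  also have "\<dots> \<le> B" using Ck_norm_bound[OF n x, of "[b]"] b C(2) by simp
  finally show "\<bar>grad (\<lambda>x. F x \<bullet> b) x \<bullet> b\<bar> \<le> B" .
qed

text \<open>Passes between the restricted Lebesgue measure, in which the norms are stated, and the
  Borel measure, in which the coarea formula is stated.\<close>

lemma nn_integral_lebesgue_on:
  fixes f :: "'a::euclidean_space \<Rightarrow> real"
  assumes S: "open S" and f: "continuous_on S f" "integrable (lebesgue_on S) f" "\<And>x. x \<in> S \<Longrightarrow> 0 \<le> f x"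
  shows "(\<integral>\<^sup>+x\<in>S. ennreal (f x) \<partial>lborel) = ennreal (LINT x|lebesgue_on S. f x)"
proof -
  have "(\<integral>\<^sup>+x\<in>S. ennreal (f x) \<partial>lborel) = (\<integral>\<^sup>+x. ennreal (indicator S x *\<^sub>R f x) \<partial>lborel)"
    by (intro nn_integral_cong) (auto simp: indicator_def)
  also have "\<dots> = (\<integral>\<^sup>+x. ennreal (indicator S x *\<^sub>R f x) \<partial>lebesgue)"
    by (simp add: nn_integral_completion)
  also have "\<dots> = (\<integral>\<^sup>+x. ennreal (f x) * indicator S x \<partial>lebesgue)"
    by (intro nn_integral_cong) (auto simp: indicator_def)
  also have "\<dots> = (\<integral>\<^sup>+x. ennreal (f x) \<partial>lebesgue_on S)"
    using S by (intro nn_integral_restrict_space[symmetric]) auto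
  also have "\<dots> = ennreal (LINT x|lebesgue_on S. f x)"
    using f by (intro nn_integral_eq_integral) (auto intro: AE_I2)
  finally show ?thesis .
qed

context two_solutions
begin

text \<open>The first of the two square roots in the final exponent: \<open>flux_difference\<close>
  controls the mean square, and Cauchy-Schwarz passes from there to the L^1 norm.\<close>

lemma flux_L1_difference:
  "(LINT x|\<mu>. norm (S.flux x - T.flux x))
    \<le> sqrt (measure \<mu> \<Omega> * (2 * M * \<sigma>1)) * sqrt (LINT x|\<mu>. norm (F x - Ft x))"
proof -
  let ?f = "\<lambda>x. norm (S.flux x - T.flux x)"
  have Jc: "continuous_on \<Omega> (\<lambda>x. S.flux x - T.flux x)" by (intro continuous_intros S.flux_cont T.flux_cont)
  have Jb: "norm (S.flux x - T.flux x) \<le> 2 * M" if x: "x \<in> \<Omega>" for x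
    using norm_triangle_ineq4[of "S.flux x" "T.flux x"] S.flux_bounds(2)[OF x] T.flux_bounds(2)[OF x] by linarith
  have i1: "integrable \<mu> ?f"
    by (rule S.integrable_bounded[of _ "2 * M"]) (use Jb in \<open>auto intro!: borel_measurable_lebesgue_on[OF S.open_Om] continuous_intros Jc\<close>)
  have i2: "integrable \<mu> (\<lambda>x. (?f x)\<^sup>2)"
    using integrable_inner[OF Jc Jc Jb Jb] by (simp add: power2_norm_eq_inner)
  have "(LINT x|\<mu>. ?f x)\<^sup>2 \<le> measure \<mu> \<Omega> * (LINT x|\<mu>. (?f x)\<^sup>2)"
    using square_integral_le[OF finite_mu i1 i2] by simp
  also have "\<dots> \<le> measure \<mu> \<Omega> * (2 * M * \<sigma>1 * (LINT x|\<mu>. norm (F x - Ft x)))"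
    by (intro mult_left_mono flux_difference) simp
  finally have "(LINT x|\<mu>. ?f x) \<le> sqrt (measure \<mu> \<Omega> * (2 * M * \<sigma>1 * (LINT x|\<mu>. norm (F x - Ft x))))"
    by (rule real_le_rsqrt)
  then show ?thesis by (simp add: real_sqrt_mult mult.assoc)
qed

end

theorem theorem3p8:
  fixes \<Omega> :: "(real^3) set" and m M k2 K Kt \<sigma>0 \<sigma>1 \<sigma>2 cg Cg :: real
  assumes "open \<Omega>" and "connected \<Omega>" and "bounded \<Omega>" and "lipschitz_boundary \<Omega>"
    and "0 < m" and "0 < \<sigma>0" and "0 < \<sigma>1" and "0 < k2" and "0 < \<sigma>2"
  shows "\<exists>C::real. \<forall>(a :: real^3 \<Rightarrow> real) (f :: real^3 \<Rightarrow> real) (ft :: real^3 \<Rightarrow> real)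
      (F :: real^3 \<Rightarrow> real^3) (Ft :: real^3 \<Rightarrow> real^3) (H :: real^3 \<Rightarrow> real)
      (u :: real^3 \<Rightarrow> real) (ut :: real^3 \<Rightarrow> real) (\<sigma> :: real^3 \<Rightarrow> real) (\<sigma>t :: real^3 \<Rightarrow> real)
      (v :: real^3 \<Rightarrow> real) (g :: real \<Rightarrow> real^3 \<Rightarrow> real).
    a \<in> borel_measurable (lebesgue_on \<Omega>) \<and> (AE x in lebesgue_on \<Omega>. m \<le> a x \<and> a x \<le> M) \<and>
    Ck_on 1 \<Omega> f \<and> continuous_on (closure \<Omega>) f \<and> (\<forall>x\<in>\<Omega>. F x = grad f x) \<and>
    Ck_on 1 \<Omega> ft \<and> continuous_on (closure \<Omega>) ft \<and> (\<forall>x\<in>\<Omega>. Ft x = grad ft x) \<and>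
    admissible \<Omega> \<sigma>0 \<sigma>1 m M a F H u \<sigma> \<and> admissible \<Omega> \<sigma>0 \<sigma>1 m M a Ft H ut \<sigma>t \<and>
    (\<forall>x\<in>frontier \<Omega>. u x = 0 \<and> ut x = 0) \<and>
    Ck_closure 2 \<Omega> F \<and> Ck_closure 2 \<Omega> Ft \<and> Ck_closure 1 \<Omega> H \<and>
    Ck_closure 2 \<Omega> \<sigma> \<and> Ck_closure 2 \<Omega> \<sigma>t \<and>
    Ck_norm 2 \<Omega> F \<le> ennreal k2 \<and> Ck_norm 2 \<Omega> Ft \<le> ennreal k2 \<and>
    Ck_norm 1 \<Omega> H \<le> ennreal k2 \<and>
    Ck_norm 2 \<Omega> \<sigma> \<le> ennreal \<sigma>2 \<and> Ck_norm 2 \<Omega> \<sigma>t \<le> ennreal \<sigma>2 \<and>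
    (\<forall>x. v x = u x + f x) \<and>
    foliated \<Omega> v g cg Cg K \<and> well_structured \<Omega> v g Kt
    \<longrightarrow> L1_norm_on \<Omega> (\<lambda>x. grad u x - grad ut x)
         \<le> C * (L1_norm_on \<Omega> (\<lambda>x. F x - Ft x)) powr (1/4)"
proof (cases "\<Omega> = {}")
  case True
  then show ?thesis by (intro exI[of _ 0]) (simp add: L1_norm_on_def integral_restrict_space)
next
  case False
  define V where "V = measure (lebesgue_on \<Omega>) \<Omega>"
  define S2 where "S2 = DIM(real^3) * \<sigma>2"
  \<comment> \<open>Bound for the right-hand sides of the weak Laplace equations, with
    \<open>S2\<close> bounding the gradients of the coefficients \<sigma> and \<sigma>t.\<close>
  define CY where "CY = M / \<sigma>0 * S2 / \<sigma>0 + k2 / \<sigma>0 + DIM(real^3) * k2"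
  \<comment> \<open>The constant \<open>Cst\<close> of \<open>transport_problem\<close> with the
    bounds m / \<sigma>1 and M / \<sigma>0 for |P| inserted. The constant is fixed before
    \<open>foliated\<close> gives any information on \<open>cg\<close> and \<open>K\<close>;
    truncation at 0 keeps it nonnegative in any case.\<close>
  define C3 where "C3 = max 0 (9 * (2 / (m / \<sigma>1) * (3 / cg)) * K / (1 / (M / \<sigma>0) * (1 / (3 * max Cg 1))))"
  \<comment> \<open>The first summand comes from the flux part of \<open>G\<close>, the second from
    its part |F - Ft|.\<close>
  define C4 where "C4 = sqrt (V * (2 * M * \<sigma>1)) / \<sigma>0 + sqrt (2 * k2 * V)"
  define C where "C = sqrt (V * (2 * CY * (C3 * C4)))"
  show ?thesis
  proof (intro exI[of _ C] allI impI, elim conjE)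
    fix a f ft :: "real^3 \<Rightarrow> real" and F Ft :: "real^3 \<Rightarrow> real^3" and H u ut \<sigma> \<sigma>t v :: "real^3 \<Rightarrow> real"
      and g :: "real \<Rightarrow> real^3 \<Rightarrow> real"
    assume a: "a \<in> borel_measurable (lebesgue_on \<Omega>)" "AE x in lebesgue_on \<Omega>. m \<le> a x \<and> a x \<le> M"
      and f: "Ck_on 1 \<Omega> f" "\<forall>x\<in>\<Omega>. F x = grad f x"
      and adm: "admissible \<Omega> \<sigma>0 \<sigma>1 m M a F H u \<sigma>" "admissible \<Omega> \<sigma>0 \<sigma>1 m M a Ft H ut \<sigma>t"
      and bdry: "\<forall>x\<in>frontier \<Omega>. u x = 0 \<and> ut x = 0"
      and Ck: "Ck_closure 2 \<Omega> F" "Ck_closure 2 \<Omega> Ft" "Ck_closure 1 \<Omega> H" "Ck_closure 2 \<Omega> \<sigma>" "Ck_closure 2 \<Omega> \<sigma>t"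
      and nF: "Ck_norm 2 \<Omega> F \<le> ennreal k2" and nFt: "Ck_norm 2 \<Omega> Ft \<le> ennreal k2"
      and nH: "Ck_norm 1 \<Omega> H \<le> ennreal k2"
      and n\<sigma>: "Ck_norm 2 \<Omega> \<sigma> \<le> ennreal \<sigma>2" and n\<sigma>t: "Ck_norm 2 \<Omega> \<sigma>t \<le> ennreal \<sigma>2"
      and v: "\<forall>x. v x = u x + f x" and fol: "foliated \<Omega> v g cg Cg K"
    have k0: "0 \<le> k2" "0 \<le> \<sigma>2" using assms by auto
    have C2: "Ck_on 2 \<Omega> F" "Ck_on 2 \<Omega> Ft" "Ck_on 1 \<Omega> H" "Ck_on 2 \<Omega> \<sigma>" "Ck_on 2 \<Omega> \<sigma>t"
      using Ck by (auto simp: Ck_closure_def)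
    have FH: "norm (F x) \<le> k2" "norm (Ft x) \<le> k2" "\<bar>H x\<bar> \<le> k2" if "x \<in> \<Omega>" for x
      using Ck_norm_bound[OF nF k0(1) that, of "[]"] Ck_norm_bound[OF nFt k0(1) that, of "[]"]
        Ck_norm_bound[OF nH k0(1) that, of "[]"] by auto
    interpret two_solutions \<Omega> \<sigma>0 \<sigma>1 m M k2 a H u \<sigma> ut \<sigma>t F Ft
      by unfold_locales (use assms a adm FH Ck_on_continuous C2 in auto)
    define \<delta> where "\<delta> = (LINT x|\<mu>. norm (F x - Ft x))"
    have \<delta>0: "0 \<le> \<delta>" unfolding \<delta>_def by (rule Bochner_Integration.integral_nonneg) simp
    have V0: "0 \<le> V" by (simp add: V_def)
    have M: "0 < M" using False S.m_le_M assms(5) by force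
    let ?w = "\<lambda>x. u x - ut x" and ?Dw = "\<lambda>x. grad u x - grad ut x"
    define G where "G x = norm (S.flux x - T.flux x) / \<sigma>0 + norm (F x - Ft x)" for x
    have FFc: "continuous_on \<Omega> (\<lambda>x. F x - Ft x)" by (intro continuous_intros S.F_cont T.F_cont)
    have FFb: "norm (F x - Ft x) \<le> 2 * k2" if x: "x \<in> \<Omega>" for x
      using norm_triangle_ineq4[of "F x" "Ft x"] FH[OF x] by linarith
    have Jc: "continuous_on \<Omega> (\<lambda>x. S.flux x - T.flux x)" by (intro continuous_intros S.flux_cont T.flux_cont)
    have Jb: "norm (S.flux x - T.flux x) \<le> 2 * M" if x: "x \<in> \<Omega>" for x
      using norm_triangle_ineq4[of "S.flux x" "T.flux x"] S.flux_bounds(2)[OF x] T.flux_bounds(2)[OF x] by linarith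
    have Gc: "continuous_on \<Omega> G" unfolding G_def[abs_def] using assms(6) by (intro continuous_intros Jc FFc) auto
    have Ji: "integrable \<mu> (\<lambda>x. norm (S.flux x - T.flux x))"
      by (rule S.integrable_bounded[of _ "2 * M"]) (use Jb in \<open>auto intro!: borel_measurable_lebesgue_on[OF assms(1)] continuous_intros Jc\<close>)
    have FFi: "integrable \<mu> (\<lambda>x. norm (F x - Ft x))"
      by (rule S.integrable_bounded[of _ "2 * k2"]) (use FFb in \<open>auto intro!: borel_measurable_lebesgue_on[OF assms(1)] continuous_intros FFc\<close>)
    have Gi: "integrable \<mu> G" unfolding G_def[abs_def] using Ji FFi by simp
    have v_der: "(v has_derivative (\<lambda>h. S.P x \<bullet> h)) (at x)" if x: "x \<in> \<Omega>" for x
    proof -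
      have "((\<lambda>x. u x + f x) has_derivative (\<lambda>h. grad u x \<bullet> h + grad f x \<bullet> h)) (at x)"
        using Ck_on_differentiable[OF S.u_C1(1) _ x] Ck_on_differentiable[OF f(1) _ x]
        by (intro has_derivative_add has_derivative_grad) auto
      moreover have "(\<lambda>h. grad u x \<bullet> h + grad f x \<bullet> h) = (\<lambda>h. S.P x \<bullet> h)"
        using f(2) x by (simp add: S.P_def inner_add_left)
      moreover have "v = (\<lambda>x. u x + f x)" using v by blast
      ultimately show ?thesis by simp
    qed
    have tangential: "\<bar>?Dw x \<bullet> h\<bar> \<le> G x * norm h" if x: "x \<in> \<Omega>" and h: "S.P x \<bullet> h = 0" for x h
    proof -
      have s: "\<sigma>0 \<le> \<sigma>t x" "0 < \<sigma>t x" using T.\<sigma>_bounds[OF x] assms(6) by auto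
      \<comment> \<open>Tangency removes the flux of the first solution, so that only the
        coefficient \<sigma>t of the second one has to be divided out and the difference of the
        coefficients never appears.\<close>
      have "S.flux x \<bullet> h = 0" using h by (simp add: S.flux_def)
      then have "T.P x \<bullet> h = - ((S.flux x - T.flux x) \<bullet> h) / \<sigma>t x"
        using s by (simp add: T.flux_def inner_diff_left)
      moreover have "?Dw x \<bullet> h = S.P x \<bullet> h - T.P x \<bullet> h - (F x - Ft x) \<bullet> h"
        by (simp add: S.P_def T.P_def inner_diff_left inner_add_left)
      ultimately have eq: "?Dw x \<bullet> h = ((S.flux x - T.flux x) \<bullet> h) / \<sigma>t x - (F x - Ft x) \<bullet> h"
        using h by simp
      have "\<bar>((S.flux x - T.flux x) \<bullet> h) / \<sigma>t x\<bar> \<le> norm (S.flux x - T.flux x) * norm h / \<sigma>0"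
        unfolding abs_divide using s assms(6) Cauchy_Schwarz_ineq2[of "S.flux x - T.flux x" h] by (intro frac_le) auto
      then have "\<bar>?Dw x \<bullet> h\<bar> \<le> norm (S.flux x - T.flux x) * norm h / \<sigma>0 + norm (F x - Ft x) * norm h"
        unfolding eq using Cauchy_Schwarz_ineq2[of "F x - Ft x" h]
          abs_triangle_ineq4[of "((S.flux x - T.flux x) \<bullet> h) / \<sigma>t x" "(F x - Ft x) \<bullet> h"] by linarith
      then show ?thesis by (simp add: G_def distrib_right)
    qed
    interpret R: transport_problem \<Omega> v ?w G S.P ?Dw g "m / \<sigma>1" "M / \<sigma>0" cg Cg K
    proof
      show "open \<Omega>" "bounded \<Omega>" "foliated \<Omega> v g cg Cg K" by (rule assms fol)+
      show "continuous_on \<Omega> S.P" by (rule S.P_cont)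
      show "0 < m / \<sigma>1" using assms by simp
      show "continuous_on (closure \<Omega>) ?w" by (intro continuous_intros S.u_C1(2) T.u_C1(2))
      show "continuous_on \<Omega> G" by (rule Gc)
    next
      fix x assume x: "x \<in> \<Omega>"
      show "(v has_derivative (\<lambda>h. S.P x \<bullet> h)) (at x)" by (rule v_der[OF x])
      then show "grad v x = S.P x" by (rule grad_eqI)
      show "m / \<sigma>1 \<le> norm (S.P x) \<and> norm (S.P x) \<le> M / \<sigma>0" using S.P_bounds[OF x] by simp
      have "(?w has_derivative (\<lambda>h. grad u x \<bullet> h - grad ut x \<bullet> h)) (at x)"
        using Ck_on_differentiable[OF S.u_C1(1) _ x] Ck_on_differentiable[OF T.u_C1(1) _ x]
        by (intro has_derivative_diff has_derivative_grad) auto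
      then show "(?w has_derivative (\<lambda>h. ?Dw x \<bullet> h)) (at x)" by (simp add: inner_diff_left)
      show "0 \<le> G x" using assms(6) by (simp add: G_def)
      show "\<bar>?Dw x \<bullet> h\<bar> \<le> G x * norm h" if "S.P x \<bullet> h = 0" for h by (rule tangential[OF x that])
    next
      show "\<And>x. x \<in> frontier \<Omega> \<Longrightarrow> ?w x = 0" using bdry by simp
    qed
    have wi: "integrable \<mu> (\<lambda>x. \<bar>?w x\<bar>)"
    proof -
      have "integrable \<mu> (\<lambda>x. 1 * u x)" "integrable \<mu> (\<lambda>x. 1 * ut x)"
        by (rule integrable_times_u[of "\<lambda>x. 1" 1]; simp)+
      then show ?thesis by simp
    qed
    have G0: "0 \<le> (LINT x|\<mu>. G x)" using R.G_nonneg by (intro Bochner_Integration.integral_nonneg) simp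
    have w_le: "(LINT x|\<mu>. \<bar>?w x\<bar>) \<le> C3 * (LINT x|\<mu>. G x)"
    proof -
      have "ennreal (LINT x|\<mu>. \<bar>?w x\<bar>) = (\<integral>\<^sup>+x\<in>\<Omega>. ennreal \<bar>?w x\<bar> \<partial>lborel)"
        by (rule nn_integral_lebesgue_on[symmetric, OF assms(1) _ wi]) (auto intro!: continuous_intros u_conts)
      also have "\<dots> \<le> ennreal R.Cst * (\<integral>\<^sup>+x\<in>\<Omega>. ennreal (G x) \<partial>lborel)" by (rule R.estimate)
      also have "(\<integral>\<^sup>+x\<in>\<Omega>. ennreal (G x) \<partial>lborel) = ennreal (LINT x|\<mu>. G x)"
        by (rule nn_integral_lebesgue_on[OF assms(1) Gc Gi R.G_nonneg])
      also have "ennreal R.Cst * ennreal (LINT x|\<mu>. G x) \<le> ennreal C3 * ennreal (LINT x|\<mu>. G x)"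
        by (intro mult_right_mono ennreal_leI) (auto simp: R.Cst_def C3_def)
      also have "\<dots> = ennreal (C3 * (LINT x|\<mu>. G x))" by (simp add: ennreal_mult' C3_def)
      finally show ?thesis using G0 by (simp add: C3_def ennreal_le_iff)
    qed
    \<comment> \<open>The term of first order in \<delta> is absorbed into the square root, since
      \<delta> is bounded by 2 * k2 * V.\<close>
    have \<delta>_le: "\<delta> \<le> sqrt (2 * k2 * V) * sqrt \<delta>"
    proof -
      have "\<delta> \<le> (LINT x|\<mu>. 2 * k2)" unfolding \<delta>_def
        by (rule integral_mono[OF FFi]) (use FFb finite_measure.integrable_const[OF finite_mu] in auto)
      then have "\<delta> \<le> 2 * k2 * V" by (simp add: V_def mult.commute)
      then have "sqrt \<delta> * sqrt \<delta> \<le> sqrt (2 * k2 * V) * sqrt \<delta>" using \<delta>0 by (intro mult_right_mono) auto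
      then show ?thesis using \<delta>0 by simp
    qed
    have G_le: "(LINT x|\<mu>. G x) \<le> C4 * sqrt \<delta>"
    proof -
      have "(LINT x|\<mu>. G x) = (LINT x|\<mu>. norm (S.flux x - T.flux x)) / \<sigma>0 + \<delta>"
        unfolding G_def \<delta>_def using Ji FFi by simp
      also have "\<dots> \<le> (sqrt (V * (2 * M * \<sigma>1)) * sqrt \<delta>) / \<sigma>0 + sqrt (2 * k2 * V) * sqrt \<delta>"
        using flux_L1_difference \<delta>_le assms(6) by (intro add_mono divide_right_mono) (auto simp: V_def \<delta>_def)
      also have "\<dots> = C4 * sqrt \<delta>" by (simp add: C4_def algebra_simps)
      finally show ?thesis .
    qed
    have energy: "(LINT x|\<mu>. (norm (?Dw x))\<^sup>2) \<le> 2 * CY * (LINT x|\<mu>. \<bar>?w x\<bar>)"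
      unfolding CY_def
    proof (rule gradient_energy[where D\<sigma>="grad \<sigma>" and D\<sigma>t="grad \<sigma>t"
          and DF="\<lambda>b. grad (\<lambda>x. F x \<bullet> b)" and DFt="\<lambda>b. grad (\<lambda>x. Ft x \<bullet> b)"])
      fix x assume x: "x \<in> \<Omega>"
      show "(\<sigma> has_derivative (\<lambda>h. grad \<sigma> x \<bullet> h)) (at x)" "(\<sigma>t has_derivative (\<lambda>h. grad \<sigma>t x \<bullet> h)) (at x)"
        using C2(4,5) x by (auto intro!: has_derivative_grad Ck_on_differentiable)
      show "norm (grad \<sigma> x) \<le> S2" "norm (grad \<sigma>t x) \<le> S2"
        unfolding S2_def using norm_grad_le[OF n\<sigma> k0(2) x] norm_grad_le[OF n\<sigma>t k0(2) x] by auto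
    next
      show "continuous_on \<Omega> (grad \<sigma>)" "continuous_on \<Omega> (grad \<sigma>t)" using C2(4,5) Ck_on_grad_continuous by (meson zero_less_numeral)+
    next
      fix b x :: "real^3" assume b: "b \<in> Basis" and x: "x \<in> \<Omega>"
      show "((\<lambda>x. F x \<bullet> b) has_derivative (\<lambda>h. grad (\<lambda>x. F x \<bullet> b) x \<bullet> h)) (at x)" "\<bar>grad (\<lambda>x. F x \<bullet> b) x \<bullet> b\<bar> \<le> k2"
        using component_derivative_bounds(1,3)[OF C2(1) _ nF k0(1)] b x by auto
      show "((\<lambda>x. Ft x \<bullet> b) has_derivative (\<lambda>h. grad (\<lambda>x. Ft x \<bullet> b) x \<bullet> h)) (at x)" "\<bar>grad (\<lambda>x. Ft x \<bullet> b) x \<bullet> b\<bar> \<le> k2"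
        using component_derivative_bounds(1,3)[OF C2(2) _ nFt k0(1)] b x by auto
    next
      fix b :: "real^3"
      show "continuous_on \<Omega> (grad (\<lambda>x. F x \<bullet> b))" using component_derivative_bounds(2)[OF C2(1) _ nF k0(1)] by simp
      show "continuous_on \<Omega> (grad (\<lambda>x. Ft x \<bullet> b))" using component_derivative_bounds(2)[OF C2(2) _ nFt k0(1)] by simp
    qed
    have CY0: "0 \<le> CY" using M assms by (simp add: CY_def S2_def)
    have C30: "0 \<le> C3" by (simp add: C3_def)
    have Dwc: "continuous_on \<Omega> ?Dw" by (intro continuous_intros S.grad_u_cont T.grad_u_cont)
    have Dwb: "norm (?Dw x) \<le> 2 * (M / \<sigma>0 + k2)" if x: "x \<in> \<Omega>" for x
      using norm_triangle_ineq4[of "grad u x" "grad ut x"] S.grad_u_bound[OF x] T.grad_u_bound[OF x] unfolding distrib_left mult_2 by linarith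
    have Dwi: "integrable \<mu> (\<lambda>x. norm (?Dw x))"
      by (rule S.integrable_bounded[of _ "2 * (M / \<sigma>0 + k2)"]) (use Dwb in \<open>auto intro!: borel_measurable_lebesgue_on[OF assms(1)] continuous_intros Dwc\<close>)
    have Dwi2: "integrable \<mu> (\<lambda>x. (norm (?Dw x))\<^sup>2)"
      using integrable_inner[OF Dwc Dwc Dwb Dwb] by (simp add: power2_norm_eq_inner)
    \<comment> \<open>The second square root: from the integral of the square to the integral of the
      norm, over a set of measure \<open>V\<close>.\<close>
    have "(LINT x|\<mu>. norm (?Dw x))\<^sup>2 \<le> V * (LINT x|\<mu>. (norm (?Dw x))\<^sup>2)"
      using square_integral_le[OF finite_mu Dwi Dwi2] by (simp add: V_def)
    also have "\<dots> \<le> V * (2 * CY * (C3 * (C4 * sqrt \<delta>)))"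
    proof (intro mult_left_mono V0)
      have "(LINT x|\<mu>. (norm (?Dw x))\<^sup>2) \<le> 2 * CY * (LINT x|\<mu>. \<bar>?w x\<bar>)" by (rule energy)
      also have "\<dots> \<le> 2 * CY * (C3 * (LINT x|\<mu>. G x))" using CY0 w_le by (intro mult_left_mono) auto
      also have "\<dots> \<le> 2 * CY * (C3 * (C4 * sqrt \<delta>))" using CY0 C30 G_le by (intro mult_left_mono) auto
      finally show "(LINT x|\<mu>. (norm (?Dw x))\<^sup>2) \<le> 2 * CY * (C3 * (C4 * sqrt \<delta>))" .
    qed
    finally have "(LINT x|\<mu>. norm (?Dw x)) \<le> sqrt (V * (2 * CY * (C3 * (C4 * sqrt \<delta>))))" by (rule real_le_rsqrt)
    also have "\<dots> = C * sqrt (sqrt \<delta>)" by (simp add: C_def real_sqrt_mult mult.assoc)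
    also have "sqrt (sqrt \<delta>) = \<delta> powr (1/4)"
      using \<delta>0 by (simp add: powr_half_sqrt[symmetric] powr_powr)
    finally show "L1_norm_on \<Omega> ?Dw \<le> C * (L1_norm_on \<Omega> (\<lambda>x. F x - Ft x)) powr (1/4)"
      by (simp add: L1_norm_on_def \<delta>_def)
  qed
qed

end
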